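(* Assume $(V,K)\in\mathcal K_1$ and $\Phi\in\mathcal C_m$. Suppose $(\phi_1)$–$(\phi_4)$ hold and that $f$ satisfies $(f_1)$, $(f_2)$, $(f_3)$. Then problem (P) possesses a nonnegative nontrivial weak solution $u\in E$ which is locally bounded, i.e. $u\in L^\infty_{loc}(\mathbb R^N)$.
   Context: Let $N\ge2$ and let $\phi:(0,\infty)\to(0,\infty)$ be a $C^1$ function; set $\Phi(t)=\int_0^{|t|}s\phi(s)\,ds$. Hypotheses on $\phi$: $(\phi_1)$ $t\mapsto t\phi(t)$ is increasing on $(0,\infty)$; $(\phi_2)$ $\lim_{t\to0^+}t\phi(t)=0$ and $\lim_{t\to\infty}t\phi(t)=\infty$; $(\phi_3)$ $1\le\ell:=\inf_{t>0}\frac{\phi(t)t^2}{\Phi(t)}\le\sup_{t>0}\frac{\phi(t)t^2}{\Phi(t)}=:m<N$, $m<\ell^*$ and $m\ne1$, where $\ell^*=\frac{N\ell}{N-\ell}$, $m^*=\frac{Nm}{N-m}$; $(\phi_4)$ $t\mapsto\phi(t)/t^{m-2}$ is nonincreasing on $(0,\infty)$. The Sobolev conjugate $\Phi_*$ is the $N$-function defined by $\Phi_*^{-1}(t)=\int_0^t\Phi^{-1}(s)s^{-(N+1)/N}ds$, and $\phi_*$ is the function with $\Phi_*(t)=\int_0^{|t|}s\phi_*(s)ds$. For an $N$-function $G$, $L^G(\Omega)$ is the Orlicz space with Luxemburg norm $\|u\|_G=\inf\{\lambda>0:\int_\Omega G(|u|/\lambda)dx\le1\}$. $D^{1,\Phi}(\mathbb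 R^N)$ is the completion of $C_0^\infty(\mathbb R^N)$ w.r.t. $\|u\|_{\Phi_*}+\|\nabla u\|_\Phi$, normed by $\|\nabla u\|_\Phi$. $V,K:\mathbb R^N\to\mathbb R$ are continuous and nonnegative; $\|u\|_{V,\Phi}=\inf\{\alpha>0:\int_{\mathbb R^N}V(x)\Phi(|u|/\alpha)dx\le1\}$ and $E=\{u\in D^{1,\Phi}(\mathbb R^N):\int V\Phi(|u|)dx<\infty\}$ with norm $\|u\|_E=\|\nabla u\|_\Phi+\|u\|_{V,\Phi}$. Conditions on $(V,K)$: $(K_0)$ $V>0$, $K\in L^\infty(\mathbb R^N)$, $K>0$ a.e.; $(K_1)$ for every sequence of Borel sets $A_n\subset\mathbb R^N$ with $\sup_n|A_n|<\infty$, $\lim_{r\to\infty}\int_{A_n\cap B_r(0)^c}K\,dx=0$ uniformly in $n$; $(K_2)$ $K/V\in L^\infty(\mathbb R^N)$. $(V,K)\in\mathcal K_1$ means $(K_0),(K_1),(K_2)$ hold. $\Phi\in\mathcal C_m$ means there is $C>0$ with $\Phi(t)\ge C|t|^m$ for all $t\in\mathbb R$. $f:\mathbb R\to\mathbb R$ is continuous with $f(s)=0$ for $s\le0$, $F(t)=\int_0^tf(s)ds$. $(f_1)$ $\lim_{t\to0}\frac{f(t)}{t\phi(t)}=0$ and $\limsup_{t\to\infty}\frac{f(t)}{t\phi_*(t)}=0$; $(f_2)$ $s\mapsto s^{1-m}f(s)$ is increasing on $(0,\infty)$; $(f_3)$ $\lim_{|t|\to\infty}F(t)/|t|^m=+\infty$.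 Problem (P): $-\mathrm{div}(\phi(|\nabla u|)\nabla u)+V(x)\phi(|u|)u=K(x)f(u)$ in $\mathbb R^N$. A weak solution is $u\in E$ with $\int\phi(|\nabla u|)\nabla u\cdot\nabla v\,dx+\int V\phi(|u|)uv\,dx=\int Kf(u)v\,dx$ for all $v\in E$. *)

theory Defs
  imports "HOL-Analysis.Analysis"
begin

definition Phi :: "(real \<Rightarrow> real) \<Rightarrow> real \<Rightarrow> real" where
  "Phi \<phi> t = (LBINT s=0..\<bar>t\<bar>. s * \<phi> s)"

definition Phi_inv :: "(real \<Rightarrow> real) \<Rightarrow> real \<Rightarrow> real" where
  "Phi_inv \<phi> s = (THE t. 0 \<le> t \<and> Phi \<phi> t = s)"

text \<open>The inverse of the Sobolev conjugate (N = space dimension).\<close>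
definition Phi_star_inv :: "(real \<Rightarrow> real) \<Rightarrow> real \<Rightarrow> real \<Rightarrow> real" where
  "Phi_star_inv \<phi> N t = (LBINT s=0..t. Phi_inv \<phi> s * s powr (-(N + 1) / N))"

definition Phi_star :: "(real \<Rightarrow> real) \<Rightarrow> real \<Rightarrow> real \<Rightarrow> real" where
  "Phi_star \<phi> N t = (THE r. 0 \<le> r \<and> Phi_star_inv \<phi> N r = \<bar>t\<bar>)"

text \<open>phi_star with Phi_star(t) = int_0^|t| s phi_star(s) ds, i.e. phi_star(t) = Phi_star'(t)/t.\<close>
definition phi_star :: "(real \<Rightarrow> real) \<Rightarrow> real \<Rightarrow> real \<Rightarrow> real" where
  "phi_star \<phi> N t = deriv (Phi_star \<phi> N) t / t"

definition ell_idx :: "(real \<Rightarrow> real) \<Rightarrow> real" where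
  "ell_idx \<phi> = Inf ((\<lambda>t. \<phi> t * t\<^sup>2 / Phi \<phi> t) ` {0<..})"

definition m_idx :: "(real \<Rightarrow> real) \<Rightarrow> real" where
  "m_idx \<phi> = Sup ((\<lambda>t. \<phi> t * t\<^sup>2 / Phi \<phi> t) ` {0<..})"

definition modular :: "(real \<Rightarrow> real) \<Rightarrow> ('a::euclidean_space \<Rightarrow> real) \<Rightarrow> ennreal" where
  "modular G u = (\<integral>\<^sup>+ x. ennreal (G \<bar>u x\<bar>) \<partial>lebesgue)"

definition orlicz_space :: "(real \<Rightarrow> real) \<Rightarrow> ('a::euclidean_space \<Rightarrow> real) set" where
  "orlicz_space G = {u. u \<in> borel_measurable lebesgue \<and>
      (\<exists>c>0. modular G (\<lambda>x. u x / c) < \<infinity>)}"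

definition lux_norm :: "(real \<Rightarrow> real) \<Rightarrow> ('a::euclidean_space \<Rightarrow> real) \<Rightarrow> real" where
  "lux_norm G u = Inf {c. c > 0 \<and> modular G (\<lambda>x. u x / c) \<le> 1}"

definition partial :: "'a::euclidean_space \<Rightarrow> ('a \<Rightarrow> real) \<Rightarrow> 'a \<Rightarrow> real" where
  "partial i f x = frechet_derivative f (at x) i"

primrec iter_partial :: "'a::euclidean_space list \<Rightarrow> ('a \<Rightarrow> real) \<Rightarrow> 'a \<Rightarrow> real" where
  "iter_partial [] f = f"
| "iter_partial (i # is) f = partial i (iter_partial is f)"

definition smooth_fn :: "('a::euclidean_space \<Rightarrow> real) \<Rightarrow> bool" where
  "smooth_fn f \<longleftrightarrow> (\<forall>is. set is \<subseteq> Basis \<longrightarrow> (\<forall>x. iter_partial is f differentiable at x))"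

definition test_fn :: "('a::euclidean_space \<Rightarrow> real) \<Rightarrow> bool" where
  "test_fn f \<longleftrightarrow> smooth_fn f \<and> compact (closure {x. f x \<noteq> 0})"

definition grad :: "('a::euclidean_space \<Rightarrow> real) \<Rightarrow> 'a \<Rightarrow> 'a" where
  "grad f x = (\<Sum>i\<in>Basis. partial i f x *\<^sub>R i)"

definition loc_integrable :: "('a::euclidean_space \<Rightarrow> 'b::{banach,second_countable_topology}) \<Rightarrow> bool" where
  "loc_integrable u \<longleftrightarrow> u \<in> borel_measurable lebesgue \<and>
     (\<forall>C. compact C \<longrightarrow> set_integrable lebesgue C u)"

definition has_weak_grad :: "('a::euclidean_space \<Rightarrow> real) \<Rightarrow> ('a \<Rightarrow> 'a) \<Rightarrow> bool" where
  "has_weak_grad u g \<longleftrightarrow> loc_integrable u \<and> loc_integrable g \<and>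
     (\<forall>\<psi>. test_fn \<psi> \<longrightarrow> (\<forall>i\<in>Basis.
        (LINT x|lebesgue. u x * partial i \<psi> x) = - (LINT x|lebesgue. (g x \<bullet> i) * \<psi> x)))"

text \<open>u (with weak gradient g) belongs to D^{1,Phi}: the completion of C_0^infinity w.r.t.
  ||u||_{Phi_*} + ||grad u||_Phi, realised as a space of functions.\<close>
definition D1Phi :: "(real \<Rightarrow> real) \<Rightarrow> ('a::euclidean_space \<Rightarrow> real) \<Rightarrow> ('a \<Rightarrow> 'a) \<Rightarrow> bool" where
  "D1Phi \<phi> u g \<longleftrightarrow> has_weak_grad u g \<and>
     u \<in> orlicz_space (Phi_star \<phi> (real DIM('a))) \<and>
     (\<lambda>x. norm (g x)) \<in> orlicz_space (Phi \<phi>) \<and>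
     (\<exists>\<psi>. (\<forall>n. test_fn (\<psi> n)) \<and>
        (\<lambda>n. lux_norm (Phi_star \<phi> (real DIM('a))) (\<lambda>x. \<psi> n x - u x)) \<longlonglongrightarrow> 0 \<and>
        (\<lambda>n. lux_norm (Phi \<phi>) (\<lambda>x. norm (grad (\<psi> n) x - g x))) \<longlonglongrightarrow> 0)"

definition E_space :: "(real \<Rightarrow> real) \<Rightarrow> ('a::euclidean_space \<Rightarrow> real) \<Rightarrow> ('a \<Rightarrow> real) \<Rightarrow> ('a \<Rightarrow> 'a) \<Rightarrow> bool" where
  "E_space \<phi> V u g \<longleftrightarrow> D1Phi \<phi> u g \<and>
     (\<integral>\<^sup>+ x. ennreal (V x * Phi \<phi> \<bar>u x\<bar>) \<partial>lebesgue) < \<infinity>"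

definition weak_solution ::
  "(real \<Rightarrow> real) \<Rightarrow> ('a::euclidean_space \<Rightarrow> real) \<Rightarrow> ('a \<Rightarrow> real) \<Rightarrow> (real \<Rightarrow> real)
     \<Rightarrow> ('a \<Rightarrow> real) \<Rightarrow> ('a \<Rightarrow> 'a) \<Rightarrow> bool" where
  "weak_solution \<phi> V K f u g \<longleftrightarrow> E_space \<phi> V u g \<and>
     (\<forall>v h. E_space \<phi> V v h \<longrightarrow>
        integrable lebesgue (\<lambda>x. \<phi> (norm (g x)) * (g x \<bullet> h x)) \<and>
        integrable lebesgue (\<lambda>x. V x * \<phi> \<bar>u x\<bar> * u x * v x) \<and>
        integrable lebesgue (\<lambda>x. K x * f (u x) * v x) \<and>
        (LINT x|lebesgue. \<phi> (norm (g x)) * (g x \<bullet> h x))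
          + (LINT x|lebesgue. V x * \<phi> \<bar>u x\<bar> * u x * v x)
          = (LINT x|lebesgue. K x * f (u x) * v x))"

end

theory Submission
  imports Defs "HOL-Complex_Analysis.Great_Picard" "HOL-Library.Diagonal_Subsequence" "HOL-Computational_Algebra.Polynomial"
begin

text \<open>The critical point is a minimax over rays. On \<open>E\<close> let \<open>J\<close> be the energy and let \<open>c\<close> be the infimum of
  \<open>sup {J (\<tau> w) | \<tau> \<ge> 0}\<close> over all \<open>w\<close> whose positive part does not vanish. By \<open>(\<phi>\<^sub>4)\<close> and \<open>(f\<^sub>2)\<close> the function
  \<open>\<tau> \<mapsto> \<tau>\<^bsup>1 - m\<^esup> J'(\<tau> w) w\<close> decreases strictly, so \<open>J\<close> has exactly one maximum on each such ray. A minimising sequence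
  may be rescaled to any prescribed size of \<open>\<integral>\<Phi>(|\<nabla>w|) + \<integral>V \<Phi>(|w|)\<close>; no boundedness argument is needed. A subsequence
  converges a.e., \<open>\<integral>K F(\<tau> w)\<close> passes to the limit by \<open>(K\<^sub>1)\<close> and the convex part is lower semicontinuous, so the limit
  \<open>v\<close> is nonzero with \<open>J (\<tau> v) \<le> c\<close> for all \<open>\<tau>\<close>. At the maximum \<open>u\<close> of its ray the derivative vanishes, as
  otherwise a small perturbation would have a ray with smaller supremum. Testing with the negative part gives \<open>u \<ge> 0\<close>, and testing
  with \<open>(u - k)\<^sup>+\<close> bounds \<open>\<integral>\<Phi>(|\<nabla>(u - k)\<^sup>+|)\<close> by \<open>\<integral>u\<^bsup>m*\<^esup>\<close> over \<open>{u > k}\<close>, from which De Giorgi's iteration yields a bound on \<open>u\<close>.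

  Since \<open>\<Phi>\<close> need not be uniformly convex, lower semicontinuity is obtained from \<open>\<Phi>(t) \<ge> C t\<^sup>m\<close>: iterated midpoints of
  the sequence nearly minimise \<open>\<integral>|\<nabla>w|\<^sup>m\<close>, hence converge strongly by uniform convexity of the \<open>m\<close>-th power.\<close>

text \<open>Two exponents coincide, and this carries the estimates. By (\<phi>4) \<Phi> and its
  conjugate grow at most like the powers m and ms, the Sobolev exponent of m, so smallness of f
  against t \<phi>_*(t) is smallness against \<open>t powr (ms - 1)\<close>; since \<Phi> is at
  least C t^m, the conjugate is at least a multiple of t^ms, so |u|^ms is integrable on the energy
  space. The power bounds also make modular convergence and norm convergence the same, hence all
  limits are taken with modulars. For ell = 1 the space need not be reflexive, and the limit of the
  gradients has to be constructed. The midpoints converge only in L^m, whereas the space is a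
  completion with respect to \<Phi>. Cutoffs bridge the gap: on a bounded set L^m convergence
  implies \<Phi> convergence, and at infinity the gradient of a cutoff, of size 1/j on an annulus of
  volume j^N, is paired with the tail of the conjugate modular. The embedding is obtained by summing
  an estimate over dyadic level sets; in it the conjugate term carries a small factor and is
  absorbed on the left.\<close>

abbreviation (input) "LM \<equiv> borel_measurable lebesgue"

abbreviation (input) seq_lim (infix "~~>" 60) where "X ~~> L \<equiv> X \<longlonglongrightarrow> L"

abbreviation (input) scale_R (infixr "*R" 75) where "c *R x \<equiv> c *\<^sub>R x"

section \<open>Modulars\<close>

text \<open>\<Phi>, its Sobolev conjugate and the pure powers all belong to this one class. The
  penultimate clause is what convexity together with \<open>G 0 = 0\<close> gives for contractions;
  the last is the doubling condition in power form, from which every modular below gets its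
  quasi-triangle inequality.\<close>

definition gf :: "(real => real) => real => bool" where
 "gf G q \<longleftrightarrow> 1 <= q & G 0 = 0 & continuous_on {0..} G & (\<forall>t>0. 0 < G t) \<and>
   (ALL s t. 0 <= s --> s <= t --> G s <= G t) \<and>
   (ALL c t. 0 <= c --> c <= 1 --> 0 <= t --> G (c * t) <= c * G t) \<and>
   (ALL c t. 1 <= c --> 0 <= t --> G (c * t) <= c powr q * G t)"

text \<open>The measure is a parameter because three are used: \<open>lebesgue\<close>,
  \<open>lborel\<close> for Fubini arguments, and \<open>lebesgue\<close> weighted by V for the
  potential term.\<close>

definition mo :: "'a measure => (real => real) => ('a => 'b::euclidean_space) => ennreal" where
 "mo M G w = (\<integral>\<^sup>+ x. ennreal (G (norm (w x))) \<partial>M)"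

abbreviation (input) "mL \<equiv> mo lebesgue"

lemma ennreal_tendsto_0_iff:
 fixes X :: "'i => ennreal"
 shows "(X \<longlongrightarrow> 0) F \<longleftrightarrow> (\<forall>e>0. eventually (%n. X n <= ennreal e) F)"
proof
 assume X: "(X \<longlongrightarrow> 0) F"
 show "\<forall>e>0. eventually (%n. X n <= ennreal e) F"
 proof (intro allI impI)
  fix e :: real assume "0 < e"
  then have "eventually (%n. X n < ennreal e) F"
   by (intro order_tendstoD(2)[OF X]) auto
  then show "eventually (%n. X n <= ennreal e) F"
   by eventually_elim auto
 qed
next
 assume a: "\<forall>e>0. eventually (%n. X n <= ennreal e) F"
 show "(X \<longlongrightarrow> 0) F"
 proof (rule order_tendstoI)
  fix b :: ennreal assume "0 < b"
  then obtain e where e: "0 < e" "ennreal e < b"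
  proof (cases b)
   case (real r)
   with \<open>0 < b\<close> show ?thesis by (intro that[of "r/2"]) (auto simp: ennreal_less_iff)
  next
   case top then show ?thesis by (intro that[of 1]) auto
  qed
  then show "eventually (%n. X n < b) F"
   using a by (force elim: eventually_mono)
 qed auto
qed

lemma ennreal_tendsto_0_le:
 fixes X Y :: "'i => ennreal"
 assumes "(Y \<longlongrightarrow> 0) F" "eventually (%n. X n <= Y n) F"
 shows "(X \<longlongrightarrow> 0) F"
 by (rule tendsto_sandwich[OF _ assms(2) tendsto_const assms(1)]) auto

lemma gfD:
 assumes "gf G q"
 shows gf_q: "1 <= q" and gf_0: "G 0 = 0" and gf_cont: "continuous_on {0..} G"
  and gf_pos: "!!t. 0 < t ==> 0 < G t" and gf_mono: "!!s t. 0 <= s ==> s <= t ==> G s <= G t"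
  and gf_sub: "!!c t. 0 <= c ==> c <= 1 ==> 0 <= t ==> G (c * t) <= c * G t"
  and gf_sup: "!!c t. 1 <= c ==> 0 <= t ==> G (c * t) <= c powr q * G t"
 using assms unfolding gf_def by blast+

lemma gf_ge0: "gf G q ==> 0 <= t ==> 0 <= G t"
 using gf_mono[of G q 0 t] gf_0[of G q] by simp

lemma gf_add:
 assumes G: "gf G q" and "0 <= s" "0 <= t"
 shows "G (s + t) <= 2 powr q * (G s + G t)"
proof -
 have "G (s + t) <= G (2 * max s t)"
  using assms by (intro gf_mono[OF G]) auto
 also have "... <= 2 powr q * G (max s t)"
  using assms by (intro gf_sup[OF G]) auto
 also have "... <= 2 powr q * (G s + G t)"
  using gf_ge0[OF G] assms by (intro mult_left_mono) (auto simp: max_def)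
 finally show ?thesis .
qed

lemma gf_scale:
 assumes G: "gf G q" and "0 <= c" "0 <= t"
 shows "G (c * t) <= max 1 (c powr q) * G t"
proof (cases "c <= 1")
 case True
 then have "G (c * t) <= c * G t" using assms by (intro gf_sub[OF G]) auto
 also have "... <= 1 * G t" using True gf_ge0[OF G \<open>0 <= t\<close>] by (intro mult_right_mono) auto
 also have "... <= max 1 (c powr q) * G t" using gf_ge0[OF G \<open>0 <= t\<close>] by (intro mult_right_mono) auto
 finally show ?thesis .
next
 case False
 then have "G (c * t) <= c powr q * G t" using assms by (intro gf_sup[OF G]) auto
 also have "... <= max 1 (c powr q) * G t" using gf_ge0[OF G \<open>0 <= t\<close>] by (intro mult_right_mono) auto
 finally show ?thesis .
qed

text \<open>\<open>G t / t\<close> is nondecreasing, so beyond any height \<open>th\<close> the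
  identity is dominated by \<open>th / G th\<close> times G. On a set of finite measure this turns a
  modular bound into a bound on the integral, with an error \<open>th\<close> per unit of measure
  that is free to choose.\<close>

lemma gf_lin:
 assumes G: "gf G q" and "0 < th" "0 <= t"
 shows "t <= th + th / G th * G t"
proof (cases "t <= th")
 case True
 then show ?thesis using gf_pos[OF G] gf_ge0[OF G] assms
  by (smt (verit) divide_nonneg_nonneg mult_nonneg_nonneg)
next
 case False
 then have "G ((th / t) * t) <= (th / t) * G t"
  using assms by (intro gf_sub[OF G]) auto
 then have "G th * t <= th * G t" using False assms by (simp add: field_simps)
 then have "t <= th / G th * G t" using gf_pos[OF G \<open>0 < th\<close>] by (simp add: field_simps)
 then show ?thesis using assms by simp
qed

lemma gf_powr: "1 <= q ==> gf (%t. t powr q) q"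
 unfolding gf_def
proof (intro conjI allI impI)
 fix c t :: real assume q: "1 <= q" and c: "0 <= c" "c <= 1" "0 <= t"
 have "c powr q <= c powr 1"
  using q c powr_mono'[of 1 q c] by simp
 then show "(c * t) powr q <= c * t powr q"
  using c by (simp add: powr_mult mult_right_mono)
next
 assume "1 <= q"
 then show "continuous_on {0..} (%t. t powr q)"
  by (intro continuous_on_powr' continuous_intros) auto
qed (auto intro!: powr_mono2 simp: powr_mult)

lemma gf_meas:
 assumes G: "gf G q" and [measurable]: "w \<in> borel_measurable M"
 shows "(%x. G (norm (w x :: 'b::euclidean_space))) \<in> borel_measurable M"
proof -
 have "continuous_on UNIV (%t. G (max 0 t))"
  by (rule continuous_on_compose2[OF gf_cont[OF G]]) (auto intro!: continuous_intros)
 then have "(%t. G (max 0 t)) \<in> borel_measurable borel"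
  by (rule borel_measurable_continuous_onI)
 then have "(%x. G (max 0 (norm (w x)))) \<in> borel_measurable M"
  by (rule measurable_compose[rotated]) auto
 then show ?thesis by simp
qed

lemma gf_meas_e:
 assumes G: "gf G q" and "w \<in> borel_measurable M"
 shows "(%x. ennreal (G (norm (w x :: 'b::euclidean_space)))) \<in> borel_measurable M"
 using gf_meas[OF assms] by measurable

lemma mo_mono:
 assumes "gf G q" "AE x in M. norm (v x) <= norm (w x)"
 shows "mo M G v <= mo M G w"
 unfolding mo_def using assms(2)
 by (intro nn_integral_mono_AE) (auto elim!: eventually_mono intro!: ennreal_leI gf_mono[OF assms(1)])

lemma mo_add:
 assumes G: "gf G q" and [measurable]: "u \<in> borel_measurable M" "v \<in> borel_measurable M"
 shows "mo M G (%x. u x + v x) <= ennreal (2 powr q) * (mo M G u + mo M G v)"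
proof -
 note [measurable] = gf_meas_e[OF G]
 have "mo M G (%x. u x + v x) <= (\<integral>\<^sup>+ x. ennreal (2 powr q) * (ennreal (G (norm (u x))) + ennreal (G (norm (v x)))) \<partial>M)"
  unfolding mo_def
 proof (rule nn_integral_mono)
  fix x
  have "G (norm (u x + v x)) <= G (norm (u x) + norm (v x))"
   by (intro gf_mono[OF G]) (auto intro: norm_triangle_ineq)
  also have "... <= 2 powr q * (G (norm (u x)) + G (norm (v x)))"
   by (intro gf_add[OF G]) auto
  finally show "ennreal (G (norm (u x + v x))) <= ennreal (2 powr q) * (ennreal (G (norm (u x))) + ennreal (G (norm (v x))))"
   using gf_ge0[OF G] by (auto simp flip: ennreal_plus ennreal_mult intro!: ennreal_leI)
 qed
 also have "... = ennreal (2 powr q) * (mo M G u + mo M G v)"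
  unfolding mo_def by (subst nn_integral_cmult) (auto simp: nn_integral_add)
 finally show ?thesis .
qed

lemma mo_scale:
 assumes G: "gf G q" and [measurable]: "u \<in> borel_measurable M"
 shows "mo M G (%x. c *R u x) <= ennreal (max 1 (\<bar>c\<bar> powr q)) * mo M G u"
proof -
 note [measurable] = gf_meas_e[OF G]
 have "mo M G (%x. c *R u x) <= (\<integral>\<^sup>+ x. ennreal (max 1 (\<bar>c\<bar> powr q)) * ennreal (G (norm (u x))) \<partial>M)"
  unfolding mo_def using gf_scale[OF G, of "\<bar>c\<bar>"] gf_ge0[OF G]
  by (intro nn_integral_mono) (auto simp flip: ennreal_mult intro!: ennreal_leI)
 then show ?thesis unfolding mo_def by (subst (asm) nn_integral_cmult) auto
qed

lemma mo_sub:
 assumes G: "gf G q" and [measurable]: "u \<in> borel_measurable M" and c: "\<bar>c\<bar> <= 1"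
 shows "mo M G (%x. c *R u x) <= ennreal \<bar>c\<bar> * mo M G u"
proof -
 note [measurable] = gf_meas_e[OF G]
 have "mo M G (%x. c *R u x) <= (\<integral>\<^sup>+ x. ennreal \<bar>c\<bar> * ennreal (G (norm (u x))) \<partial>M)"
  unfolding mo_def using gf_sub[OF G, of "\<bar>c\<bar>"] gf_ge0[OF G] c
  by (intro nn_integral_mono) (auto simp flip: ennreal_mult intro!: ennreal_leI)
 then show ?thesis unfolding mo_def by (subst (asm) nn_integral_cmult) auto
qed

lemma mo_minus: "mo M G (%x. - u x) = mo M G u"
 by (simp add: mo_def)

lemma mo_diff_swap: "mo M G (%x. u x - v x) = mo M G (%x. v x - u x)"
 by (simp add: mo_def norm_minus_commute)

lemma mo_diff:
 assumes G: "gf G q" and [measurable]: "u \<in> borel_measurable M" "v \<in> borel_measurable M"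
 shows "mo M G (%x. u x - v x) <= ennreal (2 powr q) * (mo M G u + mo M G v)"
 using mo_add[OF G, of u M "%x. - v x"] by (simp add: mo_minus)

lemma mo_triangle:
 assumes G: "gf G q" and [measurable]: "u \<in> borel_measurable M" "v \<in> borel_measurable M" "w \<in> borel_measurable M"
 shows "mo M G (%x. u x - w x) <= ennreal (2 powr q) * (mo M G (%x. u x - v x) + mo M G (%x. v x - w x))"
 using mo_add[OF G, of "%x. u x - v x" M "%x. v x - w x"] by simp

lemma mo_add_finite:
 assumes G: "gf G q" and [measurable]: "u \<in> borel_measurable M" "v \<in> borel_measurable M"
  and "mo M G u < \<infinity>" "mo M G v < \<infinity>"
 shows "mo M G (%x. u x + v x) < \<infinity>"
 by (rule le_less_trans[OF mo_add[OF G]]) (use assms in \<open>auto simp: ennreal_mult_less_top\<close>)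

lemma mo_scale_finite:
 assumes G: "gf G q" and [measurable]: "u \<in> borel_measurable M" and "mo M G u < \<infinity>"
 shows "mo M G (%x. c *R u x) < \<infinity>"
 by (rule le_less_trans[OF mo_scale[OF G]]) (use assms in \<open>auto simp: ennreal_mult_less_top\<close>)

lemma mo_tendsto_add:
 assumes G: "gf G q" and "!!n. u n \<in> borel_measurable M" "!!n. v n \<in> borel_measurable M"
  and "((%n. mo M G (u n)) \<longlongrightarrow> 0) F" "((%n. mo M G (v n)) \<longlongrightarrow> 0) F"
 shows "((%n. mo M G (%x. u n x + v n x)) \<longlongrightarrow> 0) F"
proof (rule ennreal_tendsto_0_le)
 have "((%n. ennreal (2 powr q) * (mo M G (u n) + mo M G (v n))) \<longlongrightarrow> ennreal (2 powr q) * (0 + 0)) F"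
  by (intro ennreal_tendsto_cmult tendsto_add assms) auto
 then show "((%n. ennreal (2 powr q) * (mo M G (u n) + mo M G (v n))) \<longlongrightarrow> 0) F" by simp
qed (intro always_eventually allI mo_add[OF G] assms)

lemma mo_tendsto_scale:
 assumes G: "gf G q" and "!!n. u n \<in> borel_measurable M"
  and "((%n. mo M G (u n)) \<longlongrightarrow> 0) F"
 shows "((%n. mo M G (%x. c *R u n x)) \<longlongrightarrow> 0) F"
proof (rule ennreal_tendsto_0_le)
 have "((%n. ennreal (max 1 (\<bar>c\<bar> powr q)) * mo M G (u n)) \<longlongrightarrow> ennreal (max 1 (\<bar>c\<bar> powr q)) * 0) F"
  by (intro ennreal_tendsto_cmult assms) auto
 then show "((%n. ennreal (max 1 (\<bar>c\<bar> powr q)) * mo M G (u n)) \<longlongrightarrow> 0) F" by simp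
qed (intro always_eventually allI mo_scale[OF G] assms)

lemma mo_tendsto_le:
 assumes G: "gf G q" and "((%n. mo M G (v n)) \<longlongrightarrow> 0) F"
  and "!!n. AE x in M. norm (u n x) <= norm (v n x)"
 shows "((%n. mo M G (u n)) \<longlongrightarrow> 0) F"
 by (rule ennreal_tendsto_0_le[OF assms(2)]) (intro always_eventually allI mo_mono[OF G] assms)

lemma gf_tendsto_0:
 assumes G: "gf G q" and "(X \<longlongrightarrow> 0) F" "!!n. 0 <= X n"
 shows "((%n. G (X n)) \<longlongrightarrow> 0) F"
proof -
 have "((%n. G (X n)) \<longlongrightarrow> G 0) F"
  by (rule continuous_on_tendsto_compose[OF gf_cont[OF G] assms(2)]) (use assms in auto)
 then show ?thesis using gf_0[OF G] by simp
qed

lemma gf_tendsto: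
 assumes G: "gf G q" and "(X \<longlongrightarrow> l) F" "!!n. 0 <= X n" "0 <= l"
 shows "((%n. G (X n)) \<longlongrightarrow> G l) F"
 by (rule continuous_on_tendsto_compose[OF gf_cont[OF G] assms(2)]) (use assms in auto)

lemma mo_dominated:
 fixes w :: "nat => 'a => 'b::euclidean_space"
 assumes G: "gf G q" and [measurable]: "!!n. w n \<in> borel_measurable M" "b \<in> borel_measurable M"
  and "mo M G (b :: 'a => 'c::euclidean_space) < \<infinity>"
  and "!!n. AE x in M. norm (w n x) <= norm (b x)" and "AE x in M. (%n. w n x) ~~> 0"
 shows "(%n. mo M G (w n)) ~~> 0"
proof -
 note [measurable] = gf_meas_e[OF G]
 have "(%n. (\<integral>\<^sup>+ x. ennreal (G (norm (w n x))) \<partial>M)) ~~> (\<integral>\<^sup>+ x. 0 \<partial>M)"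
 proof (rule nn_integral_dominated_convergence)
  show "(\<integral>\<^sup>+ x. ennreal (G (norm (b x))) \<partial>M) < \<infinity>" using assms(4) by (simp add: mo_def)
  show "!!j. AE x in M. ennreal (G (norm (w j x))) <= ennreal (G (norm (b x)))"
   by (rule AE_mp[OF assms(5)]) (auto intro!: ennreal_leI gf_mono[OF G])
  show "AE x in M. (%i. ennreal (G (norm (w i x)))) ~~> 0"
   using assms(6)
  proof eventually_elim
   case (elim x)
   have "(%i. ennreal (G (norm (w i x)))) ~~> ennreal 0"
    by (intro tendsto_ennrealI gf_tendsto_0[OF G] tendsto_norm_zero elim) auto
   then show ?case by simp
  qed
 qed auto
 then show ?thesis by (simp add: mo_def)
qed

lemma mo_fatou:
 fixes w :: "nat => 'a => 'b::euclidean_space"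
 assumes G: "gf G q" and [measurable]: "!!n. w n \<in> borel_measurable M"
  and "AE x in M. (%n. w n x) ~~> v x"
 shows "mo M G v <= liminf (%n. mo M G (w n))"
proof -
 note [measurable] = gf_meas_e[OF G]
 have "mo M G v = (\<integral>\<^sup>+ x. liminf (%n. ennreal (G (norm (w n x)))) \<partial>M)"
  unfolding mo_def using assms(3)
 proof (intro nn_integral_cong_AE, eventually_elim)
  case (elim x)
  have "(%n. ennreal (G (norm (w n x)))) ~~> ennreal (G (norm (v x)))"
   by (intro tendsto_ennrealI gf_tendsto[OF G] tendsto_norm elim) auto
  then show ?case by (metis lim_imp_Liminf sequentially_bot)
 qed
 also have "... <= liminf (%n. mo M G (w n))"
  unfolding mo_def by (rule nn_integral_liminf) auto
 finally show ?thesis .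
qed

lemma mo_fatou_le:
 fixes w :: "nat => 'a => 'b::euclidean_space"
 assumes G: "gf G q" and m: "!!n. w n \<in> borel_measurable M"
  and l: "AE x in M. (%n. w n x) ~~> v x" and b: "eventually (%n. mo M G (w n) <= B) sequentially"
 shows "mo M G v <= B"
proof -
 have "liminf (%n. mo M G (w n)) <= limsup (%n. mo M G (w n))" by (rule Liminf_le_Limsup) auto
 also have "... <= B" by (rule Limsup_bounded[OF b])
 finally show ?thesis using mo_fatou[OF G m l] by (rule order_trans[rotated])
qed

lemma nn_integral_le_mo:
 fixes w :: "'a => 'b::euclidean_space"
 assumes G: "gf G q" and [measurable]: "w \<in> borel_measurable M" "A \<in> sets M" and "0 < th"
 shows "(\<integral>\<^sup>+x\<in>A. ennreal (norm (w x)) \<partial>M) <= ennreal th * emeasure M A + ennreal (th / G th) * mo M G w"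
proof -
 note [measurable] = gf_meas_e[OF G]
 have "(\<integral>\<^sup>+x\<in>A. ennreal (norm (w x)) \<partial>M) <= (\<integral>\<^sup>+x. ennreal th * indicator A x + ennreal (th / G th) * ennreal (G (norm (w x))) \<partial>M)"
 proof (rule nn_integral_mono)
  fix x
  have "ennreal (norm (w x)) <= ennreal th + ennreal (th / G th) * ennreal (G (norm (w x)))"
   using gf_lin[OF G \<open>0 < th\<close>, of "norm (w x)"] gf_ge0[OF G] gf_pos[OF G \<open>0 < th\<close>] \<open>0 < th\<close>
   by (auto simp flip: ennreal_plus ennreal_mult intro!: ennreal_leI)
  then show "ennreal (norm (w x)) * indicator A x <= ennreal th * indicator A x + ennreal (th / G th) * ennreal (G (norm (w x)))"
   by (auto simp: indicator_def)
 qed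
 also have "... = ennreal th * emeasure M A + ennreal (th / G th) * mo M G w"
  unfolding mo_def by (subst nn_integral_add) (auto simp: nn_integral_cmult)
 finally show ?thesis .
qed

lemma mo_imp_L1:
 fixes w :: "nat => 'a => 'b::euclidean_space"
 assumes G: "gf G q" and [measurable]: "!!n. w n \<in> borel_measurable M" "A \<in> sets M"
  and "emeasure M A < \<infinity>" "((%n. mo M G (w n)) ~~> 0)"
 shows "(%n. \<integral>\<^sup>+x\<in>A. ennreal (norm (w n x)) \<partial>M) ~~> 0"
 unfolding ennreal_tendsto_0_iff
proof (intro allI impI)
 fix e :: real assume "0 < e"
 define \<mu> where "\<mu> = measure M A"
 have \<mu>: "emeasure M A = ennreal \<mu>" "0 <= \<mu>" using assms(4) by (auto simp: \<mu>_def emeasure_eq_ennreal_measure)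
 \<comment> \<open>The error \<open>th * \<mu>\<close> does not depend on n; the factor
   \<open>th / G th\<close> is fixed afterwards and is beaten by the vanishing modular. Adding 1
   covers \<mu> = 0.\<close>
 define th where "th = e / (2 * (\<mu> + 1))"
 have th: "0 < th" "th * \<mu> <= e / 2" using \<open>0 < e\<close> \<mu> by (auto simp: th_def field_simps)
 have "eventually (%n. mo M G (w n) <= ennreal (G th / th * (e / 2))) sequentially"
  using assms(5) th gf_pos[OF G th(1)] \<open>0 < e\<close> unfolding ennreal_tendsto_0_iff by (auto intro!: mult_pos_pos)
 then show "eventually (%n. (\<integral>\<^sup>+x\<in>A. ennreal (norm (w n x)) \<partial>M) <= ennreal e) sequentially"
 proof eventually_elim
  case (elim n)
  have "(\<integral>\<^sup>+x\<in>A. ennreal (norm (w n x)) \<partial>M) <= ennreal th * emeasure M A + ennreal (th / G th) * mo M G (w n)"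
   by (rule nn_integral_le_mo[OF G]) (auto simp: th)
  also have "... <= ennreal (th * \<mu>) + ennreal (th / G th) * ennreal (G th / th * (e / 2))"
   using th \<mu> elim by (auto simp: ennreal_mult intro!: add_mono mult_left_mono)
  also have "... = ennreal (th * \<mu> + (th / G th) * (G th / th * (e / 2)))"
   using th \<mu> gf_pos[OF G th(1)] \<open>0 < e\<close> by (simp flip: ennreal_plus ennreal_mult)
  also have "... <= ennreal e"
   using th gf_pos[OF G th(1)] by (intro ennreal_leI) (simp add: field_simps)
  finally show ?case .
 qed
qed

section \<open>Modular convergence and the Luxemburg norm\<close>

lemma modular_mo: "modular G u = mL G u"
 by (simp add: modular_def mo_def)

lemma orlicz_iff:
 assumes G: "gf G q"
 shows "u \<in> orlicz_space G \<longleftrightarrow> u \<in> LM & mL G u < \<infinity>"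
proof
 assume "u \<in> orlicz_space G"
 then obtain c where u[measurable]: "u \<in> LM" and c: "c > 0" "modular G (%x. u x / c) < \<infinity>"
  unfolding orlicz_space_def by auto
 have "mL G (%x. c *R (u x / c)) < \<infinity>"
  using c by (intro mo_scale_finite[OF G]) (auto simp: modular_mo)
 then show "u \<in> LM & mL G u < \<infinity>" using c by simp
qed (auto simp: orlicz_space_def modular_mo intro!: exI[of _ 1])

lemma lux_norm_le:
 assumes "0 < c" "mL G (%x. u x / c) <= 1"
 shows "lux_norm G u <= c"
 unfolding lux_norm_def by (rule cInf_lower) (use assms in \<open>auto simp: modular_mo intro!: bdd_belowI[of _ 0]\<close>)

text \<open>Division by \<open>1 + r\<close>, with r the modular, is a contraction and lowers the
  modular at least by that factor. It guarantees that the set in the Luxemburg infimum is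
  nonempty.\<close>

lemma mo_shrink:
 assumes G: "gf G q" and [measurable]: "u \<in> LM" and fin: "mL G (u::'a::euclidean_space => real) < \<infinity>"
 obtains c where "0 < c" "mL G (%x. u x / c) <= 1"
proof -
 define r where "r = enn2real (mL G u)"
 have r: "mL G u = ennreal r" "0 <= r" using fin by (auto simp: r_def)
 have "mL G (%x. (1 / (1 + r)) *R u x) <= ennreal \<bar>1 / (1 + r)\<bar> * mL G u"
  using r by (intro mo_sub[OF G]) auto
 also have "... <= ennreal 1" unfolding r using r by (subst ennreal_mult[symmetric]) (auto simp: field_simps intro!: ennreal_leI)
 finally show ?thesis using r by (intro that[of "1 + r"]) auto
qed

lemma lux_norm_nonneg:
 assumes G: "gf G q" "u \<in> LM" "mL G (u::'a::euclidean_space => real) < \<infinity>"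
 shows "0 <= lux_norm G u"
 unfolding lux_norm_def using mo_shrink[OF assms] by (intro cInf_greatest) (auto simp: modular_mo)

text \<open>Below norm 1 the modular is at most the norm, because scaling back by
  \<open>d < 1\<close> is a contraction; \<open>c <= 1\<close> is what makes \<open>mo_sub\<close>
  applicable.\<close>

lemma lux_norm_less_imp:
 assumes G: "gf G q" and [measurable]: "u \<in> LM" and "mL G (u::'a::euclidean_space => real) < \<infinity>"
  and c: "lux_norm G u < c" "c <= 1"
 shows "mL G u <= ennreal c"
proof -
 have "{c. c > 0 & modular G (%x. u x / c) <= 1} ~= {}"
  using mo_shrink[OF assms(1-3)] by (auto simp: modular_mo)
 from cInf_lessD[OF this] c obtain d where d: "0 < d" "d < c" "mL G (%x. u x / d) <= 1"
  unfolding lux_norm_def by (auto simp: modular_mo)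
 have "mL G (%x. d *R (u x / d)) <= ennreal \<bar>d\<bar> * mL G (%x. u x / d)"
  using d c by (intro mo_sub[OF G]) auto
 also have "... <= ennreal d * 1" using d by (intro mult_mono) auto
 also have "... <= ennreal c" using d by (simp add: ennreal_leI)
 finally show ?thesis using d by simp
qed

text \<open>From norms to modulars the contraction bound suffices. The way back uses doubling: u
  divided by e/2 must still have small modular.\<close>

lemma lux_tendsto_iff:
 assumes G: "gf G q" and [measurable]: "!!n. u n \<in> LM"
  and fin: "!!n::nat. mL G (u n::'a::euclidean_space => real) < \<infinity>"
 shows "(%n. lux_norm G (u n)) ~~> 0 \<longleftrightarrow> (%n. mL G (u n)) ~~> 0"
proof
 assume l: "(%n. lux_norm G (u n)) ~~> 0"
 show "(%n. mL G (u n)) ~~> 0"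
  unfolding ennreal_tendsto_0_iff
 proof (intro allI impI)
  fix e :: real assume "0 < e"
  then have "eventually (%n. lux_norm G (u n) < min e 1) sequentially"
   by (intro order_tendstoD(2)[OF l]) auto
  then show "eventually (%n. mL G (u n) <= ennreal e) sequentially"
  proof eventually_elim
   case (elim n)
   have "mL G (u n) <= ennreal (min e 1)"
    by (rule lux_norm_less_imp[OF G _ fin elim]) auto
   also have "... <= ennreal e" by (intro ennreal_leI) auto
   finally show ?case .
  qed
 qed
next
 assume l: "(%n. mL G (u n)) ~~> 0"
 show "(%n. lux_norm G (u n)) ~~> 0"
 proof (rule LIMSEQ_I)
  fix e :: real assume e: "0 < e"
  have "(%n. mL G (%x. (2 / e) *R u n x)) ~~> 0"
   by (rule mo_tendsto_scale[OF G _ l]) auto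
  then have "eventually (%n. mL G (%x. (2 / e) *R u n x) <= ennreal 1) sequentially"
   unfolding ennreal_tendsto_0_iff by (meson zero_less_one)
  then obtain N where N: "!!n. n >= N ==> mL G (%x. (2 / e) *R u n x) <= 1"
   unfolding eventually_sequentially by auto
  have "norm (lux_norm G (u n) - 0) < e" if "n >= N" for n
  proof -
   have "lux_norm G (u n) <= e / 2"
    using N[OF that] e by (intro lux_norm_le) (auto simp: field_simps)
   moreover have "0 <= lux_norm G (u n)" by (rule lux_norm_nonneg[OF G _ fin]) auto
   ultimately show ?thesis using e by auto
  qed
  then show "EX no. \<forall>n\<ge>no. norm (lux_norm G (u n) - 0) < e" by blast
 qed
qed

section \<open>The N-function and its Sobolev conjugate\<close>

text \<open>Serves twice: for \<Phi>, where \<open>g\<close> is \<open>Phi_inv\<close>, and for the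
  integral defining the inverse of the conjugate, where \<open>g\<close> is \<open>Phi_star\<close>.
  The definite description in \<open>g\<close> matches those in the definitions.\<close>

locale incr_bij =
 fixes f :: "real => real"
 assumes f0: "f 0 = 0" and fc: "continuous_on {0..} f"
  and fm: "!!s t. 0 <= s ==> s < t ==> f s < f t" and fu: "!!y. \<exists>t\<ge>0. y <= f t"
begin

definition g :: "real => real" where "g s = (THE t. 0 <= t & f t = s)"

lemma f_mono: "0 <= s ==> s <= t ==> f s <= f t"
 using fm[of s t] by (cases "s = t") auto

lemma f_ge0: "0 <= t ==> 0 <= f t"
 using f_mono[of 0 t] f0 by simp

lemma ex1: "0 <= s ==> \<exists>!t. 0 <= t & f t = s"
proof -
 assume s: "0 <= s"
 obtain b where b: "0 <= b" "s <= f b" using fu by blast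
 have "EX t. 0 <= t & t <= b & f t = s"
  by (rule IVT') (use s b f0 fc in \<open>auto intro: continuous_on_subset\<close>)
 then show ?thesis using fm by (metis less_irrefl linorder_neqE_linordered_idom)
qed

lemma g: "0 <= s ==> 0 <= g s" "0 <= s ==> f (g s) = s"
 using theI'[OF ex1] unfolding g_def by blast+

lemma gf: "0 <= t ==> g (f t) = t"
 using ex1[of "f t"] g[of "f t"] f_ge0[of t] by blast

lemma g_less: "0 <= s ==> s < t ==> g s < g t"
 using g[of s] g[of t] f_mono[of "g t" "g s"] by (metis leD le_less_trans less_imp_le not_le)

lemma g_mono: "0 <= s ==> s <= t ==> g s <= g t"
 using g_less[of s t] by (cases "s = t") auto

lemma g0: "g 0 = 0" using gf[of 0] f0 by simp

lemma g_pos: "0 < s ==> 0 < g s" using g_less[of 0 s] g0 by simp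

lemma le_g: "0 <= t ==> 0 <= s ==> f t <= s \<longleftrightarrow> t <= g s"
 using gf g g_mono f_mono f_ge0 by metis

lemma g_le: "0 <= t ==> 0 <= s ==> s <= f t \<longleftrightarrow> g s <= t"
 using gf g g_mono f_mono f_ge0 by metis

lemma g_cont: "continuous_on {0..} g"
proof -
 \<comment> \<open>The identity on the negative half-line makes the range the whole line; a monotone
   function with open range is continuous.\<close>
 define h where "h = (%s. if 0 <= s then g s else s)"
 have "continuous_on UNIV h"
 proof (rule continuous_onI_mono)
  have "h ` UNIV = UNIV"
  proof (intro equalityI subsetI)
   fix y :: real
   show "y \<in> h ` UNIV"
   proof (cases "0 <= y")
    case True
    then have "h (f y) = y" using gf f_ge0 by (simp add: h_def)
    then show ?thesis by (metis rangeI)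
   next
    case False
    then have "h y = y" by (simp add: h_def)
    then show ?thesis by (metis rangeI)
   qed
  qed simp
  then show "open (h ` UNIV)" by simp
  show "h x <= h y" if "x <= y" for x y
   using that g_mono[of x y] g(1)[of y] by (auto simp: h_def)
 qed
 then have "continuous_on {0..} h" by (rule continuous_on_subset) simp
 then show ?thesis by (rule continuous_on_eq) (simp add: h_def)
qed

end

locale nfun =
 fixes \<phi> :: "real => real" and m n :: real
 assumes phi_pos: "!!t. 0 < t ==> 0 < \<phi> t" and phi_cont: "continuous_on {0<..} \<phi>"
  and phi_mono: "strict_mono_on {0<..} (%t. t * \<phi> t)"
  and phi_0: "((%t. t * \<phi> t) \<longlongrightarrow> 0) (at_right 0)"
  and m1: "1 < m" and mn: "m < n"
  and phi4: "!!s t. 0 < s ==> s <= t ==> \<phi> t / t powr (m - 2) <= \<phi> s / s powr (m - 2)"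
begin

text \<open>The continuous extension of t \<phi>(t) by 0, hence the derivative of \<Phi> on the
  closed half-line. It removes the arbitrary values of \<phi> at 0 and below.\<close>

definition a :: "real => real" where "a t = (if t <= 0 then 0 else t * \<phi> t)"

abbreviation "P \<equiv> Phi \<phi>"

lemma a_pos: "0 < t ==> 0 < a t" using phi_pos by (simp add: a_def)

lemma a_0[simp]: "a 0 = 0" by (simp add: a_def)

lemma a_less: "0 <= s ==> s < t ==> a s < a t"
 using strict_mono_onD[OF phi_mono, of s t] phi_pos[of t] by (auto simp: a_def)

lemma a_mono: "s <= t ==> a s <= a t"
 using a_less[of s t] a_pos[of t] by (cases "0 <= s"; cases "s = t"; cases "t <= 0") (auto simp: a_def[of s] a_def[of t] not_le)

lemma a_nonneg: "0 <= a t" using a_pos[of t] by (cases "0 < t") (auto simp: a_def)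

lemma a_cont: "continuous_on UNIV a"
proof -
 have "isCont a t" for t
 proof -
  consider "t > 0" | "t < 0" | "t = 0" by linarith
  then show ?thesis
  proof cases
   case 1
   have "isCont (%t. t * \<phi> t) t"
    using phi_cont 1 by (intro continuous_intros) (simp add: continuous_on_eq_continuous_at)
   moreover have "eventually (%s. s * \<phi> s = a s) (nhds t)"
    using 1 eventually_nhds_in_open[of "{0<..}" t] by (auto elim!: eventually_mono simp: a_def)
   ultimately show ?thesis by (simp add: isCont_cong)
  next
   case 2
   have "isCont (%t. 0::real) t" by simp
   moreover have "eventually (%s. 0 = a s) (nhds t)"
    using 2 eventually_nhds_in_open[of "{..<0}" t] by (auto elim!: eventually_mono simp: a_def)
   ultimately show ?thesis using isCont_cong[of "%t. 0" a t] by simp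
  next
   case 3
   have "(a \<longlongrightarrow> 0) (at_right 0)"
    by (rule Lim_transform_eventually[OF phi_0]) (auto simp: eventually_at_filter a_def)
   moreover have "(a \<longlongrightarrow> 0) (at_left 0)"
    by (rule Lim_transform_eventually[OF tendsto_const]) (auto simp: eventually_at_filter a_def)
   ultimately show ?thesis using 3 by (simp add: isCont_def filterlim_split_at)
  qed
 qed
 then show ?thesis by (simp add: continuous_on_eq_continuous_at)
qed

text \<open>(\<phi>4) at the points t and ct, multiplied by ct. Both the upper growth of \<Phi> and
  the behaviour of the convex part along rays come from this inequality.\<close>

lemma a_scale: assumes "1 <= c" "0 <= t" shows "a (c * t) <= c powr (m - 1) * a t"
proof (cases "t = 0")
 case False
 then have t: "0 < t" "0 < c" "t <= c * t" using assms by auto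
 have "\<phi> (c * t) / (c * t) powr (m - 2) <= \<phi> t / t powr (m - 2)" by (rule phi4) (use t in auto)
 then have "\<phi> (c * t) <= c powr (m - 2) * \<phi> t" using t by (simp add: powr_mult field_simps)
 then have "c * t * \<phi> (c * t) <= c * t * (c powr (m - 2) * \<phi> t)" using t by (intro mult_left_mono) auto
 also have "... = (c powr 1 * c powr (m - 2)) * (t * \<phi> t)" using t by simp
 also have "c powr 1 * c powr (m - 2) = c powr (m - 1)" by (subst powr_add[symmetric]) simp
 finally show ?thesis using t by (simp add: a_def not_le mult_le_0_iff)
qed simp

lemma P_integral: "P t = integral {0..\<bar>t\<bar>} a"
proof -
 have "P t = (LBINT s=ereal 0..ereal \<bar>t\<bar>. a s)"
  unfolding Phi_def zero_ereal_def
  by (rule interval_integral_cong) (auto simp: einterval_iff a_def min_def max_def)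
 also have "... = integral {0..\<bar>t\<bar>} a"
  by (rule interval_integral_eq_integral)
   (auto intro!: borel_integrable_atLeastAtMost' continuous_on_subset[OF a_cont])
 finally show ?thesis .
qed

lemma P_0[simp]: "P 0 = 0" by (simp add: P_integral)

lemma P_abs: "P \<bar>t\<bar> = P t" by (simp add: P_integral)

lemma P_deriv_pos: assumes "0 < t" shows "(P has_real_derivative a t) (at t)"
proof -
 have "((%x. integral {0..x} a) has_real_derivative a t) (at t within {0..t + 1})"
  by (rule integral_has_real_derivative) (use assms in \<open>auto intro: continuous_on_subset[OF a_cont]\<close>)
 then have "((%x. integral {0..x} a) has_real_derivative a t) (at t)"
  using assms by (subst (asm) at_within_Icc_at) auto
 moreover have "eventually (%s. integral {0..s} a = P s) (nhds t)"
  using assms eventually_nhds_in_open[of "{0<..}" t] by (auto elim!: eventually_mono simp: P_integral)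
 ultimately show ?thesis by (subst DERIV_cong_ev[OF refl _ refl, symmetric])
qed

lemma P_le: assumes "0 <= t" shows "P t <= t * a t"
proof -
 have "integral {0..t} a <= integral {0..t} (%_. a t)"
  by (intro integral_le integrable_continuous_real continuous_on_subset[OF a_cont]) (auto intro: a_mono)
 then show ?thesis using assms by (simp add: P_integral)
qed

text \<open>By \<open>a_scale\<close>, \<open>a x >= (x / t) powr (m - 1) * a t\<close> for x <= t;
  integrating the power over [0, t] produces the factor 1/m.\<close>

lemma P_ge: assumes "0 <= t" shows "t * a t <= m * P t"
proof (cases "t = 0")
 case False
 then have t: "0 < t" using assms by simp
 have I: "((%x. x powr (m - 1)) has_integral (t powr (m - 1 + 1) / (m - 1 + 1))) {0..t}"
  by (rule has_integral_powr_from_0) (use m1 t in auto)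
 have I': "((%x. (a t / t powr (m - 1)) * x powr (m - 1)) has_integral ((a t / t powr (m - 1)) * (t powr (m - 1 + 1) / (m - 1 + 1)))) {0..t}"
  by (rule has_integral_mult_right[OF I])
 have "(a t / t powr (m - 1)) * (t powr (m - 1 + 1) / (m - 1 + 1)) <= integral {0..t} a"
 proof (rule has_integral_le[OF I' integrable_integral])
  show "a integrable_on {0..t}" by (intro integrable_continuous_real continuous_on_subset[OF a_cont]) auto
  fix x assume x: "x \<in> {0..t}"
  show "a t / t powr (m - 1) * x powr (m - 1) <= a x"
  proof (cases "x = 0")
   case False
   then have x0: "0 < x" using x by auto
   have "a t = a ((t / x) * x)" using x0 by simp
   also have "... <= (t / x) powr (m - 1) * a x" by (rule a_scale) (use x x0 in auto)
   finally show ?thesis using x0 t by (simp add: powr_divide field_simps)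
  qed simp
 qed
 also have "(a t / t powr (m - 1)) * (t powr (m - 1 + 1) / (m - 1 + 1)) = t * a t / m"
  using t m1 by (simp add: powr_diff field_simps)
 finally show ?thesis using m1 t by (simp add: P_integral field_simps)
qed simp

lemma P_nonneg: "0 <= P t"
 unfolding P_integral by (rule integral_nonneg[OF integrable_continuous_real[OF continuous_on_subset[OF a_cont]]]) (auto intro: a_nonneg)

lemma P_pos: "0 < t ==> 0 < P t"
proof -
 assume t: "0 < t"
 then have "0 < m * P t" using P_ge[of t] a_pos[of t] mult_pos_pos[of t "a t"] by linarith
 then show ?thesis using m1 by (simp add: zero_less_mult_iff)
qed

lemma P_deriv: "(P has_real_derivative (sgn t * a \<bar>t\<bar>)) (at t)"
proof -
 consider "t > 0" | "t < 0" | "t = 0" by linarith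
 then show ?thesis
 proof cases
  case 1 then show ?thesis using P_deriv_pos by simp
 next
  case 2
  have "((%s. P (- s)) has_real_derivative (a (- t) * - 1)) (at t)"
   by (rule DERIV_chain2[OF P_deriv_pos]) (use 2 in \<open>auto intro!: derivative_eq_intros\<close>)
  moreover have "P (- s) = P s" for s by (simp add: P_integral)
  ultimately show ?thesis using 2 by simp
 next
  case 3
  have "((%s. P s / s) \<longlongrightarrow> 0) (at 0)"
  proof (rule Lim_null_comparison)
   show "eventually (%s. norm (P s / s) <= a \<bar>s\<bar>) (at 0)"
    unfolding eventually_at_filter
   proof (intro always_eventually allI impI)
    fix s :: real assume "s ~= 0"
    then show "norm (P s / s) <= a \<bar>s\<bar>"
     using P_le[of "\<bar>s\<bar>"] P_nonneg[of s] by (simp add: P_abs divide_le_eq mult.commute)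
   qed
   have "isCont (%s. a \<bar>s\<bar>) 0" using a_cont
    by (intro continuous_at_compose[of _ abs a, unfolded o_def]) (auto simp: continuous_on_eq_continuous_at)
   then show "((%s. a \<bar>s\<bar>) \<longlongrightarrow> 0) (at 0)" by (simp add: isCont_def)
  qed
  then show ?thesis using 3 by (simp add: has_field_derivative_iff)
 qed
qed

lemma P_cont: "continuous_on S P"
 by (rule DERIV_continuous_on) (use P_deriv in \<open>blast intro: has_field_derivative_at_within\<close>)

lemma P_mono: "0 <= s ==> s <= t ==> P s <= P t"
proof (rule DERIV_nonneg_imp_nondecreasing[of s t])
 fix x assume "0 <= s" "s <= x"
 then have "0 <= sgn x * a \<bar>x\<bar>" using a_nonneg by (simp add: sgn_if)
 then show "EX y. (P has_real_derivative y) (at x) & 0 <= y" using P_deriv[of x] by blast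
qed

lemma P_less: "0 <= s ==> s < t ==> P s < P t"
proof (rule DERIV_pos_imp_increasing_open[of s t])
 fix x assume "0 <= s" "s < x"
 then have "0 < x" by simp
 then show "EX y. (P has_real_derivative y) (at x) & 0 < y" using P_deriv_pos[of x] a_pos[of x] by blast
qed (use P_cont in auto)

text \<open>\<open>P_le\<close> says that \<open>P t / t\<close> has nonnegative derivative.\<close>

lemma P_sub: assumes "0 <= c" "c <= 1" "0 <= t" shows "P (c * t) <= c * P t"
proof (cases "c = 0 \<or> t = 0")
 case False
 then have ct: "0 < c" "0 < t" "0 < c * t" "c * t <= t" using assms by (auto intro: mult_left_le_one_le)
 have "P (c * t) / (c * t) <= P t / t"
 proof (rule DERIV_nonneg_imp_nondecreasing[OF ct(4)])
  fix x assume x: "c * t <= x" "x <= t"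
  then have x0: "0 < x" using ct by linarith
  have "((%x. P x / x) has_real_derivative (a x * x - P x * 1) / (x * x)) (at x)"
   by (rule DERIV_divide[OF P_deriv_pos[OF x0] DERIV_ident]) (use x0 in auto)
  moreover have "0 <= (a x * x - P x * 1) / (x * x)" using P_le[of x] x0 by (auto simp: mult.commute)
  ultimately show "EX y. ((%x. P x / x) has_real_derivative y) (at x) & 0 <= y" by blast
 qed
 then show ?thesis using ct by (simp add: field_simps)
qed auto

text \<open>\<open>P_ge\<close> makes \<open>P t / t powr m\<close> nonincreasing; this is the
  doubling condition with exponent exactly m.\<close>

lemma P_sup: assumes "1 <= c" "0 <= t" shows "P (c * t) <= c powr m * P t"
proof (cases "t = 0")
 case False
 then have ct: "0 < c" "0 < t" "t <= c * t" using assms by auto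
 have "P (c * t) / (c * t) powr m <= P t / t powr m"
 proof (rule DERIV_nonpos_imp_nonincreasing[OF ct(3)])
  fix x assume x: "t <= x" "x <= c * t"
  then have x0: "0 < x" using ct by linarith
  have pd: "((%x. x powr m) has_real_derivative m * x powr (m - 1)) (at x)"
   using x0 by (rule has_real_derivative_powr)
  have d: "((%x. P x / x powr m) has_real_derivative (a x * x powr m - P x * (m * x powr (m - 1))) / (x powr m * x powr m)) (at x)"
   by (rule DERIV_divide[OF P_deriv_pos[OF x0] pd]) (use x0 in auto)
  have "a x * x powr m = x powr (m - 1) * (x * a x)" using x0 by (simp add: powr_diff)
  also have "... <= x powr (m - 1) * (m * P x)" using P_ge[of x] x0 by (intro mult_left_mono) auto
  finally have "(a x * x powr m - P x * (m * x powr (m - 1))) / (x powr m * x powr m) <= 0"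
   by (intro divide_nonpos_nonneg) (auto simp: mult_ac)
  then show "EX y. ((%x. P x / x powr m) has_real_derivative y) (at x) & y <= 0" using d by blast
 qed
 then show ?thesis using ct by (simp add: powr_mult field_simps)
qed simp

lemma gf_P: "gf P m"
 unfolding gf_def using m1 P_pos P_cont P_mono P_sub P_sup by auto

sublocale PI: incr_bij P
proof
 show "\<exists>t\<ge>0. y <= P t" for y
 proof -
  \<comment> \<open>Superlinearity gives \<open>P T >= T * P 1\<close> for T >= 1, and the right
    side is at least y for this T.\<close>
  define T where "T = max 1 (y / P 1)"
  have T: "1 <= T" "y <= T * P 1" using P_pos[of 1] by (auto simp: T_def max_def field_simps)
  have "P ((1 / T) * T) <= (1 / T) * P T" by (rule P_sub) (use T in auto)
  then have "T * P 1 <= P T" using T by (simp add: field_simps)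
  then show ?thesis using T by (intro exI[of _ T]) auto
 qed
qed (use P_cont P_less in auto)

section \<open>The inverse of \<Phi> and the inverse of its conjugate\<close>

abbreviation "I \<equiv> Phi_inv \<phi>"

lemma I_eq: "I = PI.g" by (simp add: fun_eq_iff Phi_inv_def PI.g_def)

lemmas I = PI.g[folded I_eq] and PI_I = PI.gf[folded I_eq] and I_less = PI.g_less[folded I_eq]
 and I_mono = PI.g_mono[folded I_eq] and I_pos = PI.g_pos[folded I_eq] and le_I = PI.le_g[folded I_eq]
 and I_le = PI.g_le[folded I_eq] and I_cont = PI.g_cont[folded I_eq] and I_0 = PI.g0[folded I_eq]

lemma I_scale_ge: assumes "1 <= c" "0 <= s" shows "c powr (1 / m) * I s <= I (c * s)"
proof -
 have c: "1 <= c powr (1 / m)" using assms m1 by (intro ge_one_powr_ge_zero) auto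
 have "P (c powr (1 / m) * I s) <= (c powr (1 / m)) powr m * P (I s)"
  by (rule P_sup[OF c]) (use assms I in auto)
 also have "... = c * s" using assms m1 by (simp add: powr_powr I)
 finally show ?thesis using assms c I(1)[of s] by (subst (asm) le_I) auto
qed

lemma I_scale_le: assumes "1 <= c" "0 <= s" shows "I (c * s) <= c * I s"
proof -
 have "P ((1 / c) * (c * I s)) <= (1 / c) * P (c * I s)"
  by (rule P_sub) (use assms I(1)[of s] in auto)
 then have "c * s <= P (c * I s)" using assms I(2)[of s] by (simp add: field_simps)
 then show ?thesis using assms I(1)[of s] by (subst (asm) I_le) auto
qed

definition k :: "real => real" where "k s = I s * s powr (- (n + 1) / n)"

text \<open>The reciprocal of the Sobolev exponent \<open>ms\<close>. J grows at least like the
  power r, so its inverse grows at most like the power 1/r.\<close>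

definition r :: real where "r = 1 / m - 1 / n"

definition ms :: real where "ms = n * m / (n - m)"

lemma r: "0 < r" "r < 1" "ms = 1 / r"
proof -
 show "0 < r" using m1 mn by (simp add: r_def field_simps)
 have "1 / m < 1" "0 < 1 / n" using m1 mn by auto
 then show "r < 1" unfolding r_def by linarith
 show "ms = 1 / r" using m1 mn by (simp add: r_def ms_def field_simps)
qed

lemma ms1: "1 < ms" unfolding r(3) using r(1,2) by simp

lemma k_exp: "- (n + 1) / n = - 1 - 1 / n" using m1 mn by (simp add: field_simps)

lemma k_pos: "0 < s ==> 0 < k s" by (simp add: k_def I_pos)

lemma k_nonneg: "0 <= s ==> 0 <= k s" using I(1)[of s] by (simp add: k_def)

lemma k_cont: "continuous_on {0<..} k"
 unfolding k_def by (intro continuous_intros continuous_on_subset[OF I_cont]) auto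

text \<open>Scaling down from t bounds the integrand by a multiple of \<open>s powr (r - 1)\<close>,
  integrable at 0 because m < n makes r positive. This is why the integral defining the conjugate
  converges.\<close>

lemma k_upper: assumes "0 < s" "s <= t" shows "k s <= I t * t powr (- (1 / m)) * s powr (r - 1)"
proof -
 have "(t / s) powr (1 / m) * I s <= I ((t / s) * s)" by (rule I_scale_ge) (use assms in auto)
 then have "I s <= I t * t powr (- (1 / m)) * s powr (1 / m)"
  using assms by (simp add: powr_divide powr_minus field_simps)
 then have "k s <= I t * t powr (- (1 / m)) * s powr (1 / m) * s powr (- 1 - 1 / n)"
  unfolding k_def k_exp by (intro mult_right_mono) auto
 also have "... = I t * t powr (- (1 / m)) * s powr (1 / m + (- 1 - 1 / n))" by (simp add: powr_add mult.assoc)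
 also have "1 / m + (- 1 - 1 / n) = r - 1" by (simp add: r_def)
 finally show ?thesis .
qed

definition J :: "real => real" where "J t = integral {0..t} k"

lemma k_integrable: "k integrable_on {0..t}" and k_set_integrable: "set_integrable lborel {0..t} k"
 and J_upper: "0 < t ==> J t <= ms * (I t * t powr (- (1 / n)))"
proof -
 have *: "k integrable_on {0..t} & set_integrable lborel {0..t} k & (0 < t --> J t <= ms * (I t * t powr (- (1 / n))))"
 proof (cases "0 < t")
  case False
  have "(%x. indicator {0..t} x *R k x) = (%x. 0)" using False by (auto simp: indicator_def k_def fun_eq_iff)
  then have "set_integrable lborel {0..t} k" unfolding set_integrable_def by simp
  moreover have "k integrable_on {0..t}"
   using False has_integral_integrable[OF has_integral_refl(2)[of k 0]] by (cases "t = 0") auto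
  ultimately show ?thesis using False by blast
 next
  case True
  define c where "c = I t * t powr (- (1 / m))"
  have Hp: "((%x. x powr (r - 1)) has_integral (t powr (r - 1 + 1) / (r - 1 + 1))) {0..t}"
   by (rule has_integral_powr_from_0) (use r True in auto)
  then have Hc: "((%x. c * x powr (r - 1)) has_integral (c * (t powr r / r))) {0..t}"
   using has_integral_mult_right[OF Hp, of c] by simp
  have km: "k \<in> borel_measurable (restrict_space borel {0<..})"
   using k_cont by (rule borel_measurable_continuous_on_restrict)
  have km': "(%x. indicator {0<..} x *R k x) \<in> borel_measurable borel"
   using km by (subst (asm) borel_measurable_restrict_space_iff) auto
  have k0: "k 0 = 0" by (simp add: k_def)
  \<comment> \<open>The integrand is known to be continuous only off 0; passing to the open
    half-line, which loses nothing as \<open>k 0 = 0\<close>, gives Borel measurability.\<close>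
  have ind: "indicator {0..t} x *R k x = indicator {0..t} x *R (indicator {0<..} x *R k x)" for x
   using k0 by (auto simp: indicator_def)
  have cm: "set_integrable lebesgue {0..t} (%x. c * x powr (r - 1))"
   using nonnegative_absolutely_integrable_1[of "%x. c * x powr (r - 1)" "{0..t}"] Hc I(1)[of t] True
   by (auto simp: has_integral_integrable c_def)
  have "set_integrable lebesgue {0..t} k"
   unfolding set_integrable_def
  proof (rule Bochner_Integration.integrable_bound[OF cm[unfolded set_integrable_def]])
   have "(%x. indicator {0..t} x *R (indicator {0<..} x *R k x)) \<in> LM"
    using km' by (auto intro!: measurable_completion)
   then show "(%x. indicator {0..t} x *R k x) \<in> LM" unfolding ind .
   show "AE x in lebesgue. norm (indicator {0..t} x *R k x) <= norm (indicator {0..t} x *R (c * x powr (r - 1)))"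
   proof (rule AE_I2)
    fix x
    show "norm (indicator {0..t} x *R k x) <= norm (indicator {0..t} x *R (c * x powr (r - 1)))"
     using k_upper[of x t] k_nonneg[of x] k0 by (cases "0 < x"; cases "x = 0") (auto simp: indicator_def c_def)
   qed
  qed
  then have si: "set_integrable lebesgue {0..t} k" .
  have sb: "set_integrable lborel {0..t} k"
   using si km' unfolding set_integrable_def ind
   by (subst (asm) integrable_completion) auto
  have ki: "k integrable_on {0..t}" using si by (rule set_lebesgue_integral_eq_integral(1))
  have "J t <= c * (t powr r / r)"
   unfolding J_def
  proof (rule has_integral_le[OF integrable_integral[OF ki] Hc])
   fix x assume "x \<in> {0..t}"
   then show "k x <= c * x powr (r - 1)" using k_upper[of x t] k0 by (cases "x = 0") (auto simp: c_def)
  qed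
  also have "... = ms * (I t * (t powr (- (1 / m)) * t powr r))" by (simp add: c_def r)
  also have "t powr (- (1 / m)) * t powr r = t powr (- (1 / n))"
   by (subst powr_add[symmetric]) (simp add: r_def)
  finally show ?thesis using ki sb by blast
 qed
 show "k integrable_on {0..t}" "set_integrable lborel {0..t} k" "0 < t ==> J t <= ms * (I t * t powr (- (1 / n)))"
  using * by blast+
qed

lemma J_0: "J 0 = 0" by (simp add: J_def)

lemma J_star: "0 <= t ==> Phi_star_inv \<phi> n t = J t"
 unfolding Phi_star_inv_def J_def zero_ereal_def k_def[symmetric]
 by (rule interval_integral_eq_integral) (use k_set_integrable in auto)

lemma J_cont: "continuous_on {0..} J"
proof -
 have "continuous_on {0..b} J" for b unfolding J_def by (rule indefinite_integral_continuous_1[OF k_integrable])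
 moreover have "{0..} = (\<Union>b\<in>UNIV. {0..b::real})" by auto
 ultimately have "\<forall>x\<in>{0..}. continuous (at x within {0..}) J"
 proof -
  have "continuous (at x within {0..}) J" if "0 <= x" for x
  proof -
   have "continuous (at x within {0..x + 1}) J"
    using \<open>!!b. continuous_on {0..b} J\<close>[of "x + 1"] that by (auto simp: continuous_on_eq_continuous_within)
   moreover have "at x within {0..} = at x within {0..x + 1}"
    by (rule at_within_nhd[of x "{..<x + 1}"]) auto
   ultimately show ?thesis by simp
  qed
  then show ?thesis by auto
 qed
 then show ?thesis by (simp add: continuous_on_eq_continuous_within)
qed

lemma J_deriv: assumes t: "0 < t" shows "(J has_real_derivative k t) (at t)"
proof -
 \<comment> \<open>Based at t/2 because continuity of k is available only away from 0.\<close>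
 have "((%x. integral {t/2..x} k) has_real_derivative k t) (at t within {t/2..t + 1})"
  by (rule integral_has_real_derivative) (use t in \<open>auto intro: continuous_on_subset[OF k_cont]\<close>)
 then have "((%x. J (t/2) + integral {t/2..x} k) has_real_derivative 0 + k t) (at t)"
  using t by (intro DERIV_add DERIV_const) (subst (asm) at_within_Icc_at, auto)
 moreover have "eventually (%s. J (t/2) + integral {t/2..s} k = J s) (nhds t)"
  using t eventually_nhds_in_open[of "{t/2<..}" t]
  by (auto elim!: eventually_mono simp: J_def intro!: Henstock_Kurzweil_Integration.integral_combine k_integrable)
 ultimately have "(J has_real_derivative 0 + k t) (at t)" by (subst DERIV_cong_ev[OF refl _ refl, symmetric])
 then show ?thesis by simp
qed

lemma J_less: assumes "0 <= s" "s < t" shows "J s < J t"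
proof (rule DERIV_pos_imp_increasing_open[OF assms(2)])
 show "EX y. (J has_real_derivative y) (at x) & 0 < y" if "s < x" "x < t" for x
  using J_deriv[of x] k_pos[of x] that assms by auto
 show "continuous_on {s..t} J" using assms by (auto intro: continuous_on_subset[OF J_cont])
qed

text \<open>\<open>c * k (c * s)\<close> is the derivative in s of \<open>J (c * s)\<close>; the two
  power bounds on the inverse of \<Phi> trap it between \<open>c powr r\<close> and c times
  \<open>k s\<close>.\<close>

lemma k_scale: assumes "1 <= c" "0 < s" shows "c powr r * k s <= c * k (c * s)" "c * k (c * s) <= c * k s"
proof -
 have e: "c * k (c * s) = c powr (- (1 / n)) * s powr (- 1 - 1 / n) * I (c * s)"
  using assms unfolding k_def k_exp by (simp add: powr_mult powr_diff powr_minus field_simps)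
 have "c powr r = c powr (- (1 / n)) * c powr (1 / m)" by (subst powr_add[symmetric]) (simp add: r_def)
 then have "c powr r * k s = c powr (- (1 / n)) * s powr (- 1 - 1 / n) * (c powr (1 / m) * I s)"
  unfolding k_def k_exp by simp
 also have "... <= c powr (- (1 / n)) * s powr (- 1 - 1 / n) * I (c * s)"
  by (intro mult_left_mono I_scale_ge) (use assms in auto)
 finally show "c powr r * k s <= c * k (c * s)" unfolding e .
 have "c powr (- (1 / n)) * s powr (- 1 - 1 / n) * I (c * s) <= 1 * s powr (- 1 - 1 / n) * (c * I s)"
 proof (intro mult_mono I_scale_le)
  have "c powr (- (1 / n)) <= c powr 0" by (rule powr_mono) (use assms m1 mn in auto)
  then show "c powr (- (1 / n)) <= 1" using assms by simp
 qed (use assms I(1)[of s] I(1)[of "c * s"] in auto)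
 then show "c * k (c * s) <= c * k s" unfolding e unfolding k_def k_exp by (simp add: mult_ac)
qed

text \<open>Both differences vanish at 0 and have derivatives of one sign by \<open>k_scale\<close>.
  Inverted, the lower bound becomes doubling of the conjugate with exponent 1/r and the upper bound
  its contraction property.\<close>

lemma J_scale: assumes "1 <= c" "0 <= s" shows "c powr r * J s <= J (c * s)" "J (c * s) <= c * J s"
proof -
 have dc: "((%x. J (c * x)) has_real_derivative k (c * x) * c) (at x)" if "0 < x" for x
  by (rule DERIV_chain2[OF J_deriv]) (use that assms in \<open>auto intro!: derivative_eq_intros\<close>)
 have cc: "continuous_on {0..s} (%x. J (c * x))" "continuous_on {0..s} J"
  using assms by (auto intro!: continuous_on_compose2[OF J_cont] continuous_intros continuous_on_subset[OF J_cont])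
 have "J (c * 0) - c powr r * J 0 <= J (c * s) - c powr r * J s"
 proof (rule DERIV_nonneg_imp_increasing_open[OF assms(2)])
  show "EX y. ((%x. J (c * x) - c powr r * J x) has_real_derivative y) (at x) & 0 <= y" if "0 < x" "x < s" for x
   using k_scale(1)[OF assms(1), of x] that
   by (intro exI[of _ "k (c * x) * c - c powr r * k x"] conjI DERIV_diff dc DERIV_cmult J_deriv) (auto simp: mult.commute)
 qed (use cc in \<open>auto intro!: continuous_intros\<close>)
 then show "c powr r * J s <= J (c * s)" by (simp add: J_0)
 have "c * J 0 - J (c * 0) <= c * J s - J (c * s)"
 proof (rule DERIV_nonneg_imp_increasing_open[OF assms(2)])
  show "EX y. ((%x. c * J x - J (c * x)) has_real_derivative y) (at x) & 0 <= y" if "0 < x" "x < s" for x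
   using k_scale(2)[OF assms(1), of x] that
   by (intro exI[of _ "c * k x - k (c * x) * c"] conjI DERIV_diff dc DERIV_cmult J_deriv) (auto simp: mult.commute)
 qed (use cc in \<open>auto intro!: continuous_intros\<close>)
 then show "J (c * s) <= c * J s" by (simp add: J_0)
qed

lemma J_pos: "0 < t ==> 0 < J t" using J_less[of 0 t] J_0 by simp

text \<open>Only [t/2, t] is kept, where the weight is at least its value at t and
  \<open>I s >= I (t / 2) >= I t / 2\<close>. With \<open>J_upper\<close> this shows that J is
  comparable to \<open>I t * t powr (- (1 / n))\<close>.\<close>

lemma J_lower: assumes t: "0 < t" shows "I t * t powr (- (1 / n)) / 4 <= J t"
proof -
 have It: "I t <= 2 * I (t / 2)" using I_scale_le[of 2 "t / 2"] t by simp
 have c: "continuous_on {t/2..t} k" using t by (auto intro: continuous_on_subset[OF k_cont])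
 have "((%x. I (t / 2) * t powr (- 1 - 1 / n)) has_integral (t - t/2) *R (I (t / 2) * t powr (- 1 - 1 / n))) {t/2..t}"
  using has_integral_const_real[of "I (t / 2) * t powr (- 1 - 1 / n)" "t/2" t] t by simp
 then have "(t - t/2) *R (I (t / 2) * t powr (- 1 - 1 / n)) <= integral {t/2..t} k"
 proof (rule has_integral_le[OF _ integrable_integral[OF integrable_continuous_real[OF c]]])
  fix x assume x: "x \<in> {t/2..t}"
  have "t powr (- 1 - 1 / n) <= x powr (- 1 - 1 / n)"
   by (rule powr_mono2') (use x t m1 mn in \<open>auto simp: field_simps\<close>)
  then show "I (t / 2) * t powr (- 1 - 1 / n) <= k x"
   unfolding k_def k_exp using x t I(1)[of "t/2"] I(1)[of x] by (intro mult_mono I_mono) auto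
 qed
 also have "... <= J t"
 proof -
  have "J (t/2) + integral {t/2..t} k = J t" unfolding J_def
   by (rule Henstock_Kurzweil_Integration.integral_combine[OF _ _ k_integrable]) (use t in auto)
  then show ?thesis using J_pos[of "t/2"] t by simp
 qed
 also have "(t - t/2) *R (I (t / 2) * t powr (- 1 - 1 / n)) = I (t / 2) * t powr (- (1 / n)) / 2"
  using t by (simp add: powr_diff powr_minus field_simps)
 finally show ?thesis using mult_right_mono[OF It, of "t powr (- (1 / n))"] by simp
qed

sublocale JI: incr_bij J
proof
 show "\<exists>t\<ge>0. y <= J t" for y
 proof -
  define c where "c = max 1 (y / J 1)"
  have c: "1 <= c" "y <= c * J 1" using J_pos[of 1] by (auto simp: c_def max_def field_simps)
  have "1 <= c powr (1 / r)" using c r by (intro ge_one_powr_ge_zero) auto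
  then have "(c powr (1 / r)) powr r * J 1 <= J (c powr (1 / r) * 1)" by (rule J_scale(1)) simp
  moreover have "(c powr (1 / r)) powr r = c" using c r by (simp add: powr_powr)
  ultimately show ?thesis using c by (intro exI[of _ "c powr (1 / r)"]) auto
 qed
qed (use J_cont J_less J_0 in auto)

section \<open>The Sobolev conjugate\<close>

abbreviation "Ps \<equiv> Phi_star \<phi> n"

lemma Ps_eq: "Ps t = JI.g \<bar>t\<bar>"
proof -
 have "(%r. 0 <= r & Phi_star_inv \<phi> n r = \<bar>t\<bar>) = (%r. 0 <= r & J r = \<bar>t\<bar>)"
  using J_star by (auto simp: fun_eq_iff)
 then show ?thesis by (simp add: Phi_star_def JI.g_def)
qed

lemma Ps: "0 <= t ==> 0 <= Ps t" "0 <= t ==> J (Ps t) = t"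
 by (simp_all add: Ps_eq JI.g)

lemma le_Ps: "0 <= t ==> 0 <= s ==> J t <= s \<longleftrightarrow> t <= Ps s"
 and Ps_le: "0 <= t ==> 0 <= s ==> s <= J t \<longleftrightarrow> Ps s <= t"
 by (simp_all add: Ps_eq JI.le_g JI.g_le)

lemma Ps_pos: "0 < t ==> 0 < Ps t" by (simp add: Ps_eq JI.g_pos)

lemma Ps_sup: assumes "1 <= c" "0 <= t" shows "Ps (c * t) <= c powr ms * Ps t"
proof -
 have c: "1 <= c powr ms" using assms ms1 by (intro ge_one_powr_ge_zero) auto
 have "(c powr ms) powr r * J (Ps t) <= J (c powr ms * Ps t)" by (rule J_scale(1)[OF c]) (use assms Ps in auto)
 moreover have "(c powr ms) powr r = c" using assms r by (simp add: powr_powr)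
 ultimately have "c * t <= J (c powr ms * Ps t)" using Ps(2)[OF assms(2)] by simp
 then show ?thesis using assms Ps(1)[of t] by (subst (asm) Ps_le) auto
qed

lemma Ps_sub: assumes "0 <= c" "c <= 1" "0 <= t" shows "Ps (c * t) <= c * Ps t"
proof (cases "c = 0")
 case False
 have "J ((1 / c) * (c * Ps t)) <= (1 / c) * J (c * Ps t)"
  by (rule J_scale(2)) (use False assms Ps(1)[of t] in auto)
 then have "c * t <= J (c * Ps t)" using False assms Ps(2)[of t] by (simp add: field_simps)
 then show ?thesis using assms Ps(1)[of t] by (subst (asm) Ps_le) auto
qed (simp add: Ps_eq JI.g0)

lemma gf_Ps: "gf Ps ms"
proof -
 have "continuous_on {0..} Ps" using JI.g_cont by (rule continuous_on_eq) (simp add: Ps_eq)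
 moreover have "Ps 0 = 0" by (simp add: Ps_eq JI.g0)
 moreover have "Ps s <= Ps t" if "0 <= s" "s <= t" for s t using that by (simp add: Ps_eq JI.g_mono)
 ultimately show ?thesis unfolding gf_def using ms1 Ps_pos Ps_sub Ps_sup by auto
qed

text \<open>The lower bound on \<Phi> is an upper bound on its inverse, hence by
  \<open>J_upper\<close> on J: \<open>J s <= C' * s powr r\<close>. Inverting gives the power 1/r =
  ms. Through it energy bounds control the integral of |u|^ms.\<close>

lemma Ps_lower:
 assumes "0 < C" "!!t. 0 <= t ==> C * t powr m <= P t"
 shows "\<exists>C>0. \<forall>t\<ge>0. C * t powr ms <= Ps t"
proof -
 define C' where "C' = ms * (1 / C) powr (1 / m)"
 have C': "0 < C'" using ms1 assms by (simp add: C'_def)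
 show ?thesis
 proof (intro exI[of _ "(1 / C') powr ms"] conjI allI impI)
  fix t :: real assume t: "0 <= t"
  show "(1 / C') powr ms * t powr ms <= Ps t"
  proof (cases "t = 0")
   case False
   then have t0: "0 < t" using t by simp
   define s where "s = Ps t"
   have s: "0 < s" "J s = t" using Ps_pos[OF t0] Ps(2)[OF t] by (simp_all add: s_def)
   have "C * I s powr m <= s" using assms(2)[of "I s"] I[of s] s by simp
   then have "(C * I s powr m) powr (1 / m) <= s powr (1 / m)" using assms m1 by (intro powr_mono2) auto
   then have "C powr (1 / m) * I s <= s powr (1 / m)" using assms m1 I_pos[OF s(1)] by (simp add: powr_mult powr_powr)
   then have Is: "I s <= (1 / C) powr (1 / m) * s powr (1 / m)" using assms(1) by (simp add: powr_divide field_simps)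
   have "t <= ms * (I s * s powr (- (1 / n)))" using J_upper[OF s(1)] s(2) by simp
   also have "... <= ms * ((1 / C) powr (1 / m) * s powr (1 / m) * s powr (- (1 / n)))"
    using ms1 by (intro mult_left_mono mult_right_mono Is) auto
   also have "... = C' * (s powr (1 / m) * s powr (- (1 / n)))" by (simp add: C'_def)
   also have "s powr (1 / m) * s powr (- (1 / n)) = s powr r" by (subst powr_add[symmetric]) (simp add: r_def)
   finally have "t / C' <= s powr r" using C' by (simp add: field_simps)
   then have "(t / C') powr ms <= (s powr r) powr ms" using t C' ms1 by (intro powr_mono2) auto
   also have "... = s" using s r by (simp add: powr_powr)
   also have "(t / C') powr ms = (1 / C') powr ms * t powr ms" using C' t by (simp add: powr_divide)
   finally show ?thesis by (simp add: s_def)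
  qed (simp add: Ps_eq JI.g0)
 qed (use C' in simp)
qed

text \<open>With s the larger of the two terms on the right, x is at most
  \<open>I s * s powr (- (1 / n))\<close> and y at most \<open>s powr (1 / n)\<close>, so xy is at
  most \<open>I s\<close>. It acts as a Hoelder inequality pairing the conjugate with L^n, for
  products of a function with the gradient of a cutoff.\<close>

lemma young: assumes "0 <= x" "0 <= y" shows "P (x * y) <= Ps (ms * x) + y powr n"
proof (cases "x = 0 \<or> y = 0")
 case True
 then show ?thesis using gf_ge0[OF gf_Ps, of "ms * x"] assms ms1 by auto
next
 case False
 then have xy: "0 < x" "0 < y" using assms by auto
 define s where "s = max (Ps (ms * x)) (y powr n)"
 have s: "0 < s" using xy by (simp add: s_def less_max_iff_disj)
 have "ms * x <= J s" using Ps_le[of s "ms * x"] xy ms1 s by (simp add: s_def)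
 also have "... <= ms * (I s * s powr (- (1 / n)))" by (rule J_upper[OF s])
 finally have 1: "x <= I s * s powr (- (1 / n))" using ms1 by simp
 have "(y powr n) powr (1 / n) <= s powr (1 / n)" using m1 mn by (intro powr_mono2) (auto simp: s_def)
 then have 2: "y <= s powr (1 / n)" using xy m1 mn by (simp add: powr_powr)
 have "x * y <= (I s * s powr (- (1 / n))) * s powr (1 / n)" using 1 2 xy s I_pos[OF s] by (intro mult_mono) auto
 also have "... = I s" using s by (simp add: powr_minus)
 finally have "P (x * y) <= P (I s)" using xy by (intro P_mono) auto
 also have "... = s" using s I by simp
 also have "... <= Ps (ms * x) + y powr n" using gf_ge0[OF gf_Ps, of "ms * x"] xy ms1 by (auto simp: s_def max_def)
 finally show ?thesis .
qed

text \<open>Put s = \<open>Ps t\<close>. By \<open>J_lower\<close> the left side is at most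
  \<open>4 * s / I s * y\<close>. If y <= \<open>ep * I s\<close> this is at most
  \<open>4 * ep * s\<close>; otherwise \<open>P (y / ep)\<close> is at least
  \<open>s * y / (ep * I s)\<close>. The factor ep on the right later permits absorption of the
  first term.\<close>

lemma sob: assumes "0 < t" "0 <= y" "0 < ep"
 shows "Ps t powr (1 - 1 / n) / t * y <= 4 * ep * (Ps t + P (y / ep))"
proof -
 define s where "s = Ps t"
 have s: "0 < s" "J s = t" using Ps_pos[OF assms(1)] Ps(2)[of t] assms by (simp_all add: s_def)
 have Is: "0 < I s" "P (I s) = s" using I_pos[OF s(1)] I[of s] s by auto
 have lo: "I s * s powr (- (1 / n)) / 4 <= t" using J_lower[OF s(1)] s by simp
 have "s powr (1 - 1 / n) / t <= s powr (1 - 1 / n) / (I s * s powr (- (1 / n)) / 4)"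
  using lo Is s assms by (intro divide_left_mono) (auto intro!: mult_pos_pos divide_pos_pos)
 also have "... = 4 * s / I s" using s Is by (simp add: powr_diff powr_minus field_simps)
 finally have 1: "s powr (1 - 1 / n) / t * y <= 4 * (s / I s * y)" using mult_right_mono[OF _ assms(2)] by fastforce
 have "s / I s * y <= ep * (s + P (y / ep))"
 proof (cases "y <= ep * I s")
  case True
  then have "s / I s * y <= s / I s * (ep * I s)" using s Is by (intro mult_left_mono) auto
  also have "... = ep * s" using Is by simp
  also have "... <= ep * (s + P (y / ep))" using assms P_nonneg by (intro mult_left_mono) auto
  finally show ?thesis .
 next
  case False
  then have y: "0 < y" using assms Is by (smt (verit) mult_pos_pos)
  have "P ((I s * ep / y) * (y / ep)) <= (I s * ep / y) * P (y / ep)"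
   by (rule P_sub) (use False y assms Is in \<open>auto simp: field_simps\<close>)
  then have "s <= (I s * ep / y) * P (y / ep)" using Is y assms by simp
  then have "s / I s * y <= ep * P (y / ep)" using Is y by (simp add: field_simps)
  also have "... <= ep * (s + P (y / ep))" using assms s by (intro mult_left_mono) auto
  finally show ?thesis .
 qed
 then show ?thesis using 1 unfolding s_def by linarith
qed

text \<open>\<open>k s * s\<close> equals \<open>I s * s powr (- (1 / n))\<close>, so
  \<open>J_upper\<close> says \<open>t <= ms * (k s * s)\<close> at s = \<open>Ps t\<close>.\<close>

lemma Ps_deriv: assumes t: "0 < t"
 shows "deriv Ps t = 1 / k (Ps t)" "deriv Ps t * t <= ms * Ps t" "0 < deriv Ps t"
proof -
 define s where "s = Ps t"
 have s: "0 < s" "J s = t" using Ps_pos[OF t] Ps(2)[of t] t by (simp_all add: s_def)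
 have ks: "0 < k s" by (rule k_pos[OF s(1)])
 have "(Ps has_real_derivative inverse (k s)) (at t)"
 proof (rule DERIV_inverse_function[where f = J and a = 0 and b = "t + 1"])
  show "(J has_real_derivative k s) (at (Ps t))" using J_deriv[OF s(1)] by (simp add: s_def)
  show "isCont Ps t"
   using gf_cont[OF gf_Ps] t by (intro continuous_on_interior[of "{0..}"]) (auto simp: interior_Ici)
 qed (use ks t Ps in auto)
 then show d: "deriv Ps t = 1 / k (Ps t)" by (simp add: DERIV_imp_deriv s_def divide_inverse)
 then show "0 < deriv Ps t" using ks by (simp add: s_def)
 have "t <= ms * (I s * s powr (- (1 / n)))" using J_upper[OF s(1)] s by simp
 also have "I s * s powr (- (1 / n)) = k s * s" using s unfolding k_def k_exp by (simp add: powr_diff powr_minus field_simps)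
 finally show "deriv Ps t * t <= ms * Ps t" unfolding d using ks by (simp add: s_def[symmetric] field_simps)
qed

text \<open>(f1) measures f against t \<phi>_*(t), while the estimates measure it against a power;
  this is the passage between the two. For t >= 1 doubling from the value at 1 applies.\<close>

lemma phi_star_bound: assumes "1 <= t"
 shows "0 < t * phi_star \<phi> n t" "t * phi_star \<phi> n t <= ms * Ps 1 * t powr (ms - 1)"
proof -
 have e: "t * phi_star \<phi> n t = deriv Ps t" using assms by (simp add: phi_star_def)
 show "0 < t * phi_star \<phi> n t" unfolding e using Ps_deriv(3)[of t] assms by simp
 have "deriv Ps t * t <= ms * Ps (t * 1)" using Ps_deriv(2)[of t] assms by simp
 also have "... <= ms * (t powr ms * Ps 1)" using ms1 by (intro mult_left_mono Ps_sup) (use assms in auto)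
 also have "... = ms * Ps 1 * t powr (ms - 1) * t" using assms by (simp add: powr_diff)
 finally show "t * phi_star \<phi> n t <= ms * Ps 1 * t powr (ms - 1)" unfolding e using assms by simp
qed

lemma P_convex: "convex_on UNIV P"
proof (rule convex_on_realI[where f' = "%t. sgn t * a \<bar>t\<bar>"])
 show "(P has_real_derivative sgn t * a \<bar>t\<bar>) (at t)" for t by (rule P_deriv)
 show "sgn x * a \<bar>x\<bar> <= sgn y * a \<bar>y\<bar>" if "x <= y" for x y
  using that a_mono[of x y] a_mono[of "-y" "-x"] a_nonneg[of x] a_nonneg[of y] a_nonneg[of "-x"] a_nonneg[of "-y"]
  by (auto simp: sgn_if abs_if)
qed simp

end

section \<open>Growth of the nonlinearity\<close>

locale nfun_f = nfun \<phi> m n for \<phi> :: "real => real" and m n :: real +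
 fixes f F :: "real => real"
 assumes f_cont: "continuous_on UNIV f" and f_neg: "!!s. s <= 0 ==> f s = 0"
  and f_zero: "((%t. f t / (t * \<phi> \<bar>t\<bar>)) \<longlongrightarrow> 0) (at 0)"
  and f_infty: "Limsup at_top (%t::real. ereal (f t / (t * phi_star \<phi> n t))) = 0"
  and f_mono: "strict_mono_on {0<..} (%s. s powr (1 - m) * f s)"
  and F_deriv: "!!t. (F has_real_derivative f t) (at t)" and F_0: "F 0 = 0"
  and F_super: "filterlim (%t. F t / \<bar>t\<bar> powr m) at_top at_top"
begin

lemma F_neg: "t <= 0 ==> F t = 0"
proof (cases "t = 0")
 case False
 assume "t <= 0"
 with False have "EX z. t < z & z < 0 & F 0 - F t = (0 - t) * f z" by (intro MVT2 F_deriv) auto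
 then show ?thesis using f_neg F_0 by auto
qed (simp add: F_0)

text \<open>(f3) concerns F. If \<open>s powr (1 - m) * f s\<close> stayed bounded, the mean value
  theorem would bound \<open>F t / t powr m\<close> as well; by (f2) a bound exceeded once is
  exceeded from then on.\<close>

lemma f_super: "filterlim (%s. s powr (1 - m) * f s) at_top at_top"
 unfolding filterlim_at_top
proof
 fix Z :: real
 \<comment> \<open>A positive threshold lets \<open>z powr (m - 1)\<close> be enlarged to
   \<open>t powr (m - 1)\<close>.\<close>
 have "\<exists>s>0. max 1 Z <= s powr (1 - m) * f s"
 proof (rule ccontr)
  assume "~ ?thesis"
  then have *: "!!s. 0 < s ==> s powr (1 - m) * f s < max 1 Z" by (auto simp: not_le)
  have b: "F t / \<bar>t\<bar> powr m <= max 1 Z" if t: "0 < t" for t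
  proof -
   have "EX z. 0 < z & z < t & F t - F 0 = (t - 0) * f z" by (rule MVT2[OF t F_deriv])
   then obtain z where z: "0 < z" "z < t" "F t = t * f z" using F_0 by auto
   have "z powr (m - 1) * (z powr (1 - m) * f z) <= z powr (m - 1) * max 1 Z" using *[OF z(1)] by (intro mult_left_mono) auto
   also have "z powr (m - 1) * (z powr (1 - m) * f z) = f z" using z powr_add[of z "m - 1" "1 - m"] by (simp add: mult.assoc[symmetric])
   also have "z powr (m - 1) * max 1 Z <= t powr (m - 1) * max 1 Z" using z m1 by (intro mult_right_mono powr_mono2) auto
   finally have "t * f z <= t * (t powr (m - 1) * max 1 Z)" using t by (intro mult_left_mono) auto
   also have "... = max 1 Z * t powr m" using t powr_add[of t "m - 1" 1] by simp
   finally show ?thesis using t z by (simp add: divide_le_eq)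
  qed
  have "eventually (%t. max 1 Z + 1 <= F t / \<bar>t\<bar> powr m) at_top" using F_super unfolding filterlim_at_top by blast
  then have "eventually (%t. False) (at_top :: real filter)"
   using eventually_gt_at_top[of 0] by eventually_elim (use b in force)
  then show False by (simp add: trivial_limit_at_top_linorder)
 qed
 then obtain s where s: "0 < s" "max 1 Z <= s powr (1 - m) * f s" by blast
 show "eventually (%t. Z <= t powr (1 - m) * f t) at_top"
  using eventually_gt_at_top[of s]
 proof eventually_elim
  case (elim t)
  then show ?case using strict_mono_onD[OF f_mono, of s t] s by simp
 qed
qed

lemma f_small: assumes "0 < ep" shows "\<exists>d>0. ALL s. 0 < s --> s < d --> \<bar>f s\<bar> <= ep * a s"
proof -
 have "eventually (%t. \<bar>f t / (t * \<phi> \<bar>t\<bar>)\<bar> < ep) (at 0)"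
  using tendstoD[OF f_zero assms] by (simp add: dist_real_def)
 then obtain d where d: "0 < d" "!!t. t ~= 0 ==> \<bar>t\<bar> < d ==> \<bar>f t / (t * \<phi> \<bar>t\<bar>)\<bar> < ep"
  unfolding eventually_at by (auto simp: dist_real_def)
 show ?thesis
 proof (intro exI[of _ d] conjI d(1) allI impI)
  fix s assume s: "0 < s" "s < d"
  have "\<bar>f s / a s\<bar> < ep" using d(2)[of s] s by (simp add: a_def)
  then show "\<bar>f s\<bar> <= ep * a s" using a_pos[OF s(1)] by (simp add: abs_divide divide_less_eq)
 qed
qed

lemma f_large: assumes "0 < ep" shows "\<exists>T\<ge>1. \<forall>s\<ge>T. \<bar>f s\<bar> <= ep * s powr (ms - 1)"
proof -
 define q where "q = ms * Ps 1"
 have q: "0 < q" using ms1 gf_pos[OF gf_Ps, of 1] by (simp add: q_def)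
 have "eventually (%t. ereal (f t / (t * phi_star \<phi> n t)) < ereal (ep / q)) at_top"
  by (rule Limsup_lessD) (use f_infty assms q in simp)
 \<comment> \<open>The limes superior bounds f only from above; the lower side comes from f being
   eventually nonnegative.\<close>
 moreover have "eventually (%t. 0 <= t powr (1 - m) * f t) at_top" using f_super unfolding filterlim_at_top by blast
 ultimately have "eventually (%t. \<bar>f t\<bar> <= ep * t powr (ms - 1)) at_top"
  using eventually_ge_at_top[of 1]
 proof eventually_elim
  case (elim t)
  note b = phi_star_bound[OF elim(3), folded q_def]
  have f0: "0 <= f t" using elim by (simp add: zero_le_mult_iff)
  have "f t <= ep / q * (t * phi_star \<phi> n t)" using elim(1) b(1) by (simp add: divide_less_eq)
  also have "... <= ep / q * (q * t powr (ms - 1))" using b(2) assms q by (intro mult_left_mono) auto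
  finally show ?case using f0 q by simp
 qed
 then obtain T where "!!t. T <= t ==> \<bar>f t\<bar> <= ep * t powr (ms - 1)" by (auto simp: eventually_at_top_linorder)
 then show ?thesis by (intro exI[of _ "max 1 T"]) auto
qed

lemma cont_bound: "continuous_on UNIV h ==> \<exists>B\<ge>0. \<forall>s::real. 0 <= s --> s <= T --> \<bar>h s :: real\<bar> <= B"
proof -
 assume "continuous_on UNIV h"
 then have "bounded (h ` {0..T})" by (intro compact_imp_bounded compact_continuous_image) (auto intro: continuous_on_subset)
 then obtain B where "0 < B" "!!y. y \<in> h ` {0..T} ==> \<bar>y\<bar> <= B" unfolding bounded_pos by auto
 then show ?thesis by (intro exI[of _ B]) auto
qed

text \<open>Only the a-part has to carry the small factor: between d and T the bounded f is absorbed
  in C times the power, which is bounded below there.\<close>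

lemma f_growth: assumes e: "0 < ep" shows "\<exists>C\<ge>0. ALL t. \<bar>f t\<bar> <= ep * a \<bar>t\<bar> + C * \<bar>t\<bar> powr (ms - 1)"
proof -
 obtain d where d: "0 < d" "!!s. 0 < s ==> s < d ==> \<bar>f s\<bar> <= ep * a s" using f_small[OF e] by blast
 obtain T where T: "1 <= T" "!!s. T <= s ==> \<bar>f s\<bar> <= 1 * s powr (ms - 1)" using f_large[of 1] by auto
 obtain B where B: "0 <= B" "!!s. 0 <= s ==> s <= T ==> \<bar>f s\<bar> <= B" using cont_bound[OF f_cont] by blast
 define C where "C = 1 + B / d powr (ms - 1)"
 have C: "1 <= C" using B d by (simp add: C_def)
 have "\<bar>f t\<bar> <= ep * a \<bar>t\<bar> + C * \<bar>t\<bar> powr (ms - 1)" for t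
 proof -
  have n: "0 <= ep * a \<bar>t\<bar>" "0 <= C * \<bar>t\<bar> powr (ms - 1)" using e a_nonneg C by auto
  consider "t <= 0" | "0 < t" "t < d" | "T <= t" | "d <= t" "t <= T" by linarith
  then show ?thesis
  proof cases
   case 3
   have "\<bar>f t\<bar> <= C * t powr (ms - 1)" using T(2)[OF 3] mult_right_mono[OF C, of "t powr (ms - 1)"] by simp
   then show ?thesis using n 3 T(1) by simp
  next
   case 4
   have "B = B / d powr (ms - 1) * d powr (ms - 1)" using d by simp
   also have "... <= C * t powr (ms - 1)" using 4 d B ms1 C by (intro mult_mono powr_mono2) (auto simp: C_def)
   finally show ?thesis using B(2)[of t] 4 d n by simp
  qed (use d(2)[of t] n f_neg[of t] in auto)
 qed
 then show ?thesis using C by (intro exI[of _ C]) auto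
qed

text \<open>Here both growth terms carry ep, and the remainder is bounded and supported where |t| >=
  dl. The compactness proof rests on this shape: superlevel sets of a family bounded in L^ms have
  bounded measure, as (K1) requires.\<close>

lemma F_growth: assumes e: "0 < ep"
 shows "\<exists>C\<ge>0. \<exists>dl>0. ALL t. \<bar>F t\<bar> <= ep * (P \<bar>t\<bar> + \<bar>t\<bar> powr ms) + (if dl <= \<bar>t\<bar> then C else 0)"
proof -
 obtain d where d: "0 < d" "!!s. 0 < s ==> s < d ==> \<bar>f s\<bar> <= ep * a s" using f_small[OF e] by blast
 obtain T where T: "1 <= T" "!!s. T <= s ==> \<bar>f s\<bar> <= ep * s powr (ms - 1)" using f_large[OF e] by blast
 have Fc: "continuous_on S F" for S by (rule DERIV_continuous_on[OF has_field_derivative_at_within[OF F_deriv]])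
 obtain B where B: "0 <= B" "!!s. 0 <= s ==> s <= T ==> \<bar>F s\<bar> <= B" using cont_bound[OF Fc] by blast
 \<comment> \<open>Near 0, and with the power in place of P near infinity, the majorant plus
   \<open>r * F\<close> is nondecreasing; the signs r = 1 and r = -1 give the two sides of the
   absolute value.\<close>
 have mono: "ep * P x + r * F x <= ep * P y + r * F y" if xy: "0 <= x" "x <= y" "y < d" and r: "\<bar>r\<bar> = 1" for x y r
 proof (rule DERIV_nonneg_imp_increasing_open[OF xy(2)])
  show "continuous_on {x..y} (%x. ep * P x + r * F x)" by (intro continuous_intros P_cont Fc)
  fix z assume z: "x < z" "z < y"
  have "((%x. ep * P x + r * F x) has_real_derivative ep * a z + r * f z) (at z)"
   using z xy by (intro DERIV_add DERIV_cmult F_deriv P_deriv_pos) auto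
  moreover have "\<bar>r * f z\<bar> <= ep * a z" using d(2)[of z] z xy r by (simp add: abs_mult)
  ultimately show "EX D. ((%x. ep * P x + r * F x) has_real_derivative D) (at z) & 0 <= D" by (intro exI conjI) auto
 qed
 have mono': "ep * T powr ms + r * F T <= ep * y powr ms + r * F y" if y: "T <= y" and r: "\<bar>r\<bar> = 1" for y r
 proof (rule DERIV_nonneg_imp_increasing_open[OF y])
  show "continuous_on {T..y} (%x. ep * x powr ms + r * F x)" using T ms1 by (intro continuous_intros continuous_on_powr' Fc) auto
  fix z assume z: "T < z" "z < y"
  have "((%x. ep * x powr ms + r * F x) has_real_derivative ep * (ms * z powr (ms - 1)) + r * f z) (at z)"
   using z T by (intro DERIV_add DERIV_cmult F_deriv) (auto intro!: derivative_eq_intros)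
  moreover have "1 * z powr (ms - 1) <= ms * z powr (ms - 1)" using ms1 by (intro mult_right_mono) auto
  then have "ep * z powr (ms - 1) <= ep * (ms * z powr (ms - 1))" using e by (intro mult_left_mono) auto
  then have "\<bar>r * f z\<bar> <= ep * (ms * z powr (ms - 1))" using T(2)[of z] z r by (simp add: abs_mult)
  ultimately show "EX D. ((%x. ep * x powr ms + r * F x) has_real_derivative D) (at z) & 0 <= D" by (intro exI conjI) auto
 qed
 have "\<bar>F t\<bar> <= ep * (P \<bar>t\<bar> + \<bar>t\<bar> powr ms) + (if d <= \<bar>t\<bar> then B else 0)" for t
 proof -
  have n: "0 <= ep * P \<bar>t\<bar>" "0 <= ep * \<bar>t\<bar> powr ms" using e P_nonneg by auto
  consider "t <= 0" | "0 < t" "t < d" | "d <= t" "T <= t" | "d <= t" "t <= T" by linarith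
  then show ?thesis
  proof cases
   case 1
   then show ?thesis using n B(1) F_neg[of t] by (simp add: distrib_left)
  next
   case 2
   then show ?thesis using mono[of 0 t 1] mono[of 0 t "-1"] n F_0 by (simp add: distrib_left)
  next
   case 3
   have "0 <= ep * T powr ms" using e by simp
   then show ?thesis using mono'[of t 1] mono'[of t "-1"] n B(2)[of T] 3 T d by (simp add: distrib_left)
  next
   case 4
   then show ?thesis using B(2)[of t] n d by (simp add: distrib_left)
  qed
 qed
 then show ?thesis using B(1) d(1) by blast
qed

end

text \<open>The indices are infimum and supremum of one quotient, compared here through its value at
  1; boundedness on both sides makes the two bounds meaningful.\<close>

lemma m_idx_gt_1:
 assumes pos: "!!t. 0 < t ==> 0 < \<phi> t" and bdd: "bdd_above ((%t. \<phi> t * t\<^sup>2 / Phi \<phi> t) ` {0<..})" and l: "1 <= ell_idx \<phi>" and ne: "m_idx \<phi> ~= 1"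
 shows "1 < m_idx \<phi>"
proof -
 have "0 <= Phi \<phi> t" for t
  unfolding Phi_def interval_lebesgue_integral_def set_lebesgue_integral_def
  using pos by (auto simp: einterval_def zero_ereal_def indicator_def less_imp_le intro!: integral_nonneg_AE AE_I2)
 then have b: "bdd_below ((%t. \<phi> t * t\<^sup>2 / Phi \<phi> t) ` {0<..})"
  using pos by (intro bdd_belowI[of _ 0]) (auto simp: less_imp_le)
 have i: "\<phi> 1 * 1\<^sup>2 / Phi \<phi> 1 \<in> (%t. \<phi> t * t\<^sup>2 / Phi \<phi> t) ` {0<..}" by (rule image_eqI[of _ _ 1]) auto
 have "ell_idx \<phi> <= \<phi> 1 * 1\<^sup>2 / Phi \<phi> 1" unfolding ell_idx_def by (rule cInf_lower[OF i b])
 also have "... <= m_idx \<phi>" unfolding m_idx_def by (rule cSup_upper[OF i bdd])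
 finally show ?thesis using l ne by simp
qed

text \<open>F is an antiderivative on the whole line, as differentiation of the energy requires; it
  is matched with the interval integral of (f3) for t >= 0, the range seen by the limit at
  infinity.\<close>

lemma primitive_exists:
 fixes f :: "real => real"
 assumes "continuous_on UNIV f"
 shows "EX F. (ALL t. (F has_real_derivative f t) (at t)) & (\<forall>t\<ge>0. F t = (LBINT s=0..t. f s)) & F 0 = 0"
proof -
 have "EX G. \<forall>x::real. -\<infinity> < ereal x --> ereal x < \<infinity> --> (G has_vector_derivative f x) (at x)"
  by (rule einterval_antiderivative) (use assms in \<open>auto simp: continuous_on_eq_continuous_at\<close>)
 then obtain G where G: "!!x. (G has_real_derivative f x) (at x)" by (auto simp: has_real_derivative_iff_has_vector_derivative)
 have "(LBINT s=ereal 0..ereal t. f s) = G t - G 0" if "0 <= t" for t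
  by (rule interval_integral_FTC_finite)
   (use G in \<open>auto simp: has_real_derivative_iff_has_vector_derivative[symmetric] intro: has_field_derivative_at_within continuous_on_subset[OF assms]\<close>)
 moreover have "((%t. G t - G 0) has_real_derivative f t) (at t)" for t using G[of t] by (auto intro!: derivative_eq_intros)
 ultimately show ?thesis by (intro exI[of _ "%t. G t - G 0"]) (auto simp: zero_ereal_def)
qed

section \<open>Smooth functions and cutoffs\<close>

text \<open>The functions p(1/t) exp(-1/t) are closed under differentiation, which turns p into (p -
  p') X^2. Indexing by the polynomial makes infinite differentiability an induction.\<close>

definition ebump :: "real poly => real => real" where
 "ebump p t = (if t > 0 then poly p (1 / t) * exp (- (1 / t)) else 0)"

lemma tendsto_poly_exp: "((%y. poly p y * exp (- y)) \<longlongrightarrow> (0::real)) at_top"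
proof -
 have "((%y. \<Sum>i\<le>degree p. coeff p i * (y ^ i / exp y)) \<longlongrightarrow> (\<Sum>i\<le>degree p. coeff p i * 0)) at_top"
  by (intro tendsto_sum tendsto_mult tendsto_const tendsto_power_div_exp_0)
 moreover have "(\<Sum>i\<le>degree p. coeff p i * (y ^ i / exp y)) = poly p y * exp (- y)" for y
  by (simp add: poly_altdef sum_distrib_right exp_minus divide_inverse mult.assoc)
 ultimately show ?thesis by simp
qed

lemma ebump_deriv:
 "(ebump p has_real_derivative ebump ((p - pderiv p) * [:0, 0, 1:]) t) (at t)"
proof -
 consider "t > 0" | "t < 0" | "t = 0" by linarith
 then show ?thesis
 proof cases
  case 1
  have "((%t. poly p (1 / t) * exp (- (1 / t))) has_real_derivative ebump ((p - pderiv p) * [:0, 0, 1:]) t) (at t)"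
   using 1 by (auto intro!: derivative_eq_intros simp: ebump_def field_simps power2_eq_square)
  moreover have "eventually (%s. poly p (1 / s) * exp (- (1 / s)) = ebump p s) (nhds t)"
   using 1 eventually_nhds_in_open[of "{0<..}" t] by (auto elim!: eventually_mono simp: ebump_def)
  ultimately show ?thesis by (subst DERIV_cong_ev[OF refl _ refl, symmetric])
 next
  case 2
  have "((%t. 0) has_real_derivative ebump ((p - pderiv p) * [:0, 0, 1:]) t) (at t)"
   using 2 by (auto simp: ebump_def)
  moreover have "eventually (%s. 0 = ebump p s) (nhds t)"
   using 2 eventually_nhds_in_open[of "{..<0}" t] by (auto elim!: eventually_mono simp: ebump_def)
  ultimately show ?thesis by (subst DERIV_cong_ev[OF refl _ refl, symmetric])
 next
  case 3
  \<comment> \<open>The extra factor X, evaluated at 1/y, is the division by y in the difference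
    quotient at 0.\<close>
  have "((%y. poly ([:0,1:] * p) (inverse y) * exp (- inverse y)) \<longlongrightarrow> 0) (at_right (0::real))"
   by (rule filterlim_compose[OF tendsto_poly_exp filterlim_inverse_at_top_right])
  moreover have "eventually (%y. poly ([:0,1:] * p) (inverse y) * exp (- inverse y) = ebump p y / y) (at_right (0::real))"
   using eventually_at_right_less[of "0::real"] by eventually_elim (auto simp: ebump_def field_simps)
  ultimately have r: "((%y. ebump p y / y) \<longlongrightarrow> 0) (at_right 0)" by (rule Lim_transform_eventually)
  have l: "((%y. ebump p y / y) \<longlongrightarrow> 0) (at_left 0)"
   by (rule Lim_transform_eventually[OF tendsto_const])
    (auto simp: eventually_at_filter ebump_def)
  have "((%y. (ebump p y - ebump p 0) / (y - 0)) \<longlongrightarrow> 0) (at 0)"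
   using filterlim_split_at[OF l r] by (simp add: ebump_def)
  then have "(ebump p has_real_derivative 0) (at 0)" by (subst has_field_derivative_iff) simp
  then show ?thesis using 3 by (simp add: ebump_def)
 qed
qed

text \<open>A set whose members are differentiable and whose partial derivatives stay in the set
  consists of smooth functions. \<open>base\<close> admits every iterated partial derivative of a
  given smooth function; the other rules are the operations that the constructions below
  perform.\<close>

inductive_set sm :: "('a::euclidean_space => real) set" where
 base: "smooth_fn f ==> set is \<subseteq> Basis ==> iter_partial is f \<in> sm"
| const: "(%x. c) \<in> sm"
| lin: "(%x. x \<bullet> b) \<in> sm"
| add: "u \<in> sm ==> v \<in> sm ==> (%x. u x + v x) \<in> sm"
| mult: "u \<in> sm ==> v \<in> sm ==> (%x. u x * v x) \<in> sm"
| inv: "u \<in> sm ==> (!!x. u x ~= 0) ==> (%x. inverse (u x)) \<in> sm"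
| root: "u \<in> sm ==> (!!x. 0 < u x) ==> (%x. sqrt (u x)) \<in> sm"
| bump: "u \<in> sm ==> (%x. ebump p (u x)) \<in> sm"

lemma partial_eq: "(f has_derivative f') (at x) ==> partial i f x = f' i"
 unfolding partial_def using frechet_derivative_at by metis

lemma sm_partial:
 assumes "u \<in> sm"
 shows "(ALL x. u differentiable (at x)) & (\<forall>i\<in>Basis. partial i u \<in> sm)"
proof -
 \<comment> \<open>Each rule is settled by exhibiting a derivative whose values on basis vectors are
   again built by the rules.\<close>
 have *: "(ALL x. f differentiable (at x)) & (\<forall>i\<in>Basis. partial i f \<in> sm)"
  if "!!x. (f has_derivative D x) (at x)" "!!i. i \<in> Basis ==> (%x. D x i) \<in> sm" for f :: "'a => real" and D
 proof -
  have "partial i f = (%x. D x i)" for i using partial_eq[OF that(1)] by blast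
  then show ?thesis using that unfolding differentiable_def by auto
 qed
 have d: "(u has_derivative frechet_derivative u (at x)) (at x)" if "ALL x. u differentiable (at x)" for u :: "'a => real" and x
  using that frechet_derivative_works by blast
 show ?thesis using assms
 proof induction
  case (base f "is")
  have "iter_partial is f differentiable at x" for x using base unfolding smooth_fn_def by blast
  moreover have "partial i (iter_partial is f) \<in> sm" if "i \<in> Basis" for i
   using sm.base[OF base(1), of "i # is"] base(2) that by simp
  ultimately show ?case by blast
 next
  case (const c)
  show ?case by (rule *[where D = "%x h. 0"]) (auto intro: sm.const)
 next
  case (lin b)
  show ?case by (rule *[where D = "%x h. h \<bullet> b"]) (auto intro: sm.const intro!: derivative_eq_intros)
 next
  case (add u v)
  have "(%x. frechet_derivative u (at x) i + frechet_derivative v (at x) i) \<in> sm" if "i \<in> Basis" for i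
   using add that by (auto intro!: sm.add simp: partial_def[symmetric, abs_def])
  then show ?case
   by (intro *[where D = "%x h. frechet_derivative u (at x) h + frechet_derivative v (at x) h"] has_derivative_add d)
    (use add in auto)
 next
  case (mult u v)
  have "(%x. u x * frechet_derivative v (at x) i + frechet_derivative u (at x) i * v x) \<in> sm" if "i \<in> Basis" for i
   using mult that by (auto intro!: sm.add sm.mult simp: partial_def[symmetric, abs_def])
  then show ?case
   by (intro *[where D = "%x h. u x * frechet_derivative v (at x) h + frechet_derivative u (at x) h * v x"] has_derivative_mult d)
    (use mult in auto)
 next
  case (inv u)
  show ?case
  proof (rule *[where D = "%x h. (-1) * ((inverse (u x) * frechet_derivative u (at x) h) * inverse (u x))"])
   show "((%x. inverse (u x)) has_derivative (%h. (-1) * ((inverse (u x) * frechet_derivative u (at x) h) * inverse (u x)))) (at x)" for x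
   proof -
    have "(u has_derivative frechet_derivative u (at x)) (at x)" by (rule d) (use inv in auto)
    from Deriv.has_derivative_inverse[OF inv(2)[of x] this] show ?thesis by simp
   qed
  next
   fix i :: 'a assume "i \<in> Basis"
   then have "(%x. frechet_derivative u (at x) i) \<in> sm" using inv by (simp add: partial_def[symmetric, abs_def])
   then show "(%x. (-1) * ((inverse (u x) * frechet_derivative u (at x) i) * inverse (u x))) \<in> sm"
    by (intro sm.mult sm.const sm.inv inv)
  qed
 next
  case (root u)
  show ?case
  proof (rule *[where D = "%x h. (inverse (sqrt (u x)) * (1/2)) * frechet_derivative u (at x) h"])
   show "((%x. sqrt (u x)) has_derivative (%h. (inverse (sqrt (u x)) * (1/2)) * frechet_derivative u (at x) h)) (at x)" for x
   proof -
    have "(u has_derivative frechet_derivative u (at x)) (at x)" by (rule d) (use root in auto)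
    from DERIV_compose_FDERIV[OF DERIV_real_sqrt[OF root(2)[of x]] this] show ?thesis
     by (rule has_derivative_eq_rhs) (rule ext, simp)
   qed
  next
   fix i :: 'a assume "i \<in> Basis"
   then have "(%x. frechet_derivative u (at x) i) \<in> sm" using root by (simp add: partial_def[symmetric, abs_def])
   moreover have "sqrt (u x) ~= 0" for x using root(2)[of x] by simp
   ultimately show "(%x. (inverse (sqrt (u x)) * (1/2)) * frechet_derivative u (at x) i) \<in> sm"
    by (intro sm.mult sm.const sm.inv sm.root root)
  qed
 next
  case (bump u p)
  show ?case
  proof (rule *[where D = "%x h. frechet_derivative u (at x) h * ebump ((p - pderiv p) * [:0, 0, 1:]) (u x)"])
   show "((%x. ebump p (u x)) has_derivative (%h. frechet_derivative u (at x) h * ebump ((p - pderiv p) * [:0, 0, 1:]) (u x))) (at x)" for x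
   proof (rule DERIV_compose_FDERIV[OF ebump_deriv])
    show "(u has_derivative frechet_derivative u (at x)) (at x)" by (rule d) (use bump in auto)
   qed
  next
   fix i :: 'a assume "i \<in> Basis"
   then have "(%x. frechet_derivative u (at x) i) \<in> sm" using bump by (simp add: partial_def[symmetric, abs_def])
   then show "(%x. frechet_derivative u (at x) i * ebump ((p - pderiv p) * [:0, 0, 1:]) (u x)) \<in> sm"
    by (intro sm.mult sm.bump bump)
  qed
 qed
qed

lemma sm_smooth: "u \<in> sm ==> smooth_fn u"
proof -
 assume u: "u \<in> sm"
 have "iter_partial is u \<in> sm" if "set is \<subseteq> Basis" for "is"
  using that by (induction "is") (use u sm_partial in auto)
 then show ?thesis unfolding smooth_fn_def using sm_partial by blast
qed

lemma smooth_sm: "smooth_fn u ==> u \<in> sm"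
 using sm.base[of u "[]"] by simp

lemma test_sm: "test_fn u ==> u \<in> sm"
 by (simp add: test_fn_def smooth_sm)

lemma sm_scale: "u \<in> sm ==> (%x. c * u x) \<in> sm"
 by (rule sm.mult[OF sm.const])

lemma sm_diff: "u \<in> sm ==> v \<in> sm ==> (%x. u x - v x) \<in> sm"
 using sm.add[OF _ sm_scale[of v "-1"], of u] by simp

lemma sm_sum: "(!!i. i \<in> I ==> u i \<in> sm) ==> (%x. \<Sum>i\<in>I. u i x) \<in> sm"
 by (induction I rule: infinite_finite_induct) (auto intro: sm.const sm.add)

lemma sm_power: "u \<in> sm ==> (%x. u x ^ n) \<in> sm"
 by (induction n) (auto intro: sm.const sm.mult)

lemma sm_cont: "u \<in> sm ==> continuous_on UNIV u"
 by (rule differentiable_imp_continuous_on) (simp add: differentiable_on_def sm_partial)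

lemma sm_grad: "u \<in> sm ==> (u has_derivative (%h. grad u x \<bullet> h)) (at x)"
proof -
 assume u: "u \<in> sm"
 then have d: "(u has_derivative frechet_derivative u (at x)) (at x)" using sm_partial frechet_derivative_works by blast
 have l: "linear (frechet_derivative u (at x))" using d has_derivative_linear by blast
 have "frechet_derivative u (at x) h = grad u x \<bullet> h" for h
 proof -
  have "frechet_derivative u (at x) h = frechet_derivative u (at x) (\<Sum>i\<in>Basis. (h \<bullet> i) *R i)"
   by (simp add: euclidean_representation)
  also have "... = (\<Sum>i\<in>Basis. (h \<bullet> i) * frechet_derivative u (at x) i)"
   using l by (simp add: linear_sum linear_scale)
  also have "... = grad u x \<bullet> h"
   unfolding grad_def partial_def inner_sum_left by (simp add: inner_commute mult.commute)
  finally show ?thesis .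
 qed
 then have "frechet_derivative u (at x) = (%h. grad u x \<bullet> h)" by (rule ext)
 then show ?thesis using d by simp
qed

lemma grad_eq: "(u has_derivative (%h. v \<bullet> h)) (at x) ==> grad u x = v"
 unfolding grad_def by (simp add: partial_eq[of u "%h. v \<bullet> h" x] euclidean_representation)

lemma sm_grad_cont: "u \<in> sm ==> continuous_on UNIV (grad u)"
 unfolding grad_def using sm_partial by (intro continuous_intros sm_cont) auto

lemma partial_grad: "i \<in> Basis ==> partial i u x = grad u x \<bullet> i"
 by (simp add: grad_def inner_sum_left inner_Basis if_distrib sum.delta cong: if_cong)

lemma grad_meas: "u \<in> sm ==> grad u \<in> borel_measurable borel"
 by (intro borel_measurable_continuous_onI sm_grad_cont)

lemma sm_meas: "u \<in> sm ==> u \<in> borel_measurable borel"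
 by (intro borel_measurable_continuous_onI sm_cont)

lemma grad_add: "u \<in> sm ==> v \<in> sm ==> grad (%x. u x + v x) x = grad u x + grad v x"
 by (rule grad_eq, rule has_derivative_eq_rhs[OF has_derivative_add[OF sm_grad sm_grad]])
  (simp_all add: inner_add_left fun_eq_iff)

lemma grad_mult: "u \<in> sm ==> v \<in> sm ==> grad (%x. u x * v x) x = u x *R grad v x + v x *R grad u x"
 by (rule grad_eq, rule has_derivative_eq_rhs[OF has_derivative_mult[OF sm_grad sm_grad]])
  (simp_all add: inner_add_left fun_eq_iff)

lemma grad_const: "grad (%x. c) x = 0"
 by (rule grad_eq) simp

lemma grad_cmult: "u \<in> sm ==> grad (%x. c * u x) x = c *R grad u x"
 using grad_mult[OF sm.const, of u c x] by (simp add: grad_const)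

lemma grad_comp: "u \<in> sm ==> (g has_real_derivative d) (at (u x)) ==> grad (%x. g (u x)) x = d *R grad u x"
 by (rule grad_eq, rule has_derivative_eq_rhs, rule DERIV_compose_FDERIV, assumption, rule sm_grad, assumption)
  (simp add: fun_eq_iff)

section \<open>Test functions and cutoffs\<close>

lemma test_fnI:
 assumes "test_fn f" "h \<in> sm" "!!x. f x = 0 ==> h x = 0"
 shows "test_fn h"
proof -
 have "{x. h x ~= 0} \<subseteq> {x. f x ~= 0}" using assms(3) by auto
 moreover have "bounded {x. f x ~= 0}" using assms(1) by (simp add: test_fn_def compact_closure)
 ultimately have "bounded {x. h x ~= 0}" by (rule bounded_subset[rotated])
 then show ?thesis using sm_smooth[OF assms(2)] by (simp add: test_fn_def compact_closure)
qed

lemma test_fn_bounded_I: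
 assumes "h \<in> sm" "!!x. R <= norm x ==> h x = 0"
 shows "test_fn h"
proof -
 have "bounded {x. h x ~= 0}" by (rule boundedI[of _ R]) (use assms(2) in force)
 then show ?thesis using sm_smooth[OF assms(1)] by (simp add: test_fn_def)
qed

lemma test_fn_bounded_support:
 assumes "test_fn f"
 shows "\<exists>R>0. ALL x. R <= norm x --> f x = 0 & grad f x = 0"
proof -
 have "bounded {x. f x ~= 0}" using assms by (simp add: test_fn_def compact_closure)
 then obtain B where B: "0 < B" "!!x. f x ~= 0 ==> norm x <= B" unfolding bounded_pos by auto
 have 0: "f x = 0" if "B < norm x" for x
  using B(2)[of x] that by (auto simp: not_le)
 have "grad f x = 0" if "B < norm x" for x
 proof (rule grad_eq)
  have "open {y::'a. B < norm y}" by (intro open_Collect_less continuous_intros)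
  moreover have "((%x. 0::real) has_derivative (%h. 0 \<bullet> h)) (at x)" by simp
  ultimately show "(f has_derivative (%h. 0 \<bullet> h)) (at x)"
   using that 0 by (rule_tac has_derivative_transform_within_open[of "%x. 0"]) auto
 qed
 then show ?thesis using 0 B(1) by (intro exI[of _ "B + 1"]) auto
qed

lemma test_add: "test_fn u ==> test_fn v ==> test_fn (%x. u x + v x)"
proof -
 assume a: "test_fn u" "test_fn v"
 obtain R where R: "ALL x. R <= norm x --> u x = 0 & grad u x = 0" using test_fn_bounded_support[OF a(1)] by blast
 obtain S where S: "ALL x. S <= norm x --> v x = 0 & grad v x = 0" using test_fn_bounded_support[OF a(2)] by blast
 show ?thesis by (rule test_fn_bounded_I[OF sm.add[OF test_sm[OF a(1)] test_sm[OF a(2)]], of "max R S"]) (simp add: R S)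
qed

lemma test_mult: "test_fn u ==> v \<in> sm ==> test_fn (%x. v x * u x)"
 by (rule test_fnI[of u]) (auto intro: sm.mult test_sm)

text \<open>The usual smooth transition, falling from 1 at t <= 0 to 0 at t >= 1; the two bumps in
  the denominator never vanish together.\<close>

definition sstep :: "real => real" where
 "sstep t = ebump 1 (1 - t) * inverse (ebump 1 t + ebump 1 (1 - t))"

lemma ebump1: "0 <= ebump 1 t" "0 < t ==> 0 < ebump 1 t" "t <= 0 ==> ebump 1 t = 0"
 by (auto simp: ebump_def)

lemma ebump1_sum_pos: "0 < ebump 1 t + ebump 1 (1 - t)"
 using ebump1[of t] ebump1[of "1 - t"] by (cases "0 < t") (auto simp: add_pos_nonneg add_nonneg_pos)

lemma sm_sstep: "u \<in> sm ==> (%x. sstep (u x)) \<in> sm"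
 unfolding sstep_def using ebump1_sum_pos
 by (intro sm.mult sm.inv sm.add sm.bump sm_diff sm.const) (auto simp: less_le)

lemma sstep_props: "0 <= sstep t" "sstep t <= 1" "t <= 0 ==> sstep t = 1" "1 <= t ==> sstep t = 0"
 using ebump1[of t] ebump1[of "1 - t"] ebump1_sum_pos[of t] by (auto simp: sstep_def divide_simps field_simps)

lemma sstep_deriv_bound:
 "EX C D. 0 < C & (ALL t. (sstep has_real_derivative D t) (at t)) & (ALL t. \<bar>D t\<bar> <= C) \<and>
  (ALL t. t < 0 \<or> 1 < t --> D t = 0)"
proof -
 have s: "sstep \<in> sm" using sm_sstep[OF sm.lin[of "1::real"]] by simp
 have d: "(sstep has_real_derivative grad sstep t) (at t)" for t
  using sm_grad[OF s, of t] by (simp add: has_field_derivative_def)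
 have z: "grad sstep t = 0" if "t < 0 \<or> 1 < t" for t
 proof -
  obtain U c where U: "open U" "t \<in> U" "!!s. s \<in> U ==> sstep s = c"
  proof (cases "t < 0")
   case True then show ?thesis by (intro that[of "{..<0}" 1]) (auto simp: sstep_props(3))
  next
   case False then show ?thesis using \<open>t < 0 \<or> 1 < t\<close> by (intro that[of "{1<..}" 0]) (auto simp: sstep_props(4))
  qed
  have "((%x. c) has_derivative (%h. 0 \<bullet> h)) (at t)" by simp
  then have "(sstep has_derivative (%h. 0 \<bullet> h)) (at t)"
   using U by (rule_tac has_derivative_transform_within_open[of "%x. c"]) auto
  then show ?thesis by (rule grad_eq)
 qed
 have "compact (grad sstep ` {0..1})"
  by (rule compact_continuous_image) (auto intro: continuous_on_subset[OF sm_grad_cont[OF s]])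
 then obtain C where C: "0 < C" "!!t. t \<in> {0..1} ==> \<bar>grad sstep t\<bar> <= C"
  using compact_imp_bounded bounded_pos by (metis imageI real_norm_def)
 have "\<bar>grad sstep t\<bar> <= C" for t
  using C(2)[of t] z[of t] C(1) by (cases "t \<in> {0..1}") auto
 then show ?thesis using C(1) d z by blast
qed

text \<open>The transition is composed with an affine function of |x|^2, a polynomial in the
  coordinates and therefore smooth. The gradient keeps the scale 1/(R - r), since R^2 - r^2 factors
  and |x| <= R wherever the gradient is nonzero.\<close>

lemma cutoff_exists:
 "\<exists>C>0. ALL r R. 0 <= r --> r < R --> (\<exists>ctz::'a::euclidean_space => real. test_fn ctz & (ALL x. 0 <= ctz x & ctz x <= 1) \<and>
   (ALL x. norm x <= r --> ctz x = 1) & (ALL x. R <= norm x --> ctz x = 0) & (ALL x. norm (grad ctz x) <= C / (R - r)) \<and>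
   (ALL x. norm x < r \<or> R < norm x --> grad ctz x = 0))"
proof -
 obtain C D where CD': "0 < C & (ALL t. (sstep has_real_derivative D t) (at t)) & (ALL t. \<bar>D t\<bar> <= C) \<and>
  (ALL t. t < 0 \<or> 1 < t --> D t = 0)" by (rule exE[OF sstep_deriv_bound]) (erule exE)
 then have CD: "0 < C" "!!t. (sstep has_real_derivative D t) (at t)" "!!t. \<bar>D t\<bar> <= C"
  "!!t. t < 0 \<or> 1 < t ==> D t = 0" by blast+
 show ?thesis
 proof (intro exI[of _ "2 * C"] conjI allI impI)
  fix r R :: real assume r: "0 <= r" "r < R"
  define q where "q = (%x::'a. (1 / (R\<^sup>2 - r\<^sup>2)) * ((\<Sum>b\<in>Basis. (x \<bullet> b) * (x \<bullet> b)) - r\<^sup>2))"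
  define ctz where "ctz = (%x::'a. sstep (q x))"
  have Rr: "0 < R\<^sup>2 - r\<^sup>2" using r by (simp add: power_strict_mono)
  have qe: "q x = ((norm x)\<^sup>2 - r\<^sup>2) / (R\<^sup>2 - r\<^sup>2)" for x
   by (simp add: q_def euclidean_inner[symmetric] power2_norm_eq_inner)
  have qe': "q = (%x. (1 / (R\<^sup>2 - r\<^sup>2)) * (x \<bullet> x - r\<^sup>2))"
   by (rule ext) (simp add: q_def euclidean_inner[symmetric])
  have qs: "q \<in> sm" unfolding q_def by (intro sm_scale sm_diff sm_sum sm.mult sm.lin sm.const)
  have es: "ctz \<in> sm" unfolding ctz_def by (rule sm_sstep[OF qs])
  have gq: "grad q x = (2 / (R\<^sup>2 - r\<^sup>2)) *R x" for x
   unfolding qe' by (rule grad_eq) (use Rr in \<open>auto intro!: derivative_eq_intros simp: inner_commute\<close>)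
  have ge: "grad ctz x = D (q x) *R grad q x" for x
   unfolding ctz_def by (rule grad_comp[OF qs CD(2)])
  have q0: "q x <= 0 \<longleftrightarrow> norm x <= r" "q x < 0 \<longleftrightarrow> norm x < r" for x
  proof -
   have "q x <= 0 \<longleftrightarrow> (norm x)\<^sup>2 <= r\<^sup>2" "q x < 0 \<longleftrightarrow> (norm x)\<^sup>2 < r\<^sup>2"
    using Rr unfolding qe divide_le_0_iff divide_less_0_iff by linarith+
   then show "q x <= 0 \<longleftrightarrow> norm x <= r" "q x < 0 \<longleftrightarrow> norm x < r"
    using r by (auto simp: power_mono power_strict_mono intro: power2_le_imp_le power2_less_imp_less)
  qed
  have q1: "1 <= q x \<longleftrightarrow> R <= norm x" "1 < q x \<longleftrightarrow> R < norm x" for x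
  proof -
   have "1 <= q x \<longleftrightarrow> R\<^sup>2 <= (norm x)\<^sup>2" "1 < q x \<longleftrightarrow> R\<^sup>2 < (norm x)\<^sup>2" using Rr unfolding qe le_divide_eq less_divide_eq by simp_all
   then show "1 <= q x \<longleftrightarrow> R <= norm x" "1 < q x \<longleftrightarrow> R < norm x"
    using r by (auto simp: power_mono power_strict_mono intro: power2_le_imp_le power2_less_imp_less)
  qed
  have gz: "grad ctz x = 0" if "norm x < r \<or> R < norm x" for x
   using CD(4) q0(2)[of x] q1(2)[of x] that unfolding ge by auto
  have gb: "norm (grad ctz x) <= 2 * C / (R - r)" for x
  proof (cases "R < norm x")
   case True
   then show ?thesis using gz[of x] CD(1) r by simp
  next
   case False
   have "norm (grad ctz x) <= C * ((2 / (R\<^sup>2 - r\<^sup>2)) * R)"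
    unfolding ge gq norm_scaleR using CD(3)[of "q x"] Rr False CD(1)
    by (intro mult_mono) (auto intro!: divide_right_mono)
   also have "... = 2 * C * R / ((R - r) * (R + r))" by (simp add: field_simps power2_eq_square)
   also have "... <= 2 * C * (R + r) / ((R - r) * (R + r))"
    using r CD(1) by (intro divide_right_mono) auto
   also have "... = 2 * C / (R - r)" using r by simp
   finally show ?thesis .
  qed
  have e1: "ALL x. R <= norm x --> ctz x = 0" unfolding ctz_def using q1(1) sstep_props(4) by blast
  have e0: "test_fn ctz" by (rule test_fn_bounded_I[OF es, of R]) (rule e1[rule_format])
  have e2: "ALL x. norm x <= r --> ctz x = 1" unfolding ctz_def using q0(1) sstep_props(3) by blast
  have e3: "ALL x. 0 <= ctz x & ctz x <= 1" unfolding ctz_def using sstep_props(1,2) by blast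
  have e4: "ALL x. norm (grad ctz x) <= 2 * C / (R - r)" using gb by blast
  have e5: "ALL x. norm x < r \<or> R < norm x --> grad ctz x = 0" using gz by blast
  show "\<exists>ctz::'a => real. test_fn ctz & (ALL x. 0 <= ctz x & ctz x <= 1) \<and>
   (ALL x. norm x <= r --> ctz x = 1) & (ALL x. R <= norm x --> ctz x = 0) & (ALL x. norm (grad ctz x) <= 2 * C / (R - r)) \<and>
   (ALL x. norm x < r \<or> R < norm x --> grad ctz x = 0)"
   by (rule exI[of _ ctz]) (intro conjI e0 e1 e2 e3 e4 e5)
 qed (use CD in auto)
qed

section \<open>Level sets of test functions\<close>

lemma nn_integral_lborel_shift:
 assumes [measurable]: "f \<in> borel_measurable borel"
 shows "(\<integral>\<^sup>+x. f (x + h) \<partial>lborel) = (\<integral>\<^sup>+x. f (x :: 'a::euclidean_space) \<partial>lborel)"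
proof -
 have "(\<integral>\<^sup>+x. f x \<partial>lborel) = (\<integral>\<^sup>+x. f x \<partial>distr lborel borel ((+) h))" by (simp add: lborel_distr_plus)
 also have "... = (\<integral>\<^sup>+x. f (h + x) \<partial>lborel)" by (subst nn_integral_distr) auto
 finally show ?thesis by (simp add: add.commute)
qed

lemma segment_estimate:
 fixes f :: "'a::euclidean_space => real"
 assumes d: "!!x. (f has_derivative (%h. G x \<bullet> h)) (at x)" and c: "continuous_on UNIV G"
 shows "ennreal \<bar>f (x + h) - f x\<bar> <= ennreal (norm h) * (\<integral>\<^sup>+t\<in>{0..1}. ennreal (norm (G (x + t *R h))) \<partial>lborel)"
proof -
 have vd: "((%t. f (x + t *R h)) has_vector_derivative (G (x + t *R h) \<bullet> h)) (at t within {0..1})" for t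
 proof -
  have "((%t. x + t *R h) has_derivative (%s. s *R h)) (at t within {0..1})" by (auto intro!: derivative_eq_intros)
  from has_derivative_compose[OF this d]
  show ?thesis by (simp add: has_vector_derivative_def mult.commute)
 qed
 have I: "((%t. G (x + t *R h) \<bullet> h) has_integral (f (x + 1 *R h) - f (x + 0 *R h))) {0..1}"
  by (rule fundamental_theorem_of_calculus[OF _ vd]) auto
 have ci: "continuous_on {0..1} (%t. norm (G (x + t *R h)) * norm h)"
  by (intro continuous_intros continuous_on_compose2[OF c]) auto
 define J where "J = integral {0..1} (%t. norm (G (x + t *R h)) * norm h)"
 have J: "((%t. norm (G (x + t *R h)) * norm h) has_integral J) {0..1}"
  unfolding J_def by (intro integrable_integral integrable_continuous_real ci)
 have "\<bar>f (x + h) - f x\<bar> <= J"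
 proof -
  have "norm (integral {0..1} (%t. G (x + t *R h) \<bullet> h)) <= J"
   unfolding J_def
   by (rule integral_norm_bound_integral)
    (use I J in \<open>auto simp: has_integral_integrable J_def[symmetric] Cauchy_Schwarz_ineq2\<close>)
  then show ?thesis using integral_unique[OF I] by simp
 qed
 then have "ennreal \<bar>f (x + h) - f x\<bar> <= ennreal J" by (rule ennreal_leI)
 also have "... = (\<integral>\<^sup>+t. ennreal (norm (G (x + t *R h)) * norm h) * indicator {0..1} t \<partial>lborel)"
  using nn_integral_has_integral_lebesgue'[OF _ J] by simp
 also have "... = (\<integral>\<^sup>+t. ennreal (norm h) * (ennreal (norm (G (x + t *R h))) * indicator {0..1} t) \<partial>lborel)"
  by (intro nn_integral_cong) (auto simp: ennreal_mult' mult_ac)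
 also have "... = ennreal (norm h) * (\<integral>\<^sup>+t\<in>{0..1}. ennreal (norm (G (x + t *R h))) \<partial>lborel)"
 proof (rule nn_integral_cmult)
  have "continuous_on UNIV (%t. norm (G (x + t *R h)))"
   by (intro continuous_intros continuous_on_compose2[OF c]) auto
  then have "(%t. norm (G (x + t *R h))) \<in> borel_measurable borel" by (rule borel_measurable_continuous_onI)
  then show "(%t. ennreal (norm (G (x + t *R h))) * indicator {0..1} t) \<in> borel_measurable lborel"
   by (intro borel_measurable_times_ennreal borel_measurable_indicator measurable_compose[OF _ measurable_ennreal]) auto
 qed
 finally show ?thesis .
qed

text \<open>The increment is at most |h| times the integral of |G| over the segment; after Fubini
  each point of the segment contributes a translation that maps A into B.\<close>

lemma translation_estimate:
 fixes f :: "'a::euclidean_space => real"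
 assumes d: "!!x. (f has_derivative (%h. G x \<bullet> h)) (at x)" and c: "continuous_on UNIV G"
  and A[measurable]: "A \<in> sets borel" "B \<in> sets borel"
  and AB: "!!x t. x \<in> A ==> 0 <= t ==> t <= 1 ==> x + t *R h \<in> B"
 shows "(\<integral>\<^sup>+x\<in>A. ennreal \<bar>f (x + h) - f x\<bar> \<partial>lborel) <= ennreal (norm h) * (\<integral>\<^sup>+x\<in>B. ennreal (norm (G x)) \<partial>lborel)"
proof -
 have [measurable]: "G \<in> borel_measurable borel" by (rule borel_measurable_continuous_onI[OF c])
 have "continuous_on UNIV f" using d by (intro has_derivative_continuous_on) (blast intro: has_derivative_at_withinI)
 then have [measurable]: "f \<in> borel_measurable borel" by (rule borel_measurable_continuous_onI)
 let ?I = "%x t. ennreal (norm (G (x + t *R h))) * indicator {0..1::real} t * indicator A x"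
 have "(\<integral>\<^sup>+x\<in>A. ennreal \<bar>f (x + h) - f x\<bar> \<partial>lborel) \<le>
   (\<integral>\<^sup>+x. ennreal (norm h) * (\<integral>\<^sup>+t. ?I x t \<partial>lborel) \<partial>lborel)"
  using segment_estimate[OF d c]
  by (intro nn_integral_mono) (auto simp: indicator_def)
 also have "... = ennreal (norm h) * (\<integral>\<^sup>+x. (\<integral>\<^sup>+t. ?I x t \<partial>lborel) \<partial>lborel)"
  by (rule nn_integral_cmult) measurable
 also have "(\<integral>\<^sup>+x. (\<integral>\<^sup>+t. ?I x t \<partial>lborel) \<partial>lborel) = (\<integral>\<^sup>+t. (\<integral>\<^sup>+x. ?I x t \<partial>lborel) \<partial>lborel)"
  by (rule lborel_pair.Fubini') measurable
 also have "... <= (\<integral>\<^sup>+t. (\<integral>\<^sup>+x\<in>B. ennreal (norm (G x)) \<partial>lborel) * indicator {0..1::real} t \<partial>lborel)"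
 proof (rule nn_integral_mono)
  fix t :: real
  show "(\<integral>\<^sup>+x. ?I x t \<partial>lborel) <= (\<integral>\<^sup>+x\<in>B. ennreal (norm (G x)) \<partial>lborel) * indicator {0..1::real} t"
  proof (cases "t \<in> {0..1}")
   case True
   have "(\<integral>\<^sup>+x. ?I x t \<partial>lborel) <= (\<integral>\<^sup>+x. ennreal (norm (G (x + t *R h))) * indicator B (x + t *R h) \<partial>lborel)"
    using AB True by (intro nn_integral_mono) (auto simp: indicator_def)
   also have "... = (\<integral>\<^sup>+x\<in>B. ennreal (norm (G x)) \<partial>lborel)"
    by (rule nn_integral_lborel_shift[of "%x. ennreal (norm (G x)) * indicator B x"]) measurable
   finally show ?thesis using True by simp
  qed simp
 qed
 also have "... = (\<integral>\<^sup>+x\<in>B. ennreal (norm (G x)) \<partial>lborel)"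
  by (subst nn_integral_cmult_indicator) auto
 finally show ?thesis by (simp add: mult_left_mono)
qed

lemma cont_bounded_support_integrable:
 fixes f :: "'a::euclidean_space => 'b::euclidean_space"
 assumes c: "continuous_on UNIV f" and z: "!!x. R <= norm x ==> f x = 0"
 shows "integrable lebesgue f"
proof -
 have "integrable lborel (%x. indicator (cball 0 R) x *R f x)"
  by (rule borel_integrable_compact) (auto intro: continuous_on_subset[OF c])
 moreover have "(%x. indicator (cball 0 R) x *R f x) = f"
  using z by (auto simp: indicator_def fun_eq_iff)
 ultimately show ?thesis by (simp add: integrable_completion borel_measurable_continuous_onI[OF c])
qed

lemma cont_bounded_support_bounded:
 fixes f :: "'a::euclidean_space => 'b::euclidean_space"
 assumes c: "continuous_on UNIV f" and z: "!!x. R <= norm x ==> f x = 0"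
 shows "\<exists>C>0. ALL x. norm (f x) <= C"
proof -
 have "compact (f ` cball 0 R)" by (intro compact_continuous_image continuous_on_subset[OF c]) auto
 then have "bounded (f ` cball 0 R)" by (rule compact_imp_bounded)
 then obtain C where C: "0 < C" "\<forall>y\<in>f ` cball 0 R. norm y <= C" unfolding bounded_pos by blast
 have "norm (f x) <= C" for x
  using C z[of x] by (cases "norm x <= R") auto
 then show ?thesis using C(1) by blast
qed

lemma integral_lborel_shift:
 fixes f :: "'a::euclidean_space => real"
 assumes [measurable]: "f \<in> borel_measurable borel"
 shows "(\<integral>x. f (x + h) \<partial>lborel) = (\<integral>x. f x \<partial>lborel)"
proof -
 have "(\<integral>x. f x \<partial>lborel) = (\<integral>x. f x \<partial>distr lborel borel ((+) h))" by (simp add: lborel_distr_plus)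
 also have "... = (\<integral>x. f (h + x) \<partial>lborel)" by (subst integral_distr) auto
 finally show ?thesis by (simp add: add.commute)
qed

text \<open>Difference quotients have integral 0 by translation invariance, and they converge
  dominatedly: a Lipschitz bound on a ball enlarged by one unit is the majorant, as the steps have
  length at most 1.\<close>

lemma test_partial_integral_0:
 assumes f: "test_fn f" and i: "i \<in> Basis"
 shows "(LINT x|lebesgue. grad f x \<bullet> i) = 0"
proof -
 have fs: "f \<in> sm" by (rule test_sm[OF f])
 note [measurable] = sm_meas[OF fs] grad_meas[OF fs]
 obtain R where R': "0 < R" "ALL x. R <= norm x --> f x = 0 & grad f x = 0"
  using test_fn_bounded_support[OF f] by blast
 then have R: "0 < R" "!!x. R <= norm x ==> f x = 0" "!!x. R <= norm x ==> grad f x = 0" by simp_all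
 obtain C where C: "0 < C" "ALL x. norm (grad f x) <= C"
  using cont_bounded_support_bounded[OF sm_grad_cont[OF fs] R(3)] by blast
 have lip: "\<bar>f (x + h) - f x\<bar> <= C * norm h" for x h
 proof -
  have "onorm (%h. grad f y \<bullet> h) <= C" for y
  proof (rule onorm_bound)
   show "norm (grad f y \<bullet> h) <= C * norm h" for h
    using Cauchy_Schwarz_ineq2[of "grad f y" h] mult_right_mono[OF C(2)[rule_format, of y], of "norm h"] by simp
  qed (use C in simp)
  then show ?thesis
   using differentiable_bound[of UNIV f "%x h. grad f x \<bullet> h" C "x + h" x] sm_grad[OF fs] by simp
 qed
 define s where "s = (%n x. real (Suc n) * (f (x + (1 / real (Suc n)) *R i) - f x))"
 have fi: "integrable lborel f"
  using cont_bounded_support_integrable[OF sm_cont[OF fs] R(2)] by (simp add: integrable_completion)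
 have si: "integrable lborel (%x. f (x + h))" for h
 proof (rule integrableI_bounded)
  have "(\<integral>\<^sup>+x. ennreal (norm (f (x + h))) \<partial>lborel) = (\<integral>\<^sup>+x. ennreal (norm (f x)) \<partial>lborel)"
   by (rule nn_integral_lborel_shift[of "%x. ennreal (norm (f x))"]) measurable
  then show "(\<integral>\<^sup>+x. ennreal (norm (f (x + h))) \<partial>lborel) < \<infinity>" using fi by (simp add: integrable_iff_bounded)
 qed measurable
 have s0: "(\<integral>x. s n x \<partial>lborel) = 0" for n
  unfolding s_def using fi si by (simp add: integral_lborel_shift)
 have "(%n. \<integral>x. s n x \<partial>lborel) ~~> (\<integral>x. grad f x \<bullet> i \<partial>lborel)"
 proof (rule integral_dominated_convergence)
  show "integrable lborel (%x::'a. C * indicator (cball 0 (R + 1)) x)"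
   using emeasure_bounded_finite[of "cball 0 (R + 1) :: 'a set"]
   by (intro integrable_mult_right integrable_real_indicator) (auto simp: less_top)
  show "AE x in lborel. norm (s n x) <= C * indicator (cball 0 (R + 1)) x" for n
  proof (rule AE_I2)
   fix x :: 'a
   have n: "norm ((1 / real (Suc n)) *R i) = 1 / real (Suc n)" using i by simp
   show "norm (s n x) <= C * indicator (cball 0 (R + 1)) x"
   proof (cases "norm x <= R + 1")
    case True
    have "norm (s n x) <= real (Suc n) * (C * norm ((1 / real (Suc n)) *R i))"
     unfolding s_def norm_mult using lip[of x "(1 / real (Suc n)) *R i"] by (intro mult_mono) auto
    also have "... = C" unfolding n by simp
    finally show ?thesis using True by simp
   next
    case False
    have "norm x <= norm (x + (1 / real (Suc n)) *R i) + 1 / real (Suc n)"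
     using norm_triangle_sub[of x "x + (1 / real (Suc n)) *R i"] n by simp
    moreover have "1 / real (Suc n) <= 1" by simp
    ultimately have "R <= norm (x + (1 / real (Suc n)) *R i)" using False by linarith
    then show ?thesis using R(2) False by (simp add: s_def)
   qed
  qed
  show "AE x in lborel. (%n. s n x) ~~> grad f x \<bullet> i"
  proof (rule AE_I2)
   fix x
   have "((%t. f (x + t *R i)) has_derivative (%t. grad f x \<bullet> (t *R i))) (at 0)"
   proof -
    have "((%t. x + t *R i) has_derivative (%t. t *R i)) (at 0)" by (auto intro!: derivative_eq_intros)
    from has_derivative_compose[OF this, of f "%h. grad f x \<bullet> h"] show ?thesis using sm_grad[OF fs, of x] by simp
   qed
   then have "((%t. f (x + t *R i)) has_real_derivative (grad f x \<bullet> i)) (at 0)"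
    unfolding has_field_derivative_def by (rule has_derivative_eq_rhs) (simp add: fun_eq_iff)
   then have l: "((%t. (f (x + t *R i) - f x) / t) \<longlongrightarrow> grad f x \<bullet> i) (at 0)"
    by (simp add: has_field_derivative_iff)
   have "filterlim (%n. 1 / real (Suc n)) (at 0) sequentially"
    by (rule filterlim_atI) (use LIMSEQ_inverse_real_of_nat in \<open>auto simp: divide_inverse\<close>)
   from filterlim_compose[OF l this] show "(%n. s n x) ~~> grad f x \<bullet> i"
    by (simp add: s_def mult.commute)
  qed
 qed (auto simp: s_def)
 then have "(\<integral>x. grad f x \<bullet> i \<partial>lborel) = 0" by (simp add: s0 LIMSEQ_const_iff)
 then show ?thesis by (simp add: integral_completion)
qed

lemma test_weak_grad:
 assumes f: "test_fn f" and p: "test_fn p" and i: "i \<in> Basis"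
 shows "(LINT x|lebesgue. f x * partial i p x) = - (LINT x|lebesgue. (grad f x \<bullet> i) * p x)"
proof -
 note s = test_sm[OF f] test_sm[OF p]
 obtain R where R': "0 < R" "ALL x. R <= norm x --> p x = 0 & grad p x = 0"
  using test_fn_bounded_support[OF p] by blast
 then have R: "0 < R" "!!x. R <= norm x ==> p x = 0" "!!x. R <= norm x ==> grad p x = 0" by simp_all
 have i1: "integrable lebesgue (%x. f x * (grad p x \<bullet> i))"
  by (rule cont_bounded_support_integrable[of _ R])
   (simp_all add: R continuous_on_mult[OF sm_cont[OF s(1)] continuous_on_inner[OF sm_grad_cont[OF s(2)] continuous_on_const]])
 have i2: "integrable lebesgue (%x. (grad f x \<bullet> i) * p x)"
  by (rule cont_bounded_support_integrable[of _ R])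
   (simp_all add: R continuous_on_mult[OF continuous_on_inner[OF sm_grad_cont[OF s(1)] continuous_on_const] sm_cont[OF s(2)]])
 have "0 = (LINT x|lebesgue. grad (%x. f x * p x) x \<bullet> i)"
  using test_partial_integral_0[OF test_mult[OF p s(1)] i] by simp
 also have "... = (LINT x|lebesgue. f x * (grad p x \<bullet> i) + (grad f x \<bullet> i) * p x)"
  using s by (simp add: grad_mult inner_add_left mult.commute)
 also have "... = (LINT x|lebesgue. f x * (grad p x \<bullet> i)) + (LINT x|lebesgue. (grad f x \<bullet> i) * p x)"
  by (rule Bochner_Integration.integral_add[OF i1 i2])
 finally show ?thesis by (simp add: partial_grad[OF i])
qed

text \<open>The averages over a ball of twice the volume of \<open>{f >= al}\<close> see the complement of that set at
 least half of the time; this replaces the Gagliardo-Nirenberg inequality in the Orlicz--Sobolev embedding.\<close>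

definition ramp :: "real => real" where
 "ramp y = 2 * ((max 0 y)\<^sup>2 - 2 * (max 0 (y - 1/2))\<^sup>2 + (max 0 (y - 1))\<^sup>2)"

text \<open>A hat of height 2 on [0, 1]. Its primitive \<open>ramp\<close> climbs from 0 to 1 and is
  continuously differentiable, so that compositions with it satisfy
  \<open>translation_estimate\<close>.\<close>

definition dramp :: "real => real" where
 "dramp y = 4 * (max 0 y - 2 * max 0 (y - 1/2) + max 0 (y - 1))"

lemma deriv_max0_sq: "((%y. (max 0 (y - c))\<^sup>2) has_real_derivative 2 * max 0 (y - c)) (at (y::real))"
proof -
 consider "y > c" | "y < c" | "y = c" by linarith
 then show ?thesis
 proof cases
  case 1
  have "((%y. (y - c)\<^sup>2) has_real_derivative 2 * max 0 (y - c)) (at y)"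
   using 1 by (auto intro!: derivative_eq_intros)
  moreover have "eventually (%s. (s - c)\<^sup>2 = (max 0 (s - c))\<^sup>2) (nhds y)"
   using 1 eventually_nhds_in_open[of "{c<..}" y] by (auto elim!: eventually_mono)
  ultimately show ?thesis by (subst DERIV_cong_ev[OF refl _ refl, symmetric])
 next
  case 2
  have "((%y. 0) has_real_derivative 2 * max 0 (y - c)) (at y)" using 2 by auto
  moreover have "eventually (%s. 0 = (max 0 (s - c))\<^sup>2) (nhds y)"
   using 2 eventually_nhds_in_open[of "{..<c}" y] by (auto elim!: eventually_mono)
  ultimately show ?thesis by (subst DERIV_cong_ev[OF refl _ refl, symmetric])
 next
  case 3
  have "((%s. (max 0 (s - c))\<^sup>2 / (s - c)) \<longlongrightarrow> 0) (at c)"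
  proof (rule Lim_null_comparison)
   show "eventually (%s. norm ((max 0 (s - c))\<^sup>2 / (s - c)) <= \<bar>s - c\<bar>) (at c)"
    by (auto simp: eventually_at_filter power2_eq_square max_def abs_mult)
   have "((%s. s - c) \<longlongrightarrow> c - c) (at c)" by (intro tendsto_intros)
   then show "((%s. \<bar>s - c\<bar>) \<longlongrightarrow> 0) (at c)" by (simp add: tendsto_rabs_zero)
  qed
  then show ?thesis using 3 by (simp add: has_field_derivative_iff)
 qed
qed

lemma ramp_deriv: "(ramp has_real_derivative dramp y) (at y)"
proof -
 have "((%y. 2 * ((max 0 (y - 0))\<^sup>2 - 2 * (max 0 (y - 1/2))\<^sup>2 + (max 0 (y - 1))\<^sup>2)) has_real_derivative
   2 * (2 * max 0 (y - 0) - 2 * (2 * max 0 (y - 1/2)) + 2 * max 0 (y - 1))) (at y)"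
  by (intro DERIV_cmult DERIV_add DERIV_diff deriv_max0_sq)
 then show ?thesis by (simp add: ramp_def[abs_def] dramp_def algebra_simps)
qed

lemma dramp_props: "0 <= dramp y" "dramp y <= 2" "y <= 0 \<or> 1 <= y ==> dramp y = 0"
 unfolding dramp_def by (auto simp: max_def)

lemma dramp_cont: "continuous_on UNIV dramp"
 unfolding dramp_def by (intro continuous_intros)

lemma ramp_props: "y <= 0 ==> ramp y = 0" "1 <= y ==> ramp y = 1"
 unfolding ramp_def by (auto simp: max_def power2_eq_square algebra_simps)

lemma level_set_estimate:
 fixes f :: "'a::euclidean_space => real"
 assumes f: "f \<in> sm" and ab: "0 < al" "al < \<beta>" and fin: "emeasure lborel {x. al < f x} <= ennreal \<mu>" and \<mu>: "0 < \<mu>"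
  and r: "0 < r" "unit_ball_vol DIM('a) * r ^ DIM('a) = 2 * \<mu>"
 shows "emeasure lborel {x. \<beta> <= f x} <= ennreal (4 * r / (\<beta> - al)) * (\<integral>\<^sup>+x\<in>{x. al < f x & f x < \<beta>}. ennreal (norm (grad f x)) \<partial>lborel)"
proof -
 define d where "d = \<beta> - al"
 have d: "0 < d" using ab by (simp add: d_def)
 define T where "T = (%x. ramp ((f x - al) / d))"
 define G where "G = (%x. (dramp ((f x - al) / d) / d) *R grad f x)"
 note [measurable] = sm_meas[OF f] grad_meas[OF f]
 have Td: "(T has_derivative (%h. G x \<bullet> h)) (at x)" for x
 proof -
  have "((%x. (f x - al) / d) has_derivative (%h. (grad f x \<bullet> h) / d)) (at x)"
   using d by (auto intro!: derivative_eq_intros sm_grad f)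
  from DERIV_compose_FDERIV[OF ramp_deriv this] show ?thesis unfolding T_def G_def by (simp add: field_simps)
 qed
 have Gc: "continuous_on UNIV G" unfolding G_def using d
  by (intro continuous_intros continuous_on_compose2[OF dramp_cont] sm_cont sm_grad_cont f) auto
 have [measurable]: "G \<in> borel_measurable borel" by (rule borel_measurable_continuous_onI[OF Gc])
 have "continuous_on UNIV T" using Td by (intro has_derivative_continuous_on) (blast intro: has_derivative_at_withinI)
 then have [measurable]: "T \<in> borel_measurable borel" by (rule borel_measurable_continuous_onI)
 define I where "I = (\<integral>\<^sup>+x\<in>{x. al < f x & f x < \<beta>}. ennreal (norm (grad f x)) \<partial>lborel)"
 have GI: "(\<integral>\<^sup>+x\<in>UNIV. ennreal (norm (G x)) \<partial>lborel) <= ennreal (2 / d) * I"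
 proof -
  have "(\<integral>\<^sup>+x\<in>UNIV. ennreal (norm (G x)) \<partial>lborel) <= (\<integral>\<^sup>+x. ennreal (2 / d) * (ennreal (norm (grad f x)) * indicator {x. al < f x & f x < \<beta>} x) \<partial>lborel)"
  proof (rule nn_integral_mono)
   fix x
   show "ennreal (norm (G x)) * indicator UNIV x <= ennreal (2 / d) * (ennreal (norm (grad f x)) * indicator {x. al < f x & f x < \<beta>} x)"
   proof (cases "al < f x & f x < \<beta>")
    case True
    have "norm (G x) <= 2 / d * norm (grad f x)"
     unfolding G_def norm_scaleR using d dramp_props(1,2)[of "(f x - al) / d"]
     by (intro mult_right_mono) (auto intro!: divide_right_mono)
    then show ?thesis using True d by (simp flip: ennreal_mult add: ennreal_leI)
   next
    case False
    then have "dramp ((f x - al) / d) = 0" using d by (intro dramp_props(3)) (auto simp: d_def field_simps)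
    then show ?thesis by (simp add: G_def)
   qed
  qed
  also have "... = ennreal (2 / d) * I" unfolding I_def by (rule nn_integral_cmult) measurable
  finally show ?thesis .
 qed
 define E where "E = {x. \<beta> <= f x}"
 define B where "B = ball (0::'a) r"
 have [measurable]: "E \<in> sets borel" "B \<in> sets borel" unfolding E_def B_def by measurable
 have Bm: "emeasure lborel B = ennreal (2 * \<mu>)" unfolding B_def emeasure_ball[OF less_imp_le[OF r(1)]] r(2) ..
 \<comment> \<open>At x in E the value of T is 1. Of the shifts h in the ball, of volume
   \<open>2 * \<mu>\<close>, those with f(x + h) > al fill at most \<mu>; for the others T drops to
   0.\<close>
 have low: "ennreal \<mu> * indicator E x <= (\<integral>\<^sup>+h. ennreal \<bar>T (x + h) - T x\<bar> * indicator B h \<partial>lborel)" for x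
 proof (cases "x \<in> E")
  case True
  define S where "S = {h. al < f (x + h)}"
  have [measurable]: "S \<in> sets borel" unfolding S_def by measurable
  have "emeasure lborel S = (\<integral>\<^sup>+h. indicator S h \<partial>lborel)" by simp
  also have "... = (\<integral>\<^sup>+h. indicator {x. al < f x} (h + x) \<partial>lborel)"
   by (intro nn_integral_cong) (auto simp: S_def indicator_def add.commute)
  also have "... = (\<integral>\<^sup>+h. indicator {x. al < f x} h \<partial>lborel)"
   by (rule nn_integral_lborel_shift) measurable
  also have "... <= ennreal \<mu>" using fin by simp
  finally have Sm: "emeasure lborel S <= ennreal \<mu>" .
  have "ennreal (2 * \<mu>) <= emeasure lborel (B - S) + emeasure lborel S"
   unfolding Bm[symmetric] by (rule order_trans[OF emeasure_mono emeasure_subadditive]) auto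
  also have "... <= emeasure lborel (B - S) + ennreal \<mu>" using Sm by (intro add_left_mono)
  finally have "ennreal \<mu> + ennreal \<mu> <= emeasure lborel (B - S) + ennreal \<mu>" using \<mu> by (simp flip: ennreal_plus)
  then have "ennreal \<mu> + ennreal \<mu> <= ennreal \<mu> + emeasure lborel (B - S)"
   unfolding add.commute[of "emeasure lborel (B - S)"] .
  then have "ennreal \<mu> <= emeasure lborel (B - S)" unfolding ennreal_add_left_cancel_le by simp
  also have "... = (\<integral>\<^sup>+h. indicator (B - S) h \<partial>lborel)" by simp
  also have "... <= (\<integral>\<^sup>+h. ennreal \<bar>T (x + h) - T x\<bar> * indicator B h \<partial>lborel)"
  proof (rule nn_integral_mono)
   fix h
   have "T x = 1" unfolding T_def using True d by (intro ramp_props(2)) (auto simp: E_def d_def field_simps)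
   moreover have "T (x + h) = 0" if "h \<notin> S" unfolding T_def using that d
    by (intro ramp_props(1)) (auto simp: S_def divide_le_0_iff)
   ultimately show "indicator (B - S) h <= ennreal \<bar>T (x + h) - T x\<bar> * indicator B h"
    by (auto simp: indicator_def)
  qed
  finally show ?thesis using True by simp
 qed simp
 have "ennreal \<mu> * emeasure lborel E = (\<integral>\<^sup>+x. ennreal \<mu> * indicator E x \<partial>lborel)"
  by (subst nn_integral_cmult_indicator) auto
 also have "... <= (\<integral>\<^sup>+x. (\<integral>\<^sup>+h. ennreal \<bar>T (x + h) - T x\<bar> * indicator B h \<partial>lborel) \<partial>lborel)"
  by (intro nn_integral_mono low)
 also have "... = (\<integral>\<^sup>+h. (\<integral>\<^sup>+x. ennreal \<bar>T (x + h) - T x\<bar> * indicator B h \<partial>lborel) \<partial>lborel)"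
  by (rule lborel_pair.Fubini') measurable
 also have "... <= (\<integral>\<^sup>+h. (ennreal r * (ennreal (2 / d) * I)) * indicator B h \<partial>lborel)"
 proof (rule nn_integral_mono)
  fix h
  show "(\<integral>\<^sup>+x. ennreal \<bar>T (x + h) - T x\<bar> * indicator B h \<partial>lborel) <= (ennreal r * (ennreal (2 / d) * I)) * indicator B h"
  proof (cases "h \<in> B")
   case True
   then have "norm h <= r" by (simp add: B_def)
   have "(\<integral>\<^sup>+x\<in>UNIV. ennreal \<bar>T (x + h) - T x\<bar> \<partial>lborel) <= ennreal (norm h) * (\<integral>\<^sup>+x\<in>UNIV. ennreal (norm (G x)) \<partial>lborel)"
    by (rule translation_estimate[OF Td Gc]) auto
   also have "... <= ennreal r * (ennreal (2 / d) * I)" using GI \<open>norm h <= r\<close> by (intro mult_mono ennreal_leI) auto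
   finally show ?thesis using True by simp
  qed simp
 qed
 also have "... = (ennreal r * (ennreal (2 / d) * I)) * ennreal (2 * \<mu>)"
  by (subst nn_integral_cmult_indicator) (auto simp: Bm)
 \<comment> \<open>4r/d collects the length r of the shifts, the slope 2/d of the ramp and the ratio
   2 of the volumes.\<close>
 also have "... = ennreal \<mu> * (ennreal (4 * r / d) * I)"
 proof -
  have "ennreal \<mu> * ennreal (4 * r / d) = ennreal r * ennreal (2 / d) * ennreal (2 * \<mu>)"
   using \<mu> r d by (simp flip: ennreal_mult add: field_simps)
  then show ?thesis by (simp add: mult_ac)
 qed
 finally have "ennreal \<mu> * emeasure lborel E <= ennreal \<mu> * (ennreal (4 * r / d) * I)" .
 then have "emeasure lborel E <= ennreal (4 * r / d) * I"
  using \<mu> by (subst (asm) ennreal_mult_le_mult_iff) auto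
 then show ?thesis by (simp add: E_def I_def d_def)
qed

section \<open>Orlicz--Sobolev inequality\<close>

lemma ennreal_ma: "0 <= a ==> 0 <= b ==> 0 <= c ==> ennreal a * (ennreal b + ennreal c) = ennreal (a * (b + c))"
 by (metis add_nonneg_nonneg ennreal_mult ennreal_plus)

text \<open>Substitute for the triangle inequality of the Luxemburg norm: a quarter of the sum is at
  most half the larger norm, and the contraction property turns this half into a mean of the two
  modulars.\<close>

lemma mo_quarter:
 assumes G: "gf G q" and [measurable]: "u \<in> borel_measurable M" "v \<in> borel_measurable M"
  and w: "!!x. w x = (1/4) *R (u x + v x)"
  and uv: "mo M G u <= 1" "mo M G v <= 1"
 shows "mo M G w <= 1"
proof -
 note [measurable] = gf_meas_e[OF G]
 have "mo M G w <= (\<integral>\<^sup>+ x. ennreal (1/2) * (ennreal (G (norm (u x))) + ennreal (G (norm (v x)))) \<partial>M)"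
  unfolding mo_def
 proof (rule nn_integral_mono)
  fix x
  let ?m = "max (norm (u x)) (norm (v x))"
  have "norm (w x) <= (1/2) * ?m"
   unfolding w using norm_triangle_ineq[of "u x" "v x"] by (auto simp: max_def)
  then have "G (norm (w x)) <= G ((1/2) * ?m)" by (intro gf_mono[OF G]) auto
  also have "... <= (1/2) * G ?m" by (intro gf_sub[OF G]) (auto simp: max_def)
  also have "... <= (1/2) * (G (norm (u x)) + G (norm (v x)))"
   using gf_ge0[OF G, of "norm (u x)"] gf_ge0[OF G, of "norm (v x)"] by (auto simp: max_def)
  finally have "ennreal (G (norm (w x))) <= ennreal ((1/2) * (G (norm (u x)) + G (norm (v x))))" by (rule ennreal_leI)
  also have "... = ennreal (1/2) * (ennreal (G (norm (u x))) + ennreal (G (norm (v x))))"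
   by (subst ennreal_mult', simp, subst ennreal_plus) (simp_all add: gf_ge0[OF G])
  finally show "ennreal (G (norm (w x))) <= ennreal (1/2) * (ennreal (G (norm (u x))) + ennreal (G (norm (v x))))" .
 qed
 also have "... = ennreal (1/2) * (mo M G u + mo M G v)"
  unfolding mo_def by (subst nn_integral_cmult) (auto simp: nn_integral_add)
 also have "... <= ennreal (1/2) * (ennreal 1 + ennreal 1)"
  using uv by (intro mult_left_mono add_mono) auto
 also have "ennreal 1 + ennreal 1 = ennreal (1 + 1)" by (metis ennreal_plus zero_le_one)
 also have "ennreal (1/2) * ... = ennreal ((1/2) * (1 + 1))" by (rule ennreal_mult'[symmetric]) simp
 also have "... = 1" by simp
 finally show ?thesis .
qed

text \<open>The embedding theory sees \<Phi> and its conjugate only through these properties.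
  \<open>ty\<close> carries the type whose dimension occurs in them.\<close>

locale orlicz_pair =
 fixes P Ps :: "real => real" and m ms :: real and ty :: "'a::euclidean_space itself"
 assumes m1: "1 < m" and mN: "m < DIM('a)" and ms_def: "ms = DIM('a) * m / (DIM('a) - m)"
  and gP: "gf P m" and gPs: "gf Ps ms"
  and P_lower: "\<exists>C>0. \<forall>t\<ge>0. C * t powr m <= P t"
  and Ps_lower: "\<exists>C>0. \<forall>t\<ge>0. C * t powr ms <= Ps t"
  and P_young: "\<exists>C>0. \<forall>a\<ge>0. \<forall>b\<ge>0. P (a * b) <= Ps (C * a) + b ^ DIM('a)"
  and P_sob: "\<exists>C>0. \<forall>t>0. \<forall>y\<ge>0. \<forall>ep>0. ep <= 1 -->
    Ps t powr (1 - 1 / DIM('a)) / t * y <= C * ep * (Ps t + P (y / ep))"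
begin

lemma ms_gt: "m < ms"
proof -
 have "m * (DIM('a) - m) < DIM('a) * m" using m1 by (simp add: algebra_simps)
 then show ?thesis unfolding ms_def using mN by (simp add: field_simps)
qed

lemma ms1: "1 < ms" using ms_gt m1 by simp

text \<open>\<open>D1Phi\<close> in modular form, reduced to measurability and approximability by
  test functions. Finiteness of the modulars and the weak gradient follow from these, see
  \<open>D_iff\<close>.\<close>

definition D :: "('a => real) => ('a => 'a) => bool" where
 "D u g \<longleftrightarrow> u \<in> LM & g \<in> LM \<and>
   (\<exists>pf. (ALL n. test_fn (pf n)) & (%n. mL Ps (%x. pf n x - u x)) ~~> 0 \<and>
    (%n. mL P (%x. grad (pf n) x - g x)) ~~> 0)"

text \<open>w is cut at dyadic heights. The measure of {w >= 2 al} is estimated by the gradient on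
  {al < w < 2 al}, with a radius supplied by Chebyshev's inequality, and multiplied by the size of
  \<open>Ps\<close> there; \<open>P_sob\<close> turns the product into ep times the integrand on the
  right. The gradient layers are disjoint, so the pieces add up.\<close>

lemma positive_part_estimate:
 "\<exists>C>0. \<forall>w ep. test_fn (w :: 'a => real) --> 0 < ep --> ep <= 1 --> mo lborel Ps w <= 1 -->
   (\<integral>\<^sup>+x\<in>{x. 0 < w x}. ennreal (Ps (w x)) \<partial>lborel) \<le>
   ennreal (C * ep) * ((\<integral>\<^sup>+x\<in>{x. 0 < w x}. ennreal (Ps (w x)) \<partial>lborel) + mo lborel P (%x. grad w x /\<^sub>R ep))"
proof -
 define N where "N = DIM('a)"
 define \<omega> where "\<omega> = unit_ball_vol N"
 have N: "0 < N" by (simp add: N_def)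
 have \<omega>: "0 < \<omega>" by (simp add: \<omega>_def)
 obtain C0 where C0: "0 < C0" "!!t y ep. 0 < t ==> 0 <= y ==> 0 < ep ==> ep <= 1 ==>
    Ps t powr (1 - 1 / N) / t * y <= C0 * ep * (Ps t + P (y / ep))"
  using P_sob unfolding N_def by blast
 define c where "c = 4 powr ms * 4 * (2 / \<omega>) powr (1 / N) * C0"
 have c: "0 < c" using C0 \<omega> by (simp add: c_def)
 show ?thesis
 proof (intro exI[of _ c] conjI allI impI c)
  fix w :: "'a => real" and ep :: real
  assume tw: "test_fn w" and ep: "0 < ep" "ep <= 1" and w1: "mo lborel Ps w <= 1"
  have ws: "w \<in> sm" by (rule test_sm[OF tw])
  note [measurable] = sm_meas[OF ws] grad_meas[OF ws] gf_meas_e[OF gP] gf_meas_e[OF gPs]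
  obtain R where "ALL x. R <= norm x --> w x = 0 & grad w x = 0" using test_fn_bounded_support[OF tw] by blast
  then obtain B where B: "0 < B" "ALL x. norm (w x) <= B"
   using cont_bounded_support_bounded[OF sm_cont[OF ws], of R] by blast
  \<comment> \<open>\<open>t 0 = 2 * B\<close> lies strictly above the supremum, so that every
    positive value falls into some half-open layer \<open>A n\<close>.\<close>
  define t where "t = (%n. 2 * B / 2 ^ n)"
  have t: "0 < t n" "t (Suc n) < t n" "t (Suc n) = t n / 2" for n using B by (auto simp: t_def field_simps)
  define h where "h = (%x. ennreal (Ps (norm (w x))) + ennreal (P (norm (grad w x /\<^sub>R ep))))"
  have [measurable]: "h \<in> borel_measurable borel" unfolding h_def by measurable
  define L where "L = (%n. {x. t (Suc (Suc n)) < w x & w x < t (Suc n)})"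
  define A where "A = (%n. {x. t (Suc n) <= w x & w x < t n})"
  have [measurable]: "L n \<in> sets borel" "A n \<in> sets borel" for n unfolding L_def A_def by measurable
  have step: "(\<integral>\<^sup>+x\<in>A n. ennreal (Ps (norm (w x))) \<partial>lborel) <= ennreal (c * ep) * (\<integral>\<^sup>+x\<in>L n. h x \<partial>lborel)" for n
  proof -
   define al where "al = t (Suc (Suc n))"
   define s where "s = Ps al"
   have al: "0 < al" "t (Suc n) = 2 * al" "t n = 4 * al"
    using t(1)[of "Suc (Suc n)"] t(3)[of n] t(3)[of "Suc n"] by (simp_all add: al_def)
   have s: "0 < s" unfolding s_def by (rule gf_pos[OF gPs al(1)])
   \<comment> \<open>The radius of a ball of volume 2/s, twice the Chebyshev bound 1/s for the
     measure of the superlevel set.\<close>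
   define r where "r = (2 / (\<omega> * s)) powr (1 / N)"
   have r: "0 < r" using \<omega> s by (simp add: r_def)
   have rN: "\<omega> * r ^ N = 2 * (1 / s)"
   proof -
    have "r ^ N = r powr N" using r by (simp add: powr_realpow)
    also have "... = 2 / (\<omega> * s)" unfolding r_def using N \<omega> s by (simp add: powr_powr)
    finally show ?thesis using \<omega> by simp
   qed
   have fin: "emeasure lborel {x. al < w x} <= ennreal (1 / s)"
   proof -
    have "ennreal s * emeasure lborel {x. al < w x} = (\<integral>\<^sup>+x. ennreal s * indicator {x. al < w x} x \<partial>lborel)"
     by (subst nn_integral_cmult_indicator) auto
    also have "... <= mo lborel Ps w" unfolding mo_def
     using al by (intro nn_integral_mono) (auto simp: indicator_def s_def intro!: ennreal_leI gf_mono[OF gPs])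
    also have "... <= ennreal s * ennreal (1 / s)" using w1 s by (simp flip: ennreal_mult)
    finally show ?thesis using s by (subst (asm) ennreal_mult_le_mult_iff) auto
   qed
   have Lm: "{x. al < w x & w x < 2 * al} = L n" by (simp add: L_def al_def[symmetric] al(2))
   have lev: "emeasure lborel {x. 2 * al <= w x} <= ennreal (4 * r / al) * (\<integral>\<^sup>+x\<in>L n. ennreal (norm (grad w x)) \<partial>lborel)"
    using level_set_estimate[OF ws al(1) _ fin _ r, of "2 * al"] rN s al(1) by (simp add: \<omega>_def N_def Lm)
   have "(\<integral>\<^sup>+x\<in>A n. ennreal (Ps (norm (w x))) \<partial>lborel) <= (\<integral>\<^sup>+x. ennreal (4 powr ms * s) * indicator {x. 2 * al <= w x} x \<partial>lborel)"
   proof (rule nn_integral_mono)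
    fix x
    show "ennreal (Ps (norm (w x))) * indicator (A n) x <= ennreal (4 powr ms * s) * indicator {x. 2 * al <= w x} x"
    proof (cases "x \<in> A n")
     case True
     then have x: "2 * al <= w x" "w x < 4 * al" unfolding A_def al by auto
     then have "Ps (norm (w x)) <= Ps (4 * al)" using al(1) by (intro gf_mono[OF gPs]) auto
     also have "... <= 4 powr ms * s" unfolding s_def using al(1) by (intro gf_sup[OF gPs]) auto
     finally show ?thesis using x True by (simp add: ennreal_leI)
    qed simp
   qed
   also have "... = ennreal (4 powr ms * s) * emeasure lborel {x. 2 * al <= w x}"
    by (subst nn_integral_cmult_indicator) auto
   also have "... <= ennreal (4 powr ms * s) * (ennreal (4 * r / al) * (\<integral>\<^sup>+x\<in>L n. ennreal (norm (grad w x)) \<partial>lborel))"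
    by (intro mult_left_mono lev) auto
   also have "... = (\<integral>\<^sup>+x\<in>L n. ennreal (4 powr ms * s * (4 * r / al)) * ennreal (norm (grad w x)) \<partial>lborel)"
    using s r al(1) by (subst mult.assoc[symmetric], subst ennreal_mult[symmetric])
     (auto simp: nn_integral_cmult[symmetric] mult.assoc)
   also have "... <= (\<integral>\<^sup>+x. ennreal (c * ep) * (h x * indicator (L n) x) \<partial>lborel)"
   proof (rule nn_integral_mono)
    fix x
    show "ennreal (4 powr ms * s * (4 * r / al)) * ennreal (norm (grad w x)) * indicator (L n) x <= ennreal (c * ep) * (h x * indicator (L n) x)"
    proof (cases "x \<in> L n")
     case True
     then have "al < w x" unfolding L_def al_def by simp
     then have sw: "s <= Ps (norm (w x))" unfolding s_def using al(1) by (intro gf_mono[OF gPs]) auto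
     \<comment> \<open>r is a constant times \<open>s powr (- (1 / N))\<close>, so that the product
       of s and r carries the exponent 1 - 1/N of \<open>P_sob\<close>.\<close>
     have r': "r = (2 / \<omega>) powr (1 / N) * s powr (- (1 / N))"
      unfolding r_def using \<omega> s by (simp add: powr_divide powr_mult powr_minus field_simps)
     have "s * r = (2 / \<omega>) powr (1 / N) * (s powr 1 * s powr (- (1 / N)))" unfolding r' using s by simp
     also have "s powr 1 * s powr (- (1 / N)) = s powr (1 - 1 / N)" by (subst powr_add[symmetric]) simp
     finally have sr: "s * r = (2 / \<omega>) powr (1 / N) * s powr (1 - 1 / N)" .
     have "4 powr ms * s * (4 * r / al) * norm (grad w x) = 4 powr ms * 4 * (s * r) / al * norm (grad w x)" by simp
     also have "... = 4 powr ms * 4 * (2 / \<omega>) powr (1 / N) * (Ps al powr (1 - 1 / N) / al * norm (grad w x))"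
      unfolding sr unfolding s_def by simp
     also have "... <= 4 powr ms * 4 * (2 / \<omega>) powr (1 / N) * (C0 * ep * (Ps al + P (norm (grad w x) / ep)))"
      using al(1) ep by (intro mult_left_mono C0(2)) auto
     also have "... = c * ep * (s + P (norm (grad w x) / ep))" unfolding c_def s_def by (simp add: mult_ac)
     also have "... <= c * ep * (Ps (norm (w x)) + P (norm (grad w x /\<^sub>R ep)))"
      using sw c ep by (intro mult_left_mono) (auto simp: divide_inverse mult.commute)
     finally have "ennreal (4 powr ms * s * (4 * r / al) * norm (grad w x)) <= ennreal (c * ep * (Ps (norm (w x)) + P (norm (grad w x /\<^sub>R ep))))"
      by (rule ennreal_leI)
     moreover have "ennreal (4 powr ms * s * (4 * r / al)) * ennreal (norm (grad w x)) = ennreal (4 powr ms * s * (4 * r / al) * norm (grad w x))"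
      by (rule ennreal_mult[symmetric]) (use s r al(1) in auto)
     moreover have "ennreal (c * ep) * h x = ennreal (c * ep * (Ps (norm (w x)) + P (norm (grad w x /\<^sub>R ep))))"
      unfolding h_def by (rule ennreal_ma) (use c ep gf_ge0[OF gP] gf_ge0[OF gPs] in auto)
     moreover have "indicator (L n) x = (1::ennreal)" using True by simp
     ultimately show ?thesis by (simp only: mult_1_right)
    qed simp
   qed
   also have "... = ennreal (c * ep) * (\<integral>\<^sup>+x\<in>L n. h x \<partial>lborel)" by (rule nn_integral_cmult) measurable
   finally show ?thesis .
  qed
  have tmono: "t k <= t j" if "j <= k" for j k
   unfolding t_def using that B by (intro divide_left_mono power_increasing) auto
  have disjA: "disjoint_family A"
   unfolding disjoint_family_on_def
  proof (intro ballI impI)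
   show "A i \<inter> A j = {}" if "i ~= j" for i j
    using that tmono[of "Suc i" j] tmono[of "Suc j" i] unfolding A_def by (cases "i < j") force+
  qed
  have disjL: "disjoint_family L"
   unfolding disjoint_family_on_def
  proof (intro ballI impI)
   show "L i \<inter> L j = {}" if "i ~= j" for i j
    using that tmono[of "Suc (Suc i)" "Suc j"] tmono[of "Suc (Suc j)" "Suc i"] unfolding L_def by (cases "i < j") force+
  qed
  have UA: "{x. 0 < w x} \<subseteq> (\<Union>n. A n)"
  proof
   fix x assume "x \<in> {x. 0 < w x}"
   then have x: "0 < w x" by simp
   have "t ~~> 0" unfolding t_def using LIMSEQ_divide_realpow_zero[of 2 "2 * B"] by simp
   then have "eventually (%n. t n < w x) sequentially" by (rule order_tendstoD) (rule x)
   then have ex: "EX n. t n <= w x" by (auto simp: eventually_sequentially intro: less_imp_le)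
   define n where "n = (LEAST n. t n <= w x)"
   have n: "t n <= w x" "!!k. k < n ==> w x < t k"
    unfolding n_def using LeastI_ex[OF ex] not_less_Least by (auto simp: not_le[symmetric])
   have "w x < t 0" using B(2)[rule_format, of x] B(1) by (simp add: t_def)
   then obtain k where "n = Suc k" using n(1) by (cases n) auto
   then have "x \<in> A k" using n by (auto simp: A_def)
   then show "x \<in> (\<Union>n. A n)" by blast
  qed
  have Lpos: "(\<Union>n. L n) \<subseteq> {x. 0 < w x}" using t(1) by (force simp: L_def intro: less_trans)
  define X where "X = (\<integral>\<^sup>+x\<in>{x. 0 < w x}. ennreal (Ps (w x)) \<partial>lborel)"
  have Xeq: "X = (\<integral>\<^sup>+x\<in>{x. 0 < w x}. ennreal (Ps (norm (w x))) \<partial>lborel)"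
   unfolding X_def by (intro nn_integral_cong) (auto simp: indicator_def)
  have "X <= (\<integral>\<^sup>+x\<in>(\<Union>n. A n). ennreal (Ps (norm (w x))) \<partial>lborel)"
   unfolding Xeq using UA by (intro nn_integral_mono) (auto simp: indicator_def)
  also have "... = (\<Sum>n. \<integral>\<^sup>+x\<in>A n. ennreal (Ps (norm (w x))) \<partial>lborel)"
   by (rule nn_integral_disjoint_family[OF _ _ disjA]) measurable
  also have "... <= (\<Sum>n. ennreal (c * ep) * (\<integral>\<^sup>+x\<in>L n. h x \<partial>lborel))"
   by (intro suminf_le step) auto
  also have "... = ennreal (c * ep) * (\<Sum>n. (\<integral>\<^sup>+x\<in>L n. h x \<partial>lborel))" by simp
  also have "(\<Sum>n. (\<integral>\<^sup>+x\<in>L n. h x \<partial>lborel)) = (\<integral>\<^sup>+x\<in>(\<Union>n. L n). h x \<partial>lborel)"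
   by (rule nn_integral_disjoint_family[symmetric, OF _ _ disjL]) measurable
  also have "... <= (\<integral>\<^sup>+x. ennreal (Ps (norm (w x))) * indicator {x. 0 < w x} x + ennreal (P (norm (grad w x /\<^sub>R ep))) \<partial>lborel)"
   using Lpos by (intro nn_integral_mono) (auto simp: indicator_def h_def)
  also have "... = X + mo lborel P (%x. grad w x /\<^sub>R ep)"
   unfolding Xeq mo_def by (rule nn_integral_add) measurable
  finally show "(\<integral>\<^sup>+x\<in>{x. 0 < w x}. ennreal (Ps (w x)) \<partial>lborel) \<le>
    ennreal (c * ep) * ((\<integral>\<^sup>+x\<in>{x. 0 < w x}. ennreal (Ps (w x)) \<partial>lborel) + mo lborel P (%x. grad w x /\<^sub>R ep))"
   unfolding X_def by (simp add: mult_left_mono)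
 qed
qed

text \<open>A self-improvement argument. With ep small, the estimate applied to w and -w shows that
  a modular at most 1 is in fact at most \<open>1 / 2 powr ms\<close>, so that w may be doubled.
  Starting from a strongly scaled-down pf, doubling reaches the scale set by the gradient.\<close>

lemma sobolev_test:
 "\<exists>C>0. \<forall>pf l. test_fn (pf :: 'a => real) --> 0 < l --> mL P (%x. grad pf x /\<^sub>R l) <= 1 -->
   mL Ps (%x. pf x / (C * l)) <= 1"
proof -
 obtain C where C: "0 < C" "!!w ep. test_fn (w :: 'a => real) ==> 0 < ep ==> ep <= 1 ==> mo lborel Ps w <= 1 ==>
   (\<integral>\<^sup>+x\<in>{x. 0 < w x}. ennreal (Ps (w x)) \<partial>lborel) \<le>
   ennreal (C * ep) * ((\<integral>\<^sup>+x\<in>{x. 0 < w x}. ennreal (Ps (w x)) \<partial>lborel) + mo lborel P (%x. grad w x /\<^sub>R ep))"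
  using positive_part_estimate by blast
 \<comment> \<open>Makes \<open>C * ep\<close> at most \<open>1 / (4 * 2 powr ms)\<close>: the first
   term on the right is then absorbed by half of the left side, and the target
   \<open>1 / 2 powr ms\<close> is split between the two signs.\<close>
 define ep where "ep = min 1 (1 / (4 * C * 2 powr ms))"
 have ep: "0 < ep" "ep <= 1" using C by (auto simp: ep_def)
 have Cep: "C * ep <= 1 / (4 * 2 powr ms)"
 proof -
  have "C * ep <= C * (1 / (4 * C * 2 powr ms))" using C by (intro mult_left_mono) (auto simp: ep_def)
  then show ?thesis using C by simp
 qed
 have p1: "1 <= 2 powr ms" using ms1 by (simp add: ge_one_powr_ge_zero)
 have pos: "(\<integral>\<^sup>+x\<in>{x. 0 < w x}. ennreal (Ps (w x)) \<partial>lborel) <= ennreal (1 / (2 * 2 powr ms))"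
  if w: "test_fn (w :: 'a => real)" "mo lborel Ps w <= 1" "mo lborel P (%x. grad w x /\<^sub>R ep) <= 1" for w
 proof -
  define X where "X = (\<integral>\<^sup>+x\<in>{x. 0 < w x}. ennreal (Ps (w x)) \<partial>lborel)"
  have "X <= mo lborel Ps w" unfolding X_def mo_def by (intro nn_integral_mono) (auto simp: indicator_def)
  then have "X <= 1" using w by (auto intro: order_trans)
  then obtain x where x: "X = ennreal x" "0 <= x" by (cases X) (auto simp: top_unique)
  have "ennreal x <= ennreal (C * ep) * (ennreal x + mo lborel P (%x. grad w x /\<^sub>R ep))"
   using C(2)[OF w(1) ep w(2)] unfolding X_def[symmetric] x(1) .
  also have "... <= ennreal (C * ep) * (ennreal x + ennreal 1)"
   using w(3) by (intro mult_left_mono add_left_mono) auto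
  also have "... = ennreal (C * ep * (x + 1))"
   by (rule ennreal_ma) (use x C ep in auto)
  finally have "x <= C * ep * (x + 1)" using x C ep by (subst (asm) ennreal_le_iff) auto
  also have "... <= 1 / (4 * 2 powr ms) * (x + 1)" using Cep x by (intro mult_right_mono) auto
  also have "... = 1 / (4 * 2 powr ms) * x + 1 / (4 * 2 powr ms)" by (simp add: add_divide_distrib)
  also have "... <= 1 / 2 * x + 1 / (4 * 2 powr ms)"
   using x p1 by (intro add_mono mult_right_mono) (auto simp: divide_simps)
  finally have "x <= 1 / (2 * 2 powr ms)" by (simp add: field_simps)
  then show ?thesis unfolding X_def[symmetric] x by (rule ennreal_leI)
 qed
 have half: "mo lborel Ps (%x. 2 * w x) <= 1"
  if w: "test_fn (w :: 'a => real)" "mo lborel Ps w <= 1" "mo lborel P (%x. grad w x /\<^sub>R ep) <= 1" for w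
 proof -
  have ws: "w \<in> sm" by (rule test_sm[OF w(1)])
  note [measurable] = sm_meas[OF ws] gf_meas_e[OF gPs]
  have w': "test_fn (%x. (-1) * w x)" by (rule test_mult[OF w(1) sm.const])
  have p2: "(\<integral>\<^sup>+x\<in>{x. 0 < (-1) * w x}. ennreal (Ps ((-1) * w x)) \<partial>lborel) <= ennreal (1 / (2 * 2 powr ms))"
  proof (rule pos[OF w'])
   show "mo lborel Ps (%x. (-1) * w x) <= 1" using w(2) by (simp add: mo_minus)
   show "mo lborel P (%x. grad (%x. (-1) * w x) x /\<^sub>R ep) <= 1"
    using w(3) unfolding grad_cmult[OF ws] by (simp add: mo_def)
  qed
  have "mo lborel Ps w <= (\<integral>\<^sup>+x. ennreal (Ps (norm (w x))) * indicator {x. 0 < w x} x + ennreal (Ps (norm (w x))) * indicator {x. 0 < (-1) * w x} x \<partial>lborel)"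
   unfolding mo_def
  proof (rule nn_integral_mono)
   show "ennreal (Ps (norm (w x))) <= ennreal (Ps (norm (w x))) * indicator {x. 0 < w x} x + ennreal (Ps (norm (w x))) * indicator {x. 0 < (-1) * w x} x" for x
    using gf_0[OF gPs] by (cases "w x = 0") (auto simp: indicator_def)
  qed
  also have "... = (\<integral>\<^sup>+x\<in>{x. 0 < w x}. ennreal (Ps (norm (w x))) \<partial>lborel) + (\<integral>\<^sup>+x\<in>{x. 0 < (-1) * w x}. ennreal (Ps (norm (w x))) \<partial>lborel)"
   by (rule nn_integral_add) measurable
  also have "... = (\<integral>\<^sup>+x\<in>{x. 0 < w x}. ennreal (Ps (w x)) \<partial>lborel) + (\<integral>\<^sup>+x\<in>{x. 0 < (-1) * w x}. ennreal (Ps ((-1) * w x)) \<partial>lborel)"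
   by (intro arg_cong2[where f = "(+)"] nn_integral_cong) (auto simp: indicator_def)
  also have "... <= ennreal (1 / (2 * 2 powr ms)) + ennreal (1 / (2 * 2 powr ms))"
   by (intro add_mono pos[OF w] p2)
  also have "... = ennreal (1 / 2 powr ms)" by (simp flip: ennreal_plus)
  finally have a: "mo lborel Ps w <= ennreal (1 / 2 powr ms)" .
  have "mo lborel Ps (%x. 2 *R w x) <= ennreal (max 1 (\<bar>2\<bar> powr ms)) * mo lborel Ps w"
   by (rule mo_scale[OF gPs]) measurable
  also have "... <= ennreal (2 powr ms) * ennreal (1 / 2 powr ms)" using a p1 by (intro mult_mono) (auto simp: max_def)
  also have "... = 1" by (simp flip: ennreal_mult)
  finally show ?thesis by simp
 qed
 show ?thesis
 proof (intro exI[of _ "1 / ep"] conjI allI impI)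
  fix pf :: "'a => real" and l :: real
  assume pf: "test_fn pf" and l: "0 < l" and g: "mL P (%x. grad pf x /\<^sub>R l) <= 1"
  have ps: "pf \<in> sm" by (rule test_sm[OF pf])
  note [measurable] = sm_meas[OF ps] grad_meas[OF ps]
  have g': "mo lborel P (%x. grad pf x /\<^sub>R l) <= 1" using g by (simp add: mo_def nn_integral_completion)
  define c where "c = l / ep"
  have c: "0 < c" using l ep by (simp add: c_def)
  have down: "mo lborel Ps (%x. pf x / (2 ^ n * c)) <= 1 ==> mo lborel Ps (%x. pf x / c) <= 1" for n
  proof (induction n)
   case (Suc n)
   define k where "k = 1 / (2 ^ Suc n * c)"
   have k: "0 < k" "k <= 1 / c"
    using c one_le_power[of "2::real" "Suc n"] by (auto simp: k_def field_simps simp del: power_Suc)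
   have "mo lborel Ps (%x. 2 * (k * pf x)) <= 1"
   proof (rule half)
    show "test_fn (%x. k * pf x)" by (rule test_mult[OF pf sm.const])
    show "mo lborel Ps (%x. k * pf x) <= 1" using Suc.prems by (simp add: k_def)
    have "mo lborel P (%x. grad (%x. k * pf x) x /\<^sub>R ep) <= mo lborel P (%x. grad pf x /\<^sub>R l)"
    proof (rule mo_mono[OF gP], rule AE_I2)
     fix x
     have "k / ep <= 1 / l" using k(2) ep l by (simp add: c_def field_simps)
     then have "k / ep * norm (grad pf x) <= 1 / l * norm (grad pf x)" by (intro mult_right_mono) auto
     then show "norm (grad (%x. k * pf x) x /\<^sub>R ep) <= norm (grad pf x /\<^sub>R l)"
      using k ep l by (simp add: grad_cmult[OF ps] divide_inverse mult_ac)
    qed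
    then show "mo lborel P (%x. grad (%x. k * pf x) x /\<^sub>R ep) <= 1" using g' by (rule order_trans)
   qed
   moreover have "2 * (k * pf x) = pf x / (2 ^ n * c)" for x using c by (simp add: k_def field_simps)
   ultimately show ?case using Suc.IH by simp
  qed simp
  obtain R where R: "ALL x. R <= norm x --> pf x = 0 & grad pf x = 0" using test_fn_bounded_support[OF pf] by blast
  then obtain B where B: "0 < B" "ALL x. norm (pf x) <= B"
   using cont_bounded_support_bounded[OF sm_cont[OF ps], of R] by blast
  have "mo lborel Ps pf < \<infinity>"
  proof -
   have "mo lborel Ps pf <= (\<integral>\<^sup>+x. ennreal (Ps B) * indicator (cball (0::'a) R) x \<partial>lborel)"
    unfolding mo_def
   proof (rule nn_integral_mono)
    fix x
    show "ennreal (Ps (norm (pf x))) <= ennreal (Ps B) * indicator (cball 0 R) x"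
     using R B gf_0[OF gPs] by (cases "R <= norm x") (auto intro!: ennreal_leI gf_mono[OF gPs])
   qed
   also have "... = ennreal (Ps B) * emeasure lborel (cball (0::'a) R)" by (subst nn_integral_cmult_indicator) auto
   also have "... < \<infinity>" using emeasure_bounded_finite[of "cball 0 R :: 'a set"] by (auto simp: ennreal_mult_less_top)
   finally show ?thesis .
  qed
  then obtain y where y: "mo lborel Ps pf = ennreal y" "0 <= y" by (cases "mo lborel Ps pf") auto
  \<comment> \<open>A test function has finite modular y, so some power of 2 brings the scaled
    modular down to 1 and starts the doubling.\<close>
  from real_arch_pow[of 2 "max (1 / c) (y / c)"] obtain n where n: "max (1 / c) (y / c) < 2 ^ n"
   by (auto simp del: max_less_iff_conj)
  have k: "1 <= 2 ^ n * c" "y <= 2 ^ n * c" using n c by (auto simp: field_simps)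
  have "mo lborel Ps (%x. (1 / (2 ^ n * c)) *R pf x) <= ennreal \<bar>1 / (2 ^ n * c)\<bar> * mo lborel Ps pf"
   by (rule mo_sub[OF gPs]) (use k c in auto)
  also have "... <= ennreal 1" unfolding y using k c y
   by (subst ennreal_mult[symmetric]) (auto intro!: ennreal_leI simp: field_simps)
  finally have "mo lborel Ps (%x. pf x / (2 ^ n * c)) <= 1" by simp
  then have "mo lborel Ps (%x. pf x / c) <= 1" by (rule down)
  then show "mL Ps (%x. pf x / (1 / ep * l)) <= 1" by (simp add: mo_def nn_integral_completion c_def)
 qed (use ep in auto)
qed

text \<open>\<open>mo_quarter\<close> is used twice, for the gradient of an approximating test
  function and then for the function itself, hence the factor 16.\<close>

lemma sobolev_D:
 "\<exists>C>0. ALL u g l. D u g --> 0 < l --> mL P (%x. g x /\<^sub>R l) <= 1 --> mL Ps (%x. u x / (C * l)) <= 1"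
proof -
 obtain C where C: "0 < C" "!!pf l. test_fn (pf :: 'a => real) ==> 0 < l ==> mL P (%x. grad pf x /\<^sub>R l) <= 1 ==>
   mL Ps (%x. pf x / (C * l)) <= 1"
  using sobolev_test by blast
 show ?thesis
 proof (intro exI[of _ "16 * C"] conjI allI impI)
  fix u g l assume D: "D u g" and l: "(0::real) < l" and g: "mL P (%x. g x /\<^sub>R l) <= 1"
  have [measurable]: "u \<in> LM" "g \<in> LM" using D by (auto simp: D_def)
  obtain pf where pf: "!!n. test_fn (pf n)" "(%n. mL Ps (%x. pf n x - u x)) ~~> 0"
    "(%n. mL P (%x. grad (pf n) x - g x)) ~~> 0"
   using D unfolding D_def by blast
  have [measurable]: "pf n \<in> LM" "grad (pf n) \<in> LM" for n
   using sm_meas[OF test_sm[OF pf(1)]] grad_meas[OF test_sm[OF pf(1)]] by (auto intro: measurable_completion)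
  have "(%n. mL P (%x. (1 / l) *R (grad (pf n) x - g x))) ~~> 0"
   by (rule mo_tendsto_scale[OF gP _ pf(3)]) measurable
  then have "eventually (%n. mL P (%x. (1 / l) *R (grad (pf n) x - g x)) <= ennreal 1) sequentially"
   unfolding ennreal_tendsto_0_iff by (meson zero_less_one)
  moreover have "(%n. mL Ps (%x. (1 / (4 * C * l)) *R (pf n x - u x))) ~~> 0"
   by (rule mo_tendsto_scale[OF gPs _ pf(2)]) measurable
  then have "eventually (%n. mL Ps (%x. (1 / (4 * C * l)) *R (pf n x - u x)) <= ennreal 1) sequentially"
   unfolding ennreal_tendsto_0_iff by (meson zero_less_one)
  ultimately have "eventually (%n. mL P (%x. (1 / l) *R (grad (pf n) x - g x)) <= ennreal 1 \<and>
    mL Ps (%x. (1 / (4 * C * l)) *R (pf n x - u x)) <= ennreal 1) sequentially" by (rule eventually_conj)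
  then obtain n where n: "mL P (%x. (1 / l) *R (grad (pf n) x - g x)) <= 1"
    "mL Ps (%x. (1 / (4 * C * l)) *R (pf n x - u x)) <= 1"
   unfolding eventually_sequentially by auto
  have "mL P (%x. grad (pf n) x /\<^sub>R (4 * l)) <= 1"
  proof (rule mo_quarter[OF gP _ _ _ n(1) g])
   show "grad (pf n) x /\<^sub>R (4 * l) = (1/4) *R ((1 / l) *R (grad (pf n) x - g x) + g x /\<^sub>R l)" for x
    by (simp add: scaleR_diff_right inverse_eq_divide)
  qed measurable
  then have 1: "mL Ps (%x. pf n x / (C * (4 * l))) <= 1" using l by (intro C(2) pf) auto
  have 2: "mL Ps (%x. - ((1 / (4 * C * l)) *R (pf n x - u x))) <= 1" using n(2) by (simp add: mo_minus)
  show "mL Ps (%x. u x / (16 * C * l)) <= 1"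
  proof (rule mo_quarter[OF gPs _ _ _ 1 2])
   show "u x / (16 * C * l) = (1/4) *R (pf n x / (C * (4 * l)) + - ((1 / (4 * C * l)) *R (pf n x - u x)))" for x
    using l C by (simp add: field_simps)
  qed measurable
 qed (use C in auto)
qed

text \<open>Scaling by \<open>l = a powr (1 / m)\<close> normalises the gradient at the cost of
  \<open>l powr ms\<close> on the other side. The exponent \<open>ms / m\<close> exceeds 1, and this
  gain drives the De Giorgi iteration.\<close>

lemma sobolev_small:
 "\<exists>C>0. ALL u g a. D u g --> 0 < a --> a <= 1 --> mL P g <= ennreal a -->
   mL (%t. t powr ms) u <= ennreal (C * a powr (ms / m))"
proof -
 obtain C where C: "0 < C" "!!u g l. D u g ==> 0 < l ==> mL P (%x. g x /\<^sub>R l) <= 1 ==> mL Ps (%x. u x / (C * l)) <= 1"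
  using sobolev_D by blast
 obtain c where c: "0 < c" "!!t. 0 <= t ==> c * t powr ms <= Ps t" using Ps_lower by blast
 have gms: "gf (%t. t powr ms) ms" using ms1 by (intro gf_powr) auto
 show ?thesis
 proof (intro exI[of _ "C powr ms / c"] conjI allI impI)
  fix u g a assume D: "D u g" and a: "(0::real) < a" "a <= 1" and g: "mL P g <= ennreal a"
  have [measurable]: "u \<in> LM" "g \<in> LM" using D by (auto simp: D_def)
  note [measurable] = gf_meas_e[OF gPs] gf_meas_e[OF gms]
  define l where "l = a powr (1 / m)"
  have l: "0 < l" "l <= 1" using a m1 powr_le1[of "1/m" a] by (auto simp: l_def)
  have lm: "l powr m = a" using a m1 by (simp add: l_def powr_powr)
  have "mL P (%x. (1 / l) *R g x) <= ennreal (max 1 (\<bar>1 / l\<bar> powr m)) * mL P g"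
   by (rule mo_scale[OF gP]) measurable
  also have "max 1 (\<bar>1 / l\<bar> powr m) = 1 / a"
   using l lm a by (simp add: powr_divide max_def field_simps)
  also have "ennreal (1 / a) * mL P g <= ennreal (1 / a) * ennreal a" by (intro mult_left_mono g) auto
  also have "... = 1" using a by (simp flip: ennreal_mult)
  finally have "mL P (%x. g x /\<^sub>R l) <= 1" by (simp add: divide_inverse)
  from C(2)[OF D l(1) this] have s: "mL Ps (%x. u x / (C * l)) <= 1" .
  define k where "k = (C * l) powr ms / c"
  have k: "0 < k" using C l c by (simp add: k_def)
  have "mL (%t. t powr ms) u <= (\<integral>\<^sup>+x. ennreal k * ennreal (Ps (norm (u x / (C * l)))) \<partial>lebesgue)"
   unfolding mo_def
  proof (rule nn_integral_mono)
   fix x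
   have "norm (u x) powr ms = (C * l) powr ms * norm (u x / (C * l)) powr ms"
    using C l by (subst powr_mult[symmetric]) (auto simp: abs_mult)
   also have "... = k * (c * norm (u x / (C * l)) powr ms)" using c by (simp add: k_def)
   also have "... <= k * Ps (norm (u x / (C * l)))" using k by (intro mult_left_mono c) auto
   finally show "ennreal (norm (u x) powr ms) <= ennreal k * ennreal (Ps (norm (u x / (C * l))))"
    using k by (simp add: ennreal_leI flip: ennreal_mult')
  qed
  also have "... = ennreal k * mL Ps (%x. u x / (C * l))" unfolding mo_def by (rule nn_integral_cmult) measurable
  also have "... <= ennreal k * 1" by (intro mult_left_mono s) auto
  also have "k = C powr ms / c * a powr (ms / m)"
   using C l a by (simp add: k_def l_def powr_mult powr_powr)
  finally show "mL (%t. t powr ms) u <= ennreal (C powr ms / c * a powr (ms / m))" by simp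
 qed (use C c in auto)
qed

lemma sobolev_bound:
 "EX B. ALL u g. D u g --> mL P g <= ennreal R --> mL Ps u <= ennreal B"
proof -
 obtain C where C: "0 < C" "!!u g l. D u g ==> 0 < l ==> mL P (%x. g x /\<^sub>R l) <= 1 ==> mL Ps (%x. u x / (C * l)) <= 1"
  using sobolev_D by blast
 define l where "l = max 1 R"
 show ?thesis
 proof (intro exI[of _ "max 1 (\<bar>C * l\<bar> powr ms)"] allI impI)
  fix u g assume D: "D u g" and g: "mL P g <= ennreal R"
  have [measurable]: "u \<in> LM" "g \<in> LM" using D by (auto simp: D_def)
  have l: "1 <= l" "R <= l" by (auto simp: l_def)
  have "mL P (%x. (1 / l) *R g x) <= ennreal \<bar>1 / l\<bar> * mL P g"
   by (rule mo_sub[OF gP]) (use l in auto)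
  also have "... <= ennreal (1 / l) * ennreal l" using l g by (intro mult_mono) (auto intro: order_trans ennreal_leI)
  also have "... = 1" using l by (simp flip: ennreal_mult)
  finally have "mL P (%x. g x /\<^sub>R l) <= 1" by (simp add: divide_inverse)
  then have s: "mL Ps (%x. u x / (C * l)) <= 1" using l by (intro C(2)[OF D]) auto
  have "mL Ps (%x. (C * l) *R (u x / (C * l))) <= ennreal (max 1 (\<bar>C * l\<bar> powr ms)) * mL Ps (%x. u x / (C * l))"
   by (rule mo_scale[OF gPs]) measurable
  also have "... <= ennreal (max 1 (\<bar>C * l\<bar> powr ms)) * 1" by (intro mult_left_mono s) auto
  finally show "mL Ps u <= ennreal (max 1 (\<bar>C * l\<bar> powr ms))" using C l by simp
 qed
qed

end

section \<open>The energy space\<close>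

lemma tendsto_0_pick2:
 fixes X Y :: "nat => ennreal"
 assumes "X ~~> 0" "Y ~~> 0" "0 < e"
 shows "EX n. X n <= ennreal e & Y n <= ennreal e"
proof -
 have "eventually (%n. X n <= ennreal e) sequentially" "eventually (%n. Y n <= ennreal e) sequentially"
  using assms unfolding ennreal_tendsto_0_iff by blast+
 then have "eventually (%n. X n <= ennreal e & Y n <= ennreal e) sequentially" by (rule eventually_conj)
 then show ?thesis by (auto simp: eventually_sequentially)
qed

lemma ennreal_tendsto_0_bound:
 fixes X :: "nat => ennreal" and e :: "nat => real"
 assumes "!!n. X n <= ennreal (e n)" "e ~~> 0"
 shows "X ~~> 0"
proof (rule ennreal_tendsto_0_le)
 show "(%n. ennreal (e n)) ~~> 0" using tendsto_ennrealI[OF assms(2)] by simp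
qed (use assms in auto)

lemma inverse_Suc_tendsto: "(%n. 1 / real (Suc n)) ~~> 0"
 using LIMSEQ_inverse_real_of_nat by (simp add: divide_inverse)

lemma gf_null_seq:
 assumes G: "gf G q" and l: "(%n. G (norm (w n :: 'b::real_normed_vector))) ~~> 0"
 shows "w ~~> 0"
proof (rule LIMSEQ_I)
 fix e :: real assume e: "0 < e"
 have "eventually (%n. G (norm (w n)) < G (e / 2)) sequentially"
  by (rule order_tendstoD(2)[OF l]) (use gf_pos[OF G] e in auto)
 then obtain N where N: "!!n. N <= n ==> G (norm (w n)) < G (e / 2)" by (auto simp: eventually_sequentially)
 have "norm (w n - 0) < e" if "N <= n" for n
  using gf_mono[OF G, of "e / 2" "norm (w n)"] N[OF that] e by (cases "e / 2 <= norm (w n)") auto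
 then show "EX no. \<forall>n\<ge>no. norm (w n - 0) < e" by blast
qed

text \<open>Along indices whose modulars lie below (1/2)^n the sum of the integrands is integrable,
  hence finite a.e., so its terms tend to 0.\<close>

lemma AE_subseq_null:
 fixes w :: "nat => 'a => 'b::euclidean_space"
 assumes G: "gf G q" and [measurable]: "!!n. w n \<in> borel_measurable M" and l: "(%n. mo M G (w n)) ~~> 0"
 shows "EX r. strict_mono r & (AE x in M. (%n. w (r n) x) ~~> 0)"
proof -
 note [measurable] = gf_meas_e[OF G]
 have "EX r. strict_mono (r :: nat => nat) & (ALL n. mo M G (w (r n)) <= ennreal ((1/2) ^ n))"
 proof -
  have ev: "EX N. \<forall>n\<ge>N. mo M G (w n) <= ennreal ((1/2) ^ k)" for k
   using l unfolding ennreal_tendsto_0_iff eventually_sequentially by simp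
  then obtain N where N: "!!k n. N k <= n ==> mo M G (w n) <= ennreal ((1/2) ^ k)" by metis
  define r where "r = rec_nat (N 0) (%k y. Suc (y + N (Suc k)))"
  have r: "r (Suc k) = Suc (r k + N (Suc k))" "r 0 = N 0" for k by (simp_all add: r_def)
  have "strict_mono r" by (rule strict_monoI_Suc) (simp add: r)
  moreover have "N n <= r n" for n by (cases n) (simp_all add: r)
  ultimately show ?thesis using N by blast
 qed
 then obtain r where r: "strict_mono (r :: nat => nat)" "!!n. mo M G (w (r n)) <= ennreal ((1/2) ^ n)" by blast
 have "(\<integral>\<^sup>+x. (\<Sum>n. ennreal (G (norm (w (r n) x)))) \<partial>M) = (\<Sum>n. mo M G (w (r n)))"
  unfolding mo_def by (rule nn_integral_suminf) measurable
 also have "... <= (\<Sum>n. ennreal ((1/2) ^ n))" by (intro suminf_le r) auto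
 also have "... = ennreal (\<Sum>n. (1/2) ^ n)" by (rule suminf_ennreal2) (auto intro: summable_geometric)
 finally have "(\<integral>\<^sup>+x. (\<Sum>n. ennreal (G (norm (w (r n) x)))) \<partial>M) ~= \<infinity>" by (auto simp: top_unique)
 then have "AE x in M. (\<Sum>n. ennreal (G (norm (w (r n) x)))) ~= \<infinity>"
  by (intro nn_integral_PInf_AE) auto
 then have "AE x in M. (%n. w (r n) x) ~~> 0"
 proof eventually_elim
  case (elim x)
  then have "summable (%n. G (norm (w (r n) x)))"
   by (intro summable_suminf_not_top) (auto intro: gf_ge0[OF G])
  then have "(%n. G (norm (w (r n) x))) ~~> 0" by (rule summable_LIMSEQ_zero)
  then show ?case by (rule gf_null_seq[OF G])
 qed
 then show ?thesis using r by blast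
qed

lemma cont_mo_finite:
 fixes w :: "'a::euclidean_space => 'b::euclidean_space"
 assumes G: "gf G q" and c: "continuous_on UNIV w" and z: "!!x. R <= norm x ==> w x = 0"
 shows "mL G w < \<infinity>"
proof -
 obtain B where B: "0 < B" "ALL x. norm (w x) <= B" using cont_bounded_support_bounded[OF c z] by blast
 have "mL G w <= (\<integral>\<^sup>+x. ennreal (G B) * indicator (cball (0::'a) R) x \<partial>lebesgue)"
  unfolding mo_def
 proof (rule nn_integral_mono)
  fix x
  show "ennreal (G (norm (w x))) <= ennreal (G B) * indicator (cball 0 R) x"
   using z B gf_0[OF G] by (cases "R <= norm x") (auto intro!: ennreal_leI gf_mono[OF G])
 qed
 also have "... = ennreal (G B) * emeasure lebesgue (cball (0::'a) R)" by (subst nn_integral_cmult_indicator) auto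
 also have "... < \<infinity>" using emeasure_bounded_finite[of "cball 0 R :: 'a set"] by (auto simp: ennreal_mult_less_top)
 finally show ?thesis .
qed

lemma sm_meas_leb: "u \<in> sm ==> u \<in> LM"
 by (intro measurable_completion) (simp add: sm_meas)

lemma grad_meas_leb: "u \<in> sm ==> grad u \<in> LM"
 by (intro measurable_completion) (simp add: grad_meas)

lemma test_mo_finite: "gf G q ==> test_fn u ==> mL G u < \<infinity> & mL G (grad u) < \<infinity>"
proof -
 assume G: "gf G q" and u: "test_fn u"
 obtain R where R: "ALL x. R <= norm x --> u x = 0 & grad u x = 0" using test_fn_bounded_support[OF u] by blast
 show ?thesis
  using cont_mo_finite[OF G sm_cont[OF test_sm[OF u]], of R] cont_mo_finite[OF G sm_grad_cont[OF test_sm[OF u]], of R] R by blast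
qed

text \<open>A smooth approximation of the truncation max 0 (t - k). The subtracted constant makes it
  vanish at 0, so that composition with a test function gives a test function; for k >= 0 this
  constant tends to 0 with e.\<close>

definition smax :: "real => real => real => real" where
 "smax e k t = (sqrt ((t - k)\<^sup>2 + e\<^sup>2) + (t - k)) / 2 - (sqrt (k\<^sup>2 + e\<^sup>2) - k) / 2"

definition dsmax :: "real => real => real => real" where
 "dsmax e k t = ((t - k) / sqrt ((t - k)\<^sup>2 + e\<^sup>2) + 1) / 2"

text \<open>The value 1/2 at 0 is the limit of the derivatives \<open>dsmax\<close> at the
  kink.\<close>

definition half_step :: "real => real" where
 "half_step t = (if t > 0 then 1 else if t = 0 then 1/2 else 0)"

lemma smax_0: "smax e k 0 = 0" by (simp add: smax_def)

lemma smax_pos: "e ~= 0 ==> 0 < (t - k)\<^sup>2 + (e::real)\<^sup>2" by (simp add: add_nonneg_pos)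

lemma smax_deriv: "e ~= 0 ==> (smax e k has_real_derivative dsmax e k t) (at t)"
proof -
 assume e: "e ~= 0"
 have q: "((%t. (t - k)\<^sup>2 + e\<^sup>2) has_real_derivative 2 * (t - k)) (at t)"
  by (auto intro!: derivative_eq_intros)
 have s: "((%t. sqrt ((t - k)\<^sup>2 + e\<^sup>2)) has_real_derivative inverse (sqrt ((t - k)\<^sup>2 + e\<^sup>2)) / 2 * (2 * (t - k))) (at t)"
  by (rule DERIV_chain2[OF DERIV_real_sqrt[OF smax_pos[OF e]] q])
 have "((%t. (sqrt ((t - k)\<^sup>2 + e\<^sup>2) + (t - k)) / 2 - (sqrt (k\<^sup>2 + e\<^sup>2) - k) / 2) has_real_derivative
   (inverse (sqrt ((t - k)\<^sup>2 + e\<^sup>2)) / 2 * (2 * (t - k)) + (1 - 0)) / 2 - 0) (at t)"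
  by (intro DERIV_diff DERIV_cdivide DERIV_add s DERIV_ident DERIV_const)
 moreover have "(inverse S / 2 * (2 * (t - k)) + (1 - 0)) / 2 - 0 = ((t - k) / S + 1) / 2" for S :: real
  by (cases "S = 0") (simp_all add: field_simps)
 moreover have "smax e k = (%t. (sqrt ((t - k)\<^sup>2 + e\<^sup>2) + (t - k)) / 2 - (sqrt (k\<^sup>2 + e\<^sup>2) - k) / 2)"
  by (rule ext) (rule smax_def)
 ultimately show ?thesis unfolding dsmax_def by (simp only:)
qed

lemma dsmax_bounds: "e ~= 0 ==> 0 <= dsmax e k t & dsmax e k t <= 1"
proof -
 assume e: "e ~= 0"
 have "\<bar>t - k\<bar> <= sqrt ((t - k)\<^sup>2 + e\<^sup>2)" by (rule real_le_rsqrt) simp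
 moreover define r where "r = (t - k) / sqrt ((t - k)\<^sup>2 + e\<^sup>2)"
 ultimately have "\<bar>r\<bar> <= 1"
  using smax_pos[OF e, of t k] by (simp add: divide_le_eq_1)
 then show ?thesis unfolding dsmax_def r_def[symmetric] by (simp add: abs_le_iff)
qed

lemma dsmax_cont: "e ~= 0 ==> continuous_on UNIV (dsmax e k)"
 unfolding dsmax_def using smax_pos[of e _ k] by (intro continuous_intros) (auto simp: less_le)

lemma smax_lipschitz: "e ~= 0 ==> \<bar>smax e k s - smax e k t\<bar> <= \<bar>s - t\<bar>"
proof -
 assume e: "e ~= 0"
 have b: "norm (dsmax e k z) <= 1" for z using dsmax_bounds[OF e, of k z] by simp
 have "norm (smax e k s - smax e k t) <= 1 * norm (s - t)"
  by (rule field_differentiable_bound[of UNIV])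
   (use smax_deriv[OF e] b in \<open>auto intro: has_field_derivative_at_within\<close>)
 then show ?thesis by simp
qed

lemma smax_tendsto:
 assumes "0 <= k"
 shows "(%n. smax (1 / real (Suc n)) k t) ~~> max 0 (t - k)"
proof -
 have "(%n. smax (1 / real (Suc n)) k t) ~~> smax 0 k t"
  unfolding smax_def by (intro tendsto_intros inverse_Suc_tendsto) auto
 moreover have "smax 0 k t = max 0 (t - k)" using assms by (auto simp: smax_def max_def)
 ultimately show ?thesis by simp
qed

lemma dsmax_tendsto: "(%n. dsmax (1 / real (Suc n)) k t) ~~> half_step (t - k)"
proof (cases "t = k")
 case True
 then show ?thesis by (simp add: dsmax_def half_step_def)
next
 case False
 have "(%n. dsmax (1 / real (Suc n)) k t) ~~> ((t - k) / sqrt ((t - k)\<^sup>2 + 0\<^sup>2) + 1) / 2"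
  unfolding dsmax_def by (intro tendsto_intros inverse_Suc_tendsto) (use False in auto)
 moreover have "((t - k) / sqrt ((t - k)\<^sup>2 + 0\<^sup>2) + 1) / 2 = half_step (t - k)"
  using False by (auto simp: half_step_def field_simps)
 ultimately show ?thesis by simp
qed

lemma smax_sm: "e ~= 0 ==> u \<in> sm ==> (%x. smax e k (u x)) \<in> sm"
proof -
 assume e: "e ~= 0" and u: "u \<in> sm"
 have "(%x. (1/2) * (sqrt ((u x - k)^2 + e\<^sup>2) + (u x - k)) - (sqrt (k\<^sup>2 + e\<^sup>2) - k) / 2) \<in> sm"
  by (intro sm_diff sm_scale sm.add sm.root sm_power sm.const u smax_pos e)
 then show ?thesis by (simp add: smax_def)
qed

section \<open>Closure properties of the Sobolev space \<open>D\<close>\<close>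

context orlicz_pair
begin

lemma D_meas: "D u g ==> u \<in> LM" "D u g ==> g \<in> LM"
 by (auto simp: D_def)

lemma D_approx:
 assumes "D u g" "0 < e"
 shows "\<exists>pf. test_fn pf & mL Ps (%x. pf x - u x) <= ennreal e & mL P (%x. grad pf x - g x) <= ennreal e"
 using assms tendsto_0_pick2 unfolding D_def by meson

lemma D_I:
 assumes "u \<in> LM" "g \<in> LM"
  and "!!e. 0 < e ==> \<exists>pf. test_fn pf & mL Ps (%x. pf x - u x) <= ennreal e & mL P (%x. grad pf x - g x) <= ennreal e"
 shows "D u g"
proof -
 have "\<exists>pf. ALL n. test_fn (pf n) & mL Ps (%x. pf n x - u x) <= ennreal (1 / real (Suc n)) & mL P (%x. grad (pf n) x - g x) <= ennreal (1 / real (Suc n))"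
  by (intro choice allI assms(3)) simp
 then obtain pf where pf: "!!n. test_fn (pf n)" "!!n. mL Ps (%x. pf n x - u x) <= ennreal (1 / real (Suc n))"
   "!!n. mL P (%x. grad (pf n) x - g x) <= ennreal (1 / real (Suc n))" by blast
 show ?thesis unfolding D_def
  using assms(1,2) pf(1) ennreal_tendsto_0_bound[OF pf(2) inverse_Suc_tendsto] ennreal_tendsto_0_bound[OF pf(3) inverse_Suc_tendsto] by blast
qed

lemma D_finite:
 assumes "D u g"
 shows "mL Ps u < \<infinity>" "mL P g < \<infinity>"
proof -
 note [measurable] = D_meas[OF assms]
 obtain pf where pf: "test_fn pf" "mL Ps (%x. pf x - u x) <= ennreal 1" "mL P (%x. grad pf x - g x) <= ennreal 1"
  using D_approx[OF assms zero_less_one] by blast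
 note [measurable] = sm_meas_leb[OF test_sm[OF pf(1)]] grad_meas_leb[OF test_sm[OF pf(1)]]
 have "mL Ps (%x. (u x - pf x) + pf x) < \<infinity>"
  by (rule mo_add_finite[OF gPs]) (use pf test_mo_finite[OF gPs pf(1)] in \<open>auto simp: mo_diff_swap[of _ _ u] intro: le_less_trans\<close>)
 then show "mL Ps u < \<infinity>" by simp
 have "mL P (%x. (g x - grad pf x) + grad pf x) < \<infinity>"
  by (rule mo_add_finite[OF gP]) (use pf test_mo_finite[OF gP pf(1)] in \<open>auto simp: mo_diff_swap[of _ _ g] intro: le_less_trans\<close>)
 then show "mL P g < \<infinity>" by simp
qed

lemma D_test: "test_fn pf ==> D pf (grad pf)"
 by (rule D_I) (auto intro!: sm_meas_leb grad_meas_leb test_sm exI[of _ pf] simp: mo_def gf_0[OF gP] gf_0[OF gPs])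

lemma D_lin:
 assumes u: "D u g" and v: "D v h"
 shows "D (%x. a * u x + b * v x) (%x. a *R g x + b *R h x)"
proof -
 note [measurable] = D_meas[OF u] D_meas[OF v]
 obtain pf where pf: "!!n. test_fn (pf n)" "(%n. mL Ps (%x. pf n x - u x)) ~~> 0"
    "(%n. mL P (%x. grad (pf n) x - g x)) ~~> 0" using u unfolding D_def by blast
 obtain th where th: "!!n. test_fn (th n)" "(%n. mL Ps (%x. th n x - v x)) ~~> 0"
    "(%n. mL P (%x. grad (th n) x - h x)) ~~> 0" using v unfolding D_def by blast
 note s = test_sm[OF pf(1)] test_sm[OF th(1)]
 note [measurable] = sm_meas_leb[OF s(1)] grad_meas_leb[OF s(1)] sm_meas_leb[OF s(2)] grad_meas_leb[OF s(2)]
 have 1: "(%n. mL Ps (%x. a *R (pf n x - u x) + b *R (th n x - v x))) ~~> 0"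
  by (intro mo_tendsto_add[OF gPs] mo_tendsto_scale[OF gPs] pf th) measurable
 have 2: "(%n. mL P (%x. a *R (grad (pf n) x - g x) + b *R (grad (th n) x - h x))) ~~> 0"
  by (intro mo_tendsto_add[OF gP] mo_tendsto_scale[OF gP] pf th) measurable
 have gr: "grad (%x. a * pf n x + b * th n x) x = a *R grad (pf n) x + b *R grad (th n) x" for n x
  using s by (simp add: grad_add sm_scale grad_cmult)
 show ?thesis unfolding D_def
 proof (intro conjI exI[of _ "%n x. a * pf n x + b * th n x"] allI)
  show "test_fn (%x. a * pf n x + b * th n x)" for n
   by (intro test_add test_mult[OF pf(1) sm.const] test_mult[OF th(1) sm.const])
  show "(%n. mL Ps (%x. a * pf n x + b * th n x - (a * u x + b * v x))) ~~> 0"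
   using 1 by (simp add: algebra_simps)
  show "(%n. mL P (%x. grad (%x. a * pf n x + b * th n x) x - (a *R g x + b *R h x))) ~~> 0"
   using 2 unfolding gr by (simp add: algebra_simps)
 qed measurable
qed

lemma D_diff: "D u g ==> D v h ==> D (%x. u x - v x) (%x. g x - h x)"
 using D_lin[of u g v h 1 "-1"] by simp

lemma D_scale: "D u g ==> D (%x. a * u x) (%x. a *R g x)"
 using D_lin[of u g u g a 0] by simp

text \<open>The scaling of \<open>sobolev_small\<close>, but ending in \<open>Ps\<close>: l is so
  small that C l is at most 1 and at most e, where the contraction property applies.\<close>

lemma sobolev_continuity:
 assumes "0 < e"
 shows "\<exists>d>0. ALL u g. D u g --> mL P g <= ennreal d --> mL Ps u <= ennreal e"
proof -
 obtain C where C: "0 < C" "!!u g l. D u g ==> 0 < l ==> mL P (%x. g x /\<^sub>R l) <= 1 ==> mL Ps (%x. u x / (C * l)) <= 1"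
  using sobolev_D by blast
 define l where "l = min 1 (min 1 e / C)"
 have l: "0 < l" "l <= 1" "C * l <= 1" "C * l <= e" using C assms by (auto simp: l_def min_def field_simps)
 show ?thesis
 proof (intro exI[of _ "l powr m"] conjI allI impI)
  fix u g assume D: "D u g" and g: "mL P g <= ennreal (l powr m)"
  note [measurable] = D_meas[OF D]
  have "mL P (%x. (1 / l) *R g x) <= ennreal (max 1 (\<bar>1 / l\<bar> powr m)) * mL P g"
   by (rule mo_scale[OF gP]) measurable
  also have "max 1 (\<bar>1 / l\<bar> powr m) = 1 / l powr m"
   using l m1 powr_le1[of m l] by (auto simp: powr_divide max_def field_simps)
  also have "ennreal (1 / l powr m) * mL P g <= ennreal (1 / l powr m) * ennreal (l powr m)" by (intro mult_left_mono g) auto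
  also have "... = 1" using l by (simp flip: ennreal_mult)
  finally have "mL P (%x. g x /\<^sub>R l) <= 1" by (simp add: divide_inverse)
  from C(2)[OF D l(1) this] have s: "mL Ps (%x. u x / (C * l)) <= 1" .
  have "mL Ps (%x. (C * l) *R (u x / (C * l))) <= ennreal \<bar>C * l\<bar> * mL Ps (%x. u x / (C * l))"
   by (rule mo_sub[OF gPs]) (use l C in auto)
  also have "... <= ennreal e * 1" using l C s by (intro mult_mono ennreal_leI) auto
  finally show "mL Ps u <= ennreal e" using C l by simp
 qed (use l in auto)
qed

text \<open>Convergence of the gradients makes the functions Cauchy in the \<open>Ps\<close> modular
  through the embedding, and Fatou's lemma along the a.e. convergence identifies the limit as v0. A
  test function close to one late \<open>v n\<close> is then close to v0.\<close>

lemma D_limit: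
 assumes D: "!!n. D (v n) (h n)" and [measurable]: "v0 \<in> LM" "g0 \<in> LM"
  and ae: "AE x in lebesgue. (%n. v n x) ~~> v0 x" and l: "(%n. mL P (%x. h n x - g0 x)) ~~> 0"
 shows "D v0 g0"
proof (rule D_I)
 note [measurable] = D_meas[OF D]
 fix e :: real assume e: "0 < e"
 \<comment> \<open>Leaves room for one triangle inequality in each modular, whose constants are
   \<open>2 powr m\<close> and \<open>2 powr ms\<close>.\<close>
 define e1 where "e1 = e / (4 * 2 powr max m ms)"
 have e1: "0 < e1" using e by (simp add: e1_def)
 have ee: "2 powr m * (e1 + e1) <= e" "2 powr ms * (e1 + e1) <= e"
 proof -
  have "2 powr max m ms * (e1 + e1) = e / 2" by (simp add: e1_def)
  moreover have "2 powr m * (e1 + e1) <= 2 powr max m ms * (e1 + e1)" "2 powr ms * (e1 + e1) <= 2 powr max m ms * (e1 + e1)"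
   using e1 by (intro mult_right_mono powr_mono; simp)+
  ultimately show "2 powr m * (e1 + e1) <= e" "2 powr ms * (e1 + e1) <= e"
   using e by linarith+
 qed
 obtain d where d: "0 < d" "!!u g. D u g ==> mL P g <= ennreal d ==> mL Ps u <= ennreal e1"
  using sobolev_continuity[OF e1] by blast
 define d1 where "d1 = min e1 (d / (2 * 2 powr m))"
 have d1: "0 < d1" "2 powr m * (d1 + d1) <= d" "d1 <= e1" using d e1 by (auto simp: d1_def min_def field_simps)
 obtain n where n: "!!k. n <= k ==> mL P (%x. h k x - g0 x) <= ennreal d1"
  using l d1(1) unfolding ennreal_tendsto_0_iff eventually_sequentially by blast
 have cau: "mL Ps (%x. v n x - v k x) <= ennreal e1" if "n <= k" for k
 proof (rule d(2)[OF D_diff[OF D D]])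
  have "mL P (%x. h n x - h k x) <= ennreal (2 powr m) * (mL P (%x. h n x - g0 x) + mL P (%x. g0 x - h k x))"
   by (rule mo_triangle[OF gP]) measurable
  also have "... <= ennreal (2 powr m) * (ennreal d1 + ennreal d1)"
   using n[of n] n[OF that] by (intro mult_left_mono add_mono) (auto simp: mo_diff_swap[of _ _ g0])
  also have "... = ennreal (2 powr m * (d1 + d1))" by (rule ennreal_ma) (use d1 in auto)
  also have "... <= ennreal d" using d1 by (intro ennreal_leI) auto
  finally show "mL P (%x. h n x - h k x) <= ennreal d" .
 qed
 have vn: "mL Ps (%x. v n x - v0 x) <= ennreal e1"
 proof (rule mo_fatou_le[OF gPs])
  show "AE x in lebesgue. (%k. v n x - v k x) ~~> v n x - v0 x"
   using ae by eventually_elim (intro tendsto_intros)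
  show "eventually (%k. mL Ps (%x. v n x - v k x) <= ennreal e1) sequentially"
   using cau unfolding eventually_sequentially by blast
 qed measurable
 obtain pf where pf: "test_fn pf" "mL Ps (%x. pf x - v n x) <= ennreal e1" "mL P (%x. grad pf x - h n x) <= ennreal e1"
  using D_approx[OF D e1] by blast
 note [measurable] = sm_meas_leb[OF test_sm[OF pf(1)]] grad_meas_leb[OF test_sm[OF pf(1)]]
 show "\<exists>pf. test_fn pf & mL Ps (%x. pf x - v0 x) <= ennreal e & mL P (%x. grad pf x - g0 x) <= ennreal e"
 proof (intro exI[of _ pf] conjI pf(1))
  have "mL Ps (%x. pf x - v0 x) <= ennreal (2 powr ms) * (mL Ps (%x. pf x - v n x) + mL Ps (%x. v n x - v0 x))"
   by (rule mo_triangle[OF gPs]) measurable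
  also have "... <= ennreal (2 powr ms) * (ennreal e1 + ennreal e1)" by (intro mult_left_mono add_mono pf vn) auto
  also have "... = ennreal (2 powr ms * (e1 + e1))" by (rule ennreal_ma) (use e1 in auto)
  also have "... <= ennreal e" using ee by (intro ennreal_leI) auto
  finally show "mL Ps (%x. pf x - v0 x) <= ennreal e" .
  have "mL P (%x. grad pf x - g0 x) <= ennreal (2 powr m) * (mL P (%x. grad pf x - h n x) + mL P (%x. h n x - g0 x))"
   by (rule mo_triangle[OF gP]) measurable
  also have "... <= ennreal (2 powr m) * (ennreal e1 + ennreal e1)"
   using n[of n] d1(3) by (intro mult_left_mono add_mono pf) (auto intro: order_trans ennreal_leI)
  also have "... = ennreal (2 powr m * (e1 + e1))" by (rule ennreal_ma) (use e1 in auto)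
  also have "... <= ennreal e" using ee by (intro ennreal_leI) auto
  finally show "mL P (%x. grad pf x - g0 x) <= ennreal e" .
 qed
qed measurable

text \<open>\<open>P_young\<close> with a small constant kp as second factor on the ball: kp
  contributes \<open>kp ^ DIM('a)\<close> per unit of volume, and the first factor, though divided
  by kp, has vanishing modular.\<close>

lemma local_P_null:
 assumes [measurable]: "!!n. w n \<in> LM" and l: "(%n. mL Ps (w n)) ~~> 0"
  and b: "!!n x. norm (z n x :: 'b::euclidean_space) <= C * \<bar>w n x :: real\<bar> * indicator (cball (0::'a) R) x" and C: "0 <= C"
 shows "(%n. mL P (z n)) ~~> 0"
proof -
 obtain Y where Y: "0 < Y" "!!a b. 0 <= a ==> 0 <= b ==> P (a * b) <= Ps (Y * a) + b ^ DIM('a)" using P_young by blast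
 define B where "B = cball (0::'a) R"
 note [measurable] = gf_meas_e[OF gPs]
 have [measurable]: "B \<in> sets lebesgue" by (simp add: B_def)
 define \<mu> where "\<mu> = measure lebesgue B"
 have \<mu>: "emeasure lebesgue B = ennreal \<mu>" "0 <= \<mu>"
  using emeasure_bounded_finite[of B] by (auto simp: \<mu>_def B_def emeasure_eq_ennreal_measure less_top[symmetric])
 show ?thesis unfolding ennreal_tendsto_0_iff
 proof (intro allI impI)
  fix e :: real assume e: "0 < e"
  define kp where "kp = min 1 (e / (2 * (\<mu> + 1)))"
  have kp: "0 < kp" "kp <= 1" "kp * \<mu> <= e / 2" using e \<mu>
   by (auto simp: kp_def min_def field_simps)
  have "kp ^ DIM('a) <= kp ^ 1" by (intro power_decreasing) (use kp in \<open>auto simp: Suc_le_eq\<close>)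
  then have kpN: "kp ^ DIM('a) <= kp" by simp
  have "(%n. mL Ps (%x. (Y * C / kp) *R w n x)) ~~> 0"
   by (rule mo_tendsto_scale[OF gPs _ l]) measurable
  then have "eventually (%n. mL Ps (%x. (Y * C / kp) *R w n x) <= ennreal (e / 2)) sequentially"
   unfolding ennreal_tendsto_0_iff using e by simp
  then show "eventually (%n. mL P (z n) <= ennreal e) sequentially"
  proof eventually_elim
   case (elim n)
   have "mL P (z n) <= (\<integral>\<^sup>+x. ennreal (Ps (norm ((Y * C / kp) *R w n x))) + ennreal kp * indicator B x \<partial>lebesgue)"
    unfolding mo_def
   proof (rule nn_integral_mono)
    fix x
    show "ennreal (P (norm (z n x))) <= ennreal (Ps (norm ((Y * C / kp) *R w n x))) + ennreal kp * indicator B x"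
    proof (cases "x \<in> B")
     case True
     have "P (norm (z n x)) <= P ((C * \<bar>w n x\<bar> / kp) * kp)"
      using b[of n x] True kp by (intro gf_mono[OF gP]) (auto simp: B_def)
     also have "... <= Ps (Y * (C * \<bar>w n x\<bar> / kp)) + kp ^ DIM('a)" using C kp by (intro Y(2)) auto
     also have "Y * (C * \<bar>w n x\<bar> / kp) = norm ((Y * C / kp) *R w n x)" using C kp Y(1) by (simp add: abs_mult)
     also have "Ps (norm ((Y * C / kp) *R w n x)) + kp ^ DIM('a) <= Ps (norm ((Y * C / kp) *R w n x)) + kp" using kpN by simp
     finally have "ennreal (P (norm (z n x))) <= ennreal (Ps (norm ((Y * C / kp) *R w n x)) + kp)" by (rule ennreal_leI)
     also have "... = ennreal (Ps (norm ((Y * C / kp) *R w n x))) + ennreal kp"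
      by (rule ennreal_plus) (use kp gf_ge0[OF gPs] in auto)
     finally show ?thesis using True by simp
    next
     case False
     then have "z n x = 0" using b[of n x] by (simp add: B_def)
     then show ?thesis by (simp add: gf_0[OF gP])
    qed
   qed
   also have "... = mL Ps (%x. (Y * C / kp) *R w n x) + (\<integral>\<^sup>+x. ennreal kp * indicator B x \<partial>lebesgue)"
    unfolding mo_def by (rule nn_integral_add) measurable
   also have "(\<integral>\<^sup>+x. ennreal kp * indicator B x \<partial>lebesgue) = ennreal kp * emeasure lebesgue B"
    by (rule nn_integral_cmult_indicator) measurable
   also have "mL Ps (%x. (Y * C / kp) *R w n x) + ennreal kp * emeasure lebesgue B <= ennreal (e / 2) + ennreal kp * ennreal \<mu>"
    unfolding \<mu>(1) by (rule add_right_mono[OF elim])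
   also have "... = ennreal (e / 2 + kp * \<mu>)" using e kp \<mu>(2) by (simp add: ennreal_mult[symmetric] ennreal_plus[symmetric] del: ennreal_plus)
   also have "... <= ennreal e" using kp by (intro ennreal_leI) auto
   finally show ?case .
  qed
 qed
qed

lemma D_mult:
 assumes u: "D u g" and ctz: "test_fn ctz"
 shows "D (%x. ctz x * u x) (%x. ctz x *R g x + u x *R grad ctz x)"
proof -
 note [measurable] = D_meas[OF u]
 obtain pf where pf: "!!n. test_fn (pf n)" "(%n. mL Ps (%x. pf n x - u x)) ~~> 0"
    "(%n. mL P (%x. grad (pf n) x - g x)) ~~> 0" using u unfolding D_def by blast
 note s = test_sm[OF pf(1)] test_sm[OF ctz]
 note [measurable] = sm_meas_leb[OF s(1)] grad_meas_leb[OF s(1)] sm_meas_leb[OF s(2)] grad_meas_leb[OF s(2)]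
 obtain R where R: "ALL x. R <= norm x --> ctz x = 0 & grad ctz x = 0" using test_fn_bounded_support[OF ctz] by blast
 obtain B where B: "0 < B" "ALL x. norm (ctz x) <= B" using cont_bounded_support_bounded[OF sm_cont[OF s(2)], of R] R by blast
 obtain C where C: "0 < C" "ALL x. norm (grad ctz x) <= C" using cont_bounded_support_bounded[OF sm_grad_cont[OF s(2)], of R] R by blast
 have "(%n. mL Ps (%x. B *R (pf n x - u x))) ~~> 0"
  by (intro mo_tendsto_scale[OF gPs] pf) measurable
 then have 1: "(%n. mL Ps (%x. ctz x * (pf n x - u x))) ~~> 0"
  by (rule mo_tendsto_le[OF gPs]) (use B in \<open>auto simp: abs_mult intro!: mult_right_mono\<close>)
 have "(%n. mL P (%x. B *R (grad (pf n) x - g x))) ~~> 0"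
  by (intro mo_tendsto_scale[OF gP] pf) measurable
 then have 2: "(%n. mL P (%x. ctz x *R (grad (pf n) x - g x))) ~~> 0"
  by (rule mo_tendsto_le[OF gP]) (use B in \<open>auto simp: abs_mult intro!: mult_right_mono\<close>)
 have 3: "(%n. mL P (%x. (pf n x - u x) *R grad ctz x)) ~~> 0"
 proof (rule local_P_null[OF _ pf(2)])
  show "norm ((pf n x - u x) *R grad ctz x) <= C * \<bar>pf n x - u x\<bar> * indicator (cball 0 R) x" for n x
   using R C by (cases "R <= norm x") (auto simp: mult.commute intro!: mult_right_mono)
 qed (use C in auto)
 have 4: "(%n. mL P (%x. ctz x *R (grad (pf n) x - g x) + (pf n x - u x) *R grad ctz x)) ~~> 0"
  by (intro mo_tendsto_add[OF gP] 2 3) measurable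
 show ?thesis unfolding D_def
 proof (intro conjI exI[of _ "%n x. ctz x * pf n x"] allI)
  show "test_fn (%x. ctz x * pf n x)" for n by (rule test_mult[OF pf(1) s(2)])
  show "(%n. mL Ps (%x. ctz x * pf n x - ctz x * u x)) ~~> 0"
   using 1 by (simp add: algebra_simps)
  show "(%n. mL P (%x. grad (%x. ctz x * pf n x) x - (ctz x *R g x + u x *R grad ctz x))) ~~> 0"
   using 4 by (simp add: grad_mult[OF s(2) s(1)] algebra_simps)
 qed measurable
qed

lemma D_smax:
 assumes u: "D u g" and e: "e ~= 0"
 shows "D (%x. smax e k (u x)) (%x. dsmax e k (u x) *R g x)"
proof -
 note [measurable] = D_meas[OF u]
 obtain pf' where pf': "!!n. test_fn (pf' n)" "(%n. mL Ps (%x. pf' n x - u x)) ~~> 0"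
    "(%n. mL P (%x. grad (pf' n) x - g x)) ~~> 0" using u unfolding D_def by blast
 \<comment> \<open>Pointwise convergence is needed for the term in which \<open>dsmax\<close> varies
   while g stays fixed; that term is dominated by |g|.\<close>
 have "EX r. strict_mono r & (AE x in lebesgue. (%n. pf' (r n) x - u x) ~~> 0)"
  by (rule AE_subseq_null[OF gPs _ pf'(2)]) (intro borel_measurable_diff sm_meas_leb test_sm pf'(1) D_meas[OF u])
 then obtain r where r: "strict_mono r" "AE x in lebesgue. (%n. pf' (r n) x - u x) ~~> 0" by blast
 define pf where "pf = (%n. pf' (r n))"
 have pf: "!!n. test_fn (pf n)" "(%n. mL Ps (%x. pf n x - u x)) ~~> 0"
    "(%n. mL P (%x. grad (pf n) x - g x)) ~~> 0"
  using pf'(1) LIMSEQ_subseq_LIMSEQ[OF pf'(2) r(1)] LIMSEQ_subseq_LIMSEQ[OF pf'(3) r(1)] by (simp_all add: pf_def o_def)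
 have ae: "AE x in lebesgue. (%n. pf n x) ~~> u x"
  using r(2) by eventually_elim (simp add: pf_def LIM_zero_iff)
 note s = test_sm[OF pf(1)]
 have [measurable]: "dsmax e k \<in> borel_measurable borel" by (rule borel_measurable_continuous_onI[OF dsmax_cont[OF e]])
 have "continuous_on UNIV (smax e k)"
  by (rule DERIV_continuous_on) (use smax_deriv[OF e] in \<open>blast intro: has_field_derivative_at_within\<close>)
 then have [measurable]: "smax e k \<in> borel_measurable borel" by (rule borel_measurable_continuous_onI)
 note [measurable] = sm_meas_leb[OF s] grad_meas_leb[OF s]
 have 1: "(%n. mL Ps (%x. smax e k (pf n x) - smax e k (u x))) ~~> 0"
  by (rule mo_tendsto_le[OF gPs pf(2)]) (simp add: smax_lipschitz[OF e])
 have 2: "(%n. mL P (%x. dsmax e k (pf n x) *R (grad (pf n) x - g x))) ~~> 0"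
  by (rule mo_tendsto_le[OF gP pf(3)]) (use dsmax_bounds[OF e] in \<open>auto intro!: mult_left_le_one_le\<close>)
 have 3: "(%n. mL P (%x. (dsmax e k (pf n x) - dsmax e k (u x)) *R g x)) ~~> 0"
 proof (rule mo_dominated[OF gP])
  show "mL P g < \<infinity>" by (rule D_finite(2)[OF u])
  have "\<bar>dsmax e k s - dsmax e k t\<bar> <= 1" for s t using dsmax_bounds[OF e, of k s] dsmax_bounds[OF e, of k t] by (simp add: abs_le_iff)
  then show "AE x in lebesgue. norm ((dsmax e k (pf n x) - dsmax e k (u x)) *R g x) <= norm (g x)" for n
   by (auto intro!: mult_left_le_one_le)
  show "AE x in lebesgue. (%n. (dsmax e k (pf n x) - dsmax e k (u x)) *R g x) ~~> 0"
   using ae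
  proof eventually_elim
   case (elim x)
   have "(%n. dsmax e k (pf n x)) ~~> dsmax e k (u x)"
    by (rule continuous_on_tendsto_compose[OF dsmax_cont[OF e] elim]) auto
   then have "(%n. (dsmax e k (pf n x) - dsmax e k (u x)) *R g x) ~~> (dsmax e k (u x) - dsmax e k (u x)) *R g x"
    by (intro tendsto_intros)
   then show ?case by simp
  qed
 qed measurable
 have 4: "(%n. mL P (%x. dsmax e k (pf n x) *R (grad (pf n) x - g x) + (dsmax e k (pf n x) - dsmax e k (u x)) *R g x)) ~~> 0"
  by (intro mo_tendsto_add[OF gP] 2 3) measurable
 show ?thesis unfolding D_def
 proof (intro conjI exI[of _ "%n x. smax e k (pf n x)"] allI)
  show "test_fn (%x. smax e k (pf n x))" for n
   by (rule test_fnI[OF pf(1)[of n] smax_sm[OF e s]]) (simp add: smax_0)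
  show "(%n. mL Ps (%x. smax e k (pf n x) - smax e k (u x))) ~~> 0" by (rule 1)
  show "(%n. mL P (%x. grad (%x. smax e k (pf n x)) x - dsmax e k (u x) *R g x)) ~~> 0"
   using 4 by (simp add: grad_comp[OF s smax_deriv[OF e]] algebra_simps)
 qed measurable
qed

text \<open>The limit e -> 0 of \<open>D_smax\<close>: the functions converge pointwise and the
  gradients in modular by domination, which is the form of convergence that \<open>D_limit\<close>
  accepts.\<close>

lemma D_truncate:
 assumes u: "D u g" and k: "0 <= k"
 shows "D (%x. max 0 (u x - k)) (%x. half_step (u x - k) *R g x)"
proof (rule D_limit)
 note [measurable] = D_meas[OF u]
 have [measurable]: "half_step \<in> borel_measurable borel" unfolding half_step_def[abs_def] by measurable
 have "dsmax (1 / real (Suc n)) k \<in> borel_measurable borel" for n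
  by (rule borel_measurable_continuous_onI[OF dsmax_cont]) simp
 note [measurable] = this[unfolded]
 show "D (%x. smax (1 / real (Suc n)) k (u x)) (%x. dsmax (1 / real (Suc n)) k (u x) *R g x)" for n
  by (rule D_smax[OF u]) simp
 show "(%x. max 0 (u x - k)) \<in> LM" "(%x. half_step (u x - k) *R g x) \<in> LM" by measurable
 show "AE x in lebesgue. (%n. smax (1 / real (Suc n)) k (u x)) ~~> max 0 (u x - k)" by (simp add: smax_tendsto[OF k] del: of_nat_Suc)
 have "(%n. mL P (%x. (dsmax (1 / real (Suc n)) k (u x) - half_step (u x - k)) *R g x)) ~~> 0"
 proof (rule mo_dominated[OF gP])
  show "mL P g < \<infinity>" by (rule D_finite(2)[OF u])
  have "\<bar>dsmax (1 / real (Suc n)) k s - half_step t\<bar> <= 1" for n s t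
   using dsmax_bounds[of "1 / real (Suc n)" k s] by (simp add: abs_le_iff half_step_def)
  then show "AE x in lebesgue. norm ((dsmax (1 / real (Suc n)) k (u x) - half_step (u x - k)) *R g x) <= norm (g x)" for n
   by (auto intro!: mult_left_le_one_le simp del: of_nat_Suc)
  have "(%n. (dsmax (1 / real (Suc n)) k (u x) - half_step (u x - k)) *R g x) ~~> (half_step (u x - k) - half_step (u x - k)) *R g x" for x
   by (intro tendsto_intros dsmax_tendsto)
  then show "AE x in lebesgue. (%n. (dsmax (1 / real (Suc n)) k (u x) - half_step (u x - k)) *R g x) ~~> 0" by simp
  show "(%x. (dsmax (1 / real (Suc n)) k (u x) - half_step (u x - k)) *R g x) \<in> LM" for n by measurable
 qed measurable
 then show "(%n. mL P (%x. dsmax (1 / real (Suc n)) k (u x) *R g x - half_step (u x - k) *R g x)) ~~> 0"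
  by (simp add: scaleR_diff_left)
qed

section \<open>Weak gradients and agreement with \<open>D1Phi\<close>\<close>

lemma D_loc_L1:
 assumes D: "D u g" and A: "bounded A" "A \<in> sets lebesgue"
 shows "set_integrable lebesgue A u" "set_integrable lebesgue A g"
proof -
 note [measurable] = D_meas[OF D] A(2)
 have fin: "emeasure lebesgue A < \<infinity>" using bounded_set_imp_lmeasurable[OF A] by (auto simp: fmeasurable_def)
 have "(\<integral>\<^sup>+x\<in>A. ennreal (norm (u x)) \<partial>lebesgue) <= ennreal 1 * emeasure lebesgue A + ennreal (1 / Ps 1) * mL Ps u"
  by (rule nn_integral_le_mo[OF gPs]) auto
 also have "... < \<infinity>" using fin D_finite[OF D] by (auto simp: ennreal_mult_less_top)
 also have "(\<integral>\<^sup>+x\<in>A. ennreal (norm (u x)) \<partial>lebesgue) = (\<integral>\<^sup>+x. ennreal (norm (indicator A x *R u x)) \<partial>lebesgue)"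
  by (intro nn_integral_cong) (auto simp: indicator_def)
 finally show "set_integrable lebesgue A u" unfolding set_integrable_def
  by (intro integrableI_bounded) measurable
 have "(\<integral>\<^sup>+x\<in>A. ennreal (norm (g x)) \<partial>lebesgue) <= ennreal 1 * emeasure lebesgue A + ennreal (1 / P 1) * mL P g"
  by (rule nn_integral_le_mo[OF gP]) auto
 also have "... < \<infinity>" using fin D_finite[OF D] by (auto simp: ennreal_mult_less_top)
 also have "(\<integral>\<^sup>+x\<in>A. ennreal (norm (g x)) \<partial>lebesgue) = (\<integral>\<^sup>+x. ennreal (norm (indicator A x *R g x)) \<partial>lebesgue)"
  by (intro nn_integral_cong) (auto simp: indicator_def)
 finally show "set_integrable lebesgue A g" unfolding set_integrable_def
  by (intro integrableI_bounded) measurable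
qed

lemma integral_test_tendsto:
 assumes G: "gf G q" and w: "!!n. w n \<in> LM" "w0 \<in> LM"
  and l: "(%n. mL G (%x. w n x - w0 x)) ~~> 0"
  and p: "continuous_on UNIV p" "!!x. R <= norm x ==> p x = 0"
  and int: "!!n. integrable lebesgue (%x. w n x * p x)" "integrable lebesgue (%x. w0 x * p x)"
 shows "(%n. LINT x|lebesgue. w n x * p x) ~~> (LINT x|lebesgue. w0 x * (p x :: real))"
proof -
 note [measurable] = w
 obtain B where B: "0 < B" "ALL x. norm (p x) <= B" using cont_bounded_support_bounded[OF p] by blast
 define A where "A = cball (0::'b) R"
 have A: "A \<in> sets lebesgue" "emeasure lebesgue A < \<infinity>" using emeasure_bounded_finite[of A] by (auto simp: A_def)
 note [measurable] = A(1)
 have [measurable]: "p \<in> LM" using borel_measurable_continuous_onI[OF p(1)] by (auto intro: measurable_completion)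
 have L1: "(%n. \<integral>\<^sup>+x\<in>A. ennreal (norm (w n x - w0 x)) \<partial>lebesgue) ~~> 0"
  by (rule mo_imp_L1[OF G _ A(1) A(2) l]) measurable
 have "(%n. \<integral>\<^sup>+x. norm (w n x * p x - w0 x * p x) \<partial>lebesgue) ~~> 0"
 proof (rule ennreal_tendsto_0_le)
  have "(%n. ennreal B * (\<integral>\<^sup>+x\<in>A. ennreal (norm (w n x - w0 x)) \<partial>lebesgue)) ~~> ennreal B * 0"
   by (intro ennreal_tendsto_cmult L1) auto
  then show "(%n. ennreal B * (\<integral>\<^sup>+x\<in>A. ennreal (norm (w n x - w0 x)) \<partial>lebesgue)) ~~> 0" by simp
  show "eventually (%n. (\<integral>\<^sup>+x. norm (w n x * p x - w0 x * p x) \<partial>lebesgue) <= ennreal B * (\<integral>\<^sup>+x\<in>A. ennreal (norm (w n x - w0 x)) \<partial>lebesgue)) sequentially"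
  proof (intro always_eventually allI)
   fix n
   have "(\<integral>\<^sup>+x. norm (w n x * p x - w0 x * p x) \<partial>lebesgue) <= (\<integral>\<^sup>+x. ennreal B * (ennreal (norm (w n x - w0 x)) * indicator A x) \<partial>lebesgue)"
   proof (rule nn_integral_mono)
    fix x
    show "ennreal (norm (w n x * p x - w0 x * p x)) <= ennreal B * (ennreal (norm (w n x - w0 x)) * indicator A x)"
    proof (cases "x \<in> A")
     case True
     have "norm (w n x * p x - w0 x * p x) = norm (w n x - w0 x) * norm (p x)" by (simp add: abs_mult[symmetric] algebra_simps)
     also have "... <= norm (w n x - w0 x) * B" using B by (intro mult_left_mono) auto
     finally have "ennreal (norm (w n x * p x - w0 x * p x)) <= ennreal (B * norm (w n x - w0 x))" by (intro ennreal_leI) (simp add: mult.commute)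
     also have "... = ennreal B * ennreal (norm (w n x - w0 x))" by (rule ennreal_mult) (use B in auto)
     finally show ?thesis using True by simp
    next
     case False then show ?thesis using p(2)[of x] by (simp add: A_def)
    qed
   qed
   also have "... = ennreal B * (\<integral>\<^sup>+x\<in>A. ennreal (norm (w n x - w0 x)) \<partial>lebesgue)" by (rule nn_integral_cmult) measurable
   finally show "(\<integral>\<^sup>+x. norm (w n x * p x - w0 x * p x) \<partial>lebesgue) <= ennreal B * (\<integral>\<^sup>+x\<in>A. ennreal (norm (w n x - w0 x)) \<partial>lebesgue)" .
  qed
 qed
 then show ?thesis by (intro tendsto_L1_int int) auto
qed

text \<open>Integration by parts holds for the approximating test functions, and modular convergence
  implies convergence in L^1 on the support of p.\<close>

lemma D_weak_grad:
 assumes D: "D u g"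
 shows "has_weak_grad u g"
proof -
 note [measurable] = D_meas[OF D]
 obtain pf where pf: "!!n. test_fn (pf n)" "(%n. mL Ps (%x. pf n x - u x)) ~~> 0"
    "(%n. mL P (%x. grad (pf n) x - g x)) ~~> 0" using D unfolding D_def by blast
 note s = test_sm[OF pf(1)]
 note [measurable] = sm_meas_leb[OF s] grad_meas_leb[OF s]
 have "(LINT x|lebesgue. u x * partial i p x) = - (LINT x|lebesgue. (g x \<bullet> i) * p x)" if p: "test_fn p" and i: "i \<in> Basis" for p i
 proof -
  note ps = test_sm[OF p]
  obtain R where R: "ALL x. R <= norm x --> p x = 0 & grad p x = 0" using test_fn_bounded_support[OF p] by blast
  have c: "continuous_on UNIV p" "continuous_on UNIV (%x. grad p x \<bullet> i)"
   by (rule sm_cont[OF ps]) (intro continuous_on_inner sm_grad_cont[OF ps] continuous_on_const)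
  have int: "integrable lebesgue (%x. w x * q x)"
   if q: "continuous_on UNIV q" "!!x. R <= norm x ==> q x = 0" and w: "set_integrable lebesgue (cball 0 R) w" for w q :: "'a => real"
  proof -
   obtain B where B: "0 < B" "ALL x. norm (q x) <= B" using cont_bounded_support_bounded[OF q] by blast
   have [measurable]: "q \<in> LM" using borel_measurable_continuous_onI[OF q(1)] by (auto intro: measurable_completion)
   have eq: "w x * q x = (indicator (cball 0 R) x *R w x) * q x" for x using q(2)[of x] by (cases "R <= norm x") (auto simp: indicator_def)
   have wi: "integrable lebesgue (%x. indicator (cball 0 R) x *R w x)" using w by (simp add: set_integrable_def)
   note [measurable] = borel_measurable_integrable[OF wi]
   have "integrable lebesgue (%x. (indicator (cball 0 R) x *R w x) * q x)"
   proof (rule Bochner_Integration.integrable_bound)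
    show "integrable lebesgue (%x. B * (indicator (cball 0 R) x *R w x))" by (intro integrable_mult_right wi)
    show "AE x in lebesgue. norm ((indicator (cball 0 R) x *R w x) * q x) <= norm (B * (indicator (cball 0 R) x *R w x))"
     using B by (intro AE_I2) (auto simp: abs_mult mult.commute intro!: mult_right_mono)
   qed measurable
   then show ?thesis unfolding eq .
  qed
  have gi: "set_integrable lebesgue A (%x. h x \<bullet> i)" if "set_integrable lebesgue A h" for A and h :: "'a => 'a"
   using integrable_inner_left[of i, OF that[unfolded set_integrable_def]] unfolding set_integrable_def by simp
  have l1: "(%n. LINT x|lebesgue. pf n x * (grad p x \<bullet> i)) ~~> (LINT x|lebesgue. u x * (grad p x \<bullet> i))"
   by (rule integral_test_tendsto[OF gPs _ _ pf(2) c(2), of R])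
    (use R in \<open>auto intro!: int c D_loc_L1(1)[OF D] D_loc_L1(1)[OF D_test[OF pf(1)]]\<close>)
  have l2': "(%n. mL P (%x. grad (pf n) x \<bullet> i - g x \<bullet> i)) ~~> 0"
   by (rule mo_tendsto_le[OF gP pf(3)]) (auto simp: inner_diff_left[symmetric] intro!: Basis_le_norm i)
  have l2: "(%n. LINT x|lebesgue. (grad (pf n) x \<bullet> i) * p x) ~~> (LINT x|lebesgue. (g x \<bullet> i) * p x)"
   by (rule integral_test_tendsto[OF gP _ _ l2' c(1), of R])
    (use R in \<open>auto intro!: int c gi D_loc_L1(2)[OF D] D_loc_L1(2)[OF D_test[OF pf(1)]]\<close>)
  have "(%n. - (LINT x|lebesgue. (grad (pf n) x \<bullet> i) * p x)) ~~> (LINT x|lebesgue. u x * (grad p x \<bullet> i))"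
   using l1 test_weak_grad[OF pf(1) p i] by (simp add: partial_grad[OF i])
  from LIMSEQ_unique[OF this tendsto_minus[OF l2]] show ?thesis by (simp add: partial_grad[OF i])
 qed
 moreover have "set_integrable lebesgue C u & set_integrable lebesgue C g" if "compact C" for C
  using D_loc_L1[OF D compact_imp_bounded[OF that] fmeasurableD[OF lmeasurable_compact[OF that]]] by blast
 ultimately show ?thesis unfolding has_weak_grad_def loc_integrable_def using D_meas[OF D] by blast
qed

text \<open>Test functions have finite modulars, hence so do their differences from u and g, and
  \<open>lux_tendsto_iff\<close> exchanges norms for modulars.\<close>

lemma D_iff:
 "D u g \<longleftrightarrow> has_weak_grad u g & u \<in> orlicz_space Ps & (%x. norm (g x)) \<in> orlicz_space P \<and>
   (\<exists>pf. (ALL n. test_fn (pf n)) & (%n. lux_norm Ps (%x. pf n x - u x)) ~~> 0 \<and>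
    (%n. lux_norm P (%x. norm (grad (pf n) x - g x))) ~~> 0)"
proof -
 have main: "((%n. lux_norm Ps (%x. pf n x - u x)) ~~> 0) = ((%n. mL Ps (%x. pf n x - u x)) ~~> 0) \<and>
   ((%n. lux_norm P (%x. norm (grad (pf n) x - g x))) ~~> 0) = ((%n. mL P (%x. grad (pf n) x - g x)) ~~> 0)"
  if [measurable]: "u \<in> LM" "g \<in> LM"
   and fin: "mL Ps u < \<infinity>" "mL P g < \<infinity>" and pf: "ALL n. test_fn (pf n)" for pf
 proof -
  have s: "pf n \<in> sm" for n using pf test_sm by blast
  note [measurable] = sm_meas_leb[OF s] grad_meas_leb[OF s]
  have f1: "mL Ps (%x. pf n x - u x) < \<infinity>" for n
   using mo_add_finite[OF gPs, of "pf n" lebesgue "%x. - u x"] fin(1) test_mo_finite[OF gPs, of "pf n"] pf by (simp add: mo_minus)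
  have f2: "mL P (%x. grad (pf n) x - g x) < \<infinity>" for n
   using mo_add_finite[OF gP, of "grad (pf n)" lebesgue "%x. - g x"] fin(2) test_mo_finite[OF gP, of "pf n"] pf by (simp add: mo_minus)
  have eq: "mL P (%x. norm (grad (pf n) x - g x)) = mL P (%x. grad (pf n) x - g x)" for n
   by (simp add: mo_def)
  show ?thesis
   using lux_tendsto_iff[OF gPs, of "%n x. pf n x - u x"] lux_tendsto_iff[OF gP, of "%n x. norm (grad (pf n) x - g x)"] f1 f2
   unfolding eq by simp
 qed
 have ng: "mL P (%x. norm (g x)) = mL P g" by (simp add: mo_def)
 show ?thesis
 proof
  assume D: "D u g"
  note [measurable] = D_meas[OF D]
  show "has_weak_grad u g & u \<in> orlicz_space Ps & (%x. norm (g x)) \<in> orlicz_space P \<and>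
   (\<exists>pf. (ALL n. test_fn (pf n)) & (%n. lux_norm Ps (%x. pf n x - u x)) ~~> 0 \<and>
    (%n. lux_norm P (%x. norm (grad (pf n) x - g x))) ~~> 0)"
   using D_weak_grad[OF D] D_finite[OF D] D main[OF D_meas[OF D] D_finite[OF D]]
   by (auto simp: orlicz_iff[OF gPs] orlicz_iff[OF gP] ng D_def)
 next
  assume a: "has_weak_grad u g & u \<in> orlicz_space Ps & (%x. norm (g x)) \<in> orlicz_space P \<and>
   (\<exists>pf. (ALL n. test_fn (pf n)) & (%n. lux_norm Ps (%x. pf n x - u x)) ~~> 0 \<and>
    (%n. lux_norm P (%x. norm (grad (pf n) x - g x))) ~~> 0)"
  then have mm: "u \<in> LM" "g \<in> LM" by (auto simp: has_weak_grad_def loc_integrable_def)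
  have ff: "mL Ps u < \<infinity>" "mL P g < \<infinity>" using a by (auto simp: orlicz_iff[OF gPs] orlicz_iff[OF gP] ng)
  show "D u g" using a main[OF mm ff] mm unfolding D_def by blast
 qed
qed

end

section \<open>Local compactness\<close>

lemma cball_borel[measurable]: "cball (c::'a::euclidean_space) r \<in> sets borel"
 by simp

lemma strict_mono_selection:
 assumes "!!k::nat. EX N. \<forall>n\<ge>N. Q k (n :: nat)"
 shows "EX r. strict_mono r & (ALL k. \<forall>n\<ge>r k. Q k n)"
proof -
 have "EX N. ALL k. \<forall>n\<ge>N k. Q k n" by (rule choice) (use assms in blast)
 then obtain N where N: "ALL k. \<forall>n\<ge>N k. Q k n" by blast
 define r where "r = rec_nat (N 0) (%k y. Suc (y + N (Suc k)))"
 have r: "r (Suc k) = Suc (r k + N (Suc k))" "r 0 = N 0" for k by (simp_all add: r_def)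
 have "strict_mono r" by (rule strict_monoI_Suc) (simp add: r)
 moreover have "N k <= r k" for k by (cases k) (simp_all add: r)
 then have "ALL k. \<forall>n\<ge>r k. Q k n" using N order_trans by blast
 ultimately show ?thesis by blast
qed

text \<open>The subsequence is chosen so that its k-th increment is at most \<open>(1/2)^k\<close>
  in L^1 on the ball of radius k. On the ball of fixed radius k this controls the increments from
  index k on, whence the shift \<open>j + k\<close> below.\<close>

lemma loc_L1_Cauchy_AE:
 fixes w :: "nat => 'a::euclidean_space => 'b::euclidean_space"
 assumes [measurable]: "!!n. w n \<in> LM"
  and c: "!!k e. 0 < e ==> EX N. \<forall>n\<ge>N. \<forall>l\<ge>N. (\<integral>\<^sup>+x\<in>cball 0 (real k). ennreal (norm (w n x - w l x)) \<partial>lebesgue) <= ennreal e"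
 shows "EX r w0. strict_mono r & w0 \<in> LM & (AE x in lebesgue. (%n. w (r n) x) ~~> w0 x)"
proof -
 have "EX N. \<forall>n\<ge>N. \<forall>l\<ge>n. (\<integral>\<^sup>+x\<in>cball 0 (real k). ennreal (norm (w n x - w l x)) \<partial>lebesgue) <= ennreal ((1/2)^k)" for k
  using c[of "(1/2)^k" k] by (meson order_trans zero_less_power half_gt_zero zero_less_one)
 then have "EX r. strict_mono r & (ALL k. \<forall>n\<ge>r k. \<forall>l\<ge>n. (\<integral>\<^sup>+x\<in>cball 0 (real k). ennreal (norm (w n x - w l x)) \<partial>lebesgue) <= ennreal ((1/2)^k))"
  by (rule strict_mono_selection)
 then obtain r where r: "strict_mono r"
  and rk: "ALL k. \<forall>n\<ge>r k. \<forall>l\<ge>n. (\<integral>\<^sup>+x\<in>cball 0 (real k). ennreal (norm (w n x - w l x)) \<partial>lebesgue) <= ennreal ((1/2)^k)" by blast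
 define d where "d = (%j x. norm (w (r j) x - w (r (Suc j)) x))"
 have [measurable]: "d j \<in> LM" for j unfolding d_def by measurable
 have dj: "(\<integral>\<^sup>+x\<in>cball 0 (real j). ennreal (d j x) \<partial>lebesgue) <= ennreal ((1/2)^j)" for j
  unfolding d_def using rk r by (simp add: strict_mono_less_eq)
 have ae: "AE x in lebesgue. x \<in> cball 0 (real k) --> summable (%j. d (j + k) x)" for k
 proof -
  define B where "B = cball (0::'a) (real k)"
  have [measurable]: "B \<in> sets lebesgue" by (simp add: B_def)
  have "(\<integral>\<^sup>+x. (\<Sum>j. ennreal (d (j + k) x) * indicator B x) \<partial>lebesgue) = (\<Sum>j. \<integral>\<^sup>+x. ennreal (d (j + k) x) * indicator B x \<partial>lebesgue)"
   by (rule nn_integral_suminf) measurable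
  also have "... <= (\<Sum>j. ennreal ((1/2)^j))"
  proof (rule suminf_le)
   fix j
   have "(\<integral>\<^sup>+x. ennreal (d (j + k) x) * indicator B x \<partial>lebesgue) <= (\<integral>\<^sup>+x\<in>cball 0 (real (j + k)). ennreal (d (j + k) x) \<partial>lebesgue)"
    by (intro nn_integral_mono) (auto simp: indicator_def B_def)
   also have "... <= ennreal ((1/2)^(j + k))" by (rule dj)
   also have "... <= ennreal ((1/2)^j)" by (intro ennreal_leI power_decreasing) auto
   finally show "(\<integral>\<^sup>+x. ennreal (d (j + k) x) * indicator B x \<partial>lebesgue) <= ennreal ((1/2)^j)" .
  qed auto
  also have "... = ennreal (\<Sum>j. (1/2)^j)" by (rule suminf_ennreal2) (auto intro: summable_geometric)
  finally have "(\<integral>\<^sup>+x. (\<Sum>j. ennreal (d (j + k) x) * indicator B x) \<partial>lebesgue) ~= \<infinity>" by (auto simp: top_unique)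
  then have "AE x in lebesgue. (\<Sum>j. ennreal (d (j + k) x) * indicator B x) ~= \<infinity>"
   by (intro nn_integral_PInf_AE) auto
  then show ?thesis
  proof eventually_elim
   case (elim x)
   show ?case
   proof
    assume "x \<in> cball 0 (real k)"
    then have "(\<Sum>j. ennreal (d (j + k) x)) ~= \<infinity>" using elim by (simp add: B_def)
    then show "summable (%j. d (j + k) x)" by (intro summable_suminf_not_top) (auto simp: d_def)
   qed
  qed
 qed
 have "AE x in lebesgue. ALL k. x \<in> cball 0 (real k) --> summable (%j. d (j + k) x)"
  unfolding AE_all_countable using ae by blast
 then have conv: "AE x in lebesgue. convergent (%n. w (r n) x)"
 proof eventually_elim
  case (elim x)
  obtain k where "norm x <= real k" using real_arch_simple by blast
  then have "summable (%j. d (j + k) x)" using elim by simp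
  then have "summable (%j. d j x)" using summable_iff_shift[of "%j. d j x" k] by blast
  moreover have "(%j. d j x) = (%j. norm (w (r (Suc j)) x - w (r j) x))"
   by (rule ext) (unfold d_def, rule norm_minus_commute)
  ultimately have "summable (%j. norm (w (r (Suc j)) x - w (r j) x))" by (simp only:)
  then have "summable (%j. w (r (Suc j)) x - w (r j) x)" by (rule summable_norm_cancel)
  then have "convergent (%n. \<Sum>j<n. w (r (Suc j)) x - w (r j) x)" by (simp add: summable_iff_convergent)
  then have "convergent (%n. w (r n) x - w (r 0) x)" using sum_lessThan_telescope[of "%j. w (r j) x"] by simp
  then have "convergent (%n. (w (r n) x - w (r 0) x) + w (r 0) x)" by (intro convergent_add convergent_const)
  then show ?case by simp
 qed
 define w0 where "w0 = (%x. lim (%n. w (r n) x))"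
 have "w0 \<in> LM" unfolding w0_def by (rule borel_measurable_lim_metric) measurable
 moreover have "AE x in lebesgue. (%n. w (r n) x) ~~> w0 x"
  using conv by eventually_elim (simp add: w0_def convergent_LIMSEQ_iff)
 ultimately show ?thesis using r by blast
qed

text \<open>A cone. Being Lipschitz, it makes averages of functions bounded in L^1 locally
  equi-Lipschitz; being supported in a ball of radius d, it keeps them close to the functions when
  the gradients are bounded in L^1.\<close>

definition kern :: "real => 'a::euclidean_space => real" where "kern d z = max 0 (d - norm z)"

definition kmass :: "'a::euclidean_space itself => real => real" where
 "kmass _ d = (LINT z|lborel. kern d (z::'a))"

definition avg :: "real => ('a::euclidean_space => real) => 'a => real" where
 "avg d u x = (LINT y|lborel. kern d (y - x) * u y) / kmass TYPE('a) d"

lemma kern_props: "0 <= kern d z" "0 <= d ==> kern d z <= d" "d <= norm z ==> kern d z = 0"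
 "\<bar>kern d y - kern d z\<bar> <= norm (y - z)"
proof -
 show "\<bar>kern d y - kern d z\<bar> <= norm (y - z)"
  using norm_triangle_ineq3[of y z] unfolding kern_def max_def by (auto simp: abs_le_iff)
qed (auto simp: kern_def)

lemma kern_cont: "continuous_on UNIV (%y. kern d (y - x))"
 unfolding kern_def by (intro continuous_intros)

lemma kern_int: "integrable lborel (kern d :: 'a::euclidean_space => real)"
proof -
 have c: "continuous_on UNIV (kern d :: 'a => real)" unfolding kern_def[abs_def] by (intro continuous_intros)
 have "integrable lebesgue (kern d :: 'a => real)"
  by (rule cont_bounded_support_integrable[OF c, of d]) (rule kern_props(3))
 then show ?thesis using borel_measurable_continuous_onI[OF c] by (simp add: integrable_completion)
qed

lemma kmass_pos: assumes "0 < d" shows "0 < kmass TYPE('a::euclidean_space) d"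
proof -
 have "(LINT z|lborel. (d/2) * indicator (ball 0 (d/2)) (z::'a)) <= kmass TYPE('a) d"
  unfolding kmass_def
 proof (rule integral_mono[OF _ kern_int])
  show "integrable lborel (%z::'a. (d/2) * indicator (ball 0 (d/2)) z)"
   using emeasure_bounded_finite[of "ball (0::'a) (d/2)"] by (intro integrable_mult_right integrable_real_indicator) (auto simp: less_top)
  show "(d/2) * indicator (ball 0 (d/2)) z <= kern d z" for z :: 'a
   using assms by (auto simp: indicator_def kern_def)
 qed
 moreover have "(LINT z|lborel. (d/2) * indicator (ball 0 (d/2)) (z::'a)) = (d/2) * measure lborel (ball (0::'a) (d/2))" by simp
 moreover have "0 < measure lborel (ball (0::'a) (d/2))" using assms by (simp add: content_ball)
 ultimately show ?thesis using assms by (smt (verit) half_gt_zero mult_pos_pos)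
qed

lemma avg_int:
 fixes x :: "'a::euclidean_space" and u :: "'a => real"
 assumes u: "continuous_on UNIV u"
 shows "integrable lborel (%y. kern d (y - x) * u y)"
proof -
 have c: "continuous_on UNIV (%y. kern d (y - x) * u y)" by (intro continuous_on_mult kern_cont u)
 have "integrable lebesgue (%y. kern d (y - x) * u y)"
 proof (rule cont_bounded_support_integrable[OF c, of "norm x + d"])
  fix y :: 'a assume "norm x + d <= norm y"
  then have "d <= norm (y - x)" using norm_triangle_ineq2[of y x] by linarith
  then show "kern d (y - x) * u y = 0" by (simp add: kern_props)
 qed
 then show ?thesis using borel_measurable_continuous_onI[OF c] by (simp add: integrable_completion)
qed

lemma avg_bounds:
 fixes u :: "'a::euclidean_space => real"
 assumes u: "continuous_on UNIV u" and d: "0 < d" "d <= 1" and x: "norm x <= k" "norm x' <= k"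
  and b: "(\<integral>\<^sup>+y\<in>cball 0 (k + 1). ennreal \<bar>u y\<bar> \<partial>lborel) <= ennreal C" and C: "0 <= C"
 shows "\<bar>avg d u x\<bar> <= C / kmass TYPE('a) d" "\<bar>avg d u x - avg d u x'\<bar> <= norm (x - x') * C / kmass TYPE('a) d"
proof -
 have [measurable]: "u \<in> borel_measurable borel" by (rule borel_measurable_continuous_onI[OF u])
 have kz: "kern d (y - z) = 0" if "norm z <= k" "y \<notin> cball 0 (k + 1)" for y z :: 'a
  using norm_triangle_ineq2[of y z] that d by (intro kern_props) simp
 have mass: "0 < kmass TYPE('a) d" by (rule kmass_pos[OF d(1)])
 have key: "\<bar>LINT y|lborel. kp y * u y\<bar> <= L * C"
  if i: "integrable lborel (%y. kp y * u y)" and k: "!!y. \<bar>kp y\<bar> <= L" "!!y. y \<notin> cball 0 (k + 1) ==> kp y = 0" and L: "0 <= L" for kp :: "'a => real" and L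
 proof -
  have "ennreal \<bar>LINT y|lborel. kp y * u y\<bar> <= (\<integral>\<^sup>+y. norm (kp y * u y) \<partial>lborel)"
   using integral_norm_bound_ennreal[OF i] by simp
  also have "... <= (\<integral>\<^sup>+y. ennreal L * (ennreal \<bar>u y\<bar> * indicator (cball 0 (k + 1)) y) \<partial>lborel)"
  proof (rule nn_integral_mono)
   fix y
   show "ennreal (norm (kp y * u y)) <= ennreal L * (ennreal \<bar>u y\<bar> * indicator (cball 0 (k + 1)) y)"
   proof (cases "y \<in> cball 0 (k + 1)")
    case True
    have "ennreal (norm (kp y * u y)) <= ennreal (L * \<bar>u y\<bar>)"
     using k(1)[of y] by (intro ennreal_leI) (auto simp: abs_mult intro: mult_right_mono)
    then show ?thesis using True L by (simp add: ennreal_mult)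
   next
    case False then show ?thesis using k(2)[of y] by simp
   qed
  qed
  also have "... = ennreal L * (\<integral>\<^sup>+y\<in>cball 0 (k + 1). ennreal \<bar>u y\<bar> \<partial>lborel)" by (rule nn_integral_cmult) measurable
  also have "... <= ennreal L * ennreal C" by (intro mult_left_mono b) auto
  also have "... = ennreal (L * C)" using L C by (simp add: ennreal_mult)
  finally show ?thesis using L C by (subst (asm) ennreal_le_iff) auto
 qed
 have "\<bar>LINT y|lborel. kern d (y - x) * u y\<bar> <= 1 * C"
 proof (rule key[OF avg_int[OF u]])
  show "\<bar>kern d (y - x)\<bar> <= 1" for y using kern_props(1,2)[of d "y - x"] d by simp
 qed (use kz x in auto)
 then show "\<bar>avg d u x\<bar> <= C / kmass TYPE('a) d" using mass by (simp add: avg_def abs_divide divide_right_mono)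
 have "\<bar>LINT y|lborel. (kern d (y - x) - kern d (y - x')) * u y\<bar> <= norm (x - x') * C"
 proof (rule key)
  show "integrable lborel (%y. (kern d (y - x) - kern d (y - x')) * u y)"
   unfolding left_diff_distrib by (intro Bochner_Integration.integrable_diff avg_int u)
  show "\<bar>kern d (y - x) - kern d (y - x')\<bar> <= norm (x - x')" for y
   using kern_props(4)[of d "y - x" "y - x'"] by (simp add: norm_minus_commute)
 qed (use kz x in auto)
 moreover have "(LINT y|lborel. (kern d (y - x) - kern d (y - x')) * u y) = (LINT y|lborel. kern d (y - x) * u y) - (LINT y|lborel. kern d (y - x') * u y)"
  unfolding left_diff_distrib by (intro Bochner_Integration.integral_diff avg_int u)
 ultimately show "\<bar>avg d u x - avg d u x'\<bar> <= norm (x - x') * C / kmass TYPE('a) d"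
  using mass by (simp add: avg_def abs_divide divide_right_mono diff_divide_distrib[symmetric])
qed

text \<open>\<open>u - avg d u\<close> is an average of increments u(x) - u(x + z) with |z| <= d;
  Fubini and the translation estimate give d times the L^1 norm of the gradient on the ball one unit
  larger.\<close>

lemma avg_approx:
 fixes u :: "'a::euclidean_space => real"
 assumes u: "u \<in> sm" and d: "0 < d" "d <= 1"
  and b: "(\<integral>\<^sup>+y\<in>cball 0 (k + 1). ennreal (norm (grad u y)) \<partial>lborel) <= ennreal C" and C: "0 <= C"
 shows "(\<integral>\<^sup>+x\<in>cball 0 k. ennreal \<bar>u x - avg d u x\<bar> \<partial>lborel) <= ennreal (d * C)"
proof -
 note [measurable] = sm_meas[OF u] grad_meas[OF u]
 have cu: "continuous_on UNIV u" by (rule sm_cont[OF u])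
 define M where "M = kmass TYPE('a) d"
 have M: "0 < M" unfolding M_def by (rule kmass_pos[OF d(1)])
 have km: "(kern d :: 'a => real) \<in> borel_measurable borel" using borel_measurable_integrable[OF kern_int, of d] by simp
 note [measurable] = km
 have pt: "ennreal \<bar>u x - avg d u x\<bar> <= ennreal (1 / M) * (\<integral>\<^sup>+z. ennreal (kern d z) * ennreal \<bar>u (x + z) - u x\<bar> \<partial>lborel)" for x
 proof -
  have e1: "(LINT y|lborel. kern d (y - x) * u y) = (LINT z|lborel. kern d z * u (x + z))"
   using integral_lborel_shift[of "%y. kern d (y - x) * u y" x] by (simp add: add.commute)
  have i1: "integrable lborel (%z. kern d z * u (x + z))"
   using avg_int[of "%z. u (x + z)" d 0] cu by (simp add: continuous_on_compose2[OF cu] continuous_intros)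
  have i2: "integrable lborel (%z::'a. kern d z * u x)" by (intro integrable_mult_left kern_int)
  have "M * (u x - avg d u x) = (LINT (z::'a)|lborel. kern d z * u x) - (LINT z|lborel. kern d z * u (x + z))"
   using M unfolding avg_def e1 M_def[symmetric] by (simp add: right_diff_distrib M_def kmass_def)
  also have "... = (LINT z|lborel. kern d z * u x - kern d z * u (x + z))"
   by (rule Bochner_Integration.integral_diff[symmetric, OF i2 i1])
  finally have e2: "M * (u x - avg d u x) = (LINT z|lborel. kern d z * u x - kern d z * u (x + z))" .
  have "ennreal (M * \<bar>u x - avg d u x\<bar>) = ennreal \<bar>LINT z|lborel. kern d z * u x - kern d z * u (x + z)\<bar>"
   unfolding e2[symmetric] using M by (simp add: abs_mult)
  also have "... <= (\<integral>\<^sup>+z. norm (kern d z * u x - kern d z * u (x + z)) \<partial>lborel)"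
   using integral_norm_bound_ennreal[OF Bochner_Integration.integrable_diff[OF i2 i1]] by simp
  also have "... = (\<integral>\<^sup>+z. ennreal (kern d z) * ennreal \<bar>u (x + z) - u x\<bar> \<partial>lborel)"
  proof (rule nn_integral_cong)
   fix z
   have "norm (kern d z * u x - kern d z * u (x + z)) = kern d z * \<bar>u (x + z) - u x\<bar>"
    using kern_props(1)[of d z] unfolding right_diff_distrib[symmetric] by (simp add: abs_mult abs_minus_commute)
   then show "ennreal (norm (kern d z * u x - kern d z * u (x + z))) = ennreal (kern d z) * ennreal \<bar>u (x + z) - u x\<bar>"
    using kern_props(1)[of d z] by (simp add: ennreal_mult)
  qed
  finally have f: "ennreal (M * \<bar>u x - avg d u x\<bar>) <= (\<integral>\<^sup>+z. ennreal (kern d z) * ennreal \<bar>u (x + z) - u x\<bar> \<partial>lborel)" .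
  have "ennreal \<bar>u x - avg d u x\<bar> = ennreal (1 / M) * ennreal (M * \<bar>u x - avg d u x\<bar>)"
   using M by (simp add: ennreal_mult[symmetric])
  also have "... <= ennreal (1 / M) * (\<integral>\<^sup>+z. ennreal (kern d z) * ennreal \<bar>u (x + z) - u x\<bar> \<partial>lborel)"
   by (intro mult_left_mono f) auto
  finally show ?thesis .
 qed
 have "(\<integral>\<^sup>+x\<in>cball 0 k. ennreal \<bar>u x - avg d u x\<bar> \<partial>lborel) \<le>
   (\<integral>\<^sup>+x. ennreal (1 / M) * (\<integral>\<^sup>+z. ennreal (kern d z) * ennreal \<bar>u (x + z) - u x\<bar> * indicator (cball 0 k) x \<partial>lborel) \<partial>lborel)"
  using pt by (intro nn_integral_mono) (auto simp: indicator_def)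
 also have "... = ennreal (1 / M) * (\<integral>\<^sup>+x. (\<integral>\<^sup>+z. ennreal (kern d z) * ennreal \<bar>u (x + z) - u x\<bar> * indicator (cball 0 k) x \<partial>lborel) \<partial>lborel)"
  by (rule nn_integral_cmult) measurable
 also have "(\<integral>\<^sup>+x. (\<integral>\<^sup>+z. ennreal (kern d z) * ennreal \<bar>u (x + z) - u x\<bar> * indicator (cball 0 k) x \<partial>lborel) \<partial>lborel)
   = (\<integral>\<^sup>+z. (\<integral>\<^sup>+x. ennreal (kern d z) * ennreal \<bar>u (x + z) - u x\<bar> * indicator (cball 0 k) x \<partial>lborel) \<partial>lborel)"
  by (rule lborel_pair.Fubini') measurable
 also have "... <= (\<integral>\<^sup>+z. ennreal (d * C) * ennreal (kern d (z::'a)) \<partial>lborel)"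
 proof (rule nn_integral_mono)
  fix z :: 'a
  show "(\<integral>\<^sup>+x. ennreal (kern d z) * ennreal \<bar>u (x + z) - u x\<bar> * indicator (cball 0 k) x \<partial>lborel) <= ennreal (d * C) * ennreal (kern d z)"
  proof (cases "norm z <= d")
   case True
   have "(\<integral>\<^sup>+x. ennreal (kern d z) * ennreal \<bar>u (x + z) - u x\<bar> * indicator (cball 0 k) x \<partial>lborel)
     = ennreal (kern d z) * (\<integral>\<^sup>+x\<in>cball 0 k. ennreal \<bar>u (x + z) - u x\<bar> \<partial>lborel)"
    unfolding mult.assoc by (rule nn_integral_cmult) measurable
   also have "... <= ennreal (kern d z) * (ennreal (norm z) * (\<integral>\<^sup>+x\<in>cball 0 (k + 1). ennreal (norm (grad u x)) \<partial>lborel))"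
   proof (intro mult_left_mono translation_estimate[OF sm_grad[OF u] sm_grad_cont[OF u]])
    fix x :: 'a and t :: real assume "x \<in> cball 0 k" "0 <= t" "t <= 1"
    moreover have "norm (t *R z) <= 1" using True d \<open>0 <= t\<close> \<open>t <= 1\<close> mult_mono[of t 1 "norm z" 1] by auto
    ultimately show "x + t *R z \<in> cball 0 (k + 1)" using norm_triangle_ineq[of x "t *R z"] by simp
   qed auto
   also have "... <= ennreal (kern d z) * (ennreal d * ennreal C)"
    by (intro mult_left_mono mult_mono b ennreal_leI True) auto
   also have "... = ennreal (d * C) * ennreal (kern d z)" using d C by (simp add: ennreal_mult mult_ac)
   finally show ?thesis .
  next
   case False then show ?thesis using kern_props(3)[of d z] by simp
  qed
 qed
 also have "... = ennreal (d * C) * (\<integral>\<^sup>+z. ennreal (kern d (z::'a)) \<partial>lborel)" by (rule nn_integral_cmult) measurable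
 also have "(\<integral>\<^sup>+z. ennreal (kern d (z::'a)) \<partial>lborel) = ennreal M"
  unfolding M_def kmass_def by (rule nn_integral_eq_integral[OF kern_int]) (auto intro: kern_props)
 also have "ennreal (1 / M) * (ennreal (d * C) * ennreal M) = ennreal ((1 / M) * ((d * C) * M))"
  using M d C by (simp only: ennreal_mult[symmetric] mult_nonneg_nonneg divide_nonneg_nonneg zero_le_one less_imp_le)
 also have "(1 / M) * ((d * C) * M) = d * C" using M by simp
 finally show ?thesis by (simp add: mult_left_mono)
qed

lemma avg_uniformly_Cauchy:
 fixes u :: "nat => 'a::euclidean_space => real"
 assumes u: "!!n. continuous_on UNIV (u n)" and d: "0 < d" "d <= 1"
  and b: "!!n. (\<integral>\<^sup>+y\<in>cball 0 (k + 1). ennreal \<bar>u n y\<bar> \<partial>lborel) <= ennreal C" and C: "0 < C"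
 shows "EX r. strict_mono (r::nat=>nat) & (\<forall>e>0. EX N. \<forall>n\<ge>N. \<forall>l\<ge>N. ALL x. norm x <= k --> \<bar>avg d (u (r n)) x - avg d (u (r l)) x\<bar> < e)"
proof -
 define L where "L = C / kmass TYPE('a) d"
 have L: "0 < L" using kmass_pos[OF d(1), where 'a='a] C by (simp add: L_def)
 have eq: "\<exists>dl. 0 < dl & (ALL n y. y \<in> cball 0 k & norm (x - y) < dl --> norm (avg d (u n) x - avg d (u n) y) < e)"
  if x: "x \<in> cball 0 k" "0 < e" for x :: 'a and e
 proof (intro exI[of _ "e / L"] conjI allI impI)
  fix n y assume y: "y \<in> cball 0 k & norm (x - y) < e / L"
  have "\<bar>avg d (u n) x - avg d (u n) y\<bar> <= norm (x - y) * C / kmass TYPE('a) d"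
   by (rule avg_bounds(2)[OF u d _ _ b]) (use x y C in auto)
  also have "... = norm (x - y) * L" by (simp add: L_def)
  also have "... < e" using y L by (simp add: field_simps)
  finally show "norm (avg d (u n) x - avg d (u n) y) < e" by simp
 qed (use x L in auto)
 obtain g r where gr: "strict_mono (r :: nat => nat)" "!!e. 0 < e ==> EX N. ALL n x. n >= N & x \<in> cball 0 k --> norm (avg d (u (r n)) x - g x) < e"
 proof (rule Arzela_Ascoli[of "cball 0 k" "%n. avg d (u n)" L])
  show "norm (avg d (u n) x) <= L" if "x \<in> cball 0 k" for n x
   unfolding L_def using avg_bounds(1)[OF u d _ _ b, of x x] that C by simp
 qed (use eq in auto)
 show ?thesis
 proof (intro exI[of _ r] conjI gr(1) allI impI)
  fix e :: real assume "0 < e"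
  then obtain N where N: "ALL n x. n >= N & x \<in> cball 0 k --> norm (avg d (u (r n)) x - g x) < e / 2" using gr(2)[of "e/2"] by auto
  show "EX N. \<forall>n\<ge>N. \<forall>l\<ge>N. ALL x. norm x <= k --> \<bar>avg d (u (r n)) x - avg d (u (r l)) x\<bar> < e"
  proof (intro exI[of _ N] allI impI)
   fix n l x assume "N <= n" "N <= l" "norm (x::'a) <= k"
   then have "norm (avg d (u (r n)) x - g x) < e / 2" "norm (avg d (u (r l)) x - g x) < e / 2" using N by auto
   then show "\<bar>avg d (u (r n)) x - avg d (u (r l)) x\<bar> < e" unfolding real_norm_def by linarith
  qed
 qed
qed

text \<open>At each scale d the averages are relatively compact on balls by Arzela-Ascoli, and they
  approximate the functions in L^1 at rate d uniformly in n. A diagonal subsequence is therefore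
  Cauchy in L^1 on every ball.\<close>

lemma rellich_test:
 fixes u :: "nat => 'a::euclidean_space => real"
 assumes u: "!!n. u n \<in> sm"
  and b: "!!n k. (\<integral>\<^sup>+y\<in>cball 0 (real k). ennreal \<bar>u n y\<bar> \<partial>lborel) <= ennreal (C k)"
  and bg: "!!n k. (\<integral>\<^sup>+y\<in>cball 0 (real k). ennreal (norm (grad (u n) y)) \<partial>lborel) <= ennreal (C k)" and C: "!!k. 0 < C k"
 shows "EX r w0. strict_mono r & w0 \<in> LM & (AE x in lebesgue. (%n. u (r n) x) ~~> w0 x)"
proof -
 define dl where "dl = (%k. 1 / real (Suc k))"
 have dl: "0 < dl k" "dl k <= 1" for k by (auto simp: dl_def)
 \<comment> \<open>One index k stands for the radius of the ball and for the scale 1/(k + 1), so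
   that one diagonal sequence serves all radii and all scales.\<close>
 define Q where "Q = (%(k::nat) (s::nat => nat). \<forall>e>0. EX N. \<forall>n\<ge>N. \<forall>l\<ge>N. ALL x. norm x <= real k --> \<bar>avg (dl k) (u (s n)) x - avg (dl k) (u (s l)) x\<bar> < e)"
 have bS: "(\<integral>\<^sup>+y\<in>cball 0 (real k + 1). ennreal \<bar>u n y\<bar> \<partial>lborel) <= ennreal (C (Suc k))" for n k
  using b[where k = "Suc k"] by (simp add: add.commute)
 have bgS: "(\<integral>\<^sup>+y\<in>cball 0 (real k + 1). ennreal (norm (grad (u n) y)) \<partial>lborel) <= ennreal (C (Suc k))" for n k
  using bg[where k = "Suc k"] by (simp add: add.commute)
 interpret subseqs Q
 proof
  fix n and s :: "nat => nat" assume "strict_mono s"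
  show "EX r'. strict_mono r' & Q n (s \<circ> r')"
   unfolding Q_def o_def by (rule avg_uniformly_Cauchy[OF sm_cont[OF u] dl bS C])
 qed
 have stable: "Q n (s \<circ> r)" if st: "strict_mono r" and qs: "Q n s" for r s n
  unfolding Q_def
 proof (intro allI impI)
  fix e :: real assume "0 < e"
  then obtain N where N: "\<forall>n'\<ge>N. \<forall>l\<ge>N. ALL x. norm x <= real n --> \<bar>avg (dl n) (u (s n')) x - avg (dl n) (u (s l)) x\<bar> < e"
   using qs unfolding Q_def by blast
  have "n' <= r n'" for n' by (rule strict_mono_imp_increasing[OF st])
  then show "EX N. \<forall>n'\<ge>N. \<forall>l\<ge>N. ALL x. norm x <= real n --> \<bar>avg (dl n) (u ((s \<circ> r) n')) x - avg (dl n) (u ((s \<circ> r) l)) x\<bar> < e"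
   using N by (intro exI[of _ N]) (auto intro: order_trans)
 qed
 have Qd: "Q k (%n. diagseq (n + Suc k))" for k
  using diagseq_holds[OF stable, of k] by (simp add: o_def add.commute)
 define w where "w = (%n. u (diagseq n))"
 note us = u
 have wm: "w n \<in> LM" for n unfolding w_def by (rule sm_meas_leb[OF u])
 have "EX r w0. strict_mono r & w0 \<in> LM & (AE x in lebesgue. (%n. w (r n) x) ~~> w0 x)"
 proof (rule loc_L1_Cauchy_AE[OF wm])
  fix k0 :: nat and e :: real assume e: "0 < e"
  define B where "B = cball (0::'a) (real k0)"
  have [measurable]: "B \<in> sets borel" by (simp add: B_def)
  define \<mu> where "\<mu> = measure lborel B"
  have \<mu>: "emeasure lborel B = ennreal \<mu>" "0 <= \<mu>"
   using emeasure_bounded_finite[of B] by (auto simp: \<mu>_def B_def emeasure_eq_ennreal_measure less_top[symmetric])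
  have "(%k. dl k * C (Suc k0)) ~~> 0 * C (Suc k0)" unfolding dl_def by (intro tendsto_intros inverse_Suc_tendsto)
  then have "eventually (%k. dl k * C (Suc k0) < e / 3) sequentially" by (rule order_tendstoD) (use e in auto)
  then obtain k1 where k1: "!!k. k1 <= k ==> dl k * C (Suc k0) < e / 3" by (auto simp: eventually_sequentially)
  \<comment> \<open>At least k0, so that the uniform estimate covers the given ball; at least k1, so
    that the scale is fine enough.\<close>
  define k where "k = max k0 k1"
  have k: "k0 <= k" "dl k * C (Suc k0) < e / 3" using k1[of k] by (auto simp: k_def)
  define e' where "e' = e / (3 * (\<mu> + 1))"
  have e': "0 < e'" "e' * \<mu> <= e / 3" using e \<mu>(2) by (auto simp: e'_def field_simps)
  obtain N where N: "\<forall>n\<ge>N. \<forall>l\<ge>N. ALL x. norm x <= real k --> \<bar>avg (dl k) (u (diagseq (n + Suc k))) x - avg (dl k) (u (diagseq (l + Suc k))) x\<bar> < e'"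
   using Qd[of k] e'(1) unfolding Q_def by blast
  show "EX N. \<forall>n\<ge>N. \<forall>l\<ge>N. (\<integral>\<^sup>+x\<in>cball 0 (real k0). ennreal (norm (w n x - w l x)) \<partial>lebesgue) <= ennreal e"
  proof (intro exI[of _ "N + Suc k"] allI impI)
   fix n l assume nl: "N + Suc k <= n" "N + Suc k <= l"
   have av: "\<bar>avg (dl k) (w n) x - avg (dl k) (w l) x\<bar> <= e'" if "x \<in> B" for x
    using N[rule_format, of "n - Suc k" "l - Suc k" x] nl that k(1) unfolding w_def B_def by force
   have ws: "w n \<in> sm" for n unfolding w_def by (rule u)
   have bSw: "(\<integral>\<^sup>+y\<in>cball 0 (real j + 1). ennreal \<bar>w n y\<bar> \<partial>lborel) <= ennreal (C (Suc j))" for n j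
    unfolding w_def by (rule bS)
   have cavg: "avg (dl k) (w n) \<in> borel_measurable borel" for n
   proof (rule borel_measurable_continuous_onI, rule continuous_onI)
    fix x :: 'a and ep :: real assume ep: "0 < ep"
    obtain j :: nat where j: "norm x + 1 <= real j" using real_arch_simple by blast
    define L where "L = C (Suc j) / kmass TYPE('a) (dl k)"
    have L: "0 < L" using kmass_pos[OF dl(1)[of k], where 'a='a] C by (simp add: L_def)
    show "\<exists>d>0. \<forall>x'\<in>UNIV. dist x' x < d --> dist (avg (dl k) (w n) x') (avg (dl k) (w n) x) <= ep"
    proof (intro exI[of _ "min 1 (ep / L)"] conjI ballI impI)
     fix x' assume x': "dist x' x < min 1 (ep / L)"
     have n': "norm x' <= real j" using x' j norm_triangle_ineq2[of x' x] by (auto simp: dist_norm)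
     have "\<bar>avg (dl k) (w n) x' - avg (dl k) (w n) x\<bar> <= norm (x' - x) * C (Suc j) / kmass TYPE('a) (dl k)"
      by (rule avg_bounds(2)[OF sm_cont[OF ws] dl n' _ bSw]) (use j C[of "Suc j"] in auto)
     also have "... = norm (x' - x) * L" by (simp add: L_def)
     also have "... <= ep" using x' L by (simp add: dist_norm field_simps)
     finally show "dist (avg (dl k) (w n) x') (avg (dl k) (w n) x) <= ep" by (simp add: dist_real_def)
    qed (use L ep in auto)
   qed
   note [measurable] = cavg sm_meas[OF ws]
   have ap: "(\<integral>\<^sup>+x\<in>B. ennreal \<bar>w n x - avg (dl k) (w n) x\<bar> \<partial>lborel) <= ennreal (e / 3)" for n
   proof -
    have "(\<integral>\<^sup>+x\<in>B. ennreal \<bar>w n x - avg (dl k) (w n) x\<bar> \<partial>lborel) <= ennreal (dl k * C (Suc k0))"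
     unfolding B_def by (rule avg_approx[OF ws dl]) (use bgS[where k = k0] C[of "Suc k0"] in \<open>auto simp: w_def less_imp_le\<close>)
    also have "... <= ennreal (e / 3)" using k by (intro ennreal_leI) auto
    finally show ?thesis .
   qed
   have "(\<integral>\<^sup>+x\<in>B. ennreal (norm (w n x - w l x)) \<partial>lborel) \<le>
    (\<integral>\<^sup>+x. (ennreal \<bar>w n x - avg (dl k) (w n) x\<bar> * indicator B x + ennreal \<bar>w l x - avg (dl k) (w l) x\<bar> * indicator B x) + ennreal e' * indicator B x \<partial>lborel)"
   proof (rule nn_integral_mono)
    fix x
    show "ennreal (norm (w n x - w l x)) * indicator B x <= (ennreal \<bar>w n x - avg (dl k) (w n) x\<bar> * indicator B x + ennreal \<bar>w l x - avg (dl k) (w l) x\<bar> * indicator B x) + ennreal e' * indicator B x"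
    proof (cases "x \<in> B")
     case True
     have "norm (w n x - w l x) <= (\<bar>w n x - avg (dl k) (w n) x\<bar> + \<bar>w l x - avg (dl k) (w l) x\<bar>) + e'"
      using av[OF True] unfolding real_norm_def by linarith
     then have "ennreal (norm (w n x - w l x)) <= ennreal ((\<bar>w n x - avg (dl k) (w n) x\<bar> + \<bar>w l x - avg (dl k) (w l) x\<bar>) + e')" by (rule ennreal_leI)
     then show ?thesis using True e' by simp
    qed simp
   qed
   also have "... = ((\<integral>\<^sup>+x\<in>B. ennreal \<bar>w n x - avg (dl k) (w n) x\<bar> \<partial>lborel) + (\<integral>\<^sup>+x\<in>B. ennreal \<bar>w l x - avg (dl k) (w l) x\<bar> \<partial>lborel)) + (\<integral>\<^sup>+x. ennreal e' * indicator B x \<partial>lborel)"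
    by (subst nn_integral_add, measurable, subst nn_integral_add, measurable)
   also have "(\<integral>\<^sup>+x. ennreal e' * indicator B x \<partial>lborel) = ennreal (e' * \<mu>)"
    using e' \<mu> by (subst nn_integral_cmult_indicator) (auto simp: ennreal_mult)
   also have "((\<integral>\<^sup>+x\<in>B. ennreal \<bar>w n x - avg (dl k) (w n) x\<bar> \<partial>lborel) + (\<integral>\<^sup>+x\<in>B. ennreal \<bar>w l x - avg (dl k) (w l) x\<bar> \<partial>lborel)) + ennreal (e' * \<mu>)
     <= (ennreal (e / 3) + ennreal (e / 3)) + ennreal (e / 3)"
    by (intro add_mono ap ennreal_leI e')
   also have "... = ennreal e" using e by (simp flip: ennreal_plus)
   finally show "(\<integral>\<^sup>+x\<in>cball 0 (real k0). ennreal (norm (w n x - w l x)) \<partial>lebesgue) <= ennreal e"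
    by (simp add: nn_integral_completion B_def)
  qed
 qed
 then obtain r w0 where r: "strict_mono r" "w0 \<in> LM" "AE x in lebesgue. (%n. w (r n) x) ~~> w0 x" by blast
 show ?thesis
  using r strict_mono_o[OF subseq_diagseq r(1)] unfolding w_def by (intro exI[of _ "diagseq \<circ> r"] exI[of _ w0]) (auto simp: o_def)
qed

context orlicz_pair
begin

lemma loc_L1_bound:
 fixes w :: "'a => 'b::euclidean_space"
 assumes G: "gf G q" and [measurable]: "w \<in> borel_measurable borel" and b: "mL G w <= ennreal B" "0 <= B"
 shows "(\<integral>\<^sup>+y\<in>cball 0 (real k). ennreal (norm (w y)) \<partial>lborel) <= ennreal (measure lborel (cball (0::'a) (real k)) + 1 / G 1 * B)"
proof -
 have fin: "emeasure lborel (cball (0::'a) (real k)) = ennreal (measure lborel (cball (0::'a) (real k)))"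
  using emeasure_bounded_finite[of "cball (0::'a) (real k)"] by (auto simp: emeasure_eq_ennreal_measure less_top[symmetric])
 have "(\<integral>\<^sup>+y\<in>cball 0 (real k). ennreal (norm (w y)) \<partial>lborel) <= ennreal 1 * emeasure lborel (cball (0::'a) (real k)) + ennreal (1 / G 1) * mo lborel G w"
  by (rule nn_integral_le_mo[OF G]) auto
 also have "mo lborel G w = mL G w" by (simp add: mo_def nn_integral_completion)
 also have "ennreal 1 * emeasure lborel (cball (0::'a) (real k)) + ennreal (1 / G 1) * mL G w
   <= ennreal (measure lborel (cball (0::'a) (real k))) + ennreal (1 / G 1) * ennreal B"
  unfolding fin by (intro add_mono mult_left_mono b) auto
 also have "... = ennreal (measure lborel (cball (0::'a) (real k)) + 1 / G 1 * B)"
  using gf_pos[OF G zero_less_one] b(2) by (simp only: ennreal_mult[symmetric] ennreal_plus measure_nonneg divide_nonneg_nonneg zero_le_one less_imp_le mult_nonneg_nonneg)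
 finally show ?thesis .
qed

text \<open>Test functions at modular distance 1/(n + 1) inherit the bounds; along a further
  subsequence their differences from the given functions vanish a.e., so both have the same
  limit.\<close>

lemma rellich:
 fixes v :: "nat => 'a => real"
 assumes D: "!!n. D (v n) (h n)" and b: "!!n. mL P (h n) <= ennreal R"
 shows "EX r v0. strict_mono r & v0 \<in> LM & (AE x in lebesgue. (%n. v (r n) x) ~~> v0 x)"
proof -
 note [measurable] = D_meas[OF D]
 have "\<exists>pf. ALL n. test_fn (pf n) & mL Ps (%x. pf n x - v n x) <= ennreal (1 / real (Suc n)) & mL P (%x. grad (pf n) x - h n x) <= ennreal (1 / real (Suc n))"
  by (intro choice allI D_approx D) simp
 then obtain pf where pf: "!!n. test_fn (pf n)" "!!n. mL Ps (%x. pf n x - v n x) <= ennreal (1 / real (Suc n))"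
   "!!n. mL P (%x. grad (pf n) x - h n x) <= ennreal (1 / real (Suc n))" by blast
 have s: "pf n \<in> sm" for n by (rule test_sm[OF pf(1)])
 note [measurable] = sm_meas_leb[OF s] grad_meas_leb[OF s]
 define R1 where "R1 = 2 powr m * (1 + max 0 R)"
 have gb: "mL P (grad (pf n)) <= ennreal R1" for n
 proof -
  have "mL P (%x. (grad (pf n) x - h n x) + h n x) <= ennreal (2 powr m) * (mL P (%x. grad (pf n) x - h n x) + mL P (h n))"
   by (rule mo_add[OF gP]) measurable
  also have "... <= ennreal (2 powr m) * (ennreal 1 + ennreal (max 0 R))"
   by (intro mult_left_mono add_mono order_trans[OF pf(3)] order_trans[OF b] ennreal_leI) auto
  also have "... = ennreal R1" unfolding R1_def by (rule ennreal_ma) auto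
  finally show ?thesis by simp
 qed
 obtain R2' where R2': "!!u g. D u g ==> mL P g <= ennreal R1 ==> mL Ps u <= ennreal R2'"
  using sobolev_bound[of R1] by blast
 define R2 where "R2 = max 0 R2'"
 have ub: "mL Ps (pf n) <= ennreal R2" for n
  using R2'[OF D_test[OF pf(1)] gb] unfolding R2_def by (rule order_trans) (simp add: ennreal_leI)
 define C where "C = (%k. measure lborel (cball (0::'a) (real k)) + 1 / P 1 * R1 + 1 / Ps 1 * R2 + 1)"
 have pp: "0 < P 1" "0 < Ps 1" by (auto intro: gf_pos[OF gP] gf_pos[OF gPs])
 have R12: "0 <= R1" "0 <= R2" by (auto simp: R1_def R2_def)
 have "EX r w0. strict_mono r & w0 \<in> LM & (AE x in lebesgue. (%n. pf (r n) x) ~~> w0 x)"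
 proof (rule rellich_test[OF s])
  fix n k
  show "(\<integral>\<^sup>+y\<in>cball 0 (real k). ennreal \<bar>pf n y\<bar> \<partial>lborel) <= ennreal (C k)"
   unfolding real_norm_def[symmetric]
   by (rule order_trans[OF loc_L1_bound[OF gPs sm_meas[OF s] ub R12(2)]]) (use R12 pp in \<open>auto simp: C_def intro!: ennreal_leI\<close>)
  show "(\<integral>\<^sup>+y\<in>cball 0 (real k). ennreal (norm (grad (pf n) y)) \<partial>lborel) <= ennreal (C k)"
   by (rule order_trans[OF loc_L1_bound[OF gP grad_meas[OF s] gb R12(1)]]) (use R12 pp in \<open>auto simp: C_def intro!: ennreal_leI\<close>)
 next
  show "0 < C k" for k unfolding C_def using R12 pp by (intro add_nonneg_pos add_nonneg_nonneg) auto
 qed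
 then obtain r w0 where r: "strict_mono (r::nat=>nat)" "w0 \<in> LM" "AE x in lebesgue. (%n. pf (r n) x) ~~> w0 x" by blast
 have "(%n. mL Ps (%x. pf n x - v n x)) ~~> 0" by (rule ennreal_tendsto_0_bound[OF pf(2) inverse_Suc_tendsto])
 then have l: "(%n. mL Ps (%x. pf (r n) x - v (r n) x)) ~~> 0"
  using LIMSEQ_subseq_LIMSEQ[OF _ r(1)] by (fastforce simp: o_def)
 have "EX q. strict_mono q & (AE x in lebesgue. (%n. pf (r (q n)) x - v (r (q n)) x) ~~> 0)"
  by (rule AE_subseq_null[OF gPs _ l]) measurable
 then obtain q where q: "strict_mono (q::nat=>nat)" "AE x in lebesgue. (%n. pf (r (q n)) x - v (r (q n)) x) ~~> 0" by blast
 have "AE x in lebesgue. (%n. v (r (q n)) x) ~~> w0 x"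
  using r(3) q(2)
 proof eventually_elim
  case (elim x)
  have "(%n. pf (r (q n)) x) ~~> w0 x" using LIMSEQ_subseq_LIMSEQ[OF elim(1) q(1)] by (simp add: o_def)
  from tendsto_diff[OF this elim(2)] show ?case by simp
 qed
 then show ?thesis using r(2) strict_mono_o[OF r(1) q(1)] by (intro exI[of _ "r \<circ> q"] exI[of _ w0]) (auto simp: o_def)
qed

end

section \<open>Midpoints of bounded sequences\<close>

lemma powr_above_tangent:
 assumes m: "1 < (m::real)" and x: "0 < x" "x ~= 1"
 shows "1 + m * (x - 1) < x powr m"
proof -
 define f where "f = (%x::real. x powr m - m * x)"
 have d: "(f has_real_derivative m * (t powr (m - 1) - 1)) (at t)" if "0 < t" for t
  unfolding f_def using that by (auto intro!: derivative_eq_intros simp: algebra_simps)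
 have "f 1 < f x"
 proof (cases "1 < x")
  case True
  show ?thesis
  proof (rule DERIV_pos_imp_increasing_open[OF True])
   fix t assume t: "1 < t" "t < x"
   have "1 < t powr (m - 1)" using t m by (intro gr_one_powr) auto
   then show "EX y. (f has_real_derivative y) (at t) & 0 < y"
    using d[of t] t m by (intro exI[of _ "m * (t powr (m - 1) - 1)"]) auto
  next
   show "continuous_on {1..x} f" by (rule DERIV_continuous_on, rule has_field_derivative_at_within, rule d) auto
  qed
 next
  case False
  then have x1: "x < 1" using x by simp
  show ?thesis
  proof (rule DERIV_neg_imp_decreasing_open[OF x1])
   fix t assume t: "x < t" "t < 1"
   have "t powr (m - 1) < 1 powr (m - 1)" using t m x by (intro powr_less_mono2) auto
   then show "EX y. (f has_real_derivative y) (at t) & y < 0"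
    using d[of t] t m x by (intro exI[of _ "m * (t powr (m - 1) - 1)"]) (auto simp: mult_pos_neg)
  next
   show "continuous_on {x..1} f" by (rule DERIV_continuous_on, rule has_field_derivative_at_within, rule d) (use x in auto)
  qed
 qed
 then show ?thesis by (simp add: f_def algebra_simps)
qed

text \<open>The tangent inequality at 1, applied to s/c and t/c with c the mean; the linear terms
  cancel because these two numbers average to 1.\<close>

lemma powr_midpoint_strict:
 assumes m: "1 < (m::real)" and st: "0 <= s" "0 <= t" "s ~= t"
 shows "((s + t) / 2) powr m < (s powr m + t powr m) / 2"
proof -
 define c where "c = (s + t) / 2"
 have c: "0 < c" using st by (auto simp: c_def)
 have t: "1 + m * (x - 1) <= x powr m" if "0 <= x" for x :: real
 proof (cases "x = 0 \<or> x = 1")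
  case True then show ?thesis using m by auto
 next
  case False then show ?thesis using powr_above_tangent[OF m, of x] that by simp
 qed
 have strict: "1 + m * (x - 1) < x powr m" if "0 <= x" "x ~= 1" for x :: real
 proof (cases "x = 0")
  case True then show ?thesis using m by auto
 next
  case False then show ?thesis using powr_above_tangent[OF m, of x] that by simp
 qed
 have "s + t = 2 * c" by (simp add: c_def)
 then have "s / c + t / c = (2 * c) / c" by (simp only: add_divide_distrib[symmetric])
 then have "s / c + t / c = 2" using c by simp
 then have sum: "m * (s / c - 1) + m * (t / c - 1) = 0"
 proof -
  assume "s / c + t / c = 2"
  have "m * (s / c - 1) + m * (t / c - 1) = m * (s / c + t / c - 2)" by (simp only: distrib_left[symmetric]) simp
  then show ?thesis using \<open>s / c + t / c = 2\<close> by simp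
 qed
 have "s / c ~= 1" using c st by (auto simp: c_def field_simps)
 then have "(1 + m * (s / c - 1)) + (1 + m * (t / c - 1)) < (s / c) powr m + (t / c) powr m"
  using strict[of "s / c"] t[of "t / c"] st c by (intro add_less_le_mono) auto
 then have "2 < (s / c) powr m + (t / c) powr m" using sum by linarith
 then have "2 < (s powr m + t powr m) / c powr m" using st c by (simp add: powr_divide add_divide_distrib)
 then show ?thesis using c unfolding c_def[symmetric] by (simp add: field_simps)
qed

text \<open>If the norms differ, strictness comes from the scalar power; if they agree, from the
  parallelogram law.\<close>

lemma norm_powr_midpoint_strict:
 fixes x y :: "'b::euclidean_space"
 assumes m: "1 < (m::real)" and xy: "x ~= y"
 shows "norm ((1/2) *R (x + y)) powr m < (norm x powr m + norm y powr m) / 2"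
proof (cases "norm x = norm y")
 case False
 have "norm ((1/2) *R (x + y)) powr m <= ((norm x + norm y) / 2) powr m"
  using m norm_triangle_ineq[of x y] by (intro powr_mono2) auto
 also have "... < (norm x powr m + norm y powr m) / 2" by (rule powr_midpoint_strict[OF m _ _ False]) auto
 finally show ?thesis .
next
 case True
 have "(norm (x + y))\<^sup>2 + (norm (x - y))\<^sup>2 = 2 * (norm x)\<^sup>2 + 2 * (norm y)\<^sup>2"
  by (simp add: power2_norm_eq_inner inner_add_left inner_add_right inner_diff_left inner_diff_right)
 moreover have "0 < (norm (x - y))\<^sup>2" using xy by simp
 ultimately have "(norm (x + y))\<^sup>2 < 4 * (norm y)\<^sup>2" unfolding True by linarith
 then have "(norm (x + y))\<^sup>2 < (2 * norm x)\<^sup>2" by (simp add: True power_mult_distrib)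
 then have "norm (x + y) < 2 * norm x" by (rule power2_less_imp_less) simp
 then have "norm ((1/2) *R (x + y)) powr m < norm x powr m" using m by (intro powr_less_mono2) auto
 then show ?thesis using True by simp
qed

text \<open>By homogeneity of degree m it suffices to treat pairs with larger norm 1. On the compact
  set of those with \<open>norm (x - y) powr m >= ep\<close> the midpoint defect has a positive
  minimum al; the remaining pairs are covered by the ep term.\<close>

lemma uniform_convexity:
 assumes m: "1 < (m::real)" and ep: "0 < ep"
 shows "\<exists>K\<ge>0. \<forall>x y :: 'b::euclidean_space. norm (x - y) powr m <= ep * (norm x powr m + norm y powr m)
   + K * ((norm x powr m + norm y powr m) / 2 - norm ((1/2) *R (x + y)) powr m)"
proof -
 define S where "S = {z :: 'b \<times> 'b. max (norm (fst z)) (norm (snd z)) = 1 & ep <= norm (fst z - snd z) powr m}"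
 define A where "A = (%z :: 'b \<times> 'b. (norm (fst z) powr m + norm (snd z) powr m) / 2 - norm ((1/2) *R (fst z + snd z)) powr m)"
 have cn: "continuous_on UNIV (%z. norm (f z) powr m)" if "continuous_on UNIV f" for f :: "'b \<times> 'b => 'b"
  using that by (intro continuous_on_powr' continuous_intros) (use m in auto)
 have cA: "continuous_on UNIV A" unfolding A_def by (intro continuous_intros cn; simp)
 have "S = (%z. max (norm (fst z)) (norm (snd z))) -` {1} \<inter> (%z. norm (fst z - snd z) powr m) -` {ep..}"
  unfolding S_def by auto
 moreover have "closed ((%z :: 'b \<times> 'b. max (norm (fst z)) (norm (snd z))) -` {1})"
  by (intro closed_vimage continuous_intros; simp)
 moreover have "closed ((%z :: 'b \<times> 'b. norm (fst z - snd z) powr m) -` {ep..})"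
  by (intro closed_vimage cn continuous_intros; simp)
 ultimately have "closed S" by auto
 moreover have "bounded S"
 proof (rule boundedI[of _ 2])
  fix z assume "z \<in> S"
  then have "norm (fst z) <= 1" "norm (snd z) <= 1" by (auto simp: S_def max_def split: if_splits)
  then show "norm z <= 2" using norm_Pair_le[of "fst z" "snd z"] by simp
 qed
 ultimately have cS: "compact S" by (simp add: compact_eq_bounded_closed)
 have Apos: "0 < A z" if "z \<in> S" for z
 proof -
  have "fst z ~= snd z" using that ep m by (auto simp: S_def)
  then show ?thesis using norm_powr_midpoint_strict[OF m, of "fst z" "snd z"] by (simp add: A_def)
 qed
 have "\<exists>al>0. \<forall>z\<in>S. al <= A z"
 proof (cases "S = {}")
  case False
  obtain z0 where "z0 \<in> S" "\<forall>z\<in>S. A z0 <= A z"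
   using continuous_attains_inf[OF cS False continuous_on_subset[OF cA]] by blast
  then show ?thesis using Apos by blast
 qed (auto intro: exI[of _ 1])
 then obtain al where al: "0 < al" "!!z. z \<in> S ==> al <= A z" by blast
 have A0: "0 <= A (x, y)" for x y
  using norm_powr_midpoint_strict[OF m, of x y] by (cases "x = y") (auto simp: A_def scaleR_2[symmetric])
 \<comment> \<open>\<open>2 powr m\<close> bounds the left side on normalised pairs.\<close>
 define K where "K = 2 powr m / al"
 have K: "0 <= K" using al by (simp add: K_def)
 show ?thesis
 proof (intro exI[of _ K] conjI K allI)
  fix x y :: 'b
  define t where "t = max (norm x) (norm y)"
  show "norm (x - y) powr m <= ep * (norm x powr m + norm y powr m)
   + K * ((norm x powr m + norm y powr m) / 2 - norm ((1/2) *R (x + y)) powr m)"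
  proof (cases "t = 0")
   case True
   then have "x = 0" "y = 0" by (auto simp: t_def max_def split: if_splits)
   then show ?thesis using m by simp
  next
   case False
   then have t: "0 < t" by (auto simp: t_def max_def)
   have tm: "t powr m <= norm x powr m + norm y powr m" by (auto simp: t_def max_def)
   show ?thesis
   proof (cases "norm (x - y) powr m < ep * t powr m")
    case True
    then have "norm (x - y) powr m <= ep * (norm x powr m + norm y powr m)"
     using mult_left_mono[OF tm, of ep] ep by linarith
    moreover have "0 <= K * A (x, y)" using K A0 by simp
    ultimately show ?thesis by (simp add: A_def)
   next
    case False
    define z where "z = ((1/t) *R x, (1/t) *R y)"
    have sc: "norm ((1/t) *R w) powr m = norm w powr m / t powr m" for w :: 'b
     using t by (simp add: powr_divide)
    have "max (norm (fst z)) (norm (snd z)) = 1"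
    proof (cases "norm x <= norm y")
     case True
     then have "t = norm y" by (simp add: t_def)
     then show ?thesis using True t by (simp add: z_def max_def divide_le_eq_1)
    next
     case False
     then have "t = norm x" by (simp add: t_def)
     then show ?thesis using False t by (simp add: z_def max_def divide_le_eq_1)
    qed
    moreover have "ep <= norm (fst z - snd z) powr m"
    proof -
     have "fst z - snd z = (1/t) *R (x - y)" by (simp add: z_def scaleR_diff_right)
     then have "norm (fst z - snd z) powr m = norm (x - y) powr m / t powr m" by (simp only: sc)
     then show ?thesis using False t by (simp add: le_divide_eq not_less)
    qed
    ultimately have "z \<in> S" by (simp add: S_def)
    then have "al <= A z" by (rule al(2))
    moreover have "A z = A (x, y) / t powr m"
    proof -
     have "(1/2) *R (fst z + snd z) = (1/t) *R ((1/2) *R (x + y))" by (simp add: z_def scaleR_add_right mult.commute)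
     then have n3: "norm ((1/2) *R (fst z + snd z)) powr m = norm ((1/2) *R (x + y)) powr m / t powr m" by (simp only: sc)
     have n1: "norm (fst z) powr m = norm x powr m / t powr m" "norm (snd z) powr m = norm y powr m / t powr m"
      by (simp_all only: z_def fst_conv snd_conv sc)
     show ?thesis unfolding A_def n1 n3 fst_conv snd_conv by (simp add: diff_divide_distrib add_divide_distrib)
    qed
    ultimately have "al * t powr m <= A (x, y)" using t by (simp add: field_simps)
    then have "2 powr m * t powr m <= K * A (x, y)" using al(1) by (simp add: K_def field_simps)
    moreover have "norm (x - y) powr m <= (2 * t) powr m"
     using norm_triangle_ineq4[of x y] m by (intro powr_mono2) (auto simp: t_def max_def)
    moreover have "0 <= ep * (norm x powr m + norm y powr m)" using ep by simp
    ultimately show ?thesis using t by (simp add: A_def powr_mult)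
   qed
  qed
 qed
qed

section \<open>Convex combinations of tails by iterated midpoints\<close>

context orlicz_pair
begin

abbreviation "E \<equiv> %w :: 'a => 'a. mL (%t. t powr m) w"

lemma gE: "gf (%t. t powr m) m" using m1 by (intro gf_powr) auto

text \<open>Dyadic convex combinations of the tail from n. Pairing functions with gradients gives
  both the same weights, and the inductive form reduces every convexity estimate to a single
  midpoint.\<close>

inductive_set mid :: "(nat => 'a => real) => (nat => 'a => 'a) => nat => (('a => real) \<times> ('a => 'a)) set"
 for v h n where
 base: "n <= k ==> (v k, h k) \<in> mid v h n"
| avg: "(u, g) \<in> mid v h n ==> (u', g') \<in> mid v h n ==>
  (%x. (1/2) * u x + (1/2) * u' x, %x. (1/2) *R g x + (1/2) *R g' x) \<in> mid v h n"

lemma mid_mono': "(u, g) \<in> mid v h k ==> n <= k ==> (u, g) \<in> mid v h n"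
proof (induction rule: mid.induct)
 case (base j)
 then show ?case by (intro mid.base) simp
next
 case (avg u g u' g')
 then show ?case by (intro mid.avg)
qed

lemma mid_mono: "z \<in> mid v h k ==> n <= k ==> z \<in> mid v h n"
 using mid_mono'[of "fst z" "snd z"] by simp

lemma mid_D': "(u, g) \<in> mid v h n ==> (!!k. D (v k) (h k)) ==> D u g"
proof (induction rule: mid.induct)
 case (avg u g u' g')
 show ?case by (rule D_lin) (use avg in auto)
qed auto

lemma mid_D: "z \<in> mid v h n ==> (!!k. D (v k) (h k)) ==> D (fst z) (snd z)"
 using mid_D'[of "fst z" "snd z"] by simp

lemma mid_close: "(u, g) \<in> mid v h n ==> (!!k. n <= k ==> \<bar>v k x - c\<bar> <= e) ==> \<bar>u x - c\<bar> <= (e::real)"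
proof (induction rule: mid.induct)
 case (avg u g u' g')
 then have "\<bar>u x - c\<bar> <= e" "\<bar>u' x - c\<bar> <= e" by auto
 then show ?case by (simp add: abs_le_iff field_simps)
qed auto

text \<open>Sublevel sets of a midpoint-convex modular are closed under midpoints. The scalar c is
  part of the statement so that bounds on all multiples pass to the same combinations.\<close>

lemma mid_modular':
 assumes G: "gf G q" and cv: "!!s t. 0 <= s ==> 0 <= t ==> G ((1/2) * s + (1/2) * t) <= (1/2) * G s + (1/2) * G t"
  and z: "(w, z) \<in> mid v h n" and D: "!!k. D (v k) (h k)" and b: "!!k. n <= k ==> mL G (%x. c *R h k x) <= B"
 shows "mL G (%x. c *R z x) <= B"
 using z b
proof (induction rule: mid.induct)
 case (avg u g u' g')
 have [measurable]: "g \<in> LM" "g' \<in> LM"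
  using D_meas(2)[OF mid_D'[OF avg(1) D]] D_meas(2)[OF mid_D'[OF avg(2) D]] by simp_all
 note [measurable] = gf_meas_e[OF G]
 have IH: "mL G (%x. c *R g x) <= B" "mL G (%x. c *R g' x) <= B" using avg by auto
 have "mL G (%x. c *R ((1/2) *R g x + (1/2) *R g' x)) <= (\<integral>\<^sup>+x. ennreal (1/2) * (ennreal (G (norm (c *R g x))) + ennreal (G (norm (c *R g' x)))) \<partial>lebesgue)"
  unfolding mo_def
 proof (rule nn_integral_mono)
  fix x
  have "norm (c *R ((1/2) *R g x + (1/2) *R g' x)) <= (1/2) * norm (c *R g x) + (1/2) * norm (c *R g' x)"
   using norm_triangle_ineq[of "c *R (1/2) *R g x" "c *R (1/2) *R g' x"] by (simp add: scaleR_add_right)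
  then have "G (norm (c *R ((1/2) *R g x + (1/2) *R g' x))) <= G ((1/2) * norm (c *R g x) + (1/2) * norm (c *R g' x))"
   by (intro gf_mono[OF G]) auto
  also have "... <= (1/2) * G (norm (c *R g x)) + (1/2) * G (norm (c *R g' x))" by (rule cv) auto
  also have "... = (1/2) * (G (norm (c *R g x)) + G (norm (c *R g' x)))" by (simp add: algebra_simps)
  finally have "ennreal (G (norm (c *R ((1/2) *R g x + (1/2) *R g' x)))) <= ennreal ((1/2) * (G (norm (c *R g x)) + G (norm (c *R g' x))))"
   by (rule ennreal_leI)
  also have "... = ennreal (1/2) * (ennreal (G (norm (c *R g x))) + ennreal (G (norm (c *R g' x))))"
   by (rule ennreal_ma[symmetric]) (auto intro: gf_ge0[OF G])
  finally show "ennreal (G (norm (c *R ((1/2) *R g x + (1/2) *R g' x)))) <= ..." .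
 qed
 also have "... = ennreal (1/2) * (\<integral>\<^sup>+x. ennreal (G (norm (c *R g x))) + ennreal (G (norm (c *R g' x))) \<partial>lebesgue)"
  by (rule nn_integral_cmult) measurable
 also have "(\<integral>\<^sup>+x. ennreal (G (norm (c *R g x))) + ennreal (G (norm (c *R g' x))) \<partial>lebesgue) = mL G (%x. c *R g x) + mL G (%x. c *R g' x)"
  unfolding mo_def by (rule nn_integral_add) measurable
 also have "ennreal (1/2) * ... <= ennreal (1/2) * (B + B)" by (intro mult_left_mono add_mono IH) auto
 also have "... = (ennreal (1/2) * 2) * B" by (simp only: mult_2[symmetric] mult.assoc)
 also have "ennreal (1/2) * 2 = 1"
  using ennreal_mult[of "1/2" 2] by simp
 finally show ?case by simp
qed auto

lemma mid_modular:
 assumes "gf G q" "!!s t. 0 <= s ==> 0 <= t ==> G ((1/2) * s + (1/2) * t) <= (1/2) * G s + (1/2) * G t"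
  and "z \<in> mid v h n" "!!k. D (v k) (h k)" "!!k. n <= k ==> mL G (%x. c *R h k x) <= B"
 shows "mL G (%x. c *R snd z x) <= B"
 using mid_modular'[of G q "fst z" "snd z" v h n c B] assms by simp

lemma E_mid_nonexpansive: "0 <= s ==> 0 <= t ==> ((1/2) * s + (1/2) * t) powr m <= (1/2) * s powr m + (1/2) * t powr m"
 using powr_midpoint_strict[OF m1, of s t] by (cases "s = t") (auto simp: add_divide_distrib)

lemma E_bound: "EX C. ALL w R. w \<in> LM --> mL P w <= ennreal R --> E w <= ennreal (C * max 0 R)"
proof -
 obtain C where C: "0 < C" "!!t. 0 <= t ==> C * t powr m <= P t" using P_lower by blast
 note [measurable] = gf_meas_e[OF gP] gf_meas_e[OF gE]
 show ?thesis
 proof (intro exI[of _ "1 / C"] allI impI)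
  fix w :: "'a => 'a" and R assume [measurable]: "w \<in> LM" and R: "mL P w <= ennreal R"
  have "E w <= (\<integral>\<^sup>+x. ennreal (1 / C) * ennreal (P (norm (w x))) \<partial>lebesgue)"
   unfolding mo_def
  proof (rule nn_integral_mono)
   fix x
   have "norm (w x) powr m <= 1 / C * P (norm (w x))" using C(2)[of "norm (w x)"] C(1) by (simp add: field_simps)
   then show "ennreal (norm (w x) powr m) <= ennreal (1 / C) * ennreal (P (norm (w x)))"
    using C(1) by (simp add: ennreal_leI ennreal_mult'[symmetric])
  qed
  also have "... = ennreal (1 / C) * mL P w" unfolding mo_def by (rule nn_integral_cmult) measurable
  also have "... <= ennreal (1 / C) * ennreal (max 0 R)"
   by (intro mult_left_mono order_trans[OF R] ennreal_leI) auto
  also have "... = ennreal (1 / C * max 0 R)" by (rule ennreal_mult[symmetric]) (use C in auto)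
  finally show "E w <= ennreal (1 / C * max 0 R)" .
 qed
qed

lemma E_uniform:
 assumes [measurable]: "f \<in> LM" "g \<in> LM" and ep: "0 < ep"
  and fg: "E f <= ennreal A" "E g <= ennreal A" "0 <= A" and mid: "ennreal I <= E (%x. (1/2) *R f x + (1/2) *R g x)" "0 <= I"
  and K: "0 <= K" "\<forall>x y :: 'a. norm (x - y) powr m <= ep * (norm x powr m + norm y powr m)
   + K * ((norm x powr m + norm y powr m) / 2 - norm ((1/2) *R (x + y)) powr m)"
 shows "E (%x. f x - g x) <= ennreal (2 * ep * A + K * (A - I))"
proof -
 note [measurable] = gf_meas_e[OF gE]
 define M where "M = (%x. (1/2) *R f x + (1/2) *R g x)"
 have [measurable]: "M \<in> LM" unfolding M_def by measurable
 have Me: "M x = (1/2) *R (f x + g x)" for x by (simp add: M_def scaleR_add_right)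
 \<comment> \<open>The midpoint energy stands on the left because subtraction in
   \<open>ennreal\<close> truncates; it is moved over once finiteness is known.\<close>
 have "E (%x. f x - g x) + ennreal K * E M <= ennreal (ep + K / 2) * (E f + E g)"
 proof -
  have "E (%x. f x - g x) + ennreal K * E M = (\<integral>\<^sup>+x. ennreal (norm (f x - g x) powr m) + ennreal K * ennreal (norm (M x) powr m) \<partial>lebesgue)"
   unfolding mo_def by (subst nn_integral_add, measurable, subst nn_integral_cmult, measurable)
  also have "... <= (\<integral>\<^sup>+x. ennreal (ep + K / 2) * (ennreal (norm (f x) powr m) + ennreal (norm (g x) powr m)) \<partial>lebesgue)"
  proof (rule nn_integral_mono)
   fix x
   have "norm (f x - g x) powr m + K * norm (M x) powr m <= (ep + K / 2) * (norm (f x) powr m + norm (g x) powr m)"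
    using K(2)[rule_format, of "f x" "g x"] unfolding Me by (simp add: algebra_simps add_divide_distrib)
   then have "ennreal (norm (f x - g x) powr m + K * norm (M x) powr m) <= ennreal ((ep + K / 2) * (norm (f x) powr m + norm (g x) powr m))"
    by (rule ennreal_leI)
   moreover have "ennreal (norm (f x - g x) powr m + K * norm (M x) powr m) = ennreal (norm (f x - g x) powr m) + ennreal K * ennreal (norm (M x) powr m)"
    using K(1) by (simp add: ennreal_mult)
   moreover have "ennreal (ep + K / 2) * (ennreal (norm (f x) powr m) + ennreal (norm (g x) powr m)) = ennreal ((ep + K / 2) * (norm (f x) powr m + norm (g x) powr m))"
    by (rule ennreal_ma) (use K ep in auto)
   ultimately show "ennreal (norm (f x - g x) powr m) + ennreal K * ennreal (norm (M x) powr m) <= ennreal (ep + K / 2) * (ennreal (norm (f x) powr m) + ennreal (norm (g x) powr m))"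
    by (simp only:)
  qed
  also have "... = ennreal (ep + K / 2) * (\<integral>\<^sup>+x. ennreal (norm (f x) powr m) + ennreal (norm (g x) powr m) \<partial>lebesgue)"
   by (rule nn_integral_cmult) measurable
  also have "(\<integral>\<^sup>+x. ennreal (norm (f x) powr m) + ennreal (norm (g x) powr m) \<partial>lebesgue) = E f + E g"
   unfolding mo_def by (rule nn_integral_add) measurable
  finally show ?thesis .
 qed
 also have "... <= ennreal (ep + K / 2) * (ennreal A + ennreal A)" by (intro mult_left_mono add_mono fg) auto
 also have "... = ennreal ((ep + K / 2) * (A + A))" by (rule ennreal_ma) (use K ep fg in auto)
 finally have 1: "E (%x. f x - g x) + ennreal K * E M <= ennreal ((ep + K / 2) * (A + A))" .
 have 2: "E (%x. f x - g x) + ennreal (K * I) <= ennreal ((ep + K / 2) * (A + A))"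
  using mid K(1) by (intro order_trans[OF _ 1] add_left_mono) (auto simp: M_def ennreal_mult intro: mult_left_mono)
 then have "E (%x. f x - g x) ~= top" by (auto simp: top_unique)
 then obtain e where e: "E (%x. f x - g x) = ennreal e" "0 <= e" by (cases "E (%x. f x - g x)") auto
 have "ennreal (e + K * I) <= ennreal ((ep + K / 2) * (A + A))" using 2 e K mid by simp
 then have "e + K * I <= (ep + K / 2) * (A + A)" using K ep fg by (subst (asm) ennreal_le_iff) auto
 then show ?thesis unfolding e by (intro ennreal_leI) (simp add: algebra_simps)
qed

text \<open>Let \<open>I n\<close> be the infimum of E over the combinations of the tail from n. It
  increases to a limit L, and near-minimisers \<open>W n\<close> form a Cauchy sequence: the
  midpoint of two of them beyond N still has energy at least \<open>I N\<close>, so uniform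
  convexity bounds their distance by L - \<open>I N\<close> up to small terms.\<close>

lemma strong_midpoints:
 fixes v :: "nat => 'a => real"
 assumes D: "!!n. D (v n) (h n)" and b: "!!n. mL P (h n) <= ennreal R"
 shows "EX U G g0. (ALL n. (U n, G n) \<in> mid v h n) & g0 \<in> LM \<and>
   (AE x in lebesgue. (%n. G n x) ~~> g0 x) & (%n. E (%x. G n x - g0 x)) ~~> 0"
proof -
 obtain C where C: "!!w R. w \<in> LM ==> mL P w <= ennreal R ==> E w <= ennreal (C * max 0 R)"
  using E_bound by blast
 define A where "A = max 0 (C * max 0 R)"
 have Eh: "E (h k) <= ennreal A" for k
  using C[OF D_meas(2)[OF D] b] unfolding A_def by (rule order_trans) (simp add: ennreal_leI)
 have zD: "D (fst z) (snd z)" if "z \<in> mid v h n" for z n by (rule mid_D[OF that D])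
 have Ez: "E (snd z) <= ennreal A" if "z \<in> mid v h n" for z n
  using mid_modular[OF gE E_mid_nonexpansive that D, of 1 "ennreal A"] Eh by simp
 define I where "I = (%n. Inf ((%z. enn2real (E (snd z))) ` mid v h n))"
 have ne: "mid v h n ~= {}" for n using mid.base[of n n v h] by blast
 have bd: "bdd_below ((%z. enn2real (E (snd z))) ` mid v h n)" for n by (rule bdd_belowI[of _ 0]) auto
 have Er: "E (snd z) = ennreal (enn2real (E (snd z)))" if "z \<in> mid v h n" for z n
  using le_less_trans[OF Ez[OF that] ennreal_less_top] by (simp add: ennreal_enn2real)
 have I0: "0 <= I n" for n unfolding I_def using ne by (intro cInf_greatest) auto
 have I_le: "I n <= enn2real (E (snd z))" if "z \<in> mid v h n" for z n unfolding I_def using that bd by (intro cInf_lower) auto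
 have ImonoS: "I n <= I k" if "n <= k" for n k
  unfolding I_def using mid_mono[OF _ that] ne bd by (intro cInf_superset_mono) auto
 have IA: "I n <= A" for n
 proof -
  have "E (h n) <= ennreal A" by (rule Eh)
  then have "enn2real (E (h n)) <= A" by (simp add: enn2real_leI A_def)
  then show ?thesis using I_le[OF mid.base[of n n v h]] by simp
 qed
 have "incseq I" using ImonoS by (simp add: incseq_def)
 then obtain L where L: "I ~~> L" "!!n. I n <= L" using incseq_convergent[of I A] IA by blast
 have L0: "0 <= L" using L(2)[of 0] I0[of 0] by simp
 have "EX Z. ALL n. Z n \<in> mid v h n & enn2real (E (snd (Z n))) < I n + 1 / real (Suc n)"
 proof (intro choice allI)
  fix n
  have "I n < I n + 1 / real (Suc n)" by simp
  then show "EX z. z \<in> mid v h n & enn2real (E (snd z)) < I n + 1 / real (Suc n)"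
   using cInf_lessD[of "(%z. enn2real (E (snd z))) ` mid v h n"] ne unfolding I_def by fastforce
 qed
 then obtain Z where Z: "!!n. Z n \<in> mid v h n" "!!n. enn2real (E (snd (Z n))) < I n + 1 / real (Suc n)" by blast
 define W where "W = (%n. snd (Z n))"
 have Wm: "W n \<in> LM" for n unfolding W_def by (rule D_meas(2)[OF zD[OF Z(1)]])
 note [measurable] = Wm
 have WE: "E (W n) <= ennreal (L + 1 / real (Suc n))" for n
 proof -
  have "E (W n) = ennreal (enn2real (E (W n)))" unfolding W_def by (rule Er[OF Z(1)])
  also have "... <= ennreal (L + 1 / real (Suc n))" using Z(2)[of n] L(2)[of n] by (intro ennreal_leI) (simp add: W_def)
  finally show ?thesis .
 qed
 have cau: "EX N. \<forall>n\<ge>N. \<forall>l\<ge>N. E (%x. W n x - W l x) <= ennreal e" if e: "0 < e" for e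
 proof -
  define ep where "ep = e / (4 * (L + 1))"
  have ep: "0 < ep" using e L0 by (simp add: ep_def)
  obtain K where K: "0 <= K" "\<forall>x y :: 'a. norm (x - y) powr m <= ep * (norm x powr m + norm y powr m)
    + K * ((norm x powr m + norm y powr m) / 2 - norm ((1/2) *R (x + y)) powr m)"
   using uniform_convexity[OF m1 ep, where 'b = 'a] by blast
  have "(%n. K * ((L + 1 / real (Suc n)) - I n)) ~~> K * ((L + 0) - L)" by (intro tendsto_intros L inverse_Suc_tendsto)
  then have "eventually (%n. K * ((L + 1 / real (Suc n)) - I n) < e / 2) sequentially"
   by (rule order_tendstoD) (use e in simp)
  then obtain N where N: "!!n. N <= n ==> K * ((L + 1 / real (Suc n)) - I n) < e / 2" by (auto simp: eventually_sequentially)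
  show ?thesis
  proof (intro exI[of _ N] allI impI)
   fix n l assume nl: "N <= n" "N <= l"
   define B where "B = L + 1 / real (Suc N)"
   have B: "L <= B" "B <= L + 1" "0 <= B" using L0 by (auto simp: B_def)
   have WB: "E (W j) <= ennreal B" if "N <= j" for j
    using that by (intro order_trans[OF WE] ennreal_leI) (auto simp: B_def field_simps)
   have mm: "(%x. (1/2) * fst (Z n) x + (1/2) * fst (Z l) x, %x. (1/2) *R W n x + (1/2) *R W l x) \<in> mid v h N"
    unfolding W_def by (rule mid.avg) (use mid_mono[OF Z(1) nl(1)] mid_mono[OF Z(1) nl(2)] in simp_all)
   have low: "ennreal (I N) <= E (%x. (1/2) *R W n x + (1/2) *R W l x)"
    using ennreal_leI[OF I_le[OF mm]] Er[OF mm] by (simp only: snd_conv)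
   have "E (%x. W n x - W l x) <= ennreal (2 * ep * B + K * (B - I N))"
    by (rule E_uniform[OF Wm Wm ep WB[OF nl(1)] WB[OF nl(2)] B(3) low I0 K])
   also have "... <= ennreal e"
   proof (rule ennreal_leI)
    have "2 * ep * B <= 2 * ep * (L + 1)" using B ep by (intro mult_left_mono) auto
    also have "... = e / 2" 
    proof -
     have ne: "4 * (L + 1) ~= 0" using L0 by simp
     have "ep * (4 * (L + 1)) = e" unfolding ep_def by (simp only: times_divide_eq_left nonzero_mult_div_cancel_right[OF ne])
     then show ?thesis by (simp add: algebra_simps)
    qed
    finally have "2 * ep * B <= e / 2" .
    moreover have "K * (B - I N) < e / 2" unfolding B_def by (rule N) simp
    ultimately show "2 * ep * B + K * (B - I N) <= e" by linarith
   qed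
   finally show "E (%x. W n x - W l x) <= ennreal e" .
  qed
 qed
 have "EX r w0. strict_mono r & w0 \<in> LM & (AE x in lebesgue. (%n. W (r n) x) ~~> w0 x)"
 proof (rule loc_L1_Cauchy_AE[OF Wm])
  fix k :: nat and e :: real assume e: "0 < e"
  define \<mu> where "\<mu> = measure lebesgue (cball (0::'a) (real k))"
  have \<mu>: "emeasure lebesgue (cball (0::'a) (real k)) = ennreal \<mu>" "0 <= \<mu>"
   using emeasure_bounded_finite[of "cball (0::'a) (real k)"] by (auto simp: \<mu>_def emeasure_eq_ennreal_measure less_top[symmetric])
  define th where "th = e / (2 * (\<mu> + 1))"
  have th: "0 < th" "th * \<mu> <= e / 2" using e \<mu> by (auto simp: th_def field_simps)
  define c where "c = th / th powr m"
  have c: "0 < c" using th by (simp add: c_def)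
  obtain N where N: "\<forall>n\<ge>N. \<forall>l\<ge>N. E (%x. W n x - W l x) <= ennreal (e / (2 * c))" using cau[of "e / (2 * c)"] e c by auto
  show "EX N. \<forall>n\<ge>N. \<forall>l\<ge>N. (\<integral>\<^sup>+x\<in>cball 0 (real k). ennreal (norm (W n x - W l x)) \<partial>lebesgue) <= ennreal e"
  proof (intro exI[of _ N] allI impI)
   fix n l assume nl: "N <= n" "N <= l"
   have "(\<integral>\<^sup>+x\<in>cball 0 (real k). ennreal (norm (W n x - W l x)) \<partial>lebesgue) <= ennreal th * emeasure lebesgue (cball (0::'a) (real k)) + ennreal c * E (%x. W n x - W l x)"
    unfolding c_def by (rule nn_integral_le_mo[OF gE _ _ th(1)]) auto
   also have "... <= ennreal th * ennreal \<mu> + ennreal c * ennreal (e / (2 * c))"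
    unfolding \<mu>(1) using N nl by (intro add_left_mono mult_left_mono) auto
   also have "... = ennreal (th * \<mu> + c * (e / (2 * c)))"
    using th \<mu> c e by (simp only: ennreal_mult[symmetric] ennreal_plus less_imp_le mult_nonneg_nonneg divide_nonneg_pos mult_pos_pos zero_less_numeral)
   also have "... <= ennreal e" using th c by (intro ennreal_leI) simp
   finally show "(\<integral>\<^sup>+x\<in>cball 0 (real k). ennreal (norm (W n x - W l x)) \<partial>lebesgue) <= ennreal e" .
  qed
 qed
 then obtain r g0 where r: "strict_mono (r::nat=>nat)" and g0[measurable]: "g0 \<in> LM" and ae: "AE x in lebesgue. (%n. W (r n) x) ~~> g0 x" by blast
 have rn: "n <= r n" for n by (rule strict_mono_imp_increasing[OF r])
 show ?thesis
 proof (intro exI[of _ "%n. fst (Z (r n))"] exI[of _ "%n. W (r n)"] exI[of _ g0] conjI allI g0 ae)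
  show "(fst (Z (r n)), W (r n)) \<in> mid v h n" for n
   using mid_mono[OF Z(1) rn, of n] by (simp add: W_def)
  show "(%n. E (%x. W (r n) x - g0 x)) ~~> 0"
   unfolding ennreal_tendsto_0_iff
  proof (intro allI impI)
   fix e :: real assume "0 < e"
   then obtain N where N: "\<forall>n\<ge>N. \<forall>l\<ge>N. E (%x. W n x - W l x) <= ennreal e" using cau by blast
   show "eventually (%n. E (%x. W (r n) x - g0 x) <= ennreal e) sequentially"
    unfolding eventually_sequentially
   proof (intro exI[of _ N] allI impI)
    fix n assume n: "N <= n"
    show "E (%x. W (r n) x - g0 x) <= ennreal e"
    proof (rule mo_fatou_le[OF gE])
     show "AE x in lebesgue. (%l. W (r n) x - W (r l) x) ~~> W (r n) x - g0 x"
      using ae by eventually_elim (intro tendsto_intros)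
     show "eventually (%l. E (%x. W (r n) x - W (r l) x) <= ennreal e) sequentially"
      unfolding eventually_sequentially using N n rn order_trans by (intro exI[of _ N]) blast
    qed measurable
   qed
  qed
 qed
qed

end

section \<open>Weak limits\<close>

declare cball_borel[measurable del]

lemma cball_lebesgue[measurable]: "cball (c::'a::euclidean_space) r \<in> sets lebesgue"
 by simp

locale orlicz_var = orlicz_pair P Ps m ms ty for P Ps :: "real => real" and m ms :: real and ty :: "'a::euclidean_space itself" +
 fixes a :: "real => real"
 assumes a_cont: "continuous_on UNIV a" and a_0: "a 0 = 0" and a_less: "!!s t. 0 <= s ==> s < t ==> a s < a t"
  and a_scale: "!!c t. 1 <= c ==> 0 <= t ==> a (c * t) <= c powr (m - 1) * a t"
  and P_deriv: "!!t. (P has_real_derivative (sgn t * a \<bar>t\<bar>)) (at t)"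
  and Pa_upper: "!!t. 0 <= t ==> t * a t <= m * P t" and Pa_lower: "!!t. 0 <= t ==> P t <= t * a t"
  and P_convex: "convex_on UNIV P"
begin

lemma P_midpoint: "P ((1/2) * s + (1/2) * t) <= (1/2) * P s + (1/2) * P t"
 using convex_onD[OF P_convex, of "1/2" s t] by (simp add: add.commute)

lemma ball_measure: "emeasure lebesgue (cball (0::'a) R) = ennreal (measure lebesgue (cball (0::'a) R))"
 using emeasure_bounded_finite[of "cball (0::'a) R"] by (auto simp: emeasure_eq_ennreal_measure less_top[symmetric])

text \<open>\<Phi> grows at most like the power m, the conjugate at least like the larger power
  \<open>ms\<close>.\<close>

lemma P_subcritical: assumes ep: "0 < ep" shows "\<exists>T>0. \<forall>t\<ge>T. P t <= ep * Ps t"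
proof -
 obtain c where c: "0 < c" "!!t. 0 <= t ==> c * t powr ms <= Ps t" using Ps_lower by blast
 define q where "q = P 1 / (c * ep)"
 have q: "0 < q" using gf_pos[OF gP, of 1] c ep by (simp add: q_def)
 define T where "T = max 1 (q powr (1 / (ms - m)))"
 show ?thesis
 proof (intro exI[of _ T] conjI allI impI)
  fix t assume t: "T <= t"
  have t1: "1 <= t" "q powr (1 / (ms - m)) <= t" using t by (auto simp: T_def)
  have "(q powr (1 / (ms - m))) powr (ms - m) <= t powr (ms - m)" using t1 ms_gt q by (intro powr_mono2) auto
  then have qt: "q <= t powr (ms - m)" using q ms_gt by (simp add: powr_powr)
  have "P (t * 1) <= t powr m * P 1" by (rule gf_sup[OF gP]) (use t1 in auto)
  also have "P 1 = q * (c * ep)" using c ep by (simp add: q_def)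
  also have "t powr m * (q * (c * ep)) <= t powr m * (t powr (ms - m) * (c * ep))"
   using qt c ep by (intro mult_left_mono mult_right_mono) auto
  also have "... = ep * (c * (t powr m * t powr (ms - m)))" by simp
  also have "t powr m * t powr (ms - m) = t powr ms" by (subst powr_add[symmetric]) simp
  also have "ep * (c * t powr ms) <= ep * Ps t" using c(2)[of t] t1 ep by (intro mult_left_mono) auto
  finally show "P t <= ep * Ps t" by simp
 qed (simp add: T_def less_max_iff_disj)
qed

text \<open>Split at a height T. Above it \<Phi> is a small fraction of the conjugate, whose
  integrals are bounded; below it the functions are bounded on a ball and dominated convergence
  applies.\<close>

lemma local_P_Vitali:
 fixes w :: "nat => 'a => real" and z :: "nat => 'a => 'b::euclidean_space"
 assumes [measurable]: "!!n. w n \<in> LM" and l: "AE x in lebesgue. (%n. w n x) ~~> 0"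
  and B: "!!n. mL Ps (w n) <= ennreal B" and C: "0 <= C"
  and b: "!!n x. norm (z n x) <= C * \<bar>w n x\<bar> * indicator (cball (0::'a) R) x"
 shows "(%n. mL P (z n)) ~~> 0"
 unfolding ennreal_tendsto_0_iff
proof (intro allI impI)
 fix e :: real assume e: "0 < e"
 define c1 where "c1 = max 1 (C powr m)"
 have c1: "0 < c1" by (simp add: c1_def less_max_iff_disj)
 define M where "M = max 0 B + 1"
 have M: "0 < M" "max 0 B <= M" by (auto simp: M_def)
 define ep where "ep = e / (2 * c1 * M)"
 have ep: "0 < ep" using e c1 M by (simp add: ep_def)
 have epB: "c1 * ep * max 0 B <= e / 2"
 proof -
  have "c1 * ep * M = e / 2" using c1 M unfolding ep_def by simp
  moreover have "c1 * ep * max 0 B <= c1 * ep * M" using c1 ep M by (intro mult_left_mono) auto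
  ultimately show ?thesis by simp
 qed
 obtain T where T: "0 < T" "!!t. T <= t ==> P t <= ep * Ps t" using P_subcritical[OF ep] by blast
 define y where "y = (%n x. indicator (cball (0::'a) R) x * min \<bar>w n x\<bar> T)"
 note [measurable] = gf_meas_e[OF gP] gf_meas_e[OF gPs]
 have ym[measurable]: "y n \<in> LM" for n unfolding y_def by measurable
 have "(%n. mL P (y n)) ~~> 0"
 proof (rule mo_dominated[OF gP ym])
  show "(%x::'a. indicator (cball 0 R) x * T) \<in> LM" by measurable
  have "mL P (%x::'a. indicator (cball 0 R) x * T) = (\<integral>\<^sup>+x. ennreal (P T) * indicator (cball (0::'a) R) x \<partial>lebesgue)"
   unfolding mo_def using T gf_0[OF gP] by (intro nn_integral_cong) (auto simp: indicator_def)
  also have "... < \<infinity>" by (subst nn_integral_cmult_indicator) (auto simp: ball_measure ennreal_mult_less_top)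
  finally show "mL P (%x::'a. indicator (cball 0 R) x * T) < \<infinity>" .
  show "AE x in lebesgue. norm (y n x) <= norm (indicator (cball (0::'a) R) x * T)" for n
   using T by (intro AE_I2) (auto simp: y_def indicator_def)
  show "AE x in lebesgue. (%n. y n x) ~~> 0" using l
  proof eventually_elim
   case (elim x)
   have "(%n. indicator (cball (0::'a) R) x * min \<bar>w n x\<bar> T) ~~> indicator (cball (0::'a) R) x * min \<bar>0\<bar> T"
    by (intro tendsto_intros elim)
   then show ?case using T by (simp add: y_def)
  qed
 qed
 then have "eventually (%n. mL P (y n) <= ennreal (e / (2 * c1))) sequentially"
  unfolding ennreal_tendsto_0_iff using e c1 by simp
 then show "eventually (%n. mL P (z n) <= ennreal e) sequentially"
 proof eventually_elim
  case (elim n)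
  have "mL P (z n) <= (\<integral>\<^sup>+x. ennreal (c1 * ep) * ennreal (Ps (norm (w n x))) + ennreal c1 * ennreal (P (norm (y n x))) \<partial>lebesgue)"
   unfolding mo_def
  proof (rule nn_integral_mono)
   fix x
   show "ennreal (P (norm (z n x))) <= ennreal (c1 * ep) * ennreal (Ps (norm (w n x))) + ennreal c1 * ennreal (P (norm (y n x)))"
   proof (cases "x \<in> cball 0 R")
    case True
    have "P (norm (z n x)) <= P (C * \<bar>w n x\<bar>)" using b[of n x] True by (intro gf_mono[OF gP]) auto
    also have "... <= c1 * P \<bar>w n x\<bar>" unfolding c1_def by (rule gf_scale[OF gP C]) simp
    also have "P \<bar>w n x\<bar> <= ep * Ps \<bar>w n x\<bar> + P (min \<bar>w n x\<bar> T)"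
    proof (cases "T <= \<bar>w n x\<bar>")
     case True
     then show ?thesis using T(2)[of "\<bar>w n x\<bar>"] gf_ge0[OF gP, of T] gf_ge0[OF gPs, of T] T(1) ep by (auto simp: min_def)
    next
     case False
     then show ?thesis using gf_ge0[OF gPs, of "\<bar>w n x\<bar>"] ep by (simp add: min_def)
    qed
    finally have "P (norm (z n x)) <= c1 * ep * Ps (norm (w n x)) + c1 * P (norm (y n x))"
     using c1 True T(1) by (simp add: y_def algebra_simps)
    then have "ennreal (P (norm (z n x))) <= ennreal (c1 * ep * Ps (norm (w n x)) + c1 * P (norm (y n x)))" by (rule ennreal_leI)
    also have "... = ennreal (c1 * ep * Ps (norm (w n x))) + ennreal (c1 * P (norm (y n x)))"
     by (rule ennreal_plus) (use c1 ep gf_ge0[OF gP] gf_ge0[OF gPs] in auto)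
    also have "ennreal (c1 * ep * Ps (norm (w n x))) = ennreal (c1 * ep) * ennreal (Ps (norm (w n x)))"
     by (rule ennreal_mult) (use c1 ep gf_ge0[OF gPs] in auto)
    also have "ennreal (c1 * P (norm (y n x))) = ennreal c1 * ennreal (P (norm (y n x)))"
     by (rule ennreal_mult) (use c1 gf_ge0[OF gP] in auto)
    finally show ?thesis .
   next
    case False
    then have "z n x = 0" using b[of n x] by simp
    then show ?thesis by (simp add: gf_0[OF gP])
   qed
  qed
  also have "... = ennreal (c1 * ep) * mL Ps (w n) + ennreal c1 * mL P (y n)"
   unfolding mo_def by (subst nn_integral_add, measurable, subst nn_integral_cmult, measurable, subst nn_integral_cmult, measurable)
  also have "... <= ennreal (c1 * ep) * ennreal (max 0 B) + ennreal c1 * ennreal (e / (2 * c1))"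
   by (intro add_mono mult_left_mono elim order_trans[OF B] ennreal_leI) auto
  also have "... = ennreal (c1 * ep * max 0 B) + ennreal (c1 * (e / (2 * c1)))"
   using c1 ep e by (simp add: ennreal_mult[symmetric])
  also have "... <= ennreal (e / 2) + ennreal (e / 2)"
   using c1 epB by (intro add_mono ennreal_leI) auto
  also have "... = ennreal e" using e by (simp flip: ennreal_plus)
  finally show ?case .
 qed
qed

text \<open>\<open>P t <= P dl + c * t powr m\<close>: below dl by monotonicity, above it by
  doubling from dl. The first term costs \<open>P dl\<close> times the volume of the ball, which is
  small with dl.\<close>

lemma local_P_from_E:
 fixes z :: "nat => 'a => 'a"
 assumes [measurable]: "!!n. z n \<in> LM" and l: "(%n. E (z n)) ~~> 0"
  and s: "!!n x. R <= norm x ==> z n x = 0"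
 shows "(%n. mL P (z n)) ~~> 0"
 unfolding ennreal_tendsto_0_iff
proof (intro allI impI)
 fix e :: real assume e: "0 < e"
 note [measurable] = gf_meas_e[OF gP] gf_meas_e[OF gE]
 define \<mu> where "\<mu> = measure lebesgue (cball (0::'a) R)"
 have \<mu>: "0 <= \<mu>" by (simp add: \<mu>_def)
 have P1: "0 < P 1" by (rule gf_pos[OF gP]) simp
 define M where "M = P 1 * \<mu> + 1"
 have M: "0 < M" "P 1 * \<mu> <= M" using P1 \<mu> by (auto simp: M_def intro!: add_nonneg_pos)
 define dl where "dl = min 1 (e / (2 * M))"
 have dl: "0 < dl" "dl <= 1" using e M by (auto simp: dl_def)
 have Pd: "0 < P dl" by (rule gf_pos[OF gP dl(1)])
 have "P dl * \<mu> <= e / 2"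
 proof -
  have "P (dl * 1) <= dl * P 1" by (rule gf_sub[OF gP]) (use dl in auto)
  then have "P dl * \<mu> <= dl * (P 1 * \<mu>)" using \<mu> mult_right_mono[of "P dl" "dl * P 1" \<mu>] by simp
  also have "... <= dl * M" using dl M by (intro mult_left_mono) auto
  also have "... <= e / (2 * M) * M" using M by (intro mult_right_mono) (auto simp: dl_def)
  also have "... = e / 2" using M by simp
  finally show ?thesis .
 qed
 define c where "c = P dl / dl powr m"
 have c: "0 < c" using Pd dl by (simp add: c_def)
 have "eventually (%n. E (z n) <= ennreal (e / (2 * c))) sequentially"
  using l e c unfolding ennreal_tendsto_0_iff by simp
 then show "eventually (%n. mL P (z n) <= ennreal e) sequentially"
 proof eventually_elim
  case (elim n)
  have "mL P (z n) <= (\<integral>\<^sup>+x. ennreal (P dl) * indicator (cball (0::'a) R) x + ennreal c * ennreal (norm (z n x) powr m) \<partial>lebesgue)"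
   unfolding mo_def
  proof (rule nn_integral_mono)
   fix x
   show "ennreal (P (norm (z n x))) <= ennreal (P dl) * indicator (cball (0::'a) R) x + ennreal c * ennreal (norm (z n x) powr m)"
   proof (cases "R <= norm x")
    case True
    then show ?thesis using s[OF True] gf_0[OF gP] by simp
   next
    case False
    have "P (norm (z n x)) <= P dl + c * norm (z n x) powr m"
    proof (cases "norm (z n x) <= dl")
     case True
     then have "P (norm (z n x)) <= P dl" by (intro gf_mono[OF gP]) auto
     then show ?thesis using c by (simp add: add_increasing2)
    next
     case False
     have "P ((norm (z n x) / dl) * dl) <= (norm (z n x) / dl) powr m * P dl" by (rule gf_sup[OF gP]) (use False dl in auto)
     then have "P (norm (z n x)) <= c * norm (z n x) powr m" using dl by (simp add: c_def powr_divide mult.commute)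
     then show ?thesis using Pd by simp
    qed
    then have "ennreal (P (norm (z n x))) <= ennreal (P dl + c * norm (z n x) powr m)" by (rule ennreal_leI)
    also have "... = ennreal (P dl) + ennreal c * ennreal (norm (z n x) powr m)"
     using Pd c by (simp add: ennreal_mult)
    finally show ?thesis using False by simp
   qed
  qed
  also have "... = ennreal (P dl) * ennreal \<mu> + ennreal c * E (z n)"
   unfolding mo_def by (subst nn_integral_add, measurable, subst nn_integral_cmult, measurable)
    (subst nn_integral_cmult_indicator, auto simp: ball_measure \<mu>_def)
  also have "... <= ennreal (P dl) * ennreal \<mu> + ennreal c * ennreal (e / (2 * c))" by (intro add_left_mono mult_left_mono elim) auto
  also have "... = ennreal (P dl * \<mu>) + ennreal (c * (e / (2 * c)))"
   using Pd \<mu> c e by (simp add: ennreal_mult[symmetric])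
  also have "... <= ennreal (e / 2) + ennreal (e / 2)" using c \<open>P dl * \<mu> <= e / 2\<close> by (intro add_mono ennreal_leI) auto
  also have "... = ennreal e" using e by (simp flip: ennreal_plus)
  finally show ?case .
 qed
qed

text \<open>\<open>P_young\<close> splits the product into the conjugate of a multiple of v, whose
  integral outside the growing ball vanishes, and the N-th power of a multiple of kp divided by the
  radius. Integrated over a ball of twice the radius the latter does not depend on j, and it is
  small with kp.\<close>

lemma annulus_null:
 assumes v[measurable]: "v \<in> LM" and fin: "mL Ps (v :: 'a => real) < \<infinity>" and C: "0 < C"
  and b: "!!j x. norm (z j x :: 'a) <= \<bar>v x\<bar> * (C / real (Suc j))"
  and s: "!!j x. norm x < real (Suc j) \<or> 2 * real (Suc j) < norm x ==> z j x = 0"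
 shows "(%j. mL P (z j)) ~~> 0"
 unfolding ennreal_tendsto_0_iff
proof (intro allI impI)
 fix e :: real assume e: "0 < e"
 note [measurable] = gf_meas_e[OF gP] gf_meas_e[OF gPs]
 define N where "N = DIM('a)"
 obtain Y where Y: "0 < Y" "!!a b. 0 <= a ==> 0 <= b ==> P (a * b) <= Ps (Y * a) + b ^ N" using P_young unfolding N_def by blast
 define \<omega> where "\<omega> = unit_ball_vol (real N)"
 have \<omega>: "0 < \<omega>" by (simp add: \<omega>_def)
 define A where "A = (C * 2) ^ N * \<omega>"
 have A: "0 < A" using C \<omega> by (simp add: A_def)
 define kp where "kp = min 1 (e / (2 * A))"
 have kp: "0 < kp" "kp <= 1" using e A by (auto simp: kp_def)
 have "kp ^ N <= kp ^ 1" by (intro power_decreasing) (use kp in \<open>auto simp: N_def Suc_le_eq\<close>)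
 then have kpA: "kp ^ N * A <= e / 2" using A e mult_right_mono[of "kp ^ N" "e / (2 * A)" A] by (simp add: kp_def)
 have [measurable]: "- ball (0::'a) R \<in> sets lebesgue" for R by (simp add: Compl_in_sets_lebesgue)
 define y where "y = (%j x. indicator (- ball (0::'a) (real (Suc j))) x * ((Y / kp) * v x))"
 have ym[measurable]: "y j \<in> LM" for j unfolding y_def by measurable
 have "(%j. mL Ps (y j)) ~~> 0"
 proof (rule mo_dominated[OF gPs ym])
  show "(%x. (Y / kp) *R v x) \<in> LM" by measurable
  show "mL Ps (%x. (Y / kp) *R v x) < \<infinity>" by (rule mo_scale_finite[OF gPs v fin])
  show "AE x in lebesgue. norm (y j x) <= norm ((Y / kp) *R v x)" for j by (intro AE_I2) (auto simp: y_def indicator_def)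
  show "AE x in lebesgue. (%j. y j x) ~~> 0"
  proof (rule AE_I2)
   fix x :: 'a
   obtain k where "norm x < real k" using reals_Archimedean2 by blast
   then have "eventually (%j. 0 = y j x) sequentially"
    unfolding eventually_sequentially by (intro exI[of _ k]) (auto simp: y_def indicator_def)
   then show "(%j. y j x) ~~> 0" by (rule Lim_transform_eventually[OF tendsto_const])
  qed
 qed
 then have "eventually (%j. mL Ps (y j) <= ennreal (e / 2)) sequentially"
  unfolding ennreal_tendsto_0_iff using e by simp
 then show "eventually (%j. mL P (z j) <= ennreal e) sequentially"
 proof eventually_elim
  case (elim j)
  define B where "B = cball (0::'a) (2 * real (Suc j))"
  define t where "t = (kp * (C / real (Suc j))) ^ N"
  have t: "0 <= t" using kp C by (simp add: t_def)
  have "mL P (z j) <= (\<integral>\<^sup>+x. ennreal (Ps (norm (y j x))) + ennreal t * indicator B x \<partial>lebesgue)"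
   unfolding mo_def
  proof (rule nn_integral_mono)
   fix x
   show "ennreal (P (norm (z j x))) <= ennreal (Ps (norm (y j x))) + ennreal t * indicator B x"
   proof (cases "norm x < real (Suc j) \<or> 2 * real (Suc j) < norm x")
    case True
    then show ?thesis using s[OF True] gf_0[OF gP] by simp
   next
    case False
    have "P (norm (z j x)) <= P ((\<bar>v x\<bar> / kp) * (kp * (C / real (Suc j))))"
     using b[of j x] kp by (intro gf_mono[OF gP]) auto
    also have "... <= Ps (Y * (\<bar>v x\<bar> / kp)) + t" unfolding t_def using kp C by (intro Y(2)) auto
    also have "Y * (\<bar>v x\<bar> / kp) = norm (y j x)" using False Y(1) kp by (simp add: y_def abs_mult)
    finally have "ennreal (P (norm (z j x))) <= ennreal (Ps (norm (y j x)) + t)" by (rule ennreal_leI)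
    also have "... = ennreal (Ps (norm (y j x))) + ennreal t" by (rule ennreal_plus) (use t gf_ge0[OF gPs] in auto)
    finally show ?thesis using False by (simp add: B_def)
   qed
  qed
  also have "... = mL Ps (y j) + (\<integral>\<^sup>+x. ennreal t * indicator B x \<partial>lebesgue)"
   unfolding mo_def B_def by (rule nn_integral_add) measurable
  also have "(\<integral>\<^sup>+x. ennreal t * indicator B x \<partial>lebesgue) = ennreal t * emeasure lborel B"
   unfolding B_def by (subst nn_integral_cmult_indicator) auto
  also have "emeasure lborel B = ennreal (\<omega> * (2 * real (Suc j)) ^ N)"
   unfolding B_def \<omega>_def N_def by (rule emeasure_cball) simp
  also have "ennreal t * ennreal (\<omega> * (2 * real (Suc j)) ^ N) = ennreal (t * (\<omega> * (2 * real (Suc j)) ^ N))"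
   by (rule ennreal_mult[symmetric]) (use t \<omega> in auto)
  also have "t * (\<omega> * (2 * real (Suc j)) ^ N) = kp ^ N * A"
   unfolding t_def A_def by (simp add: power_mult_distrib power_divide del: of_nat_Suc)
  also have "mL Ps (y j) + ennreal (kp ^ N * A) <= ennreal (e / 2) + ennreal (e / 2)"
   by (intro add_mono elim ennreal_leI kpA)
  also have "... = ennreal e" using e by (simp flip: ennreal_plus)
  finally show ?case .
 qed
qed

text \<open>The a.e. limit passes to midpoints, whose gradients converge strongly in L^m to a
  candidate g0. Bounds on the modulars of all multiples c hold for one and the same g0, as the
  energy has to be semicontinuous along an entire ray. Membership in \<open>D\<close> is shown for
  cutoff versions, and then the cutoffs exhaust the space.\<close>

lemma weak_limit:
 fixes v :: "nat => 'a => real"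
 assumes D: "!!n. D (v n) (h n)" and b: "!!n. mL P (h n) <= ennreal R"
  and v0[measurable]: "v0 \<in> LM" and ae: "AE x in lebesgue. (%n. v n x) ~~> v0 x"
 shows "EX g0. D v0 g0 & (ALL c B. (EX N. \<forall>n\<ge>N. mL P (%x. c *R h n x) <= B) --> mL P (%x. c *R g0 x) <= B)"
proof -
 obtain U G g0 where UG: "ALL n. (U n, G n) \<in> mid v h n" and g0[measurable]: "g0 \<in> LM"
  and aeG: "AE x in lebesgue. (%n. G n x) ~~> g0 x" and EG: "(%n. E (%x. G n x - g0 x)) ~~> 0"
  using strong_midpoints[of v h R, OF D b] by blast
 have DU: "D (U n) (G n)" for n using mid_D'[OF UG[rule_format] D] .
 note [measurable] = D_meas[OF DU]
 have aeU: "AE x in lebesgue. (%n. U n x) ~~> v0 x" using ae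
 proof eventually_elim
  case (elim x)
  show ?case
  proof (rule LIMSEQ_I)
   fix e :: real assume "0 < e"
   then obtain N where N: "\<forall>k\<ge>N. norm (v k x - v0 x) < e / 2" using LIMSEQ_D[OF elim, of "e / 2"] by auto
   have "norm (U n x - v0 x) < e" if "N <= n" for n
   proof -
    have "\<bar>U n x - v0 x\<bar> <= e / 2"
     by (rule mid_close[OF UG[rule_format]]) (use N that in \<open>auto simp: less_imp_le\<close>)
    then show ?thesis using \<open>0 < e\<close> by simp
   qed
   then show "EX no. \<forall>n\<ge>no. norm (U n x - v0 x) < e" by blast
  qed
 qed
 have Gc: "mL P (%x. c *R G n x) <= B" if "!!k. n <= k ==> mL P (%x. c *R h k x) <= B" for n c B
  using mid_modular'[OF gP P_midpoint UG[rule_format] D that] by simp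
 have lim: "mL P (%x. c *R g0 x) <= B" if N: "\<forall>n\<ge>N. mL P (%x. c *R h n x) <= B" for c B N
 proof (rule mo_fatou_le[OF gP])
  show "AE x in lebesgue. (%n. c *R G n x) ~~> c *R g0 x" using aeG by eventually_elim (intro tendsto_intros)
  show "eventually (%n. mL P (%x. c *R G n x) <= B) sequentially"
   unfolding eventually_sequentially using N by (intro exI[of _ N] allI impI Gc) auto
 qed measurable
 have GR: "mL P (G n) <= ennreal R" for n using Gc[of n 1 "ennreal R"] b by simp
 have gR: "mL P g0 <= ennreal R" using lim[of 0 1 "ennreal R"] b by simp
 obtain B0 where B0: "!!u g. D u g ==> mL P g <= ennreal R ==> mL Ps u <= ennreal B0"
  using sobolev_bound[of R] by blast
 have UB: "mL Ps (U n) <= ennreal B0" for n by (rule B0[OF DU GR])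
 have vB: "mL Ps v0 <= ennreal B0"
  by (rule mo_fatou_le[OF gPs _ aeU]) (use UB in auto)
 define B1 where "B1 = 2 powr ms * (max 0 B0 + max 0 B0)"
 have dB: "mL Ps (%x. U n x - v0 x) <= ennreal B1" for n
 proof -
  have "mL Ps (%x. U n x - v0 x) <= ennreal (2 powr ms) * (mL Ps (U n) + mL Ps v0)"
   by (rule mo_diff[OF gPs]) measurable
  also have "... <= ennreal (2 powr ms) * (ennreal (max 0 B0) + ennreal (max 0 B0))"
   by (intro mult_left_mono add_mono order_trans[OF UB] order_trans[OF vB] ennreal_leI) auto
  also have "... = ennreal B1" unfolding B1_def by (rule ennreal_ma) auto
  finally show ?thesis .
 qed
 \<comment> \<open>On a bounded set strong convergence in L^m handles the gradient, and a.e.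
   convergence with bounded \<open>Ps\<close> modulars handles the product with the gradient of the
   cutoff.\<close>
 have cutD: "D (%x. ctz x * v0 x) (%x. ctz x *R g0 x + v0 x *R grad ctz x)" if ctz: "test_fn ctz" for ctz
 proof (rule D_limit)
  note s = test_sm[OF ctz]
  note [measurable] = sm_meas_leb[OF s] grad_meas_leb[OF s]
  obtain R where R: "ALL x. R <= norm x --> ctz x = 0 & grad ctz x = 0" using test_fn_bounded_support[OF ctz] by blast
  obtain M where M: "0 < M" "ALL x. norm (ctz x) <= M" using cont_bounded_support_bounded[OF sm_cont[OF s], of R] R by blast
  obtain C where C: "0 < C" "ALL x. norm (grad ctz x) <= C" using cont_bounded_support_bounded[OF sm_grad_cont[OF s], of R] R by blast
  show "D (%x. ctz x * U n x) (%x. ctz x *R G n x + U n x *R grad ctz x)" for n by (rule D_mult[OF DU ctz])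
  show "AE x in lebesgue. (%n. ctz x * U n x) ~~> ctz x * v0 x" using aeU by eventually_elim (intro tendsto_intros)
  have 1: "(%n. mL P (%x. ctz x *R (G n x - g0 x))) ~~> 0"
  proof (rule local_P_from_E)
   have "(%n. E (%x. M *R (G n x - g0 x))) ~~> 0" by (rule mo_tendsto_scale[OF gE _ EG]) measurable
   then show "(%n. E (%x. ctz x *R (G n x - g0 x))) ~~> 0"
    by (rule mo_tendsto_le[OF gE]) (use M in \<open>auto intro!: mult_right_mono\<close>)
   show "ctz x *R (G n x - g0 x) = 0" if "R <= norm x" for n x using R that by simp
  qed measurable
  have 2: "(%n. mL P (%x. (U n x - v0 x) *R grad ctz x)) ~~> 0"
  proof (rule local_P_Vitali[OF _ _ dB])
   show "AE x in lebesgue. (%n. U n x - v0 x) ~~> 0" using aeU by eventually_elim (simp add: LIM_zero)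
   show "norm ((U n x - v0 x) *R grad ctz x) <= C * \<bar>U n x - v0 x\<bar> * indicator (cball 0 R) x" for n x
    using R C by (cases "R <= norm x") (auto simp: mult.commute intro!: mult_right_mono)
  qed (use C in auto)
  have "(%n. mL P (%x. ctz x *R (G n x - g0 x) + (U n x - v0 x) *R grad ctz x)) ~~> 0"
   by (intro mo_tendsto_add[OF gP] 1 2) measurable
  then show "(%n. mL P (%x. (ctz x *R G n x + U n x *R grad ctz x) - (ctz x *R g0 x + v0 x *R grad ctz x))) ~~> 0"
   by (simp add: algebra_simps)
  show "(%x. ctz x * v0 x) \<in> LM" "(%x. ctz x *R g0 x + v0 x *R grad ctz x) \<in> LM" by measurable
 qed
 obtain C where C: "0 < C" "ALL r R. 0 <= r --> r < R --> (\<exists>ctz::'a => real. test_fn ctz & (ALL x. 0 <= ctz x & ctz x <= 1) \<and>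
   (ALL x. norm x <= r --> ctz x = 1) & (ALL x. R <= norm x --> ctz x = 0) & (ALL x. norm (grad ctz x) <= C / (R - r)) \<and>
   (ALL x. norm x < r \<or> R < norm x --> grad ctz x = 0))" using cutoff_exists[where 'a = 'a] by (elim exE conjE)
 have "\<exists>ctz. ALL j. test_fn (ctz j :: 'a => real) & (ALL x. 0 <= ctz j x & ctz j x <= 1) \<and>
   (ALL x. norm x <= real (Suc j) --> ctz j x = 1) & (ALL x. 2 * real (Suc j) <= norm x --> ctz j x = 0) & (ALL x. norm (grad (ctz j) x) <= C / (2 * real (Suc j) - real (Suc j))) \<and>
   (ALL x. norm x < real (Suc j) \<or> 2 * real (Suc j) < norm x --> grad (ctz j) x = 0)"
  by (intro choice allI C(2)[rule_format]) auto
 then obtain ctz where ctz0: "ALL j. test_fn (ctz j :: 'a => real) & (ALL x. 0 <= ctz j x & ctz j x <= 1) \<and>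
   (ALL x. norm x <= real (Suc j) --> ctz j x = 1) & (ALL x. 2 * real (Suc j) <= norm x --> ctz j x = 0) & (ALL x. norm (grad (ctz j) x) <= C / (2 * real (Suc j) - real (Suc j))) \<and>
   (ALL x. norm x < real (Suc j) \<or> 2 * real (Suc j) < norm x --> grad (ctz j) x = 0)" by (elim exE)
 have ctzt: "test_fn (ctz j)" for j using ctz0 by simp
 have ctz1: "0 <= ctz j x" "ctz j x <= 1" for j x using ctz0 by simp_all
 have ctz2: "ctz j x = 1" if "norm x <= real (Suc j)" for j x using ctz0 that by blast
 have ctz3: "norm (grad (ctz j) x) <= C / real (Suc j)" for j x
 proof -
  have "norm (grad (ctz j) x) <= C / (2 * real (Suc j) - real (Suc j))" using ctz0 by blast
  then show ?thesis by simp
 qed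
 have ctz4: "grad (ctz j) x = 0" if "norm x < real (Suc j) \<or> 2 * real (Suc j) < norm x" for j x using ctz0 that by blast
 have ctzlim: "(%j. ctz j x) ~~> 1" for x
 proof -
  obtain k where k: "norm x <= real k" using real_arch_simple by blast
  then have "eventually (%j. 1 = ctz j x) sequentially"
   unfolding eventually_sequentially by (intro exI[of _ k] allI impI) (rule ctz2[symmetric], simp)
  then show ?thesis by (rule Lim_transform_eventually[OF tendsto_const])
 qed
 note s = test_sm[OF ctzt]
 note [measurable] = sm_meas_leb[OF s] grad_meas_leb[OF s]
 have "D v0 g0"
 proof (rule D_limit)
  show "D (%x. ctz j x * v0 x) (%x. ctz j x *R g0 x + v0 x *R grad (ctz j) x)" for j by (rule cutD[OF ctzt])
  have "(%j. ctz j x * v0 x) ~~> 1 * v0 x" for x by (intro tendsto_intros ctzlim)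
  then show "AE x in lebesgue. (%j. ctz j x * v0 x) ~~> v0 x" by simp
  have 1: "(%j. mL P (%x. (ctz j x - 1) *R g0 x)) ~~> 0"
  proof (rule mo_dominated[OF gP])
   show "mL P g0 < \<infinity>" using gR ennreal_less_top le_less_trans by fastforce
   show "AE x in lebesgue. norm ((ctz j x - 1) *R g0 x) <= norm (g0 x)" for j
    using ctz1 by (intro AE_I2) (auto intro!: mult_left_le_one_le simp: abs_le_iff)
   have "(%j. (ctz j x - 1) *R g0 x) ~~> (1 - 1) *R g0 x" for x by (intro tendsto_intros ctzlim)
   then show "AE x in lebesgue. (%j. (ctz j x - 1) *R g0 x) ~~> 0" by simp
  qed measurable
  have 2: "(%j. mL P (%x. v0 x *R grad (ctz j) x)) ~~> 0"
  proof (rule annulus_null[OF v0 _ C(1)])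
   show "mL Ps v0 < \<infinity>" using vB ennreal_less_top le_less_trans by fastforce
   show "norm (v0 x *R grad (ctz j) x) <= \<bar>v0 x\<bar> * (C / real (Suc j))" for j x
    using mult_left_mono[OF ctz3[of j x], of "\<bar>v0 x\<bar>"] by (simp del: of_nat_Suc)
   show "v0 x *R grad (ctz j) x = 0" if "norm x < real (Suc j) \<or> 2 * real (Suc j) < norm x" for j x
    using ctz4[OF that] by simp
  qed
  have "(%j. mL P (%x. (ctz j x - 1) *R g0 x + v0 x *R grad (ctz j) x)) ~~> 0"
   by (intro mo_tendsto_add[OF gP] 1 2) measurable
  then show "(%j. mL P (%x. (ctz j x *R g0 x + v0 x *R grad (ctz j) x) - g0 x)) ~~> 0"
   by (simp add: algebra_simps)
 qed measurable
 then show ?thesis using lim by blast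
qed

end

section \<open>Differentiation of the functionals\<close>

lemma mvt_bound:
 fixes \<Theta> :: "'b::euclidean_space => real"
 assumes d: "!!z. (\<Theta> has_derivative (%h. \<Gamma> z \<bullet> h)) (at z)"
 shows "\<exists>th. 0 < th & th < 1 & \<Theta> (z + y) - \<Theta> z = \<Gamma> (z + th *R y) \<bullet> y"
proof -
 have "((%t. \<Theta> (z + t *R y)) has_real_derivative \<Gamma> (z + t *R y) \<bullet> y) (at t)" for t
 proof -
  have "((%t. z + t *R y) has_derivative (%s. s *R y)) (at t)" by (auto intro!: derivative_eq_intros)
  from has_derivative_compose[OF this d] show ?thesis
   unfolding has_field_derivative_def by (rule has_derivative_eq_rhs) (simp add: fun_eq_iff)
 qed
 then have "\<exists>th. 0 < th & th < 1 & \<Theta> (z + 1 *R y) - \<Theta> (z + 0 *R y) = (1 - 0) * (\<Gamma> (z + th *R y) \<bullet> y)"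
  by (intro MVT2) auto
 then show ?thesis by simp
qed

text \<open>One template for the gradient term, the potential term and the nonlinearity, each
  restricted to the plane spanned by two directions. \<open>dom\<close> is a majorant uniform for
  bounded parameters, from which differentiability and continuity of the derivative follow by
  dominated convergence.\<close>

locale param_family =
 fixes \<omega> :: "'a::euclidean_space => real" and \<xi> ctz :: "'a => 'b::euclidean_space" and \<Theta> :: "'b => real" and \<Gamma> :: "'b => 'b"
 assumes \<omega>m: "\<omega> \<in> LM" and \<xi>m: "\<xi> \<in> LM" and ctzm: "ctz \<in> LM"
  and \<Gamma>c: "continuous_on UNIV \<Gamma>" and \<Theta>d: "!!z. (\<Theta> has_derivative (%h. \<Gamma> z \<bullet> h)) (at z)" and \<Theta>0: "\<Theta> 0 = 0"
  and dom: "!!R. 1 <= R ==> EX M. integrable lebesgue M & (AE x in lebesgue. \<forall>tu sg. \<bar>tu\<bar> <= R --> \<bar>sg\<bar> <= R -->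
    \<bar>\<omega> x\<bar> * norm (\<Gamma> (tu *R \<xi> x + sg *R ctz x)) * (norm (\<xi> x) + norm (ctz x)) <= M x)"
begin

lemma \<Theta>c: "continuous_on UNIV \<Theta>"
 using \<Theta>d by (intro has_derivative_continuous_on) (blast intro: has_derivative_at_withinI)

lemma \<Gamma>m[measurable]: "\<Gamma> \<in> borel_measurable borel" and \<Theta>m[measurable]: "\<Theta> \<in> borel_measurable borel"
 by (rule borel_measurable_continuous_onI[OF \<Gamma>c]) (rule borel_measurable_continuous_onI[OF \<Theta>c])

lemmas [measurable] = \<omega>m \<xi>m ctzm

definition I where "I tu sg = (LINT x|lebesgue. \<omega> x * \<Theta> (tu *R \<xi> x + sg *R ctz x))"

definition dI where "dI tu sg tu' sg' = (LINT x|lebesgue. \<omega> x * (\<Gamma> (tu *R \<xi> x + sg *R ctz x) \<bullet> (tu' *R \<xi> x + sg' *R ctz x)))"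

lemma dir_bound:
 assumes "\<bar>tu'\<bar> <= R" "\<bar>sg'\<bar> <= R" "0 <= R" "\<bar>w\<bar> * norm G * (norm x + norm y) <= (M::real)"
 shows "\<bar>w * (G \<bullet> (tu' *R x + sg' *R y))\<bar> <= R * M"
proof -
 have "norm (tu' *R x + sg' *R y) <= R * norm x + R * norm y"
  using assms by (intro order_trans[OF norm_triangle_ineq] add_mono) (auto intro: mult_right_mono)
 then have "norm G * norm (tu' *R x + sg' *R y) <= norm G * (R * (norm x + norm y))"
  by (intro mult_left_mono) (auto simp: algebra_simps)
 then have "\<bar>G \<bullet> (tu' *R x + sg' *R y)\<bar> <= norm G * (R * (norm x + norm y))"
  by (rule order_trans[OF Cauchy_Schwarz_ineq2])
 then have "\<bar>w * (G \<bullet> (tu' *R x + sg' *R y))\<bar> <= \<bar>w\<bar> * (norm G * (R * (norm x + norm y)))"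
  unfolding abs_mult by (intro mult_left_mono) auto
 also have "... = R * (\<bar>w\<bar> * norm G * (norm x + norm y))" by simp
 also have "... <= R * M" using assms by (intro mult_left_mono) auto
 finally show ?thesis .
qed

lemma dI_integrable: "integrable lebesgue (%x. \<omega> x * (\<Gamma> (tu *R \<xi> x + sg *R ctz x) \<bullet> (tu' *R \<xi> x + sg' *R ctz x)))"
proof -
 define R where "R = 1 + \<bar>tu\<bar> + \<bar>sg\<bar> + \<bar>tu'\<bar> + \<bar>sg'\<bar>"
 have R: "1 <= R" "\<bar>tu\<bar> <= R" "\<bar>sg\<bar> <= R" "\<bar>tu'\<bar> <= R" "\<bar>sg'\<bar> <= R" by (auto simp: R_def)
 obtain M where M: "integrable lebesgue M" and AEM: "AE x in lebesgue. \<forall>tu sg. \<bar>tu\<bar> <= R --> \<bar>sg\<bar> <= R -->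
    \<bar>\<omega> x\<bar> * norm (\<Gamma> (tu *R \<xi> x + sg *R ctz x)) * (norm (\<xi> x) + norm (ctz x)) <= M x" using dom[OF R(1)] by (elim exE conjE) (rule that)
 show ?thesis
 proof (rule Bochner_Integration.integrable_bound[OF integrable_mult_right[OF M, of R]])
  show "AE x in lebesgue. norm (\<omega> x * (\<Gamma> (tu *R \<xi> x + sg *R ctz x) \<bullet> (tu' *R \<xi> x + sg' *R ctz x))) <= norm (R * M x)"
   using AEM
  proof eventually_elim
   case (elim x)
   have "\<bar>\<omega> x * (\<Gamma> (tu *R \<xi> x + sg *R ctz x) \<bullet> (tu' *R \<xi> x + sg' *R ctz x))\<bar> <= R * M x"
    by (rule dir_bound) (use R elim in auto)
   then show ?case by simp
  qed
 qed measurable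
qed

lemma I_integrable: "integrable lebesgue (%x. \<omega> x * \<Theta> (tu *R \<xi> x + sg *R ctz x))"
proof -
 define R where "R = 1 + \<bar>tu\<bar> + \<bar>sg\<bar>"
 have R: "1 <= R" "\<bar>tu\<bar> <= R" "\<bar>sg\<bar> <= R" by (auto simp: R_def)
 obtain M where M: "integrable lebesgue M" and AEM: "AE x in lebesgue. \<forall>tu sg. \<bar>tu\<bar> <= R --> \<bar>sg\<bar> <= R -->
    \<bar>\<omega> x\<bar> * norm (\<Gamma> (tu *R \<xi> x + sg *R ctz x)) * (norm (\<xi> x) + norm (ctz x)) <= M x" using dom[OF R(1)] by (elim exE conjE) (rule that)
 show ?thesis
 proof (rule Bochner_Integration.integrable_bound[OF integrable_mult_right[OF M, of R]])
  show "AE x in lebesgue. norm (\<omega> x * \<Theta> (tu *R \<xi> x + sg *R ctz x)) <= norm (R * M x)"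
   using AEM
  proof eventually_elim
   case (elim x)
   obtain th where th: "0 < th" "th < 1" "\<Theta> (0 + (tu *R \<xi> x + sg *R ctz x)) - \<Theta> 0 = \<Gamma> (0 + th *R (tu *R \<xi> x + sg *R ctz x)) \<bullet> (tu *R \<xi> x + sg *R ctz x)"
    using mvt_bound[OF \<Theta>d] by blast
   have b: "\<bar>th * tu\<bar> <= R" "\<bar>th * sg\<bar> <= R" using th R mult_mono[of th 1 "\<bar>tu\<bar>" R] mult_mono[of th 1 "\<bar>sg\<bar>" R] by (auto simp: abs_mult)
   have e: "\<Theta> (tu *R \<xi> x + sg *R ctz x) = \<Gamma> ((th * tu) *R \<xi> x + (th * sg) *R ctz x) \<bullet> (tu *R \<xi> x + sg *R ctz x)"
    using th(3) \<Theta>0 by (simp add: scaleR_add_right)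
   have "\<bar>\<omega> x * \<Theta> (tu *R \<xi> x + sg *R ctz x)\<bar> <= R * M x"
    unfolding e by (rule dir_bound) (use R elim b in auto)
   then show ?case by simp
  qed
 qed measurable
qed

lemma dI_lin: "dI tu sg (c * p + d * q) (c * p' + d * q') = c * dI tu sg p p' + d * dI tu sg q q'"
proof -
 have "dI tu sg (c * p + d * q) (c * p' + d * q') = (LINT x|lebesgue. c * (\<omega> x * (\<Gamma> (tu *R \<xi> x + sg *R ctz x) \<bullet> (p *R \<xi> x + p' *R ctz x)))
   + d * (\<omega> x * (\<Gamma> (tu *R \<xi> x + sg *R ctz x) \<bullet> (q *R \<xi> x + q' *R ctz x))))"
  unfolding dI_def by (intro Bochner_Integration.integral_cong) (simp_all add: inner_add_right scaleR_add_left algebra_simps)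
 also have "... = c * dI tu sg p p' + d * dI tu sg q q'"
  unfolding dI_def by (subst Bochner_Integration.integral_add) (auto intro!: integrable_mult_right dI_integrable)
 finally show ?thesis .
qed

lemma dI_cont:
 assumes "T ~~> tu" "S ~~> sg"
 shows "(%n. dI (T n) (S n) tu' sg') ~~> dI tu sg tu' sg'"
proof -
 obtain B1 where B1: "!!n. \<bar>T n\<bar> <= B1" using convergent_imp_Bseq[of T] assms(1) by (auto simp: convergent_def Bseq_def)
 obtain B2 where B2: "!!n. \<bar>S n\<bar> <= B2" using convergent_imp_Bseq[of S] assms(2) by (auto simp: convergent_def Bseq_def)
 define R where "R = 1 + \<bar>B1\<bar> + \<bar>B2\<bar> + \<bar>tu'\<bar> + \<bar>sg'\<bar>"
 have R: "1 <= R" "!!n. \<bar>T n\<bar> <= R" "!!n. \<bar>S n\<bar> <= R" "\<bar>tu'\<bar> <= R" "\<bar>sg'\<bar> <= R"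
  using order_trans[OF order_trans[OF B1 abs_ge_self], of "1 + \<bar>B1\<bar> + \<bar>B2\<bar> + \<bar>tu'\<bar> + \<bar>sg'\<bar>"] order_trans[OF order_trans[OF B2 abs_ge_self], of "1 + \<bar>B1\<bar> + \<bar>B2\<bar> + \<bar>tu'\<bar> + \<bar>sg'\<bar>"] by (auto simp: R_def intro: order_trans)
 obtain M where M: "integrable lebesgue M" and AEM: "AE x in lebesgue. \<forall>tu sg. \<bar>tu\<bar> <= R --> \<bar>sg\<bar> <= R -->
    \<bar>\<omega> x\<bar> * norm (\<Gamma> (tu *R \<xi> x + sg *R ctz x)) * (norm (\<xi> x) + norm (ctz x)) <= M x" using dom[OF R(1)] by (elim exE conjE) (rule that)
 show ?thesis unfolding dI_def
 proof (rule integral_dominated_convergence[where w = "%x. R * M x"])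
  show "integrable lebesgue (%x. R * M x)" by (intro integrable_mult_right M)
  show "AE x in lebesgue. norm (\<omega> x * (\<Gamma> (T n *R \<xi> x + S n *R ctz x) \<bullet> (tu' *R \<xi> x + sg' *R ctz x))) <= R * M x" for n
   using AEM
  proof eventually_elim
   case (elim x)
   show ?case unfolding real_norm_def by (rule dir_bound) (use R(1) R(2,3)[of n] R(4,5) elim in auto)
  qed
  show "AE x in lebesgue. (%n. \<omega> x * (\<Gamma> (T n *R \<xi> x + S n *R ctz x) \<bullet> (tu' *R \<xi> x + sg' *R ctz x))) ~~> \<omega> x * (\<Gamma> (tu *R \<xi> x + sg *R ctz x) \<bullet> (tu' *R \<xi> x + sg' *R ctz x))"
   by (intro AE_I2 tendsto_intros continuous_on_tendsto_compose[OF \<Gamma>c] assms) auto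
 qed measurable
qed

text \<open>By the mean value theorem the difference quotient at x is the integrand of
  \<open>dI\<close> at an intermediate parameter, so the same majorant applies. That parameter
  depends on x, and its convergence for each fixed x is enough.\<close>

lemma I_deriv: "((%t. I (tu + t * tu') (sg + t * sg')) has_real_derivative dI tu sg tu' sg') (at 0)"
 unfolding has_field_derivative_iff
proof (subst tendsto_at_iff_sequentially, intro allI impI)
 fix X :: "nat => real" assume X0: "ALL i. X i \<in> UNIV - {0}" and X: "X ~~> 0"
 obtain B1 where B1: "!!n. \<bar>X n\<bar> <= B1" using convergent_imp_Bseq[of X] X by (auto simp: convergent_def Bseq_def)
 define R where "R = 1 + \<bar>tu\<bar> + \<bar>sg\<bar> + (1 + \<bar>B1\<bar>) * (\<bar>tu'\<bar> + \<bar>sg'\<bar>)"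
 have Rb: "\<bar>tu + s * tu'\<bar> <= R" "\<bar>sg + s * sg'\<bar> <= R" if "\<bar>s\<bar> <= \<bar>B1\<bar>" for s
 proof -
  have "\<bar>s * tu'\<bar> <= (1 + \<bar>B1\<bar>) * (\<bar>tu'\<bar> + \<bar>sg'\<bar>)" "\<bar>s * sg'\<bar> <= (1 + \<bar>B1\<bar>) * (\<bar>tu'\<bar> + \<bar>sg'\<bar>)"
   unfolding abs_mult using that by (intro mult_mono; simp)+
  moreover have "1 + \<bar>tu\<bar> + \<bar>sg\<bar> + (1 + \<bar>B1\<bar>) * (\<bar>tu'\<bar> + \<bar>sg'\<bar>) = R" by (simp add: R_def)
  ultimately show "\<bar>tu + s * tu'\<bar> <= R" "\<bar>sg + s * sg'\<bar> <= R" by linarith+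
 qed
 have R: "1 <= R" "\<bar>tu'\<bar> <= R" "\<bar>sg'\<bar> <= R"
 proof -
  have "1 * (\<bar>tu'\<bar> + \<bar>sg'\<bar>) <= (1 + \<bar>B1\<bar>) * (\<bar>tu'\<bar> + \<bar>sg'\<bar>)" by (intro mult_right_mono) auto
  then have "1 + \<bar>tu'\<bar> + \<bar>sg'\<bar> <= R" unfolding R_def using abs_ge_zero[of tu] abs_ge_zero[of sg] by argo
  then show "1 <= R" "\<bar>tu'\<bar> <= R" "\<bar>sg'\<bar> <= R" by auto
 qed
 obtain M where M: "integrable lebesgue M" and AEM: "AE x in lebesgue. \<forall>tu sg. \<bar>tu\<bar> <= R --> \<bar>sg\<bar> <= R -->
    \<bar>\<omega> x\<bar> * norm (\<Gamma> (tu *R \<xi> x + sg *R ctz x)) * (norm (\<xi> x) + norm (ctz x)) <= M x" using dom[OF R(1)] by (elim exE conjE) (rule that)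
 define q where "q = (%n x. (\<omega> x * \<Theta> ((tu + X n * tu') *R \<xi> x + (sg + X n * sg') *R ctz x) - \<omega> x * \<Theta> (tu *R \<xi> x + sg *R ctz x)) / X n)"
 have eq: "EX s. \<bar>s\<bar> <= \<bar>X n\<bar> & q n x = \<omega> x * (\<Gamma> ((tu + s * tu') *R \<xi> x + (sg + s * sg') *R ctz x) \<bullet> (tu' *R \<xi> x + sg' *R ctz x))" for n x
 proof -
  define z where "z = tu *R \<xi> x + sg *R ctz x"
  define y where "y = tu' *R \<xi> x + sg' *R ctz x"
  obtain th where th: "0 < th" "th < 1" "\<Theta> (z + X n *R y) - \<Theta> z = \<Gamma> (z + th *R X n *R y) \<bullet> (X n *R y)"
   using mvt_bound[OF \<Theta>d] by blast
  have e: "(tu + s * tu') *R \<xi> x + (sg + s * sg') *R ctz x = z + s *R y" for s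
   by (simp add: z_def y_def scaleR_add_left scaleR_add_right)
  have "q n x = \<omega> x * (\<Theta> (z + X n *R y) - \<Theta> z) / X n" unfolding q_def e by (simp add: z_def right_diff_distrib)
  also have "... = \<omega> x * (\<Gamma> (z + (th * X n) *R y) \<bullet> y)" unfolding th(3) using X0[rule_format, of n] by simp
  finally have "q n x = \<omega> x * (\<Gamma> (z + (th * X n) *R y) \<bullet> y)" .
  moreover have "\<bar>th * X n\<bar> <= \<bar>X n\<bar>" using th by (simp add: abs_mult mult_left_le_one_le)
  ultimately show ?thesis unfolding e y_def[symmetric] by blast
 qed
 have "(%n. LINT x|lebesgue. q n x) ~~> dI tu sg tu' sg'"
  unfolding dI_def
 proof (rule integral_dominated_convergence[where w = "%x. R * M x"])
  show "integrable lebesgue (%x. R * M x)" by (intro integrable_mult_right M)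
  show "AE x in lebesgue. norm (q n x) <= R * M x" for n
   using AEM
  proof eventually_elim
   case (elim x)
   obtain s where s: "\<bar>s\<bar> <= \<bar>X n\<bar>" "q n x = \<omega> x * (\<Gamma> ((tu + s * tu') *R \<xi> x + (sg + s * sg') *R ctz x) \<bullet> (tu' *R \<xi> x + sg' *R ctz x))"
    using eq by blast
   have "\<bar>s\<bar> <= \<bar>B1\<bar>" using s(1) B1[of n] by linarith
   then show ?case unfolding s(2) real_norm_def by (intro dir_bound) (use R Rb elim in auto)
  qed
  show "AE x in lebesgue. (%n. q n x) ~~> \<omega> x * (\<Gamma> (tu *R \<xi> x + sg *R ctz x) \<bullet> (tu' *R \<xi> x + sg' *R ctz x))"
  proof (rule AE_I2)
   fix x
   have "EX s. ALL n. \<bar>s n\<bar> <= \<bar>X n\<bar> & q n x = \<omega> x * (\<Gamma> ((tu + s n * tu') *R \<xi> x + (sg + s n * sg') *R ctz x) \<bullet> (tu' *R \<xi> x + sg' *R ctz x))"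
    by (rule choice) (use eq in blast)
   then obtain s where s: "!!n. \<bar>s n\<bar> <= \<bar>X n\<bar>" "!!n. q n x = \<omega> x * (\<Gamma> ((tu + s n * tu') *R \<xi> x + (sg + s n * sg') *R ctz x) \<bullet> (tu' *R \<xi> x + sg' *R ctz x))" by blast
   have s0: "s ~~> 0" by (rule Lim_null_comparison[OF _ tendsto_rabs_zero[OF X]]) (use s(1) in auto)
   have "(%n. \<omega> x * (\<Gamma> ((tu + s n * tu') *R \<xi> x + (sg + s n * sg') *R ctz x) \<bullet> (tu' *R \<xi> x + sg' *R ctz x))) ~~>
     \<omega> x * (\<Gamma> ((tu + 0 * tu') *R \<xi> x + (sg + 0 * sg') *R ctz x) \<bullet> (tu' *R \<xi> x + sg' *R ctz x))"
    by (intro tendsto_intros continuous_on_tendsto_compose[OF \<Gamma>c] s0) auto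
   then show "(%n. q n x) ~~> \<omega> x * (\<Gamma> (tu *R \<xi> x + sg *R ctz x) \<bullet> (tu' *R \<xi> x + sg' *R ctz x))" by (simp add: s(2))
  qed
  show "q n \<in> LM" for n unfolding q_def by measurable
 qed measurable
 moreover have "(LINT x|lebesgue. q n x) = (I (tu + X n * tu') (sg + X n * sg') - I tu sg) / X n" for n
  unfolding q_def I_def by (simp add: Bochner_Integration.integral_diff[OF I_integrable I_integrable])
 ultimately show "((%t. (I (tu + t * tu') (sg + t * sg') - I (tu + 0 * tu') (sg + 0 * sg')) / (t - 0)) \<circ> X) ~~> dI tu sg tu' sg'"
  by (simp add: o_def)
qed

end

section \<open>The vector field generated by \<phi>\<close>

context orlicz_var
begin

text \<open>This is \<phi>(|z|) z, with value 0 at 0 through division by zero; the polymorphic form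
  serves gradients and scalars alike.\<close>

definition A :: "'b::euclidean_space => 'b" where "A z = (a (norm z) / norm z) *R z"

lemma a_mono: "0 <= s ==> s <= t ==> a s <= a t"
 using a_less[of s t] by (cases "s = t") auto

lemma a_ge0: "0 <= t ==> 0 <= a t" using a_mono[of 0 t] a_0 by simp

lemma a_pos: "0 < t ==> 0 < a t" using a_less[of 0 t] a_0 by simp

lemma norm_A: "norm (A z) = a (norm z)"
 using a_ge0[of "norm z"] a_0 by (cases "z = 0") (auto simp: A_def)

lemma A_inner_self: "A z \<bullet> z = a (norm z) * norm z"
proof (cases "z = 0")
 case False
 then show ?thesis by (simp add: A_def power2_norm_eq_inner[symmetric] power2_eq_square)
qed (simp add: A_def)

lemma A_scale: "0 < c ==> A (c *R z) = (a (c * norm z) / norm z) *R z"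
 by (simp add: A_def)

lemma A_cont: "continuous_on UNIV (A :: 'b::euclidean_space => 'b)"
proof -
 have an: "isCont (%z::'b. a (norm z)) z" for z
  using a_cont by (intro isCont_o2[OF isCont_norm]) (auto simp: continuous_on_eq_continuous_at)
 have "isCont A z" for z :: 'b
 proof (cases "z = 0")
  case True
  have "((%z::'b. a (norm z)) \<longlongrightarrow> 0) (at 0)" using an[of 0] a_0 by (simp add: isCont_def)
  then have "(A \<longlongrightarrow> 0) (at (0::'b))"
   by (rule Lim_null_comparison[rotated]) (simp add: norm_A)
  then show ?thesis using True by (simp add: isCont_def A_def)
 next
  case False
  then show ?thesis unfolding A_def[abs_def] by (intro continuous_intros an) auto
 qed
 then show ?thesis by (simp add: continuous_on_eq_continuous_at)
qed

lemma P_norm_deriv: "((%z::'b::euclidean_space. P (norm z)) has_derivative (%h. A z \<bullet> h)) (at z)"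
proof (cases "z = 0")
 case False
 have "((%z. P (norm z)) has_derivative (%h. (h \<bullet> sgn z) * (sgn (norm z) * a \<bar>norm z\<bar>))) (at z)"
  by (rule DERIV_compose_FDERIV[OF P_deriv has_derivative_norm[OF False]])
 then show ?thesis by (rule has_derivative_eq_rhs) (use False in \<open>simp add: fun_eq_iff A_def sgn_div_norm inner_commute field_simps\<close>)
next
 case True
 have "((%h::'b. (P (norm (0 + h)) - P (norm (0::'b)) - 0) /\<^sub>R norm h) \<longlongrightarrow> 0) (at 0)"
 proof (rule Lim_null_comparison)
  have "isCont (%z::'b. a (norm z)) 0"
   using a_cont by (intro isCont_o2[OF isCont_norm]) (auto simp: continuous_on_eq_continuous_at)
  then show "((%z::'b. a (norm z)) \<longlongrightarrow> 0) (at 0)" using a_0 by (simp add: isCont_def)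
  show "eventually (%h::'b. norm ((P (norm (0 + h)) - P (norm (0::'b)) - 0) /\<^sub>R norm h) <= a (norm h)) (at 0)"
   unfolding eventually_at_filter
  proof (intro always_eventually allI impI)
   fix h :: 'b assume "h ~= 0"
   then show "norm ((P (norm (0 + h)) - P (norm (0::'b)) - 0) /\<^sub>R norm h) <= a (norm h)"
    using Pa_lower[of "norm h"] gf_ge0[OF gP, of "norm h"] gf_0[OF gP]
    by (simp add: field_simps)
  qed
 qed
 from this[THEN tendsto_norm_zero] show ?thesis using True by (simp add: has_derivative_at A_def bounded_linear_zero inverse_eq_divide)
qed

text \<open>a is monotone and \<open>s * a s <= m * P s\<close>; enlarging the second factor s to
  \<open>R * s\<close> is harmless as R >= 1.\<close>

lemma A_dom:
 assumes "1 <= R" "\<bar>tu\<bar> <= R" "\<bar>sg\<bar> <= R"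
 shows "norm (A (tu *R x + sg *R y)) * (norm x + norm y) <= m * P (R * (norm x + norm y))"
proof -
 define s where "s = norm x + norm y"
 have s: "0 <= s" by (simp add: s_def)
 have "norm (tu *R x + sg *R y) <= R * norm x + R * norm y"
  using assms by (intro order_trans[OF norm_triangle_ineq] add_mono) (auto intro: mult_right_mono)
 then have "norm (A (tu *R x + sg *R y)) <= a (R * s)" unfolding norm_A by (intro a_mono) (auto simp: s_def algebra_simps)
 then have "norm (A (tu *R x + sg *R y)) * s <= a (R * s) * (R * s)"
  using s assms a_ge0[of "R * s"] by (intro mult_mono) (auto simp: mult_le_cancel_right1 not_less)
 also have "... <= m * P (R * s)" using Pa_upper[of "R * s"] s assms by (simp add: mult.commute)
 finally show ?thesis by (simp add: s_def)
qed

end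

section \<open>The variational problem\<close>

lemma mo_integrable:
 assumes G: "gf G q" and [measurable]: "w \<in> borel_measurable M" and f: "mo M G (w :: 'a => 'b::euclidean_space) < \<infinity>"
 shows "integrable M (%x. G (norm (w x)))" "mo M G w = ennreal (LINT x|M. G (norm (w x)))"
proof -
 have m[measurable]: "(%x. G (norm (w x))) \<in> borel_measurable M" by (rule gf_meas[OF G]) simp
 show i: "integrable M (%x. G (norm (w x)))"
  using f gf_ge0[OF G] by (intro integrableI_nonneg) (auto simp: mo_def)
 show "mo M G w = ennreal (LINT x|M. G (norm (w x)))"
  unfolding mo_def by (rule nn_integral_eq_integral[OF i]) (use gf_ge0[OF G] in auto)
qed

text \<open>kb bounds K and kv bounds K/V. The two go with different growth terms: the a-part of f
  is charged to the potential through kv, the power part to L^ms through kb.\<close>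

locale var_problem = orlicz_var P Ps m ms ty a for P Ps :: "real => real" and m ms :: real and ty :: "'a::euclidean_space itself" and a :: "real => real" +
 fixes V K :: "'a => real" and f F :: "real => real" and kb kv :: real
 assumes V_cont: "continuous_on UNIV V" and V_pos: "!!x. 0 < V x"
  and K_cont: "continuous_on UNIV K" and K_nonneg: "!!x. 0 <= K x" and K_pos: "AE x in lebesgue. 0 < K x"
  and K_kb: "AE x in lebesgue. K x <= kb" and K_kv: "AE x in lebesgue. K x <= kv * V x" and kb: "0 < kb" and kv: "0 < kv"
  and K1: "!!A ep. (!!n::nat. A n \<in> sets borel) ==> (\<exists>M::real. ALL n. emeasure lebesgue (A n) <= ennreal M) ==> 0 < ep ==>
    EX R. ALL n. set_nn_integral lebesgue (A n \<inter> - ball 0 R) (%x. ennreal (K x)) <= ennreal ep"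
  and f_cont: "continuous_on UNIV f" and f_neg: "!!s. s <= 0 ==> f s = 0"
  and F_deriv: "!!t. (F has_real_derivative f t) (at t)" and F_neg: "!!t. t <= 0 ==> F t = 0"
  and G1: "!!ep. 0 < ep ==> \<exists>C\<ge>0. ALL t. \<bar>f t\<bar> <= ep * a \<bar>t\<bar> + C * \<bar>t\<bar> powr (ms - 1)"
  and G2: "!!ep. 0 < ep ==> \<exists>C\<ge>0. \<exists>dl>0. ALL t. \<bar>F t\<bar> <= ep * (P \<bar>t\<bar> + \<bar>t\<bar> powr ms) + (if dl <= \<bar>t\<bar> then C else 0)"
  and f2: "!!s t. 0 < s ==> s < t ==> s powr (1 - m) * f s < t powr (1 - m) * f t"
  and f3: "filterlim (%s. s powr (1 - m) * f s) at_top at_top"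
begin

abbreviation "MV \<equiv> density lebesgue (%x. ennreal (V x))"

definition Es :: "('a => real) => ('a => 'a) => bool" where
 "Es u g \<longleftrightarrow> D u g & mo MV P u < \<infinity>"

lemma V_meas[measurable]: "V \<in> LM" and K_meas[measurable]: "K \<in> LM"
 using borel_measurable_continuous_onI[OF V_cont] borel_measurable_continuous_onI[OF K_cont] by (auto intro: measurable_completion)

lemma f_meas[measurable]: "f \<in> borel_measurable borel"
 by (rule borel_measurable_continuous_onI[OF f_cont])

lemma F_cont: "continuous_on UNIV F"
 by (rule DERIV_continuous_on) (use F_deriv in \<open>blast intro: has_field_derivative_at_within\<close>)

lemma F_meas[measurable]: "F \<in> borel_measurable borel"
 by (rule borel_measurable_continuous_onI[OF F_cont])

lemma A_meas[measurable]: "(A :: 'b::euclidean_space => 'b) \<in> borel_measurable borel"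
 by (rule borel_measurable_continuous_onI[OF A_cont])

lemma a_meas[measurable]: "a \<in> borel_measurable borel"
 by (rule borel_measurable_continuous_onI[OF a_cont])

lemma gms: "gf (%t. t powr ms) ms" using ms1 by (intro gf_powr) simp

lemma Es_meas: "Es u g ==> u \<in> LM" "Es u g ==> g \<in> LM"
 by (auto simp: Es_def D_meas)

lemma Es_lin:
 assumes "Es u g" "Es w h"
 shows "Es (%x. tu * u x + sg * w x) (%x. tu *R g x + sg *R h x)"
proof -
 note [measurable] = Es_meas[OF assms(1)] Es_meas[OF assms(2)]
 have "mo MV P (%x. tu *R u x + sg *R w x) < \<infinity>"
  by (intro mo_add_finite[OF gP] mo_scale_finite[OF gP]) (use assms in \<open>auto simp: Es_def\<close>)
 then show ?thesis using assms D_lin by (auto simp: Es_def)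
qed

lemma Es_scale: "Es u g ==> Es (%x. c * u x) (%x. c *R g x)"
 using Es_lin[of u g u g c 0] by simp

text \<open>The chosen constant is a fixed term, so that the bound is visibly uniform over all
  u.\<close>

lemma mo_ms_le:
 assumes [measurable]: "u \<in> LM" and B: "mL Ps (u :: 'a => real) <= B"
 shows "mL (%t. t powr ms) u <= ennreal (1 / (SOME C. 0 < C & (\<forall>t\<ge>0. C * t powr ms <= Ps t))) * B"
proof -
 define c where "c = (SOME C. 0 < C & (\<forall>t\<ge>0. C * t powr ms <= Ps t))"
 have c: "0 < c" "!!t. 0 <= t ==> c * t powr ms <= Ps t" using someI_ex[OF Ps_lower] unfolding c_def by auto
 note [measurable] = gf_meas_e[OF gPs]
 have "mL (%t. t powr ms) u <= (\<integral>\<^sup>+x. ennreal (1 / c) * ennreal (Ps (norm (u x))) \<partial>lebesgue)"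
  unfolding mo_def
 proof (rule nn_integral_mono)
  fix x
  show "ennreal (norm (u x) powr ms) <= ennreal (1 / c) * ennreal (Ps (norm (u x)))"
   using c(1) c(2)[of "norm (u x)"] by (subst ennreal_mult[symmetric]) (auto intro!: ennreal_leI gf_ge0[OF gPs] simp: field_simps)
 qed
 also have "... = ennreal (1 / c) * mL Ps u" unfolding mo_def by (rule nn_integral_cmult) measurable
 also have "... <= ennreal (1 / c) * B" by (intro mult_left_mono B) simp
 finally show ?thesis unfolding c_def .
qed

lemma D_ms: "D u g ==> mL (%t. t powr ms) u < \<infinity>"
 using D_finite(1)[of u g] by (intro le_less_trans[OF mo_ms_le[OF D_meas(1) order_refl]]) (auto simp: ennreal_mult_less_top)

lemma MV_integrable:
 assumes [measurable]: "u \<in> LM" and "mo MV P (u :: 'a => real) < \<infinity>"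
 shows "integrable lebesgue (%x. V x * P \<bar>u x\<bar>)" "mo MV P u = ennreal (LINT x|lebesgue. V x * P \<bar>u x\<bar>)"
proof -
 have m[measurable]: "(%x. P (norm (u x))) \<in> LM" by (rule gf_meas[OF gP]) simp
 have "integrable MV (%x. P (norm (u x)))" "mo MV P u = ennreal (LINT x|MV. P (norm (u x)))"
  using assms by (intro mo_integrable[OF gP]; simp)+
 moreover have "AE x in lebesgue. 0 <= V x" using V_pos by (simp add: less_imp_le)
 ultimately show "integrable lebesgue (%x. V x * P \<bar>u x\<bar>)" "mo MV P u = ennreal (LINT x|lebesgue. V x * P \<bar>u x\<bar>)"
  using integrable_density[OF m V_meas] integral_density[OF m V_meas] by simp_all
qed

text \<open>The weak gradient is an explicit argument, so that linear combinations act on pairs of a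
  function and its gradient.\<close>

definition J where "J u g = (LINT x|lebesgue. P (norm (g x))) + (LINT x|lebesgue. V x * P \<bar>u x\<bar>) - (LINT x|lebesgue. K x * F (u x))"
 for u :: "'a => real" and g :: "'a => 'a"

definition dJ where "dJ u g w h = (LINT x|lebesgue. A (g x) \<bullet> h x) + (LINT x|lebesgue. V x * (A (u x) * w x)) - (LINT x|lebesgue. K x * (f (u x) * w x))"
 for u w :: "'a => real" and g h :: "'a => 'a"

text \<open>The pointwise majorant for the nonlinear family: \<open>kv * v\<close> replaces k in
  front of the a-part, which then belongs to the potential modular, and kb replaces it in front of
  the power.\<close>

lemma f_dom:
 assumes C: "0 <= C" "!!t. \<bar>f t\<bar> <= 1 * a \<bar>t\<bar> + C * \<bar>t\<bar> powr (ms - 1)"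
  and R: "1 <= R" "\<bar>tu\<bar> <= R" "\<bar>sg\<bar> <= R" and K: "0 <= k" "k <= kb" "k <= kv * v"
 shows "k * \<bar>f (tu * x + sg * y)\<bar> * (\<bar>x\<bar> + \<bar>y\<bar>) <= kv * (v * (m * P (R * (\<bar>x\<bar> + \<bar>y\<bar>)))) + kb * (C * (R * (\<bar>x\<bar> + \<bar>y\<bar>)) powr ms)"
proof -
 define s where "s = \<bar>x\<bar> + \<bar>y\<bar>"
 define z where "z = \<bar>tu * x + sg * y\<bar>"
 have s: "0 <= s" "s <= R * s" using R by (auto simp: s_def mult_le_cancel_right1)
 have z: "0 <= z" "z <= R * s"
 proof -
  have "z <= \<bar>tu\<bar> * \<bar>x\<bar> + \<bar>sg\<bar> * \<bar>y\<bar>" unfolding z_def using abs_triangle_ineq[of "tu * x" "sg * y"] by (simp add: abs_mult)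
  also have "... <= R * \<bar>x\<bar> + R * \<bar>y\<bar>" using R by (intro add_mono mult_right_mono) auto
  finally show "z <= R * s" by (simp add: s_def algebra_simps)
 qed (simp add: z_def)
 have "\<bar>f (tu * x + sg * y)\<bar> <= a z + C * z powr (ms - 1)" using C(2)[of "tu * x + sg * y"] by (simp add: z_def)
 also have "... <= a (R * s) + C * (R * s) powr (ms - 1)" using z C(1) ms1 by (intro add_mono mult_left_mono powr_mono2 a_mono) auto
 finally have "\<bar>f (tu * x + sg * y)\<bar> * s <= (a (R * s) + C * (R * s) powr (ms - 1)) * (R * s)"
  using s z a_ge0[of "R * s"] C(1) by (intro mult_mono) auto
 also have "... = R * s * a (R * s) + C * ((R * s) powr (ms - 1) * (R * s))" by (simp add: algebra_simps)
 also have "(R * s) powr (ms - 1) * (R * s) = (R * s) powr ms"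
  using s R powr_add[of "R * s" "ms - 1" 1] ms1 by (cases "R * s = 0") (auto simp: less_le)
 also have "R * s * a (R * s) + C * (R * s) powr ms <= m * P (R * s) + C * (R * s) powr ms"
  using Pa_upper[of "R * s"] s by simp
 finally have "k * (\<bar>f (tu * x + sg * y)\<bar> * s) <= k * (m * P (R * s)) + k * (C * (R * s) powr ms)"
  using K(1) by (simp add: mult_left_mono distrib_left[symmetric])
 also have "... <= (kv * v) * (m * P (R * s)) + kb * (C * (R * s) powr ms)"
  using K C(1) m1 gf_ge0[OF gP, of "R * s"] s by (intro add_mono mult_right_mono) auto
 finally show ?thesis by (simp add: s_def mult.assoc)
qed

lemma families:
 assumes u: "Es u g" and w: "Es w h"
 shows "param_family (%_. 1) g h (%z. P (norm z)) A" "param_family V u w (%z. P \<bar>z\<bar>) A" "param_family K u w F f"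
proof -
 note [measurable] = Es_meas[OF u] Es_meas[OF w]
 note fin = D_finite[OF u[unfolded Es_def, THEN conjunct1]] D_finite[OF w[unfolded Es_def, THEN conjunct1]]
 have g1: "mL P (%x. R *R (norm (g x) + norm (h x))) < \<infinity>" for R
  by (intro mo_add_finite[OF gP] mo_scale_finite[OF gP]) (use fin in \<open>auto simp: mo_def\<close>)
 have g2: "mo MV P (%x. R *R (norm (u x) + norm (w x))) < \<infinity>" for R
  by (intro mo_add_finite[OF gP] mo_scale_finite[OF gP]) (use u w in \<open>auto simp: mo_def Es_def\<close>)
 have g3: "mL (%t. t powr ms) (%x. R *R (norm (u x) + norm (w x))) < \<infinity>" for R
  by (intro mo_add_finite[OF gms] mo_scale_finite[OF gms]) (use u w D_ms in \<open>auto simp: mo_def Es_def\<close>)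
 have i1: "integrable lebesgue (%x. P (R * (norm (g x) + norm (h x))))" if "1 <= R" for R
  using mo_integrable(1)[OF gP _ g1[of R]] that by (simp add: abs_mult)
 have i2: "integrable lebesgue (%x. V x * P (R * (\<bar>u x\<bar> + \<bar>w x\<bar>)))" if "1 <= R" for R
  using MV_integrable(1)[OF _ g2[of R]] that by (simp add: abs_mult)
 have i3: "integrable lebesgue (%x. (R * (\<bar>u x\<bar> + \<bar>w x\<bar>)) powr ms)" if "1 <= R" for R
  using mo_integrable(1)[OF gms _ g3[of R]] that by (simp add: abs_mult)
 show "param_family (%_. 1) g h (%z. P (norm z)) A"
 proof (unfold_locales)
  fix R :: real assume R: "1 <= R"
  show "EX M. integrable lebesgue M & (AE x in lebesgue. \<forall>tu sg. \<bar>tu\<bar> <= R --> \<bar>sg\<bar> <= R -->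
    \<bar>1\<bar> * norm (A (tu *R g x + sg *R h x)) * (norm (g x) + norm (h x)) <= M x)"
   by (intro exI[of _ "%x. m * P (R * (norm (g x) + norm (h x)))"] conjI integrable_mult_right i1 R AE_I2 allI impI)
    (use A_dom[OF R] in simp)
 qed (auto intro: A_cont P_norm_deriv simp: gf_0[OF gP])
 show "param_family V u w (%z. P \<bar>z\<bar>) A"
 proof (unfold_locales)
  fix R :: real assume R: "1 <= R"
  show "EX M. integrable lebesgue M & (AE x in lebesgue. \<forall>tu sg. \<bar>tu\<bar> <= R --> \<bar>sg\<bar> <= R -->
    \<bar>V x\<bar> * norm (A (tu *R u x + sg *R w x)) * (norm (u x) + norm (w x)) <= M x)"
  proof (intro exI[of _ "%x. m * (V x * P (R * (\<bar>u x\<bar> + \<bar>w x\<bar>)))"] conjI integrable_mult_right i2 R AE_I2 allI impI)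
   fix x tu sg assume "\<bar>tu\<bar> <= R" "\<bar>sg\<bar> <= R"
   from mult_left_mono[OF A_dom[OF R this, of "u x" "w x"] less_imp_le[OF V_pos[of x]]]
   show "\<bar>V x\<bar> * norm (A (tu *R u x + sg *R w x)) * (norm (u x) + norm (w x)) <= m * (V x * P (R * (\<bar>u x\<bar> + \<bar>w x\<bar>)))"
    using V_pos[of x] by (simp add: mult_ac)
  qed
 qed (use P_norm_deriv[where 'b = real] in \<open>auto intro: A_cont simp: gf_0[OF gP]\<close>)
 show "param_family K u w F f"
 proof (unfold_locales)
  obtain C where C: "0 <= C" "!!t. \<bar>f t\<bar> <= 1 * a \<bar>t\<bar> + C * \<bar>t\<bar> powr (ms - 1)" using G1[of 1] by auto
  fix R :: real assume R: "1 <= R"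
  show "EX M. integrable lebesgue M & (AE x in lebesgue. \<forall>tu sg. \<bar>tu\<bar> <= R --> \<bar>sg\<bar> <= R -->
    \<bar>K x\<bar> * norm (f (tu *R u x + sg *R w x)) * (norm (u x) + norm (w x)) <= M x)"
  proof (intro exI[of _ "%x. kv * (m * (V x * P (R * (\<bar>u x\<bar> + \<bar>w x\<bar>)))) + kb * (C * (R * (\<bar>u x\<bar> + \<bar>w x\<bar>)) powr ms)"] conjI
    Bochner_Integration.integrable_add integrable_mult_right i2 i3 R)
   show "AE x in lebesgue. \<forall>tu sg. \<bar>tu\<bar> <= R --> \<bar>sg\<bar> <= R --> \<bar>K x\<bar> * norm (f (tu *R u x + sg *R w x)) * (norm (u x) + norm (w x)) \<le>
     kv * (m * (V x * P (R * (\<bar>u x\<bar> + \<bar>w x\<bar>)))) + kb * (C * (R * (\<bar>u x\<bar> + \<bar>w x\<bar>)) powr ms)"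
    using K_kb K_kv
   proof eventually_elim
    case (elim x)
    then show ?case using f_dom[OF C R, of _ _ "K x" "V x" "u x" "w x"] K_nonneg[of x] by (simp add: mult.left_commute[of m])
   qed
  qed
 qed (use F_deriv in \<open>auto intro: f_cont F_neg simp: has_field_derivative_def\<close>)
qed

end

text \<open>On the plane spanned by two directions calculus of two real variables takes the place of
  differentiation in a function space.\<close>

locale two_dirs = var_problem +
 fixes u g w h assumes u: "Es u g" and w: "Es w h"
begin

sublocale G: param_family "%_. 1" g h "%z. P (norm z)" A by (rule families(1)[OF u w])
sublocale U: param_family V u w "%z. P \<bar>z\<bar>" A by (rule families(2)[OF u w])
sublocale N: param_family K u w F f by (rule families(3)[OF u w])

definition "jj tu sg = J (%x. tu * u x + sg * w x) (%x. tu *R g x + sg *R h x)"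

definition "dj tu sg tu' sg' = dJ (%x. tu * u x + sg * w x) (%x. tu *R g x + sg *R h x) (%x. tu' * u x + sg' * w x) (%x. tu' *R g x + sg' *R h x)"

lemma jj_eq: "jj tu sg = G.I tu sg + U.I tu sg - N.I tu sg"
 by (simp add: jj_def J_def G.I_def U.I_def N.I_def)

lemma dj_eq: "dj tu sg tu' sg' = G.dI tu sg tu' sg' + U.dI tu sg tu' sg' - N.dI tu sg tu' sg'"
 by (simp add: dj_def dJ_def G.dI_def U.dI_def N.dI_def)

lemma jj_deriv: "((%t. jj (tu + t * tu') (sg + t * sg')) has_real_derivative dj tu sg tu' sg') (at 0)"
 unfolding jj_eq dj_eq by (intro DERIV_add DERIV_diff G.I_deriv U.I_deriv N.I_deriv)

lemma jj_deriv1: "((%tu. jj tu 0) has_real_derivative dj tu 0 1 0) (at tu)"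
 using jj_deriv[of tu 1 0 0] DERIV_shift[of "%tu. jj tu 0" _ 0 tu] by (simp add: add.commute)

text \<open>The second coordinate is \<open>tu * s\<close> because the perturbed ray consists of the
  multiples tu of u + s w.\<close>

lemma jj_deriv2: "((%s. jj tu (tu * s)) has_real_derivative dj tu (tu * s) 0 tu) (at s)"
 using jj_deriv[of tu 0 "tu * s" tu] DERIV_shift[of "%s. jj tu (tu * s)" _ 0 s] by (simp add: algebra_simps)

lemma dj_cont: "T ~~> tu ==> S ~~> sg ==> (%n. dj (T n) (S n) tu' sg') ~~> dj tu sg tu' sg'"
 unfolding dj_eq by (intro tendsto_add tendsto_diff G.dI_cont U.dI_cont N.dI_cont)

lemma dj_lin: "dj tu sg (c * p + d * q) (c * p' + d * q') = c * dj tu sg p p' + d * dj tu sg q q'"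
 unfolding dj_eq G.dI_lin U.dI_lin N.dI_lin by (simp add: algebra_simps)

lemma dJ_integrable:
 "integrable lebesgue (%x. A (g x) \<bullet> h x)" "integrable lebesgue (%x. V x * (A (u x) * w x))" "integrable lebesgue (%x. K x * (f (u x) * w x))"
 using G.dI_integrable[of 1 0 0 1] U.dI_integrable[of 1 0 0 1] N.dI_integrable[of 1 0 0 1] by simp_all

end

section \<open>Compactness and monotonicity along rays\<close>

context var_problem
begin

lemma clip_estimate:
 fixes p q C e :: real
 assumes "\<bar>p\<bar> <= s + C" "\<bar>q\<bar> <= t + C" "0 <= C" "0 <= s" "0 <= t"
 shows "\<bar>p - q\<bar> <= \<bar>max (- C) (min C p) - max (- C) (min C q)\<bar> + s + t"
 using assms by (auto simp: max_def min_def abs_le_iff split: if_splits)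

text \<open>Up to ep times bounded integrals, F is bounded and lives where |v| >= dl. These sets
  have uniformly bounded measure, so (K1) makes their K-mass outside a large ball small for all n at
  once; inside the ball a clipped F converges dominatedly.\<close>

lemma K_compact:
 fixes v :: "nat => 'a => real"
 assumes [measurable]: "!!n. v n \<in> LM" "v0 \<in> LM"
  and ae: "AE x in lebesgue. (%n. v n x) ~~> v0 x" and B: "0 <= B"
  and b1: "!!n. mo MV P (v n) <= ennreal B" "mo MV P v0 <= ennreal B"
  and b2: "!!n. mL (%t. t powr ms) (v n) <= ennreal B" "mL (%t. t powr ms) v0 <= ennreal B"
  and i: "!!n. integrable lebesgue (%x. K x * F (v n x))" "integrable lebesgue (%x. K x * F (v0 x))"
 shows "(%n. LINT x|lebesgue. K x * F (v n x)) ~~> (LINT x|lebesgue. K x * F (v0 x))"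
proof (rule LIMSEQ_I)
 fix e :: real assume e: "0 < e"
 define X where "X = (kv + kb) * (B + 1)"
 have X: "0 < X" using kv kb B by (simp add: X_def)
 define ep where "ep = e / (8 * X)"
 have ep: "0 < ep" "ep * (kv * (B + B) + kb * (B + B)) <= e / 4"
 proof -
  show "0 < ep" using e X by (simp add: ep_def)
  have "ep * (kv * (B + B) + kb * (B + B)) <= ep * (2 * X)"
   using \<open>0 < ep\<close> kv kb by (intro mult_left_mono) (auto simp: X_def algebra_simps)
  also have "... = e / 4" using X by (simp add: ep_def field_simps)
  finally show "ep * (kv * (B + B) + kb * (B + B)) <= e / 4" .
 qed
 obtain C' dl where C': "0 <= C'" "0 < dl" "!!t. \<bar>F t\<bar> <= ep * (P \<bar>t\<bar> + \<bar>t\<bar> powr ms) + (if dl <= \<bar>t\<bar> then C' else 0)"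
  using G2[OF ep(1)] by auto
 define C where "C = C' + 1"
 have C: "0 < C" "!!t. \<bar>F t\<bar> <= ep * (P \<bar>t\<bar> + \<bar>t\<bar> powr ms) + (if dl <= \<bar>t\<bar> then C else 0)"
  using C'(1) by (simp add: C_def, intro order_trans[OF C'(3)]) (simp add: C_def)
 \<comment> \<open>The limit is placed in front of the sequence so that (K1) yields one radius for
   all of them.\<close>
 define vv where "vv = case_nat v0 v"
 have vvm[measurable]: "vv k \<in> LM" for k by (cases k) (auto simp: vv_def)
 have bb1: "mo MV P (vv k) <= ennreal B" and bb2: "mL (%t. t powr ms) (vv k) <= ennreal B" for k
  using b1 b2 by (cases k; simp add: vv_def)+
 \<comment> \<open>(K1) speaks of Borel sets, so the superlevel sets are formed from Borel
   representatives.\<close>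
 have "EX v'. ALL k. v' k \<in> borel_measurable lborel & (AE x in lborel. vv k x = v' k x)"
  by (intro choice allI) (use completion_ex_borel_measurable_real[OF vvm] in blast)
 then obtain v' where v'0: "!!k. v' k \<in> borel_measurable lborel" "!!k. AE x in lborel. vv k x = v' k x" by blast
 have v'[measurable]: "v' k \<in> borel_measurable borel" for k using v'0(1) by simp
 have v'2: "AE x in lebesgue. vv k x = v' k x" for k by (rule AE_completion[OF v'0(2)])
 define S where "S = (%k. {x. dl <= \<bar>v' k x\<bar>})"
 have Sb[measurable]: "S k \<in> sets borel" for k unfolding S_def by measurable
 have Sl[measurable]: "S k \<in> sets lebesgue" for k using Sb[of k] by simp
 have "emeasure lebesgue (S k) <= ennreal (B / dl powr ms)" for k
 proof -
  have "emeasure lebesgue (S k) = (\<integral>\<^sup>+x. indicator (S k) x \<partial>lebesgue)" by simp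
  also have "... <= (\<integral>\<^sup>+x. ennreal (1 / dl powr ms) * ennreal (norm (vv k x) powr ms) \<partial>lebesgue)"
  proof (rule nn_integral_mono_AE, use v'2[of k] in eventually_elim)
   case (elim x)
   show ?case
   proof (cases "x \<in> S k")
    case True
    then have "dl powr ms <= norm (vv k x) powr ms" using C' ms1 elim by (intro powr_mono2) (auto simp: S_def)
    then show ?thesis using True C' by (subst ennreal_mult[symmetric]) (auto simp flip: ennreal_1 intro!: ennreal_leI)
   qed simp
  qed
  also have "... = ennreal (1 / dl powr ms) * mL (%t. t powr ms) (vv k)" unfolding mo_def by (rule nn_integral_cmult) measurable
  also have "... <= ennreal (1 / dl powr ms) * ennreal B" by (intro mult_left_mono bb2) simp
  finally show ?thesis using B by (simp add: ennreal_mult[symmetric])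
 qed
 then have "EX M. ALL k. emeasure lebesgue (S k) <= ennreal M" by blast
 from K1[OF Sb this, of "e / (8 * C)"] e C
 obtain R where R: "!!k. set_nn_integral lebesgue (S k \<inter> - ball 0 R) (%x. ennreal (K x)) <= ennreal (e / (8 * C))" by auto
 define W where "W = (%k. S k \<inter> - ball (0::'a) R)"
 have [measurable]: "W k \<in> sets lebesgue" for k unfolding W_def by auto
 have Wi: "integrable lebesgue (%x. K x * indicator (W k) x)" and Wl: "(LINT x|lebesgue. K x * indicator (W k) x) <= e / (8 * C)" for k
 proof -
  have le: "(\<integral>\<^sup>+x. ennreal (K x * indicator (W k) x) \<partial>lebesgue) <= ennreal (e / (8 * C))"
   using R[of k] by (simp add: W_def ennreal_mult' K_nonneg ennreal_indicator)
  show i: "integrable lebesgue (%x. K x * indicator (W k) x)"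
   by (rule integrableI_nonneg) (use le in \<open>auto simp: K_nonneg less_top[symmetric] top_unique\<close>)
  show "(LINT x|lebesgue. K x * indicator (W k) x) <= e / (8 * C)"
   using le nn_integral_eq_integral[OF i] e C K_nonneg by (simp add: ennreal_le_iff)
 qed
 \<comment> \<open>Clipping at C changes differences of F by no more than the ep terms, by
   \<open>clip_estimate\<close>, and provides an integrable majorant on the ball.\<close>
 define cl where "cl = (%t. max (- C) (min C (F t)))"
 have clc: "continuous_on UNIV cl" unfolding cl_def by (intro continuous_intros F_cont)
 have [measurable]: "cl \<in> borel_measurable borel" by (rule borel_measurable_continuous_onI[OF clc])
 have ball_m[measurable]: "ball (0::'a) R \<in> sets lebesgue" by simp
 define b where "b = (%n x. K x * \<bar>cl (v n x) - cl (v0 x)\<bar> * indicator (ball (0::'a) R) x)"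
 have Ki: "integrable lebesgue (%x. kb * (2 * C) * indicator (ball (0::'a) R) x)"
  using emeasure_bounded_finite[of "ball (0::'a) R"] by (intro integrable_mult_right integrable_real_indicator) (auto simp: less_top)
 have bb: "AE x in lebesgue. norm (b n x) <= kb * (2 * C) * indicator (ball (0::'a) R) x" for n
  using K_kb
 proof eventually_elim
  case (elim x)
  have "\<bar>cl (v n x) - cl (v0 x)\<bar> <= 2 * C" using C by (auto simp: cl_def max_def min_def)
  then have "K x * \<bar>cl (v n x) - cl (v0 x)\<bar> <= kb * (2 * C)" using elim kb K_nonneg[of x] by (intro mult_mono) auto
  then show ?case using K_nonneg[of x] by (simp add: b_def indicator_def)
 qed
 have bm[measurable]: "b n \<in> LM" for n unfolding b_def by measurable
 have bi: "integrable lebesgue (b n)" for n by (rule Bochner_Integration.integrable_bound[OF Ki bm]) (use bb[of n] in eventually_elim, simp)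
 have "(%n. LINT x|lebesgue. b n x) ~~> (LINT x|(lebesgue :: 'a measure). 0)"
 proof (rule integral_dominated_convergence[OF _ bm Ki _ bb])
  show "AE x in lebesgue. (%n. b n x) ~~> 0"
   using ae
  proof eventually_elim
   case (elim x)
   have "(%n. K x * \<bar>cl (v n x) - cl (v0 x)\<bar> * indicator (ball (0::'a) R) x) ~~> K x * \<bar>cl (v0 x) - cl (v0 x)\<bar> * indicator (ball (0::'a) R) x"
    by (intro tendsto_intros continuous_on_tendsto_compose[OF clc elim]) auto
   then show ?case by (simp add: b_def)
  qed
 qed simp
 then have "eventually (%n. (LINT x|lebesgue. b n x) < e / 4) sequentially" by (rule order_tendstoD) (use e in simp)
 then obtain N where N: "!!n. N <= n ==> (LINT x|lebesgue. b n x) < e / 4" by (auto simp: eventually_sequentially)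
 have VP: "integrable lebesgue (%x. V x * P \<bar>vv k x\<bar>)" "(LINT x|lebesgue. V x * P \<bar>vv k x\<bar>) <= B" for k
 proof -
  have fin: "mo MV P (vv k) < \<infinity>" using bb1[of k] by (auto simp: less_top[symmetric] top_unique)
  show "integrable lebesgue (%x. V x * P \<bar>vv k x\<bar>)" by (rule MV_integrable(1)[OF _ fin]) simp
  show "(LINT x|lebesgue. V x * P \<bar>vv k x\<bar>) <= B" using MV_integrable(2)[OF _ fin] bb1[of k] B by (simp add: ennreal_le_iff)
 qed
 have VM: "integrable lebesgue (%x. \<bar>vv k x\<bar> powr ms)" "(LINT x|lebesgue. \<bar>vv k x\<bar> powr ms) <= B" for k
 proof -
  have fin: "mL (%t. t powr ms) (vv k) < \<infinity>" using bb2[of k] by (auto simp: less_top[symmetric] top_unique)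
  show "integrable lebesgue (%x. \<bar>vv k x\<bar> powr ms)" using mo_integrable(1)[OF gms _ fin] by simp
  show "(LINT x|lebesgue. \<bar>vv k x\<bar> powr ms) <= B" using mo_integrable(2)[OF gms _ fin] bb2[of k] B by (simp add: ennreal_le_iff)
 qed
 define H where "H = (%k x. kv * (V x * P \<bar>vv k x\<bar>) + kb * \<bar>vv k x\<bar> powr ms)"
 have Hi: "integrable lebesgue (H k)" for k unfolding H_def using VP VM by simp
 have Hl: "(LINT x|lebesgue. H k x) <= kv * B + kb * B" for k
 proof -
  have "(LINT x|lebesgue. H k x) = kv * (LINT x|lebesgue. V x * P \<bar>vv k x\<bar>) + kb * (LINT x|lebesgue. \<bar>vv k x\<bar> powr ms)"
   unfolding H_def using VP VM by simp
  also have "... <= kv * B + kb * B" using VP(2)[of k] VM(2)[of k] kv kb by (intro add_mono mult_left_mono) auto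
  finally show ?thesis .
 qed
 have pw: "AE x in lebesgue. \<bar>K x * F (v n x) - K x * F (v0 x)\<bar> <= b n x + ep * (H (Suc n) x + H 0 x) + C * (K x * indicator (W (Suc n)) x + K x * indicator (W 0) x)" for n
  using K_kb K_kv v'2[of "Suc n"] v'2[of 0]
 proof eventually_elim
  case (elim x)
  have vvx: "vv (Suc n) x = v n x" "vv 0 x = v0 x" by (simp_all add: vv_def)
  define s where "s = (%k. ep * (P \<bar>vv k x\<bar> + \<bar>vv k x\<bar> powr ms))"
  have s: "0 <= s k" for k unfolding s_def using ep(1) gf_ge0[OF gP] by simp
  have Ks: "K x * s k <= ep * H k x" for k
  proof -
   have "K x * P \<bar>vv k x\<bar> <= kv * V x * P \<bar>vv k x\<bar>" "K x * \<bar>vv k x\<bar> powr ms <= kb * \<bar>vv k x\<bar> powr ms"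
    using elim gf_ge0[OF gP] by (intro mult_right_mono; simp)+
   then have "K x * P \<bar>vv k x\<bar> + K x * \<bar>vv k x\<bar> powr ms <= H k x" unfolding H_def by (simp add: mult.assoc)
   from mult_left_mono[OF this less_imp_le[OF ep(1)]] show ?thesis by (simp add: s_def algebra_simps)
  qed
  have Fb: "\<bar>F (vv k x)\<bar> <= s k + C * indicator (S k) x" if "vv k x = v' k x" for k
   using C(2)[of "vv k x"] that unfolding s_def S_def by (auto simp: indicator_def split: if_splits)
  have Fb': "\<bar>F (v n x)\<bar> <= s (Suc n) + C * indicator (S (Suc n)) x" "\<bar>F (v0 x)\<bar> <= s 0 + C * indicator (S 0) x"
   using Fb[of "Suc n"] Fb[of 0] elim vvx by auto
  have ind: "C * indicator (S k) x <= C" for k using C by (simp add: indicator_def)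
  have "\<bar>F (v n x) - F (v0 x)\<bar> <= \<bar>cl (v n x) - cl (v0 x)\<bar> * indicator (ball (0::'a) R) x + (s (Suc n) + s 0) + C * (indicator (W (Suc n)) x + indicator (W 0) x)"
  proof (cases "x \<in> ball 0 R")
   case True
   have "\<bar>F (v n x) - F (v0 x)\<bar> <= \<bar>cl (v n x) - cl (v0 x)\<bar> + s (Suc n) + s 0"
    unfolding cl_def
    by (rule clip_estimate[OF order_trans[OF Fb'(1) add_left_mono[OF ind]] order_trans[OF Fb'(2) add_left_mono[OF ind]] less_imp_le[OF C(1)] s s])
   moreover have "0 <= C * (indicator (W (Suc n)) x + indicator (W 0) x)" using C by simp
   ultimately show ?thesis using True by simp
  next
   case False
   then have "indicator (W k) x = (indicator (S k) x :: real)" for k by (simp add: W_def indicator_def)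
   then show ?thesis using Fb' False abs_triangle_ineq4[of "F (v n x)" "F (v0 x)"] by (simp add: distrib_left)
  qed
  from mult_left_mono[OF this K_nonneg[of x]]
  have "\<bar>K x * F (v n x) - K x * F (v0 x)\<bar> <= b n x + (K x * s (Suc n) + K x * s 0) + C * (K x * indicator (W (Suc n)) x + K x * indicator (W 0) x)"
   using K_nonneg[of x] by (simp add: b_def right_diff_distrib[symmetric] abs_mult distrib_left[of "K x"] mult.assoc mult.left_commute[of "K x" C])
  then show ?case using Ks[of "Suc n"] Ks[of 0] by (simp add: distrib_left)
 qed
 show "EX no. \<forall>n\<ge>no. norm ((LINT x|lebesgue. K x * F (v n x)) - (LINT x|lebesgue. K x * F (v0 x))) < e"
 proof (intro exI[of _ N] allI impI)
  fix n assume n: "N <= n"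
  have "norm ((LINT x|lebesgue. K x * F (v n x)) - (LINT x|lebesgue. K x * F (v0 x))) = norm (LINT x|lebesgue. K x * F (v n x) - K x * F (v0 x))"
   using i by simp
  also have "... <= (LINT x|lebesgue. b n x + ep * (H (Suc n) x + H 0 x) + C * (K x * indicator (W (Suc n)) x + K x * indicator (W 0) x))"
   by (rule order_trans[OF integral_norm_bound integral_mono_AE]) (use i bi Hi Wi pw[of n] in auto)
  also have "... = (LINT x|lebesgue. b n x) + ep * ((LINT x|lebesgue. H (Suc n) x) + (LINT x|lebesgue. H 0 x))
    + C * ((LINT x|lebesgue. K x * indicator (W (Suc n)) x) + (LINT x|lebesgue. K x * indicator (W 0) x))"
   using bi Hi Wi by simp
  also have "... < e / 4 + ep * (kv * (B + B) + kb * (B + B)) + C * (e / (8 * C) + e / (8 * C))"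
  proof -
   have "ep * ((LINT x|lebesgue. H (Suc n) x) + (LINT x|lebesgue. H 0 x)) <= ep * (kv * (B + B) + kb * (B + B))"
    using ep(1) Hl[of "Suc n"] Hl[of 0] by (intro mult_left_mono) (auto simp: algebra_simps)
   moreover have "C * ((LINT x|lebesgue. K x * indicator (W (Suc n)) x) + (LINT x|lebesgue. K x * indicator (W 0) x)) <= C * (e / (8 * C) + e / (8 * C))"
    using C Wl[of "Suc n"] Wl[of 0] by (intro mult_left_mono add_mono) auto
   ultimately show ?thesis using N[OF n] by linarith
  qed
  also have "... <= e / 4 + e / 4 + e / 4" using ep(2) C by (simp add: field_simps)
  finally show "norm ((LINT x|lebesgue. K x * F (v n x)) - (LINT x|lebesgue. K x * F (v0 x))) < e" using e by simp
 qed
qed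

section \<open>Energy and derivative along rays\<close>

definition "Jr w h tu = J (%x. tu * w x) (%x. tu *R h x)"
definition "dr w h tu = dJ (%x. tu * w x) (%x. tu *R h x) w h"
definition "good w h \<longleftrightarrow> Es w h & ~ (AE x in lebesgue. w x <= 0)"

lemma A_dir: "0 <= tu ==> A (tu *R z) \<bullet> z = a (tu * norm z) * norm z"
proof (cases "tu = 0 \<or> z = 0")
 case False
 assume "0 <= tu"
 then show ?thesis using False by (simp add: A_scale power2_norm_eq_inner[symmetric] power2_eq_square)
qed (auto simp: A_def a_0)

text \<open>\<open>a_scale\<close> in the form used along rays: divided by
  \<open>t powr (m - 1)\<close>, the derivative of the convex part does not increase.\<close>

lemma a_ratio: assumes "0 < s" "s <= t" "0 <= x" shows "t powr (1 - m) * (a (t * x) * x) <= s powr (1 - m) * (a (s * x) * x)"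
proof -
 have "a (t * x) <= (t / s) powr (m - 1) * a (s * x)" using a_scale[of "t / s" "s * x"] assms by simp
 also have "(t / s) powr (m - 1) = t powr (m - 1) * s powr (1 - m)" using assms by (simp add: powr_divide powr_minus_divide[of s "m - 1", simplified])
 finally have "t powr (1 - m) * a (t * x) <= t powr (1 - m) * (t powr (m - 1) * s powr (1 - m) * a (s * x))" by (rule mult_left_mono) simp
 also have "... = s powr (1 - m) * a (s * x)" using assms powr_add[of t "1 - m" "m - 1"] by simp
 finally show ?thesis using assms by (simp add: mult.assoc[symmetric] mult_right_mono)
qed

lemma f_ratio: assumes "0 < t" "0 < x" shows "t powr (1 - m) * (f (t * x) * x) = x powr m * ((t * x) powr (1 - m) * f (t * x))"
proof -
 have "x powr m * x powr (1 - m) = x" using assms powr_add[of x m "1 - m"] by simp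
 then show ?thesis using assms by (simp add: powr_mult)
qed

lemma f_ratio_less: assumes "0 < s" "s < t" "0 < x" shows "s powr (1 - m) * (f (s * x) * x) < t powr (1 - m) * (f (t * x) * x)"
 using assms f2[of "s * x" "t * x"] by (subst (1 2) f_ratio) auto

lemma f_ratio_le: assumes "0 < s" "s <= t" shows "s powr (1 - m) * (f (s * x) * x) <= t powr (1 - m) * (f (t * x) * x)"
proof (cases "0 < x & s < t")
 case False
 then show ?thesis using assms f_neg[of "s * x"] f_neg[of "t * x"] by (cases "s = t") (auto simp: mult_nonneg_nonpos not_less)
qed (use f_ratio_less assms in \<open>auto simp: less_imp_le\<close>)

lemma self_dirs:
 assumes "Es w h"
 shows Jr_deriv: "(Jr w h has_real_derivative dr w h tu) (at tu)"
  and dr_cont: "continuous_on UNIV (dr w h)"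
  and dr_int: "integrable lebesgue (%x. A (tu *R h x) \<bullet> h x)" "integrable lebesgue (%x. V x * (A (tu * w x) * w x))"
   "integrable lebesgue (%x. K x * (f (tu * w x) * w x))" "integrable lebesgue (%x. K x * F (tu * w x))"
  and Jr_split: "Jr w h tu = (LINT x|lebesgue. P (norm (tu *R h x))) + (LINT x|lebesgue. V x * P \<bar>tu * w x\<bar>) - (LINT x|lebesgue. K x * F (tu * w x))"
  and Q_cont: "continuous_on UNIV (%tu. (LINT x|lebesgue. P (norm (tu *R h x))) + (LINT x|lebesgue. V x * P \<bar>tu * w x\<bar>))"
proof -
 interpret two_dirs P Ps m ms ty a V K f F kb kv w h w h by unfold_locales (rule assms)+
 have jr: "jj tu 0 = Jr w h tu" "dj tu 0 1 0 = dr w h tu" for tu by (simp_all add: jj_def dj_def Jr_def dr_def)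
 show "(Jr w h has_real_derivative dr w h tu) (at tu)" using jj_deriv1[of tu] by (simp add: jr)
 show "continuous_on UNIV (dr w h)"
  unfolding continuous_on_sequentially comp_def using dj_cont[OF _ tendsto_const, of _ _ 0 1 0] by (auto simp: jr)
 show "integrable lebesgue (%x. A (tu *R h x) \<bullet> h x)" "integrable lebesgue (%x. V x * (A (tu * w x) * w x))" "integrable lebesgue (%x. K x * (f (tu * w x) * w x))"
  using G.dI_integrable[of tu 0 1 0] U.dI_integrable[of tu 0 1 0] N.dI_integrable[of tu 0 1 0] by simp_all
 show "integrable lebesgue (%x. K x * F (tu * w x))" using N.I_integrable[of tu 0] by simp
 show "Jr w h tu = (LINT x|lebesgue. P (norm (tu *R h x))) + (LINT x|lebesgue. V x * P \<bar>tu * w x\<bar>) - (LINT x|lebesgue. K x * F (tu * w x))"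
  by (simp add: Jr_def J_def)
 have "((%tu. G.I tu 0 + U.I tu 0) has_real_derivative G.dI tu 0 1 0 + U.dI tu 0 1 0) (at tu)" for tu
  using DERIV_add[OF G.I_deriv[of tu 1 0 0] U.I_deriv[of tu 1 0 0]] DERIV_shift[of "%tu. G.I tu 0 + U.I tu 0" _ 0 tu] by (simp add: add.commute)
 then have "continuous_on UNIV (%tu. G.I tu 0 + U.I tu 0)" by (intro DERIV_continuous_on[OF has_field_derivative_at_within])
 then show "continuous_on UNIV (%tu. (LINT x|lebesgue. P (norm (tu *R h x))) + (LINT x|lebesgue. V x * P \<bar>tu * w x\<bar>))"
  by (simp add: G.I_def U.I_def)
qed

lemma dr_split:
 assumes "Es w h" "0 <= tu"
 shows "dr w h tu = (LINT x|lebesgue. a (tu * norm (h x)) * norm (h x)) + (LINT x|lebesgue. V x * (a (tu * \<bar>w x\<bar>) * \<bar>w x\<bar>)) - (LINT x|lebesgue. K x * (f (tu * w x) * w x))"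
  "integrable lebesgue (%x. a (tu * norm (h x)) * norm (h x))" "integrable lebesgue (%x. V x * (a (tu * \<bar>w x\<bar>) * \<bar>w x\<bar>))"
 using dr_int[OF assms(1), of tu] A_dir[OF assms(2), where 'b = 'a] A_dir[OF assms(2), where 'b = real] by (simp_all add: dr_def dJ_def)

text \<open>The nonlinear difference stays explicit on the right: its positivity gives strict
  decrease, and its growth shows that the derivative becomes negative.\<close>

lemma dr_ratio:
 assumes w: "Es w h" and st: "0 < s" "s <= t"
 shows "t powr (1 - m) * dr w h t <= s powr (1 - m) * dr w h s - (LINT x|lebesgue. K x * (t powr (1 - m) * (f (t * w x) * w x) - s powr (1 - m) * (f (s * w x) * w x)))"
  and "integrable lebesgue (%x. K x * (t powr (1 - m) * (f (t * w x) * w x) - s powr (1 - m) * (f (s * w x) * w x)))"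
proof -
 have t: "0 <= t" "0 <= s" using st by auto
 have e: "(%x. K x * (t powr (1 - m) * (f (t * w x) * w x) - s powr (1 - m) * (f (s * w x) * w x))) =
   (%x. t powr (1 - m) * (K x * (f (t * w x) * w x)) - s powr (1 - m) * (K x * (f (s * w x) * w x)))"
  by (simp add: fun_eq_iff algebra_simps)
 note I = dr_int(3)[OF w]
 show "integrable lebesgue (%x. K x * (t powr (1 - m) * (f (t * w x) * w x) - s powr (1 - m) * (f (s * w x) * w x)))"
  unfolding e by (intro Bochner_Integration.integrable_diff integrable_mult_right I)
 have Z: "(LINT x|lebesgue. K x * (t powr (1 - m) * (f (t * w x) * w x) - s powr (1 - m) * (f (s * w x) * w x))) =
   t powr (1 - m) * (LINT x|lebesgue. K x * (f (t * w x) * w x)) - s powr (1 - m) * (LINT x|lebesgue. K x * (f (s * w x) * w x))"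
  unfolding e by (subst Bochner_Integration.integral_diff) (simp_all add: I)
 have X: "t powr (1 - m) * (LINT x|lebesgue. a (t * norm (h x)) * norm (h x)) <= s powr (1 - m) * (LINT x|lebesgue. a (s * norm (h x)) * norm (h x))"
  unfolding integral_mult_right_zero[symmetric]
  by (intro integral_mono integrable_mult_right dr_split(2)[OF w] t a_ratio st) simp
 have Y: "t powr (1 - m) * (LINT x|lebesgue. V x * (a (t * \<bar>w x\<bar>) * \<bar>w x\<bar>)) <= s powr (1 - m) * (LINT x|lebesgue. V x * (a (s * \<bar>w x\<bar>) * \<bar>w x\<bar>))"
  unfolding integral_mult_right_zero[symmetric]
 proof (intro integral_mono integrable_mult_right dr_split(3)[OF w] t)
  fix x
  show "t powr (1 - m) * (V x * (a (t * \<bar>w x\<bar>) * \<bar>w x\<bar>)) <= s powr (1 - m) * (V x * (a (s * \<bar>w x\<bar>) * \<bar>w x\<bar>))"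
   using mult_left_mono[OF a_ratio[OF st abs_ge_zero[of "w x"]] less_imp_le[OF V_pos[of x]]] by (simp only: mult.left_commute)
 qed
 show "t powr (1 - m) * dr w h t <= s powr (1 - m) * dr w h s - (LINT x|lebesgue. K x * (t powr (1 - m) * (f (t * w x) * w x) - s powr (1 - m) * (f (s * w x) * w x)))"
  unfolding Z dr_split(1)[OF w t(1)] dr_split(1)[OF w t(2)] using X Y by (simp add: algebra_simps)
qed

lemma dr_weak: assumes "Es w h" "0 < s" "s <= t" shows "t powr (1 - m) * dr w h t <= s powr (1 - m) * dr w h s"
proof -
 have "0 <= (LINT x|lebesgue. K x * (t powr (1 - m) * (f (t * w x) * w x) - s powr (1 - m) * (f (s * w x) * w x)))"
  by (intro integral_nonneg_AE AE_I2 mult_nonneg_nonneg K_nonneg) (use f_ratio_le[OF assms(2,3)] in simp)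
 then show ?thesis using dr_ratio(1)[OF assms] by linarith
qed

text \<open>K > 0 a.e., and where w > 0 the nonlinear difference is strictly positive by (f2); that
  set is not null.\<close>

lemma dr_strict: assumes g: "good w h" and st: "0 < s" "s < t" shows "t powr (1 - m) * dr w h t < s powr (1 - m) * dr w h s"
proof -
 have w: "Es w h" using g by (simp add: good_def)
 let ?q = "%x. K x * (t powr (1 - m) * (f (t * w x) * w x) - s powr (1 - m) * (f (s * w x) * w x))"
 note I = dr_ratio[OF w st(1) less_imp_le[OF st(2)]]
 have q0: "AE x in lebesgue. 0 <= ?q x" by (intro AE_I2 mult_nonneg_nonneg K_nonneg) (use f_ratio_le[OF st(1) less_imp_le[OF st(2)]] in simp)
 have "integral\<^sup>L lebesgue ?q ~= 0"
 proof
  assume "integral\<^sup>L lebesgue ?q = 0"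
  then have "AE x in lebesgue. ?q x = 0" using integral_nonneg_eq_0_iff_AE[OF I(2) q0] by simp
  with K_pos have "AE x in lebesgue. w x <= 0"
  proof eventually_elim
   case (elim x)
   then show ?case using f_ratio_less[OF st, of "w x"] by (cases "0 < w x") auto
  qed
  then show False using g by (simp add: good_def)
 qed
 moreover have "0 <= integral\<^sup>L lebesgue ?q" by (rule integral_nonneg_AE[OF q0])
 ultimately show ?thesis using I(1) by linarith
qed

lemma dr_sign:
 assumes "Es w h" "0 < s" "s <= t"
 shows "dr w h s <= 0 ==> dr w h t <= 0" "0 <= dr w h t ==> 0 <= dr w h s"
proof -
 have p: "0 < s powr (1 - m)" "0 < t powr (1 - m)" using assms by auto
 show "dr w h t <= 0" if "dr w h s <= 0"
  using dr_weak[OF assms] mult_nonneg_nonpos[OF less_imp_le[OF p(1)] that] p(2) by (smt (verit) mult_pos_pos)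
 show "0 <= dr w h s" if "0 <= dr w h t"
  using dr_weak[OF assms] mult_nonneg_nonneg[OF less_imp_le[OF p(2)] that] p(1) by (smt (verit) mult_pos_neg)
qed

text \<open>By \<open>dr_sign\<close> the derivative passes at most once from nonnegative to
  nonpositive, so its sign at one point b decides monotonicity on one side of b.\<close>

lemma Jr_mono:
 assumes w: "Es w h" and b: "0 < b"
 shows "0 <= dr w h b ==> 0 <= tu ==> tu <= b ==> Jr w h tu <= Jr w h b" "dr w h b <= 0 ==> b <= tu ==> Jr w h tu <= Jr w h b"
proof -
 have c: "continuous_on S (Jr w h)" for S by (rule DERIV_continuous_on[OF has_field_derivative_at_within[OF Jr_deriv[OF w]]])
 show "Jr w h tu <= Jr w h b" if "0 <= dr w h b" "0 <= tu" "tu <= b"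
 proof (rule DERIV_nonneg_imp_increasing_open[OF that(3) _ c])
  fix x assume x: "tu < x" "x < b"
  show "EX y. (Jr w h has_real_derivative y) (at x) & 0 <= y"
   using Jr_deriv[OF w, of x] dr_sign(2)[OF w, of x b] x that by (intro exI[of _ "dr w h x"]) auto
 qed
 show "Jr w h tu <= Jr w h b" if "dr w h b <= 0" "b <= tu"
 proof (rule DERIV_nonpos_imp_decreasing_open[OF that(2) _ c])
  fix x assume x: "b < x" "x < tu"
  show "EX y. (Jr w h has_real_derivative y) (at x) & y <= 0"
   using Jr_deriv[OF w, of x] dr_sign(1)[OF w, of b x] x that b by (intro exI[of _ "dr w h x"]) auto
 qed
qed

end

section \<open>The Nehari level\<close>

context var_problem
begin

lemma good_Es: "good w h ==> Es w h" by (simp add: good_def)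

text \<open>Otherwise \<open>dr_ratio\<close> between 1 and k + 1 bounds the integrals of the
  nonlinear differences by \<open>dr w h 1\<close>. Fatou's lemma makes their lower limit finite
  a.e., while superlinearity makes it infinite wherever w > 0 and K > 0.\<close>

lemma dr_neg: assumes g: "good w h" shows "\<exists>t>0. dr w h t < 0"
proof (rule ccontr)
 assume "~ ?thesis"
 then have n: "!!t. 0 < t ==> 0 <= dr w h t" by force
 note w = good_Es[OF g]
 note [measurable] = Es_meas[OF w]
 define q where "q = (%k x. K x * (real (Suc k) powr (1 - m) * (f (real (Suc k) * w x) * w x) - 1 powr (1 - m) * (f (1 * w x) * w x)))"
 have qm[measurable]: "q k \<in> LM" for k unfolding q_def by measurable
 have q0: "0 <= q k x" for k x unfolding q_def by (intro mult_nonneg_nonneg K_nonneg) (use f_ratio_le[of 1 "real (Suc k)" "w x"] in simp)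
 have "(\<integral>\<^sup>+x. ennreal (q k x) \<partial>lebesgue) <= ennreal (dr w h 1)" for k
 proof -
  have s: "0 < real (Suc k)" "1 <= real (Suc k)" by auto
  note R = dr_ratio[OF w zero_less_one s(2)]
  have "0 <= real (Suc k) powr (1 - m) * dr w h (real (Suc k))" "1 powr (1 - m) * dr w h 1 = dr w h 1" using n[OF s(1)] by auto
  then have I: "(LINT x|lebesgue. q k x) <= dr w h 1" unfolding q_def using R(1) by linarith
  have "(\<integral>\<^sup>+x. ennreal (q k x) \<partial>lebesgue) = ennreal (LINT x|lebesgue. q k x)"
   by (rule nn_integral_eq_integral) (use R(2) q0 in \<open>auto simp: q_def\<close>)
  also have "... <= ennreal (dr w h 1)" by (rule ennreal_leI[OF I])
  finally show ?thesis .
 qed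
 then have "liminf (%k. \<integral>\<^sup>+x. ennreal (q k x) \<partial>lebesgue) <= ennreal (dr w h 1)"
  by (intro order_trans[OF Liminf_le_Limsup] Limsup_bounded) auto
 with nn_integral_liminf[of "%k x. ennreal (q k x)" lebesgue]
 have "(\<integral>\<^sup>+x. liminf (%k. ennreal (q k x)) \<partial>lebesgue) ~= \<infinity>" by (auto simp: top_unique)
 then have "AE x in lebesgue. liminf (%k. ennreal (q k x)) ~= \<infinity>" by (intro nn_integral_PInf_AE) auto
 with K_pos have "AE x in lebesgue. w x <= 0"
 proof eventually_elim
  case (elim x)
  show ?case
  proof (rule ccontr)
   assume "~ w x <= 0"
   then have wx: "0 < w x" by simp
   have "filterlim (%k. real (Suc k) * w x) at_top sequentially"
    using wx by (intro filterlim_at_top_mult_tendsto_pos[OF tendsto_const] filterlim_compose[OF filterlim_real_sequentially] filterlim_Suc) auto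
   from filterlim_compose[OF f3 this]
   have "filterlim (%k. (real (Suc k) * w x) powr (1 - m) * f (real (Suc k) * w x)) at_top sequentially" .
   then have 1: "filterlim (%k. w x powr m * ((real (Suc k) * w x) powr (1 - m) * f (real (Suc k) * w x))) at_top sequentially"
    using wx by (intro filterlim_tendsto_pos_mult_at_top[OF tendsto_const]) auto
   have "filterlim (%k. real (Suc k) powr (1 - m) * (f (real (Suc k) * w x) * w x)) at_top sequentially"
    by (rule filterlim_cong[THEN iffD2, OF refl refl _ 1]) (use wx in \<open>intro always_eventually allI f_ratio, auto\<close>)
   then have "filterlim (%k. - (1 powr (1 - m) * (f (1 * w x) * w x)) + real (Suc k) powr (1 - m) * (f (real (Suc k) * w x) * w x)) at_top sequentially"
    by (rule filterlim_tendsto_add_at_top[OF tendsto_const])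
   then have "filterlim (%k. K x * (- (1 powr (1 - m) * (f (1 * w x) * w x)) + real (Suc k) powr (1 - m) * (f (real (Suc k) * w x) * w x))) at_top sequentially"
    using elim by (intro filterlim_tendsto_pos_mult_at_top[OF tendsto_const]) auto
   then have l: "filterlim (%k. q k x) at_top sequentially" by (simp add: q_def add.commute)
   obtain c where c: "0 <= c" "liminf (%k. ennreal (q k x)) = ennreal c" using elim by (cases "liminf (%k. ennreal (q k x))") auto
   have "ennreal (c + 1) <= liminf (%k. ennreal (q k x))"
    by (rule Liminf_bounded) (use l in \<open>auto simp: filterlim_at_top intro!: ennreal_leI elim: eventually_mono\<close>)
   then show False using c by simp
  qed
 qed
 then show False using g by (simp add: good_def)
qed

lemma good_pos: assumes g: "good w h" shows "0 < (LINT x|lebesgue. V x * (a (1 * \<bar>w x\<bar>) * \<bar>w x\<bar>))" "0 < (LINT x|lebesgue. V x * P \<bar>w x\<bar>)"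
proof -
 note w = good_Es[OF g]
 note [measurable] = Es_meas[OF w]
 have pos: "0 < integral\<^sup>L lebesgue q" if i: "integrable lebesgue q" and q: "!!x. 0 <= q x" "!!x. 0 < w x ==> 0 < q x" for q :: "'a => real"
 proof -
  have q0: "AE x in lebesgue. 0 <= q x" using q(1) by simp
  have "integral\<^sup>L lebesgue q ~= 0"
  proof
   assume "integral\<^sup>L lebesgue q = 0"
   then have "AE x in lebesgue. q x = 0" using integral_nonneg_eq_0_iff_AE[OF i q0] by simp
   then have "AE x in lebesgue. w x <= 0"
   proof eventually_elim
    case (elim x)
    then show ?case using q(2)[of x] by (cases "0 < w x") auto
   qed
   then show False using g by (simp add: good_def)
  qed
  then show ?thesis using integral_nonneg_AE[OF q0] by simp
 qed
 show "0 < (LINT x|lebesgue. V x * (a (1 * \<bar>w x\<bar>) * \<bar>w x\<bar>))"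
  by (rule pos[OF dr_split(3)[OF w]]) (use a_ge0 a_pos V_pos in \<open>auto simp: less_imp_le\<close>)
 show "0 < (LINT x|lebesgue. V x * P \<bar>w x\<bar>)"
  by (rule pos[OF MV_integrable(1)]) (use w gf_ge0[OF gP] gf_pos[OF gP] V_pos in \<open>auto simp: Es_def less_imp_le\<close>)
qed

text \<open>Near 0 the potential part is at least a multiple of \<open>t powr (m - 1)\<close>. The
  growth bound with ep = 1/(2 kv) consumes half of it and leaves a term in
  \<open>t powr (ms - 1)\<close>, of higher order as ms > m.\<close>

lemma dr_pos: assumes g: "good w h" shows "\<exists>t>0. 0 < dr w h t"
proof -
 note w = good_Es[OF g]
 note [measurable] = Es_meas[OF w]
 obtain C where C: "0 <= C" "!!t. \<bar>f t\<bar> <= 1 / (2 * kv) * a \<bar>t\<bar> + C * \<bar>t\<bar> powr (ms - 1)"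
  using G1[of "1 / (2 * kv)"] kv by auto
 define al where "al = (LINT x|lebesgue. V x * (a (1 * \<bar>w x\<bar>) * \<bar>w x\<bar>))"
 have al: "0 < al" unfolding al_def by (rule good_pos[OF g])
 have im: "integrable lebesgue (%x. \<bar>w x\<bar> powr ms)" using mo_integrable(1)[OF gms _ D_ms] w by (auto simp: Es_def)
 define \<beta> where "\<beta> = kb * C * (LINT x|lebesgue. \<bar>w x\<bar> powr ms)"
 have \<beta>: "0 <= \<beta>" unfolding \<beta>_def using kb C by (intro mult_nonneg_nonneg integral_nonneg_AE) auto
 have lo: "t powr (m - 1) * al / 2 - t powr (ms - 1) * \<beta> <= dr w h t" if t: "0 < t" "t <= 1" for t
 proof -
  define Y where "Y = (LINT x|lebesgue. V x * (a (t * \<bar>w x\<bar>) * \<bar>w x\<bar>))"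
  have iY: "integrable lebesgue (%x. V x * (a (t * \<bar>w x\<bar>) * \<bar>w x\<bar>))" using dr_split(3)[OF w] t by simp
  have "(LINT x|lebesgue. t powr (m - 1) * (V x * (a (1 * \<bar>w x\<bar>) * \<bar>w x\<bar>))) <= Y" unfolding Y_def
  proof (rule integral_mono[OF _ iY])
   show "integrable lebesgue (%x. t powr (m - 1) * (V x * (a (1 * \<bar>w x\<bar>) * \<bar>w x\<bar>)))" by (rule integrable_mult_right[OF dr_split(3)[OF w]]) simp
   fix x
   have "t powr (m - 1) * a (1 * \<bar>w x\<bar>) <= a (t * \<bar>w x\<bar>)"
    using a_scale[of "1 / t" "t * \<bar>w x\<bar>"] t by (simp add: powr_divide field_simps)
   from mult_left_mono[OF mult_right_mono[OF this abs_ge_zero[of "w x"]] less_imp_le[OF V_pos[of x]]]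
   show "t powr (m - 1) * (V x * (a (1 * \<bar>w x\<bar>) * \<bar>w x\<bar>)) <= V x * (a (t * \<bar>w x\<bar>) * \<bar>w x\<bar>)" by (simp add: mult_ac)
  qed
  then have Y: "t powr (m - 1) * al <= Y" by (simp add: al_def)
  have "(LINT x|lebesgue. K x * (f (t * w x) * w x)) <= (LINT x|lebesgue. 1/2 * (V x * (a (t * \<bar>w x\<bar>) * \<bar>w x\<bar>)) + t powr (ms - 1) * (kb * C) * \<bar>w x\<bar> powr ms)"
  proof (rule integral_mono_AE[OF dr_int(3)[OF w]])
   show "integrable lebesgue (%x. 1/2 * (V x * (a (t * \<bar>w x\<bar>) * \<bar>w x\<bar>)) + t powr (ms - 1) * (kb * C) * \<bar>w x\<bar> powr ms)"
    by (intro Bochner_Integration.integrable_add integrable_mult_right iY im)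
   show "AE x in lebesgue. K x * (f (t * w x) * w x) <= 1/2 * (V x * (a (t * \<bar>w x\<bar>) * \<bar>w x\<bar>)) + t powr (ms - 1) * (kb * C) * \<bar>w x\<bar> powr ms"
    using K_kb K_kv
   proof eventually_elim
    case (elim x)
    have "f (t * w x) * w x <= \<bar>f (t * w x)\<bar> * \<bar>w x\<bar>" using abs_ge_self[of "f (t * w x) * w x"] by (simp add: abs_mult)
    also have "... <= (1 / (2 * kv) * a (t * \<bar>w x\<bar>) + C * (t * \<bar>w x\<bar>) powr (ms - 1)) * \<bar>w x\<bar>"
     using C(2)[of "t * w x"] t by (intro mult_right_mono) (auto simp: abs_mult)
    also have "... = 1 / (2 * kv) * (a (t * \<bar>w x\<bar>) * \<bar>w x\<bar>) + C * (t powr (ms - 1) * \<bar>w x\<bar> powr ms)"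
    proof -
     have "\<bar>w x\<bar> powr (ms - 1) * \<bar>w x\<bar> = \<bar>w x\<bar> powr ms" using powr_add[of "\<bar>w x\<bar>" "ms - 1" 1] ms1 by (cases "w x = 0") auto
     then show ?thesis using t by (simp add: powr_mult distrib_right mult.assoc)
    qed
    finally have "f (t * w x) * w x <= 1 / (2 * kv) * (a (t * \<bar>w x\<bar>) * \<bar>w x\<bar>) + C * (t powr (ms - 1) * \<bar>w x\<bar> powr ms)" .
    from mult_left_mono[OF this K_nonneg[of x]]
    have "K x * (f (t * w x) * w x) <= K x * (1 / (2 * kv) * (a (t * \<bar>w x\<bar>) * \<bar>w x\<bar>)) + K x * (C * (t powr (ms - 1) * \<bar>w x\<bar> powr ms))"
     by (simp only: distrib_left)
    also have "... <= (kv * V x) * (1 / (2 * kv) * (a (t * \<bar>w x\<bar>) * \<bar>w x\<bar>)) + kb * (C * (t powr (ms - 1) * \<bar>w x\<bar> powr ms))"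
     using elim t C(1) kv a_ge0[of "t * \<bar>w x\<bar>"] by (intro add_mono mult_right_mono) auto
    finally show ?case using kv by (simp add: mult_ac)
   qed
  qed
  also have "... = Y / 2 + t powr (ms - 1) * \<beta>" unfolding Y_def \<beta>_def using iY im by simp
  finally have Z: "(LINT x|lebesgue. K x * (f (t * w x) * w x)) <= Y / 2 + t powr (ms - 1) * \<beta>" .
  have "0 <= (LINT x|lebesgue. a (t * norm (h x)) * norm (h x))" using a_ge0 t by (intro integral_nonneg_AE) auto
  then show ?thesis using dr_split(1)[OF w, of t] t Y Z unfolding Y_def[symmetric] by simp
 qed
 define r where "r = min (1/2) (al / (4 * (\<beta> + 1)))"
 have r: "0 < r" "r < 1" "r * \<beta> < al / 2"
 proof -
  show "0 < r" "r < 1" using al \<beta> by (auto simp: r_def)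
  define B where "B = \<beta> + 1"
  have B: "0 < B" "\<beta> <= B" using \<beta> by (auto simp: B_def)
  have "r * \<beta> <= al / (4 * B) * B" using al \<beta> B by (intro mult_mono) (auto simp: r_def B_def)
  also have "... = al / 4" using B by (simp add: field_simps)
  finally show "r * \<beta> < al / 2" using al by simp
 qed
 \<comment> \<open>Chosen so that \<open>t powr (ms - m)\<close>, the ratio of the two powers,
   equals r.\<close>
 define t where "t = r powr (1 / (ms - m))"
 have t: "0 < t" "t <= 1" "t powr (ms - m) = r" using r ms_gt powr_le1[of "1 / (ms - m)" r] by (auto simp: t_def powr_powr)
 have "t powr (ms - 1) = t powr (m - 1) * r" unfolding t(3)[symmetric] by (simp add: powr_add[symmetric])
 then have "t powr (m - 1) * (al / 2 - r * \<beta>) <= dr w h t" using lo[OF t(1,2)] by (simp add: algebra_simps)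
 moreover have "0 < t powr (m - 1) * (al / 2 - r * \<beta>)" using t r by simp
 ultimately show ?thesis using t(1) by (intro exI[of _ t]) auto
qed

lemma nehari: assumes g: "good w h" shows "\<exists>t>0. dr w h t = 0"
proof -
 note w = good_Es[OF g]
 obtain s where s: "0 < s" "0 < dr w h s" using dr_pos[OF g] by blast
 obtain t where t: "0 < t" "dr w h t < 0" using dr_neg[OF g] by blast
 have st: "s <= t" using dr_sign(1)[OF w t(1), of s] s t by (cases "s <= t") auto
 have "EX x. s <= x & x <= t & dr w h x = 0"
  by (rule IVT2'[OF _ _ st continuous_on_subset[OF dr_cont[OF w]]]) (use s t in auto)
 then obtain x where "s <= x" "dr w h x = 0" by blast
 then show ?thesis using s by (intro exI[of _ x]) auto
qed

text \<open>The infimum is taken over upper bounds of the ray energies, which gives the minimax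
  value with plain inequalities in place of suprema.\<close>

definition c where "c = Inf {b. EX w h. good w h & (\<forall>tu\<ge>0. Jr w h tu <= b)}"

lemma Jr_0: "Jr w h 0 = 0" by (simp add: Jr_def J_def gf_0[OF gP] F_neg)

lemma c_le: "good w h ==> (!!tu. 0 <= tu ==> Jr w h tu <= b) ==> c <= b"
 unfolding c_def by (rule cInf_lower) (auto intro!: bdd_belowI[of _ 0] simp: Jr_0 dest: spec[of _ 0])

lemma good_exists: "EX w h. good w h"
proof -
 obtain ctz :: "'a => real" where ctz: "test_fn ctz" "ALL x. norm x <= 1 --> ctz x = 1" "ALL x. 0 <= ctz x"
  using cutoff_exists[where 'a = 'a] by (elim exE conjE) (metis zero_le_one one_less_numeral_iff semiring_norm(76))
 obtain R where R: "0 < R" "ALL x. R <= norm x --> ctz x = 0 & grad ctz x = 0" using test_fn_bounded_support[OF ctz(1)] by blast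
 note [measurable] = sm_meas_leb[OF test_sm[OF ctz(1)]]
 have c: "continuous_on UNIV (%x. V x * P \<bar>ctz x\<bar>)"
  using sm_cont[OF test_sm[OF ctz(1)]] by (intro continuous_intros V_cont continuous_on_compose2[OF gf_cont[OF gP]]) auto
 have "integrable lebesgue (%x. V x * P \<bar>ctz x\<bar>)" by (rule cont_bounded_support_integrable[OF c, of R]) (simp add: R gf_0[OF gP])
 then have "(\<integral>\<^sup>+x. ennreal (V x * P \<bar>ctz x\<bar>) \<partial>lebesgue) < \<infinity>"
  using V_pos gf_ge0[OF gP] by (subst nn_integral_eq_integral) (auto simp: less_imp_le)
 moreover have "mo MV P ctz = (\<integral>\<^sup>+x. ennreal (V x * P \<bar>ctz x\<bar>) \<partial>lebesgue)"
  unfolding mo_def using gf_meas_e[OF gP, of ctz lebesgue] V_pos gf_ge0[OF gP] by (subst nn_integral_density) (auto simp: ennreal_mult' less_imp_le)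
 ultimately have "Es ctz (grad ctz)" using D_test[OF ctz(1)] by (simp add: Es_def)
 moreover have "~ (AE x in lebesgue. ctz x <= 0)"
 proof
  assume "AE x in lebesgue. ctz x <= 0"
  then have "AE x in lebesgue. x \<notin> cball (0::'a) 1" 
  proof eventually_elim
   case (elim x)
   then show ?case using ctz(2)[rule_format, of x] by auto
  qed
  then have "emeasure lebesgue (cball (0::'a) 1) = 0" by (subst (asm) AE_iff_measurable[of "cball (0::'a) 1"]) auto
  then show False using content_cball_pos[of 1 "0::'a"] by (simp add: measure_def)
 qed
 ultimately show ?thesis unfolding good_def by blast
qed

lemma good_bounded: assumes g: "good w h" shows "EX b. \<forall>tu\<ge>0. Jr w h tu <= b"
proof -
 obtain t where t: "0 < t" "dr w h t = 0" using nehari[OF g] by blast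
 then show ?thesis using Jr_mono[OF good_Es[OF g] t(1)] by (intro exI[of _ "Jr w h t"]) (metis le_cases order_refl)
qed

lemma c_set: "{b. EX w h. good w h & (\<forall>tu\<ge>0. Jr w h tu <= b)} ~= {}"
 using good_exists good_bounded by blast

lemma c_ge0: "0 <= c"
 unfolding c_def by (rule cInf_greatest[OF c_set]) (auto simp: Jr_0 dest: spec[of _ 0])

lemma good_scale: "good w h ==> 0 < t ==> good (%x. t * w x) (%x. t *R h x)"
 unfolding good_def using Es_scale by (auto simp: mult_le_0_iff not_le)

lemma Jr_scale: "Jr (%x. t * w x) (%x. t *R h x) tu = Jr w h (tu * t)"
 by (simp add: Jr_def mult.assoc)

lemma dJ_scale: "dJ u g (%x. t * w x) (%x. t *R h x) = t * dJ u g w h"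
 by (simp add: dJ_def mult.left_commute[of _ t] right_diff_distrib distrib_left)

text \<open>The convex part is continuous along a ray, vanishes at 0 and grows at least linearly, so
  any positive size is attained. The size c + 1 looks ahead to the limit: at tu = 1 it forces the
  integral of K F to be at least 1 - ep, which prevents vanishing.\<close>

lemma normalised: assumes ep: "0 < ep"
 shows "EX w h. good w h & (LINT x|lebesgue. P (norm (h x))) + (LINT x|lebesgue. V x * P \<bar>w x\<bar>) = c + 1 & (\<forall>tu\<ge>0. Jr w h tu <= c + ep)"
proof -
 have "\<exists>b\<in>{b. EX w h. good w h & (\<forall>tu\<ge>0. Jr w h tu <= b)}. b < c + ep"
  by (rule cInf_lessD[OF c_set]) (use ep in \<open>simp add: c_def\<close>)
 then obtain w h b where g: "good w h" and b: "!!tu. 0 <= tu ==> Jr w h tu <= b" "b < c + ep" by blast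
 note w = good_Es[OF g]
 note [measurable] = Es_meas[OF w]
 define Q where "Q = (%tu. (LINT x|lebesgue. P (norm (tu *R h x))) + (LINT x|lebesgue. V x * P \<bar>tu * w x\<bar>))"
 have iP: "integrable lebesgue (%x. P (norm (tu *R h x)))" for tu
  by (rule mo_integrable(1)[OF gP]) (use mo_scale_finite[OF gP _ D_finite(2)] w in \<open>auto simp: Es_def\<close>)
 have iV: "integrable lebesgue (%x. V x * P \<bar>tu * w x\<bar>)" for tu
  using MV_integrable(1)[of "%x. tu * w x"] Es_scale[OF w, of tu] by (auto simp: Es_def)
 have PP: "tu * P x <= P (tu * x)" if "1 <= tu" "0 <= x" for tu x
  using gf_sub[OF gP, of "1 / tu" "tu * x"] that by (simp add: field_simps)
 have Q: "tu * Q 1 <= Q tu" if tu: "1 <= tu" for tu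
 proof -
  have "(LINT x|lebesgue. tu * P (norm (1 *R h x))) <= (LINT x|lebesgue. P (norm (tu *R h x)))"
   using PP[OF tu] tu by (intro integral_mono integrable_mult_right iP) simp
  moreover have "(LINT x|lebesgue. tu * (V x * P \<bar>1 * w x\<bar>)) <= (LINT x|lebesgue. V x * P \<bar>tu * w x\<bar>)"
  proof (intro integral_mono integrable_mult_right iV)
   fix x
   show "tu * (V x * P \<bar>1 * w x\<bar>) <= V x * P \<bar>tu * w x\<bar>"
    using mult_left_mono[OF PP[OF tu abs_ge_zero[of "w x"]] less_imp_le[OF V_pos[of x]]] tu by (simp add: abs_mult mult.left_commute)
  qed
  ultimately show ?thesis by (simp add: Q_def distrib_left)
 qed
 have "0 <= (LINT x|lebesgue. P (norm (h x)))" using gf_ge0[OF gP] by (intro integral_nonneg_AE) auto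
 then have Q1: "0 < Q 1" using good_pos(2)[OF g] by (simp add: Q_def)
 define T where "T = max 1 ((c + 1) / Q 1)"
 have "c + 1 <= T * Q 1" using Q1 by (simp add: T_def max_def field_simps)
 then have QT: "c + 1 <= Q T" using Q[of T] by (simp add: T_def)
 have Q0: "Q 0 = 0" by (simp add: Q_def gf_0[OF gP])
 have "\<exists>tu\<ge>0. tu <= T & Q tu = c + 1"
  by (rule IVT') (use QT Q0 c_ge0 Q_cont[OF w] in \<open>auto simp: Q_def T_def intro: continuous_on_subset\<close>)
 then obtain tu where tu: "0 <= tu" "Q tu = c + 1" by blast
 then have tu0: "0 < tu" using Q0 c_ge0 by (cases "tu = 0") auto
 have "Jr (%x. tu * w x) (%x. tu *R h x) t <= c + ep" if "0 <= t" for t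
  unfolding Jr_scale using b(1)[of "t * tu"] b(2) that tu by simp
 then show ?thesis using good_scale[OF g tu0] tu(2) unfolding Q_def by blast
qed

end

section \<open>Existence of a critical point\<close>

context var_problem
begin

lemma minimizer: "EX u g. good u g & (\<forall>tu\<ge>0. Jr u g tu <= c) & dr u g 1 = 0"
proof -
 let ?Q = "%w h. (LINT x|lebesgue. P (norm (h x))) + (LINT x|lebesgue. V x * P \<bar>w x\<bar>)"
 have "EX p. ALL n. good (fst (p n)) (snd (p n)) & ?Q (fst (p n)) (snd (p n)) = c + 1 & (\<forall>tu\<ge>0. Jr (fst (p n)) (snd (p n)) tu <= c + 1 / real (Suc n))"
  by (intro choice allI) (use normalised in simp)
 then obtain p where p: "!!n. good (fst (p n)) (snd (p n))" "!!n. ?Q (fst (p n)) (snd (p n)) = c + 1"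
  "!!n tu. 0 <= tu ==> Jr (fst (p n)) (snd (p n)) tu <= c + 1 / real (Suc n)" by blast
 have bnd: "mL P (snd (p n)) <= ennreal (c + 1)" "mo MV P (fst (p n)) <= ennreal (c + 1)" for n
 proof -
  note e = good_Es[OF p(1)[of n]]
  note [measurable] = Es_meas[OF e]
  have 0: "0 <= (LINT x|lebesgue. P (norm (h x)))" "0 <= (LINT x|lebesgue. V x * P \<bar>w x\<bar>)" for h :: "'a => 'a" and w
   using gf_ge0[OF gP] V_pos by (auto intro!: integral_nonneg_AE simp: less_imp_le)
  show "mL P (snd (p n)) <= ennreal (c + 1)"
   using mo_integrable(2)[OF gP _ D_finite(2), of "snd (p n)" "fst (p n)"] e p(2)[of n] 0(2)[of "fst (p n)"] by (auto simp: Es_def intro!: ennreal_leI)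
  show "mo MV P (fst (p n)) <= ennreal (c + 1)"
   using MV_integrable(2)[of "fst (p n)"] e p(2)[of n] 0(1)[of "snd (p n)"] by (auto simp: Es_def intro!: ennreal_leI)
 qed
 have Dp: "D (fst (p n)) (snd (p n))" for n using good_Es[OF p(1)[of n]] by (simp add: Es_def)
 obtain r v0 where r: "strict_mono r" and v0[measurable]: "v0 \<in> LM" and ae: "AE x in lebesgue. (%n. fst (p (r n)) x) ~~> v0 x"
  using rellich[of "%n. fst (p n)" "%n. snd (p n)", OF Dp bnd(1)] by blast
 define v where "v = (%n. fst (p (r n)))"
 define h where "h = (%n. snd (p (r n)))"
 have gv: "good (v n) (h n)" for n unfolding v_def h_def by (rule p(1))
 note Ev = good_Es[OF gv]
 note [measurable] = Es_meas[OF Ev]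
 have Dv: "D (v n) (h n)" for n using Ev[of n] by (simp add: Es_def)
 have aev: "AE x in lebesgue. (%n. v n x) ~~> v0 x" using ae by (simp add: v_def)
 have b1: "mL P (h n) <= ennreal (c + 1)" "mo MV P (v n) <= ennreal (c + 1)" "?Q (v n) (h n) = c + 1" for n
  unfolding v_def h_def by (rule bnd p(2))+
 have Jv: "Jr (v n) (h n) tu <= c + 1 / real (Suc n)" if "0 <= tu" for n tu
 proof -
  have "c + 1 / real (Suc (r n)) <= c + 1 / real (Suc n)" using seq_suble[OF r, of n] by (simp add: frac_le)
  then show ?thesis using p(3)[OF that, of "r n"] unfolding v_def h_def by (rule order_trans[rotated])
 qed
 obtain B1 where B1: "!!u g. D u g ==> mL P g <= ennreal (c + 1) ==> mL Ps u <= ennreal B1" using sobolev_bound by blast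
 define kk where "kk = 1 / (SOME C. 0 < C & (\<forall>t\<ge>0. C * t powr ms <= Ps t))"
 define B where "B = max (c + 1) (\<bar>kk\<bar> * \<bar>B1\<bar>)"
 have B: "0 <= B" using c_ge0 by (simp add: B_def le_max_iff_disj)
 have b2: "mL (%t. t powr ms) (v n) <= ennreal B" "mo MV P (v n) <= ennreal B" for n
 proof -
  have "mL (%t. t powr ms) (v n) <= ennreal kk * ennreal B1" unfolding kk_def by (rule mo_ms_le[OF _ B1[OF Dv b1(1)]]) simp
  also have "... <= ennreal \<bar>kk\<bar> * ennreal \<bar>B1\<bar>" by (intro mult_mono ennreal_leI) auto
  also have "... <= ennreal B" unfolding B_def by (subst ennreal_mult[symmetric]) (auto intro!: ennreal_leI)
  finally show "mL (%t. t powr ms) (v n) <= ennreal B" .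
  show "mo MV P (v n) <= ennreal B" by (rule order_trans[OF b1(2)]) (simp add: B_def ennreal_leI)
 qed
 have aeV: "AE x in MV. (%n. v n x) ~~> v0 x" using aev by (subst AE_density) auto
 have b3: "mL (%t. t powr ms) v0 <= ennreal B" by (rule mo_fatou_le[OF gms _ aev]) (use b2 in auto)
 have b4: "mo MV P v0 <= ennreal B" by (rule mo_fatou_le[OF gP _ aeV]) (use b2 in auto)
 \<comment> \<open>The bounds for all multiples refer to this one g0; below, each tu uses
   \<open>c' = tu\<close>.\<close>
 obtain g0 where g0: "D v0 g0" "!!c' B. (EX N. \<forall>n\<ge>N. mL P (%x. c' *R h n x) <= B) ==> mL P (%x. c' *R g0 x) <= B"
  using weak_limit[OF Dv b1(1) v0 aev] by blast
 have E0: "Es v0 g0" using g0(1) b4 by (auto simp: Es_def less_top[symmetric] top_unique)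
 note [measurable] = Es_meas[OF E0]
 have Zl: "(%n. LINT x|lebesgue. K x * F (tu * v n x)) ~~> (LINT x|lebesgue. K x * F (tu * v0 x))" for tu
 proof (rule K_compact)
  define B' where "B' = max 1 (\<bar>tu\<bar> powr m) * B + max 1 (\<bar>tu\<bar> powr ms) * B"
  show "AE x in lebesgue. (%n. tu * v n x) ~~> tu * v0 x" using aev by eventually_elim (intro tendsto_intros)
  have s: "0 <= max 1 (\<bar>tu\<bar> powr m) * B" "0 <= max 1 (\<bar>tu\<bar> powr ms) * B" using B by (auto intro!: mult_nonneg_nonneg simp: le_max_iff_disj)
  show "0 <= B'" unfolding B'_def using s by simp
  have 1: "mo MV P (%x. tu * z x) <= ennreal B'" if [measurable]: "z \<in> LM" and "mo MV P z <= ennreal B" for z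
  proof -
   have "mo MV P (%x. tu *R z x) <= ennreal (max 1 (\<bar>tu\<bar> powr m)) * ennreal B"
    by (rule order_trans[OF mo_scale[OF gP] mult_left_mono]) (use that in auto)
   also have "... <= ennreal B'" unfolding B'_def using B s by (subst ennreal_mult[symmetric]) (auto intro!: ennreal_leI)
   finally show ?thesis by simp
  qed
  show "mo MV P (%x. tu * v n x) <= ennreal B'" "mo MV P (%x. tu * v0 x) <= ennreal B'" for n by (rule 1; use b2 b4 in simp)+
  have 2: "mL (%t. t powr ms) (%x. tu * z x) <= ennreal B'" if [measurable]: "z \<in> LM" and "mL (%t. t powr ms) z <= ennreal B" for z :: "'a => real"
  proof -
   have "mL (%t. t powr ms) (%x. tu *R z x) <= ennreal (max 1 (\<bar>tu\<bar> powr ms)) * ennreal B"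
    by (rule order_trans[OF mo_scale[OF gms] mult_left_mono]) (use that in auto)
   also have "... <= ennreal B'" unfolding B'_def using B s by (subst ennreal_mult[symmetric]) (auto intro!: ennreal_leI)
   finally show ?thesis by simp
  qed
  show "mL (%t. t powr ms) (%x. tu * v n x) <= ennreal B'" "mL (%t. t powr ms) (%x. tu * v0 x) <= ennreal B'" for n by (rule 2; use b2 b3 in simp)+
 qed (use dr_int(4)[OF Ev] dr_int(4)[OF E0] in auto)
 have Jc: "Jr v0 g0 tu <= c" if tu: "0 <= tu" for tu
 proof -
  define Z where "Z = (LINT x|lebesgue. K x * F (tu * v0 x))"
  define X where "X = (%h :: 'a => 'a. LINT x|lebesgue. P (norm (tu *R h x)))"
  define Y where "Y = (%w :: 'a => real. LINT x|lebesgue. V x * P \<bar>tu * w x\<bar>)"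
  have Y0: "0 <= Y w" and X0: "0 <= X h'" for w h' unfolding X_def Y_def using gf_ge0[OF gP] V_pos by (auto intro!: integral_nonneg_AE simp: less_imp_le)
  have mX: "mL P (%x. tu *R h' x) = ennreal (X h')" if "Es w h'" for w h'
   unfolding X_def using Es_scale[OF that, of tu] by (intro mo_integrable(2)[OF gP] D_finite(2)) (auto simp: Es_def D_meas)
  have mY: "mo MV P (%x. tu * w x) = ennreal (Y w)" if "Es w h'" for w h'
   unfolding Y_def using Es_scale[OF that, of tu] by (intro MV_integrable(2)) (auto simp: Es_def D_meas)
  \<comment> \<open>Fatou's lemma bounds \<open>Y (v n)\<close> from below and the nonlinear term
    converges, so \<open>X (h n)\<close> is eventually at most c + Z - Y v0 + e; an eventual bound
    of this kind is what passes to g0.\<close>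
  have "X g0 + Y v0 <= c + Z"
  proof (rule field_le_epsilon)
   fix e :: real assume e: "0 < e"
   have "eventually (%n. Y v0 - e / 3 <= Y (v n)) sequentially"
   \<comment> \<open>Strict inequality in \<open>ennreal\<close> below \<open>Y v0\<close> requires
     \<open>Y v0\<close> to be positive, since negative reals are cut to 0.\<close>
   proof (cases "Y v0 = 0")
    case True
    have "Y v0 - e / 3 <= Y (v n)" for n using Y0[of "v n"] e True by simp
    then show ?thesis by simp
   next
    case False
    have "mo MV P (%x. tu * v0 x) <= liminf (%n. mo MV P (%x. tu * v n x))"
     by (rule mo_fatou[OF gP]) (use aeV in \<open>auto elim!: eventually_mono intro!: tendsto_intros\<close>)
    then have "ennreal (Y v0 - e / 3) < liminf (%n. ennreal (Y (v n)))"
     unfolding mY[OF E0] mY[OF Ev] using False Y0[of v0] e by (intro less_le_trans[OF ennreal_lessI]) auto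
    from less_LiminfD[OF this] show ?thesis by (rule eventually_mono) (meson ennreal_leI linear not_le)
   qed
   moreover have "eventually (%n. (LINT x|lebesgue. K x * F (tu * v n x)) < Z + e / 3) sequentially"
    by (rule order_tendstoD(2)[OF Zl[of tu]]) (use e in \<open>simp add: Z_def\<close>)
   moreover have "eventually (%n. 1 / real (Suc n) < e / 3) sequentially"
    by (rule order_tendstoD(2)[OF inverse_Suc_tendsto]) (use e in simp)
   ultimately have ev: "eventually (%n. X (h n) <= c + Z - Y v0 + e) sequentially"
   proof eventually_elim
    case (elim n)
    have "X (h n) + Y (v n) - (LINT x|lebesgue. K x * F (tu * v n x)) <= c + 1 / real (Suc n)"
     using Jv[OF tu, of n] unfolding Jr_split[OF Ev] X_def Y_def .
    then show ?case using elim by linarith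
   qed
   then obtain N where N: "\<forall>n\<ge>N. X (h n) <= c + Z - Y v0 + e" by (auto simp: eventually_sequentially)
   have "mL P (%x. tu *R g0 x) <= ennreal (c + Z - Y v0 + e)"
    by (rule g0(2)) (use N mX[OF Ev] in \<open>auto intro!: exI[of _ N] ennreal_leI\<close>)
   moreover have "0 <= c + Z - Y v0 + e" using N X0[of "h N"] by force
   ultimately show "X g0 + Y v0 <= c + Z + e" unfolding mX[OF E0] by (simp add: ennreal_le_iff)
  qed
  then show ?thesis unfolding Jr_split[OF E0] X_def Y_def Z_def by simp
 qed
 have gv0: "good v0 g0"
  unfolding good_def
 proof (intro conjI E0 notI)
  assume "AE x in lebesgue. v0 x <= 0"
  then have "AE x in lebesgue. K x * F (1 * v0 x) = 0" by eventually_elim (simp add: F_neg)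
  then have z: "(LINT x|lebesgue. K x * F (1 * v0 x)) = 0" by (rule integral_eq_zero_AE)
  have "(%n. (LINT x|lebesgue. K x * F (1 * v n x)) + 1 / real (Suc n)) ~~> 0 + 0"
   using Zl[of 1] unfolding z by (rule tendsto_add[OF _ inverse_Suc_tendsto])
  \<comment> \<open>Convex part of size c + 1 against energy at most c + 1/(n + 1) leaves nearly 1
    for the nonlinear term, whose limit would be 0 if v0 <= 0.\<close>
  moreover have "1 <= (LINT x|lebesgue. K x * F (1 * v n x)) + 1 / real (Suc n)" for n
   using Jv[of 1 n] b1(3)[of n] unfolding Jr_split[OF Ev] by simp
  ultimately have "1 <= (0 + 0 :: real)" by (intro LIMSEQ_le_const) auto
  then show False by simp
 qed
 obtain t where t: "0 < t" "dr v0 g0 t = 0" using nehari[OF gv0] by blast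
 show ?thesis
 proof (intro exI conjI allI impI)
  show "good (%x. t * v0 x) (%x. t *R g0 x)" by (rule good_scale[OF gv0 t(1)])
  show "Jr (%x. t * v0 x) (%x. t *R g0 x) tu <= c" if "0 <= tu" for tu unfolding Jr_scale using Jc[of "tu * t"] that t by simp
  show "dr (%x. t * v0 x) (%x. t *R g0 x) 1 = 0" using t(2) by (simp add: dr_def dJ_scale)
 qed
qed

text \<open>Suppose moving along w decreases J. For a small s the ray through u + s w stays below c
  by at least \<open>kp * s\<close> while tu is within dl of 1. Beyond this window its energy is
  controlled by the endpoints, because the derivative along the new ray is still positive at 1 - dl
  and negative at 1 + dl and such rays are unimodal. This contradicts the definition of c.\<close>

lemma critical_le:
 assumes g: "good u g" and Jc: "!!tu. 0 <= tu ==> Jr u g tu <= c" and d1: "dr u g 1 = 0" and w: "Es w h"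
 shows "0 <= dJ u g w h"
proof (rule ccontr)
 assume neg: "~ 0 <= dJ u g w h"
 note u = good_Es[OF g]
 interpret two_dirs P Ps m ms ty a V K f F kb kv u g w h by unfold_locales (rule u w)+
 \<comment> \<open>Half of the negative slope persists in a neighbourhood of tu = 1, s = 0.\<close>
 define kp where "kp = - dJ u g w h / 2"
 have kp: "0 < kp" using neg by (simp add: kp_def)
 have l0: "dj tu sg 0 tu = tu * dj tu sg 0 1" for tu sg using dj_lin[of tu sg tu 0 0 0 1 0] by simp
 have "\<exists>n::nat. \<forall>tu s. \<bar>tu - 1\<bar> <= 1 / real (Suc (Suc n)) --> 0 <= s --> s <= 1 / real (Suc (Suc n)) --> dj tu (tu * s) 0 tu <= - kp"
 proof (rule ccontr)
  assume "~ ?thesis"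
  then have "\<forall>n::nat. EX q. \<bar>fst q - 1\<bar> <= 1 / real (Suc (Suc n)) & 0 <= snd q & snd q <= 1 / real (Suc (Suc n)) & - kp < dj (fst q) (fst q * snd q) 0 (fst q)"
   by (simp add: not_le)
  from choice[OF this] obtain q where q: "!!n::nat. \<bar>fst (q n) - 1\<bar> <= 1 / real (Suc (Suc n))" "!!n. 0 <= snd (q n)"
   "!!n. snd (q n) <= 1 / real (Suc (Suc n))" "!!n. - kp < dj (fst (q n)) (fst (q n) * snd (q n)) 0 (fst (q n))" by blast
  have z: "(%n. 1 / real (Suc (Suc n))) ~~> 0" using inverse_Suc_tendsto by (rule LIMSEQ_Suc)
  have "(%n. fst (q n) - 1) ~~> 0" by (rule Lim_null_comparison[OF _ z]) (use q(1) in simp)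
  then have f1: "(%n. fst (q n)) ~~> 1" by (simp add: LIM_zero_iff)
  have s0: "(%n. snd (q n)) ~~> 0" by (rule Lim_null_comparison[OF _ z]) (use q(2,3) in simp)
  have "(%n. fst (q n) * dj (fst (q n)) (fst (q n) * snd (q n)) 0 1) ~~> 1 * dj 1 (1 * 0) 0 1"
   by (intro tendsto_intros dj_cont f1 s0)
  moreover have "dj 1 (1 * 0) 0 1 = - 2 * kp" by (simp add: dj_def kp_def)
  ultimately have "(%n. dj (fst (q n)) (fst (q n) * snd (q n)) 0 (fst (q n))) ~~> - 2 * kp" unfolding l0[symmetric] by simp
  then have "- kp <= - 2 * kp" by (rule LIMSEQ_le_const) (use q(4) in \<open>auto simp: less_imp_le\<close>)
  then show False using kp by simp
 qed
 then obtain n :: nat where n: "!!tu s. \<bar>tu - 1\<bar> <= 1 / real (Suc (Suc n)) ==> 0 <= s ==> s <= 1 / real (Suc (Suc n)) ==> dj tu (tu * s) 0 tu <= - kp" by blast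
 define dl where "dl = 1 / real (Suc (Suc n))"
 have dl: "0 < dl" "dl < 1" by (auto simp: dl_def)
 have ddr: "dj tu 0 1 0 = dr u g tu" for tu by (simp add: dj_def dr_def)
 \<comment> \<open>Strictness in \<open>dr_strict\<close> makes the critical point tu = 1 a genuine
   sign change, which survives small s by continuity.\<close>
 have a1: "0 < dj (1 - dl) ((1 - dl) * 0) 1 0" and a2: "dj (1 + dl) ((1 + dl) * 0) 1 0 < 0"
  using dr_strict[OF g, of "1 - dl" 1] dr_strict[OF g, of 1 "1 + dl"] dl d1 by (auto simp: ddr zero_less_mult_iff mult_less_0_iff)
 have lim: "(%k. dj tu (tu * (1 / real (Suc k))) 1 0 + 1 / real (Suc k) * dj tu (tu * (1 / real (Suc k))) 0 1) ~~> dj tu (tu * 0) 1 0 + 0 * dj tu (tu * 0) 0 1" for tu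
  by (intro tendsto_intros dj_cont inverse_Suc_tendsto)
 have l1: "dj tu (tu * s) 1 s = dj tu (tu * s) 1 0 + s * dj tu (tu * s) 0 1" for tu s using dj_lin[of tu "tu * s" 1 1 s 0 0 1] by simp
 have "eventually (%k. 0 < dj (1 - dl) ((1 - dl) * (1 / real (Suc k))) 1 (1 / real (Suc k))) sequentially"
  unfolding l1 by (rule order_tendstoD(1)[OF lim]) (use a1 in simp)
 moreover have "eventually (%k. dj (1 + dl) ((1 + dl) * (1 / real (Suc k))) 1 (1 / real (Suc k)) < 0) sequentially"
  unfolding l1 by (rule order_tendstoD(2)[OF lim]) (use a2 in simp)
 moreover have "eventually (%k. 1 / real (Suc k) < dl) sequentially"
  by (rule order_tendstoD(2)[OF inverse_Suc_tendsto dl(1)])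
 ultimately have "eventually (%k. 0 < dj (1 - dl) ((1 - dl) * (1 / real (Suc k))) 1 (1 / real (Suc k)) \<and>
   dj (1 + dl) ((1 + dl) * (1 / real (Suc k))) 1 (1 / real (Suc k)) < 0 & 1 / real (Suc k) < dl) sequentially" by eventually_elim blast
 then obtain k where "0 < dj (1 - dl) ((1 - dl) * (1 / real (Suc k))) 1 (1 / real (Suc k))"
   "dj (1 + dl) ((1 + dl) * (1 / real (Suc k))) 1 (1 / real (Suc k)) < 0" "1 / real (Suc k) < dl" by (auto simp: eventually_sequentially)
 moreover define s where "s = 1 / real (Suc k)"
 ultimately have s: "0 < dj (1 - dl) ((1 - dl) * s) 1 s" "dj (1 + dl) ((1 + dl) * s) 1 s < 0" "s < dl" "0 < s" by simp_all
 define u' where "u' = (%x. u x + s * w x)"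
 define g' where "g' = (%x. g x + s *R h x)"
 have E': "Es u' g'" using Es_lin[OF u w, of 1 s] by (simp add: u'_def g'_def)
 have drp: "dr u' g' tu = dj tu (tu * s) 1 s" and Jrp: "Jr u' g' tu = jj tu (tu * s)" for tu
  by (simp_all add: dr_def dj_def Jr_def jj_def u'_def g'_def distrib_left scaleR_add_right mult.assoc)
 have mid: "Jr u' g' tu <= c - kp * s" if tu: "\<bar>tu - 1\<bar> <= dl" for tu
 proof -
  have "EX z. 0 < z & z < s & jj tu (tu * s) - jj tu (tu * 0) = (s - 0) * dj tu (tu * z) 0 tu"
   by (rule MVT2[OF s(4)]) (rule jj_deriv2)
  then obtain z where z: "0 < z" "z < s" "jj tu (tu * s) - jj tu (tu * 0) = (s - 0) * dj tu (tu * z) 0 tu" by blast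
  have "dj tu (tu * z) 0 tu <= - kp" by (rule n[folded dl_def]) (use tu z s in auto)
  then have "s * dj tu (tu * z) 0 tu <= s * (- kp)" using s by (intro mult_left_mono) auto
  moreover have "jj tu 0 <= c" using Jc[of tu] tu dl by (simp add: jj_def Jr_def)
  ultimately show ?thesis using z(3) unfolding Jrp by (simp add: mult.commute)
 qed
 have all: "Jr u' g' tu <= c - kp * s" if "0 <= tu" for tu
 proof -
  consider "\<bar>tu - 1\<bar> <= dl" | "tu <= 1 - dl" | "1 + dl <= tu" by linarith
  then show ?thesis
  proof cases
   case 2
   have "Jr u' g' tu <= Jr u' g' (1 - dl)" by (rule Jr_mono(1)[OF E']) (use 2 that s dl in \<open>auto simp: drp\<close>)
   also have "... <= c - kp * s" by (rule mid) (use dl in simp)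
   finally show ?thesis .
  next
   case 3
   have "Jr u' g' tu <= Jr u' g' (1 + dl)" by (rule Jr_mono(2)[OF E']) (use 3 s dl in \<open>auto simp: drp\<close>)
   also have "... <= c - kp * s" by (rule mid) (use dl in simp)
   finally show ?thesis .
  qed (rule mid)
 qed
 \<comment> \<open>For a nonpositive function the nonlinear term vanishes, so the derivative along
   its ray could not be negative at 1 + dl.\<close>
 have "good u' g'"
  unfolding good_def
 proof (intro conjI E' notI)
  assume "AE x in lebesgue. u' x <= 0"
  then have "AE x in lebesgue. K x * (f ((1 + dl) * u' x) * u' x) = 0"
   by eventually_elim (use dl in \<open>simp add: f_neg mult_nonneg_nonpos\<close>)
  then have "(LINT x|lebesgue. K x * (f ((1 + dl) * u' x) * u' x)) = 0" by (rule integral_eq_zero_AE)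
  moreover have "0 <= (LINT x|lebesgue. a ((1 + dl) * norm (g' x)) * norm (g' x))" "0 <= (LINT x|lebesgue. V x * (a ((1 + dl) * \<bar>u' x\<bar>) * \<bar>u' x\<bar>))"
   using dl a_ge0 V_pos by (auto intro!: integral_nonneg_AE simp: less_imp_le)
  ultimately have "0 <= dr u' g' (1 + dl)" using dr_split(1)[OF E', of "1 + dl"] dl by simp
  then show False using s(2) by (simp add: drp)
 qed
 from c_le[OF this all] show False using mult_pos_pos[OF kp s(4)] by simp
qed

lemma critical_point: "EX u g. good u g & (ALL w h. Es w h --> dJ u g w h = 0)"
proof -
 obtain u g where u: "good u g" "!!tu. 0 <= tu ==> Jr u g tu <= c" "dr u g 1 = 0" using minimizer by blast
 have "dJ u g w h = 0" if w: "Es w h" for w h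
 proof -
  have "0 <= dJ u g w h" "0 <= - dJ u g w h"
   using critical_le[OF u w] critical_le[OF u Es_scale[OF w, of "-1"]] dJ_scale[of u g "-1" w h] by simp_all
  then show ?thesis by simp
 qed
 then show ?thesis using u(1) by blast
qed

lemma Es_I: "D w h ==> (!!x. \<bar>w x\<bar> <= \<bar>u x\<bar>) ==> Es u g ==> Es w h"
 unfolding Es_def by (auto intro!: le_less_trans[OF mo_mono[OF gP, where w = u]])

text \<open>Tested with the negative part, the nonlinear term vanishes pointwise and the two others
  are nonpositive, hence both zero; V > 0 then forces u >= 0.\<close>

lemma critical_nonneg:
 assumes u: "Es u g" and crit: "!!w h. Es w h ==> dJ u g w h = 0"
 shows "AE x in lebesgue. 0 <= u x"
proof -
 define w where "w = (%x. max 0 (- 1 * u x - 0))"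
 define h where "h = (%x. half_step (- 1 * u x - 0) *R (- 1 *R g x))"
 have "D w h" unfolding w_def h_def by (rule D_truncate[OF D_scale]) (use u in \<open>auto simp: Es_def\<close>)
 then have w: "Es w h" by (rule Es_I[OF _ _ u]) (auto simp: w_def)
 interpret two_dirs P Ps m ms ty a V K f F kb kv u g w h by unfold_locales (rule u w)+
 have hs: "0 <= half_step t" for t by (simp add: half_step_def)
 have "A (g x) \<bullet> h x <= 0" for x
  using A_inner_self[of "g x"] a_ge0[of "norm (g x)"] hs by (simp add: h_def mult_nonneg_nonneg)
 then have 1: "(LINT x|lebesgue. A (g x) \<bullet> h x) <= 0" using integral_nonneg_AE[of "%x. - (A (g x) \<bullet> h x)" lebesgue] by simp
 have p: "V x * (A (u x) * w x) <= 0" and p': "u x < 0 ==> V x * (A (u x) * w x) ~= 0" for x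
 proof -
  have e: "A (u x) * w x = - (a \<bar>u x\<bar> * \<bar>u x\<bar>)" if "u x < 0" using that by (simp add: A_def w_def)
  show "V x * (A (u x) * w x) <= 0"
  proof (cases "u x < 0")
   case True
   then show ?thesis using a_ge0[of "\<bar>u x\<bar>"] V_pos[of x] by (simp add: e mult_nonneg_nonpos less_imp_le)
  qed (simp add: w_def)
  show "u x < 0 ==> V x * (A (u x) * w x) ~= 0" using e a_pos[of "\<bar>u x\<bar>"] V_pos[of x] by simp
 qed
 have 2: "(LINT x|lebesgue. V x * (A (u x) * w x)) <= 0" using p integral_nonneg_AE[of "%x. - (V x * (A (u x) * w x))" lebesgue] by simp
 have fw: "f (u x) * w x = 0" for x using f_neg[of "u x"] by (cases "u x <= 0") (auto simp: w_def)
 have "(LINT x|lebesgue. K x * (f (u x) * w x)) = 0" unfolding fw by simp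
 then have "(LINT x|lebesgue. V x * (A (u x) * w x)) = 0" using crit[OF w] 1 2 by (simp add: dJ_def)
 then have "(LINT x|lebesgue. - (V x * (A (u x) * w x))) = 0" by simp
 moreover have "integrable lebesgue (%x. - (V x * (A (u x) * w x)))" using dJ_integrable(2) by simp
 moreover have "AE x in lebesgue. 0 <= - (V x * (A (u x) * w x))" using p by simp
 ultimately have "AE x in lebesgue. - (V x * (A (u x) * w x)) = 0" using integral_nonneg_eq_0_iff_AE by blast
 then show ?thesis
 proof eventually_elim
  case (elim x)
  then show ?case using p'[of x] by (cases "u x < 0") auto
 qed
qed

end

section \<open>Boundedness by De Giorgi iteration\<close>

context var_problem
begin

text \<open>No cutoff is needed: with \<open>ep = 1 / kv\<close> in the growth condition the \<open>a\<close>-part of \<open>K f(u)\<close> is absorbed by the potential term.\<close>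

lemma level_energy:
 assumes u: "Es u g" and crit: "!!w h. Es w h ==> dJ u g w h = 0" and u0: "AE x in lebesgue. 0 <= u x"
  and C: "0 <= C" "!!t. \<bar>f t\<bar> <= 1 / kv * a \<bar>t\<bar> + C * \<bar>t\<bar> powr (ms - 1)"
  and k: "0 <= k1" "k1 < k2" "k2 <= L * (k2 - k1)" and B: "0 <= B" "mL (%t. t powr ms) (%x. max 0 (u x - k1)) <= ennreal B"
 shows "mL P (%x. half_step (u x - k2) *R g x) <= ennreal (kb * C * L powr ms * B)"
proof -
 define w where "w = (%x. max 0 (u x - k2))"
 define h where "h = (%x. half_step (u x - k2) *R g x)"
 note [measurable] = Es_meas[OF u]
 have Dw: "D w h" unfolding w_def h_def by (rule D_truncate) (use u k in \<open>auto simp: Es_def\<close>)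
 then have w: "Es w h" by (rule Es_I[OF _ _ u]) (use k in \<open>auto simp: w_def\<close>)
 interpret two_dirs P Ps m ms ty a V K f F kb kv u g w h by unfold_locales (rule u w)+
 have L: "0 < L" using k by (smt (verit) mult_nonneg_nonneg mult_nonpos_nonneg)
 \<comment> \<open>On {u > k2} the quotient u / (u - k1) is below its value at u = k2, which the
   hypothesis bounds by L.\<close>
 have ul: "u x <= L * (u x - k1)" if "k2 < u x" for x
 proof -
  have "k1 * k2 <= k1 * u x" using that k by (intro mult_left_mono) auto
  then have "u x * (k2 - k1) <= (u x - k1) * k2" by (simp add: algebra_simps)
  also have "... <= (u x - k1) * (L * (k2 - k1))" using k that by (intro mult_left_mono) auto
  finally show ?thesis using k by (simp add: mult.assoc[symmetric] mult.commute[of "u x - k1"])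
 qed
 \<comment> \<open>\<open>half_step\<close> takes values in [0, 1], so the contraction property
   applies to P; then \<open>P s <= s * a s\<close>.\<close>
 have ph: "P (norm (h x)) <= A (g x) \<bullet> h x" for x
 proof -
  have S: "0 <= half_step (u x - k2)" "half_step (u x - k2) <= 1" by (auto simp: half_step_def)
  have "P (norm (h x)) <= half_step (u x - k2) * P (norm (g x))" using gf_sub[OF gP S, of "norm (g x)"] S by (simp add: h_def)
  also have "... <= half_step (u x - k2) * (norm (g x) * a (norm (g x)))" using S Pa_lower by (intro mult_left_mono) auto
  also have "... = A (g x) \<bullet> h x" using A_inner_self[of "g x"] by (simp add: h_def mult.commute)
  finally show ?thesis .
 qed
 have fin1: "mL (%t. t powr ms) (%x. max 0 (u x - k1)) < \<infinity>" using B(2) by (auto simp: less_top[symmetric] top_unique)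
 have i1: "integrable lebesgue (%x. (max 0 (u x - k1)) powr ms)" and l1: "(LINT x|lebesgue. (max 0 (u x - k1)) powr ms) <= B"
  using mo_integrable[OF gms _ fin1] B by (simp_all add: ennreal_le_iff)
 have "(LINT x|lebesgue. A (g x) \<bullet> h x) = (LINT x|lebesgue. K x * (f (u x) * w x) - V x * (A (u x) * w x))"
  using crit[OF w] dJ_integrable by (simp add: dJ_def)
 also have "... <= (LINT x|lebesgue. kb * C * L powr ms * (max 0 (u x - k1)) powr ms)"
 proof (rule integral_mono_AE)
  show "AE x in lebesgue. K x * (f (u x) * w x) - V x * (A (u x) * w x) <= kb * C * L powr ms * (max 0 (u x - k1)) powr ms"
   using u0 K_kb K_kv
  proof eventually_elim
   case (elim x)
   show ?case
   proof (cases "k2 < u x")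
    case True
    then have ux: "0 < u x" "0 < w x" "w x <= u x" "w x ~= 0" using k by (auto simp: w_def)
    have "K x * f (u x) <= K x * (1 / kv * a (u x) + C * u x powr (ms - 1))"
     using C(2)[of "u x"] ux K_nonneg[of x] by (intro mult_left_mono) auto
    also have "... <= kv * V x * (1 / kv * a (u x)) + kb * (C * u x powr (ms - 1))"
     unfolding distrib_left using elim a_pos[OF ux(1)] kv C(1) by (intro add_mono mult_right_mono) auto
    also have "... = V x * a (u x) + kb * C * u x powr (ms - 1)" using kv by simp
    finally have "(K x * f (u x) - V x * a (u x)) * w x <= kb * C * u x powr (ms - 1) * w x" using ux by (intro mult_right_mono) auto
    also have "... <= kb * C * u x powr (ms - 1) * u x" using ux kb C by (intro mult_left_mono) auto
    also have "... = kb * C * u x powr ms" using ux powr_add[of "u x" "ms - 1" 1] by simp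
    also have "... <= kb * C * (L * (u x - k1)) powr ms" using ul[OF True] ux kb C ms1 by (intro mult_left_mono powr_mono2) auto
    also have "... = kb * C * L powr ms * (max 0 (u x - k1)) powr ms" using True k L by (simp add: powr_mult)
    finally show ?thesis using ux by (simp add: A_def algebra_simps)
   next
    case False
    then show ?thesis using kb C L by (simp add: w_def)
   qed
  qed
 qed (use dJ_integrable i1 in auto)
 also have "... <= kb * C * L powr ms * B" using l1 kb C by (simp add: mult_left_mono)
 finally have "(LINT x|lebesgue. A (g x) \<bullet> h x) <= kb * C * L powr ms * B" .
 moreover have "(LINT x|lebesgue. P (norm (h x))) <= (LINT x|lebesgue. A (g x) \<bullet> h x)"
  by (rule integral_mono[OF mo_integrable(1)[OF gP _ D_finite(2)[OF Dw]] dJ_integrable(1) ph]) (rule D_meas(2)[OF Dw])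
 ultimately show ?thesis
  using mo_integrable(2)[OF gP D_meas(2)[OF Dw] D_finite(2)[OF Dw]] by (simp add: h_def ennreal_leI)
qed

text \<open>With y_j the integral of the power ms of the positive part of u - k_j, the energy
  estimate and the embedding give y_(j+1) <= C5 (C4 b^j y_j)^q, where q = ms/m > 1. The bound y_j <=
  Y th^j reproduces itself when (b th)^q = th and Y is small; u then exceeds the limit level 2M only
  on a null set.\<close>

lemma critical_bounded:
 assumes u: "Es u g" and crit: "!!w h. Es w h ==> dJ u g w h = 0" and u0: "AE x in lebesgue. 0 <= u x"
 shows "EX M. AE x in lebesgue. u x <= M"
proof -
 note [measurable] = Es_meas[OF u]
 have Du: "D u g" using u by (simp add: Es_def)
 obtain C0 where C0: "0 <= C0" "!!t. \<bar>f t\<bar> <= 1 / kv * a \<bar>t\<bar> + C0 * \<bar>t\<bar> powr (ms - 1)" using G1[of "1 / kv"] kv by auto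
 \<comment> \<open>Made strictly positive because C4 is divided by.\<close>
 define C where "C = C0 + 1"
 have C: "0 <= C" "\<bar>f t\<bar> <= 1 / kv * a \<bar>t\<bar> + C * \<bar>t\<bar> powr (ms - 1)" for t
  using C0(1) order_trans[OF C0(2)[of t], of "1 / kv * a \<bar>t\<bar> + C * \<bar>t\<bar> powr (ms - 1)"] by (auto simp: C_def mult_right_mono)
 obtain C5 where C5: "0 < C5" "!!u g a. D u g ==> 0 < a ==> a <= 1 ==> mL P g <= ennreal a ==> mL (%t. t powr ms) u <= ennreal (C5 * a powr (ms / m))"
  using sobolev_small by blast
 define b where "b = (2::real) powr ms"
 define C4 where "C4 = kb * C * 4 powr ms"
 define q where "q = ms / m"
 \<comment> \<open>The solution of \<open>(b * th) powr q = th\<close>; it absorbs the factor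
   \<open>b ^ j\<close> produced by the shrinking gaps between levels.\<close>
 define th where "th = b powr (- q / (q - 1))"
 have q: "1 < q" using ms_gt m1 by (simp add: q_def)
 have b: "1 < b" using ms1 powr_less_mono[of 0 ms 2] by (simp add: b_def)
 have C4: "0 < C4" using kb C0(1) by (simp add: C4_def C_def)
 have th: "0 < th" "th < 1" using b q powr_less_one[of b "- q / (q - 1)"] by (auto simp: th_def field_simps)
 have bt: "b * th = b powr (- 1 / (q - 1))"
 proof -
  have "1 + - q / (q - 1) = - 1 / (q - 1)" using q by (simp add: field_simps)
  then show ?thesis using powr_add[of b 1 "- q / (q - 1)"] b by (simp add: th_def)
 qed
 have btq: "(b * th) powr q = th" unfolding bt by (simp add: powr_powr th_def)
 have bt1: "0 < b * th" "b * th <= 1" using b th q bt powr_le1[of "1 / (q - 1)" "1 / b"] by (auto simp: powr_minus_divide powr_divide)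
 \<comment> \<open>At most 1 so that \<open>sobolev_small\<close> applies, and small enough for
   \<open>C5 * Z powr q <= th * (Z / C4)\<close>, which is one step of the recursion.\<close>
 define Z where "Z = min 1 ((th / (C4 * C5)) powr (1 / (q - 1)))"
 have Z: "0 < Z" "Z <= 1" using th C4 C5 by (auto simp: Z_def)
 have Zq: "C5 * Z powr q <= th * (Z / C4)"
 proof -
  have "Z powr (q - 1) <= ((th / (C4 * C5)) powr (1 / (q - 1))) powr (q - 1)" using Z q by (intro powr_mono2) (auto simp: Z_def)
  also have "... = th / (C4 * C5)" using q th C4 C5 by (simp add: powr_powr)
  finally have "Z powr (q - 1) * Z <= th / (C4 * C5) * Z" using Z by (intro mult_right_mono) auto
  moreover have "Z powr (q - 1) * Z = Z powr q" using powr_add[of Z "q - 1" 1] Z by simp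
  ultimately have "C5 * Z powr q <= C5 * (th / (C4 * C5) * Z)" using C5 by (intro mult_left_mono) auto
  also have "... = th * (Z / C4)" using C5 C4 by simp
  finally show ?thesis .
 qed
 define Y where "Y = Z / C4"
 have Y: "0 < Y" using Z C4 by (simp add: Y_def)
 define W where "W = (%k x. max 0 (u x - k))"
 have "(%n. mL (%t. t powr ms) (W (real n))) ~~> 0"
 proof (rule mo_dominated[OF gms _ _ D_ms[OF Du]])
  show "AE x in lebesgue. (%n. W (real n) x) ~~> 0"
  proof (rule AE_I2)
   fix x
   have "eventually (%n. W (real n) x = 0) sequentially"
    using eventually_ge_at_top[of "nat \<lceil>\<bar>u x\<bar>\<rceil>"]
   proof eventually_elim
    case (elim n)
    then have "u x <= real n" by linarith
    then show ?case by (simp add: W_def)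
   qed
   then show "(%n. W (real n) x) ~~> 0" by (rule tendsto_eventually)
  qed
 qed (auto simp: W_def)
 \<comment> \<open>Taking a successor index guarantees a positive starting level M.\<close>
 from tendsto_0_pick2[OF LIMSEQ_Suc[OF this] LIMSEQ_Suc[OF this] Y] obtain n where "mL (%t. t powr ms) (W (real (Suc n))) <= ennreal Y" by blast
 moreover define M where "M = real (Suc n)"
 ultimately have M: "0 < M" "mL (%t. t powr ms) (W M) <= ennreal Y" by simp_all
 define k where "k = (%j::nat. M * (2 - (1/2) ^ j))"
 have it: "mL (%t. t powr ms) (W (k j)) <= ennreal (Y * th ^ j)" for j
 proof (induction j)
  case 0
  then show ?case using M by (simp add: k_def)
 next
  case (Suc j)
  \<comment> \<open>The gap is \<open>M * (1/2) ^ Suc j\<close> and the level stays below 2M, whence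
    the ratio \<open>2 ^ (j + 2)\<close>.\<close>
  define L where "L = (2::real) ^ (j + 2)"
  have h: "(1/2::real) ^ j <= 1" "0 < (1/2::real) ^ j" by (simp_all add: power_le_one)
  have hL: "L * (1/2) ^ Suc j = 2" by (simp add: L_def power_one_over field_simps)
  have kd: "k (Suc j) - k j = M * (1/2) ^ Suc j" by (simp add: k_def algebra_simps)
  have kk: "0 <= k j" "k j < k (Suc j)" "k (Suc j) <= L * (k (Suc j) - k j)"
  proof -
   show "0 <= k j" using h M by (simp add: k_def)
   have "0 < M * (1/2) ^ Suc j" using M by simp
   then show "k j < k (Suc j)" using kd by linarith
   have "L * (k (Suc j) - k j) = M * (L * (1/2) ^ Suc j)" unfolding kd by simp
   also have "... = M * 2" unfolding hL ..
   finally show "k (Suc j) <= L * (k (Suc j) - k j)" using M by (simp add: k_def)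
  qed
  have "mL P (%x. half_step (u x - k (Suc j)) *R g x) <= ennreal (kb * C * L powr ms * (Y * th ^ j))"
   by (rule level_energy[OF u crit u0 C kk]) (use Suc Y th in \<open>auto simp: W_def\<close>)
  moreover have "kb * C * L powr ms * (Y * th ^ j) = Z * (b * th) ^ j"
  proof -
   have "L powr ms = (4 * 2 powr real j) powr ms" by (simp add: L_def powr_realpow power_add)
   also have "... = 4 powr ms * b ^ j" by (simp add: powr_mult powr_powr b_def powr_power mult.commute)
   finally have e: "kb * C * L powr ms = C4 * b ^ j" by (simp add: C4_def)
   show ?thesis unfolding e Y_def using C4 by (simp add: power_mult_distrib)
  qed
  ultimately have mP: "mL P (%x. half_step (u x - k (Suc j)) *R g x) <= ennreal (Z * (b * th) ^ j)" by simp
  have "mL (%t. t powr ms) (W (k (Suc j))) <= ennreal (C5 * (Z * (b * th) ^ j) powr (ms / m))"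
  proof (rule C5(2)[OF _ _ _ mP])
   show "D (W (k (Suc j))) (%x. half_step (u x - k (Suc j)) *R g x)" unfolding W_def by (rule D_truncate[OF Du]) (use kk in simp)
   show "0 < Z * (b * th) ^ j" using Z bt1 by simp
   show "Z * (b * th) ^ j <= 1" 
    by (rule mult_le_one[OF Z(2) zero_le_power[OF less_imp_le[OF bt1(1)]] power_le_one[OF less_imp_le[OF bt1(1)] bt1(2)]])
  qed
  also have "C5 * (Z * (b * th) ^ j) powr (ms / m) = C5 * Z powr q * th ^ j"
  proof -
   have "((b * th) ^ j) powr q = ((b * th) powr real j) powr q" by (simp only: powr_realpow[OF bt1(1)])
   also have "... = ((b * th) powr q) powr real j" by (simp only: powr_powr mult.commute)
   also have "... = ((b * th) powr q) ^ j" by (rule powr_realpow) (use b th in simp)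
   finally show ?thesis using Z bt1 unfolding btq by (simp add: q_def[symmetric] powr_mult)
  qed
  also have "ennreal (C5 * Z powr q * th ^ j) <= ennreal (th * (Z / C4) * th ^ j)" using th Zq by (intro ennreal_leI mult_right_mono) auto
  finally show ?case by (simp add: Y_def mult_ac)
 qed
 have le: "mL (%t. t powr ms) (W (2 * M)) <= ennreal (Y * th ^ j)" for j
 proof -
  have "k j <= 2 * M" using M by (simp add: k_def)
  then have "norm (W (2 * M) x) <= norm (W (k j) x)" for x by (auto simp: W_def max_def)
  then show ?thesis by (intro order_trans[OF mo_mono[OF gms] it]) simp
 qed
 have "(%j. ennreal (Y * th ^ j)) ~~> ennreal (Y * 0)"
  using th by (intro tendsto_ennrealI tendsto_intros LIMSEQ_power_zero) auto
 then have "mL (%t. t powr ms) (W (2 * M)) <= ennreal (Y * 0)" by (rule LIMSEQ_le_const) (use le in auto)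
 then have "(\<integral>\<^sup>+x. ennreal (norm (W (2 * M) x) powr ms) \<partial>lebesgue) = 0" by (simp add: mo_def)
 moreover have "(%x. ennreal (norm (W (2 * M) x) powr ms)) \<in> LM" unfolding W_def by measurable
 ultimately have "AE x in lebesgue. ennreal (norm (W (2 * M) x) powr ms) = 0" by (subst (asm) nn_integral_0_iff_AE)
 then have "AE x in lebesgue. u x <= 2 * M"
 proof eventually_elim
  case (elim x)
  then show ?case by (cases "u x <= 2 * M") (auto simp: W_def)
 qed
 then show ?thesis by blast
qed

end

section \<open>The weak solution\<close>

context var_problem
begin

lemma Es_iff: "Es u g \<longleftrightarrow> D u g & (\<integral>\<^sup>+x. ennreal (V x * P \<bar>u x\<bar>) \<partial>lebesgue) < \<infinity>"
proof -
 have "mo MV P u = (\<integral>\<^sup>+x. ennreal (V x * P \<bar>u x\<bar>) \<partial>lebesgue)" if [measurable]: "u \<in> LM"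
  unfolding mo_def using gf_meas_e[OF gP, of u lebesgue] V_pos gf_ge0[OF gP]
  by (subst nn_integral_density) (auto simp: ennreal_mult' less_imp_le)
 then show ?thesis using D_meas(1)[of u g] by (auto simp: Es_def)
qed

end

theorem theorem1p1:
  fixes \<phi> :: "real \<Rightarrow> real" and V K :: "'a::euclidean_space \<Rightarrow> real" and f :: "real \<Rightarrow> real"
  assumes dim: "DIM('a) \<ge> 2"
    and phi_pos: "\<forall>t>0. \<phi> t > 0"
    and phi_C1: "\<phi> C1_differentiable_on {0<..}"
    and phi1: "strict_mono_on {0<..} (\<lambda>t. t * \<phi> t)"
    and phi2a: "((\<lambda>t. t * \<phi> t) \<longlongrightarrow> 0) (at_right 0)"
    and phi2b: "filterlim (\<lambda>t. t * \<phi> t) at_top at_top"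
    and phi3_bdd: "bdd_above ((\<lambda>t. \<phi> t * t\<^sup>2 / Phi \<phi> t) ` {0<..})"
    and phi3a: "1 \<le> ell_idx \<phi>"
    and phi3b: "m_idx \<phi> < real DIM('a)"
    and phi3c: "m_idx \<phi> < real DIM('a) * ell_idx \<phi> / (real DIM('a) - ell_idx \<phi>)"
    and phi3d: "m_idx \<phi> \<noteq> 1"
    and phi4: "\<forall>s t. 0 < s \<longrightarrow> s \<le> t \<longrightarrow>
                 \<phi> t / t powr (m_idx \<phi> - 2) \<le> \<phi> s / s powr (m_idx \<phi> - 2)"
    and Cm: "\<exists>C>0. \<forall>t. Phi \<phi> t \<ge> C * \<bar>t\<bar> powr (m_idx \<phi>)"
    and V_cont: "continuous_on UNIV V" and K_cont: "continuous_on UNIV K"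
    and V_nonneg: "\<forall>x. V x \<ge> 0" and K_nonneg: "\<forall>x. K x \<ge> 0"
    and K0_V: "\<forall>x. V x > 0"
    and K0_Kinf: "\<exists>M. AE x in lebesgue. \<bar>K x\<bar> \<le> M"
    and K0_Kpos: "AE x in lebesgue. K x > 0"
    and K1: "\<forall>A :: nat \<Rightarrow> 'a set. (\<forall>n. A n \<in> sets borel) \<and>
               (\<exists>M::real. \<forall>n. emeasure lebesgue (A n) \<le> ennreal M) \<longrightarrow>
               (\<forall>\<epsilon>>0. \<exists>R. \<forall>r\<ge>R. \<forall>n.
                  set_nn_integral lebesgue (A n \<inter> - ball 0 r) (\<lambda>x. ennreal (K x)) < ennreal \<epsilon>)"
    and K2: "\<exists>M. AE x in lebesgue. \<bar>K x / V x\<bar> \<le> M"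
    and f_cont: "continuous_on UNIV f"
    and f_neg: "\<forall>s\<le>0. f s = 0"
    and f1a: "((\<lambda>t. f t / (t * \<phi> \<bar>t\<bar>)) \<longlongrightarrow> 0) (at 0)"
    and f1b: "Limsup at_top (\<lambda>t::real. ereal (f t / (t * phi_star \<phi> (real DIM('a)) t))) = 0"
    and f2: "strict_mono_on {0<..} (\<lambda>s. s powr (1 - m_idx \<phi>) * f s)"
    and f3: "filterlim (\<lambda>t. (LBINT s=0..t. f s) / \<bar>t\<bar> powr (m_idx \<phi>)) at_top at_top"
  shows "\<exists>u g. weak_solution \<phi> V K f u g \<and>
           (AE x in lebesgue. u x \<ge> 0) \<and> \<not> (AE x in lebesgue. u x = 0) \<and>
           (\<forall>C. compact C \<longrightarrow> (\<exists>M. AE x in lebesgue. x \<in> C \<longrightarrow> \<bar>u x\<bar> \<le> M))"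
proof -
 define m where "m = m_idx \<phi>"
 define n where "n = real DIM('a)"
 have m1: "1 < m" unfolding m_def by (rule m_idx_gt_1) (use phi_pos phi3_bdd phi3a phi3d in auto)
 obtain F where F: "!!t. (F has_real_derivative f t) (at t)" "!!t. 0 <= t ==> F t = (LBINT s=0..t. f s)" "F 0 = 0"
  using primitive_exists[OF f_cont] by blast
 have F_super: "filterlim (%t. F t / \<bar>t\<bar> powr m) at_top at_top"
  unfolding m_def
  by (rule filterlim_cong[THEN iffD2, OF refl refl _ f3]) (use eventually_ge_at_top[of 0] in eventually_elim, simp add: F)
 interpret N: nfun_f \<phi> m n f F
  using phi_pos C1_differentiable_imp_continuous_on[OF phi_C1] phi1 phi2a m1 phi3b phi4 f_cont f_neg f1a f1b f2 F F_super
  by unfold_locales (auto simp: m_def n_def)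
 obtain C where C: "0 < C" "!!t. C * \<bar>t\<bar> powr m <= Phi \<phi> t" using Cm by (auto simp: m_def)
 have Plow: "C * t powr m <= Phi \<phi> t" if "0 <= t" for t using C(2)[of t] that by simp
 obtain Kb where Kb: "AE x in lebesgue. \<bar>K x\<bar> <= Kb" using K0_Kinf by blast
 obtain Kv where Kv: "AE x in lebesgue. \<bar>K x / V x\<bar> <= Kv" using K2 by blast
 \<comment> \<open>The dimension becomes an integer power; b = 0 is separate since
   \<open>powr_realpow\<close> asks for a positive base.\<close>
 have young: "Phi \<phi> (s * b) <= Phi_star \<phi> n (N.ms * s) + b ^ DIM('a)" if "0 <= s" "0 <= b" for s b
  using N.young[OF that] that by (cases "b = 0") (auto simp: n_def powr_realpow)
 \<comment> \<open>Absolute value plus 1 makes the essential bounds of K and K/V positive; divisions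
   by kv rely on this.\<close>
 interpret Q: var_problem "Phi \<phi>" "Phi_star \<phi> n" m N.ms "TYPE('a)" N.a V K f F "\<bar>Kb\<bar> + 1" "\<bar>Kv\<bar> + 1"
 proof unfold_locales
  show "\<exists>C>0. \<forall>t\<ge>0. C * t powr m <= Phi \<phi> t" using C(1) Plow by blast
  show "\<exists>C>0. \<forall>t\<ge>0. C * t powr N.ms <= Phi_star \<phi> n t" by (rule N.Ps_lower[OF C(1) Plow])
  show "\<exists>C>0. \<forall>a\<ge>0. \<forall>b\<ge>0. Phi \<phi> (a * b) <= Phi_star \<phi> n (C * a) + b ^ DIM('a)"
   using N.ms1 young by (intro exI[of _ N.ms]) auto
  show "\<exists>C>0. \<forall>t>0. \<forall>y\<ge>0. \<forall>ep>0. ep <= 1 --> Phi_star \<phi> n t powr (1 - 1 / real DIM('a)) / t * y <= C * ep * (Phi_star \<phi> n t + Phi \<phi> (y / ep))"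
   using N.sob by (intro exI[of _ 4]) (auto simp: n_def)
  show "AE x in lebesgue. K x <= \<bar>Kb\<bar> + 1" using Kb by eventually_elim simp
  show "AE x in lebesgue. K x <= (\<bar>Kv\<bar> + 1) * V x"
   using Kv
  proof eventually_elim
   case (elim x)
   have V: "0 < V x" using K0_V by simp
   have "K x / V x <= \<bar>Kv\<bar> + 1" using elim abs_ge_self[of "K x / V x"] abs_ge_self[of Kv] by linarith
   then show ?case using V by (simp add: divide_le_eq)
  qed
  show "1 < m" by (rule m1)
  show "m < real DIM('a)" using phi3b by (simp add: m_def)
  show "N.ms = real DIM('a) * m / (real DIM('a) - m)" unfolding N.ms_def by (simp add: n_def)
  show "gf (Phi \<phi>) m" "gf (Phi_star \<phi> n) N.ms" "continuous_on UNIV N.a" "N.a 0 = 0" "convex_on UNIV (Phi \<phi>)"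
   by (rule N.gf_P N.gf_Ps N.a_cont N.a_0 N.P_convex)+
  show "N.a s < N.a t" if "0 <= s" "s < t" for s t by (rule N.a_less[OF that])
  show "N.a (c * t) <= c powr (m - 1) * N.a t" if "1 <= c" "0 <= t" for c t by (rule N.a_scale[OF that])
  show "(Phi \<phi> has_real_derivative sgn t * N.a \<bar>t\<bar>) (at t)" for t by (rule N.P_deriv)
  show "t * N.a t <= m * Phi \<phi> t" "Phi \<phi> t <= t * N.a t" if "0 <= t" for t by (rule N.P_ge[OF that] N.P_le[OF that])+
  show "continuous_on UNIV V" "continuous_on UNIV K" "continuous_on UNIV f" by (fact V_cont K_cont f_cont)+
  show "0 < V x" "0 <= K x" for x using K0_V K_nonneg by auto
  show "AE x in lebesgue. 0 < K x" by (fact K0_Kpos)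
  show "0 < \<bar>Kb\<bar> + 1" "0 < \<bar>Kv\<bar> + 1" by auto
  show "f s = 0" if "s <= 0" for s using f_neg that by blast
  show "(F has_real_derivative f t) (at t)" for t by (rule F)
  show "F t = 0" if "t <= 0" for t by (rule N.F_neg[OF that])
  show "\<exists>C\<ge>0. ALL t. \<bar>f t\<bar> <= ep * N.a \<bar>t\<bar> + C * \<bar>t\<bar> powr (N.ms - 1)" if "0 < ep" for ep by (rule N.f_growth[OF that])
  show "\<exists>C\<ge>0. \<exists>dl>0. ALL t. \<bar>F t\<bar> <= ep * (Phi \<phi> \<bar>t\<bar> + \<bar>t\<bar> powr N.ms) + (if dl <= \<bar>t\<bar> then C else 0)" if "0 < ep" for ep
   by (rule N.F_growth[OF that])
  show "s powr (1 - m) * f s < t powr (1 - m) * f t" if "0 < s" "s < t" for s t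
   using strict_mono_onD[OF f2, of s t] that by (simp add: m_def)
  show "filterlim (%s. s powr (1 - m) * f s) at_top at_top" by (rule N.f_super)
  fix A :: "nat => 'a set" and ep :: real
  assume A: "!!n. A n \<in> sets borel" "\<exists>M::real. ALL n. emeasure lebesgue (A n) <= ennreal M" "0 < ep"
  then obtain R where "\<forall>r\<ge>R. ALL n. set_nn_integral lebesgue (A n \<inter> - ball 0 r) (%x. ennreal (K x)) < ennreal ep"
   using K1[rule_format, of A ep] by blast
  then show "EX R. ALL n. set_nn_integral lebesgue (A n \<inter> - ball 0 R) (%x. ennreal (K x)) <= ennreal ep"
   by (intro exI[of _ R]) (auto intro: less_imp_le)
 qed
 \<comment> \<open>The given energy space coincides with the modular one, so the test directions
   range over the same pairs.\<close>
 have E: "E_space \<phi> V u g \<longleftrightarrow> Q.Es u g" for u g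
  unfolding E_space_def D1Phi_def Q.Es_iff Q.D_iff n_def[symmetric] by blast
 obtain u g where u: "Q.good u g" and crit: "!!w h. Q.Es w h ==> Q.dJ u g w h = 0" using Q.critical_point by blast
 have Eu: "Q.Es u g" by (rule Q.good_Es[OF u])
 have u0: "AE x in lebesgue. 0 <= u x" by (rule Q.critical_nonneg[OF Eu crit])
 obtain M where M: "AE x in lebesgue. u x <= M" using Q.critical_bounded[OF Eu crit u0] by blast
 \<comment> \<open>Valid also at z = 0, where both sides vanish whatever the value of \<phi> at
   0.\<close>
 have A1: "Q.A z \<bullet> y = \<phi> (norm z) * (z \<bullet> y)" for z y :: 'a by (auto simp: Q.A_def N.a_def)
 have A2: "Q.A z = \<phi> \<bar>z\<bar> * z" for z :: real by (auto simp: Q.A_def N.a_def)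
 have "weak_solution \<phi> V K f u g"
  unfolding weak_solution_def E
 proof (intro conjI allI impI Eu)
  fix v h assume v: "Q.Es v h"
  interpret T: two_dirs "Phi \<phi>" "Phi_star \<phi> n" m N.ms "TYPE('a)" N.a V K f F "\<bar>Kb\<bar> + 1" "\<bar>Kv\<bar> + 1" u g v h
   by unfold_locales (rule Eu v)+
  show "integrable lebesgue (%x. \<phi> (norm (g x)) * (g x \<bullet> h x))" "integrable lebesgue (%x. V x * \<phi> \<bar>u x\<bar> * u x * v x)"
   "integrable lebesgue (%x. K x * f (u x) * v x)"
   using T.dJ_integrable by (simp_all add: A1 A2 mult.assoc)
  show "(LINT x|lebesgue. \<phi> (norm (g x)) * (g x \<bullet> h x)) + (LINT x|lebesgue. V x * \<phi> \<bar>u x\<bar> * u x * v x) = (LINT x|lebesgue. K x * f (u x) * v x)"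
   using crit[OF v] by (simp add: Q.dJ_def A1 A2 mult.assoc)
 qed
 moreover have "~ (AE x in lebesgue. u x = 0)"
 proof
  assume "AE x in lebesgue. u x = 0"
  then have "AE x in lebesgue. u x <= 0" by eventually_elim simp
  then show False using u by (simp add: Q.good_def)
 qed
 moreover have "AE x in lebesgue. x \<in> C --> \<bar>u x\<bar> <= M" for C using u0 M by eventually_elim simp
 ultimately show ?thesis using u0 by blast
qed

end
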